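(* Let $M\colon[0,\infty)\to[0,\infty)$ be continuous, $\mathcal{M}(t)=\int_0^t M(\tau)\,d\tau$, $\gamma\in[1,p_m^*/q)$ (so that $1<\gamma p<p_m^*$), and assume: (M2) for every $\sigma>0$ there exists $k_\sigma>0$ such that $M(t)\ge k_\sigma$ for all $t\ge\sigma$; (M3) there exists $C_0>0$ such that $\mathcal{M}(t)\ge C_0t^\gamma$ for all $t\ge0$; (M5) $\mathcal{M}(\theta s)\le\theta^\gamma\mathcal{M}(s)$ for all $0<\theta\le1$ and all $s\ge0$. Let $h\colon\Omega\times\mathbb{R}\to\mathbb{R}$ be continuous, $H(x,t)=\int_0^t h(x,s)\,ds$, and assume that there exist $r\in(1,p_m^* )$ and $C_r>0$ such that $$|h(x,t)|\le C_r(1+|t|^{r-1})\qquad\text{for a.e. }x\in\Omega\text{ and all }t\in\mathbb{R},$$ and that, with $$\lambda_{\mathcal{H},p}=\inf_{u\in W_0^{m,\mathcal{H}}(\Omega),\,u\ne0}\frac{\mathcal{M}\big(\Phi_{\mathcal{H}}(\nabla^m u)\big)}{\int_\Omega|u|^{\gamma p}\,dx},$$ (h6) $\displaystyle\limsup_{|t|\to\infty}\frac{H(x,t)}{|t|^{\gamma p}}<\lambda_{\mathcal{H},p}$ uniformly for a.e. $x\in\Omega$; (h8) $\displaystyle\lambda_{\mathcal{H},p}<\liminf_{|t|\to0}\frac{H(x,t)}{|t|^{\gamma p}}$ uniformly for a.e. $x\in\Omega$. Then the functional $\mathcal{J}\colon W_0^{m,\mathcal{H}}(\Omega)\to\mathbb{R}$,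 $$\mathcal{J}(u)=\mathcal{M}\big(\Phi_{\mathcal{H}}(\nabla^m u)\big)-\int_\Omega H(x,u)\,dx,$$ is bounded from below and $$c:=\inf\{\mathcal{J}(u):u\in W_0^{m,\mathcal{H}}(\Omega)\}<0$$ is a critical value of $\mathcal{J}$. Consequently, the problem $$M\big(\Phi_{\mathcal{H}}(\nabla^m u)\big)\,\mathcal{L}^m_{p,q,a}u=h(x,u)\ \text{ in }\Omega,\qquad u=\nabla u=\cdots=\nabla^{m-1}u=0\ \text{ on }\partial\Omega$$ admits a nontrivial weak solution.
   Context: Standing assumptions: $\Omega\subset\mathbb{R}^N$ is a bounded domain with Lipschitz boundary, $m\in\mathbb{N}$ ($m\ge 1$), $1<p<q$, $mq<N$, $\frac{q}{p}\le\frac{N}{N-1}$, $a\in C^{0,\kappa}(\overline\Omega)$ for some $\kappa\in(0,1]$, and $a(x)\ge a_0>0$ for all $x\in\overline\Omega$. Set $p_m^*=\frac{Np}{N-mp}$. Notation: $\nabla^k u=\nabla\Delta^{(k-1)/2}u$ if $k$ is odd, $\nabla^k u=\Delta^{k/2}u$ if $k$ is even. Let $\mathcal{H}(x,t)=t^p+a(x)t^q$ for $t\ge0$. $L^{\mathcal{H}}(\Omega)$ is the space of measurable $u\colon\Omega\to\mathbb{R}$ with $\int_\Omega\mathcal{H}(x,|u|)\,dx<\infty$, with Luxemburg norm $\|u\|_{\mathcal{H}}=\inf\{\lambda>0:\int_\Omega\mathcal{H}(x,|u|/\lambda)\,dx\le1\}$; for vector-valued functions $\|v\|_{\mathcal H}=\||v|\|_{\mathcal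 H}$. $W^{m,\mathcal{H}}(\Omega)$ consists of $u\in L^{\mathcal{H}}(\Omega)$ with $|\nabla^k u|\in L^{\mathcal{H}}(\Omega)$ for $k=0,\dots,m$, with norm $\sum_{k=0}^m\|\nabla^k u\|_{\mathcal{H}}$; $W_0^{m,\mathcal{H}}(\Omega)$ is the completion of $C_0^\infty(\Omega)$ in this norm, equipped with the equivalent norm $\|u\|=\|\nabla^m u\|_{\mathcal{H}}$. $$\Phi_{\mathcal{H}}(\nabla^m u)=\int_\Omega\Big(\frac{|\nabla^m u|^p}{p}+a(x)\frac{|\nabla^m u|^q}{q}\Big)dx.$$ The uniform inequality in (h6) means: there are $\varepsilon,T>0$ such that for a.e. $x\in\Omega$, $H(x,t)\le(\lambda_{\mathcal{H},p}-\varepsilon)|t|^{\gamma p}$ for all $|t|\ge T$. The uniform inequality in (h8) means: there are $\varepsilon,\delta>0$ such that for a.e. $x\in\Omega$, $H(x,t)\ge(\lambda_{\mathcal{H},p}+\varepsilon)|t|^{\gamma p}$ for all $|t|\le\delta$. The polyharmonic double phase operator is: for $m$ even, $\mathcal{L}^m_{p,q,a}u=\Delta^{m/2}\big(|\Delta^{m/2}u|^{p-2}\Delta^{m/2}u+a(x)|\Delta^{m/2}u|^{q-2}\Delta^{m/2}u\big)$; for $m$ odd, $\mathcal{L}^m_{p,q,a}u=-\operatorname{div}\big(\Delta^{(m-1)/2}(|w|^{p-2}w+a(x)|w|^{q-2}w)\big)$ with $w=\nabla\Delta^{(m-1)/2}u$. A weak solution of the problem is a $u\in W_0^{m,\mathcal{H}}(\Omega)$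 such that for all $\varphi\in W_0^{m,\mathcal{H}}(\Omega)$ $$M\big(\Phi_{\mathcal{H}}(\nabla^m u)\big)\int_\Omega\big(|\nabla^m u|^{p-2}\nabla^m u+a(x)|\nabla^m u|^{q-2}\nabla^m u\big)\cdot\nabla^m\varphi\,dx=\int_\Omega h(x,u)\varphi\,dx.$$ *)

theory Defs
  imports "HOL-Analysis.Analysis"
begin

section \<open>Lipschitz domains and Hoelder continuity\<close>

text \<open>Near every boundary point the set is, after a rotation taking \<open>e\<close> to the last coordinate
  direction, the strict epigraph of a Lipschitz function on the hyperplane orthogonal to \<open>e\<close>.\<close>

definition lipschitz_boundary :: "'a::euclidean_space set \<Rightarrow> bool" where
  "lipschitz_boundary \<Omega> \<longleftrightarrow>
     (\<forall>x0\<in>frontier \<Omega>. \<exists>r>0. \<exists>e. norm e = 1 \<and>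
        (\<exists>g :: 'a \<Rightarrow> real. \<exists>L. L-lipschitz_on {y. y \<bullet> e = 0} g \<and>
          \<Omega> \<inter> ball x0 r = {x \<in> ball x0 r. x \<bullet> e > g (x - (x \<bullet> e) *\<^sub>R e)}))"

definition bounded_lipschitz_domain :: "'a::euclidean_space set \<Rightarrow> bool" where
  "bounded_lipschitz_domain \<Omega> \<longleftrightarrow>
     open \<Omega> \<and> connected \<Omega> \<and> \<Omega> \<noteq> {} \<and> bounded \<Omega> \<and> lipschitz_boundary \<Omega>"

definition hoelder_on :: "real \<Rightarrow> 'a::metric_space set \<Rightarrow> ('a \<Rightarrow> real) \<Rightarrow> bool" where
  "hoelder_on \<kappa> S f \<longleftrightarrow> (\<exists>C\<ge>0. \<forall>x\<in>S. \<forall>y\<in>S. \<bar>f x - f y\<bar> \<le> C * dist x y powr \<kappa>)"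


section \<open>Test functions and polyharmonic gradients\<close>

definition pderiv_dir :: "'a::euclidean_space \<Rightarrow> ('a \<Rightarrow> real) \<Rightarrow> 'a \<Rightarrow> real" where
  "pderiv_dir i f x = frechet_derivative f (at x) i"

primrec Ck :: "nat \<Rightarrow> ('a::euclidean_space \<Rightarrow> real) \<Rightarrow> bool" where
  "Ck 0 f \<longleftrightarrow> continuous_on UNIV f"
| "Ck (Suc k) f \<longleftrightarrow> f differentiable_on UNIV \<and> (\<forall>i\<in>Basis. Ck k (pderiv_dir i f))"

definition test_functions :: "'a::euclidean_space set \<Rightarrow> ('a \<Rightarrow> real) set" where
  "test_functions \<Omega> =
     {\<phi>. (\<forall>k. Ck k \<phi>) \<and> compact (closure {x. \<phi> x \<noteq> 0}) \<and> closure {x. \<phi> x \<noteq> 0} \<subseteq> \<Omega>}"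

definition laplacian :: "('a::euclidean_space \<Rightarrow> real) \<Rightarrow> 'a \<Rightarrow> real" where
  "laplacian f x = (\<Sum>i\<in>Basis. pderiv_dir i (pderiv_dir i f) x)"

text \<open>\<open>\<nabla>\<^sup>k\<close> is scalar-valued for even \<open>k\<close> and vector-valued for odd \<open>k\<close>. Both cases are
  embedded isometrically in \<open>real \<times> 'a\<close>: scalars in the first component, vectors in
  the second. Norms and inner products are those of the scalar or the vector.\<close>

definition nabla :: "nat \<Rightarrow> ('a::euclidean_space \<Rightarrow> real) \<Rightarrow> 'a \<Rightarrow> real \<times> 'a" where
  "nabla k f x =
     (if even k then ((laplacian ^^ (k div 2)) f x, 0)
      else (0, \<Sum>i\<in>Basis. pderiv_dir i ((laplacian ^^ ((k - 1) div 2)) f) x *\<^sub>R i))"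

definition locally_integrable ::
  "'a::euclidean_space set \<Rightarrow> ('a \<Rightarrow> 'b::euclidean_space) \<Rightarrow> bool" where
  "locally_integrable \<Omega> u \<longleftrightarrow> (\<forall>K. compact K \<and> K \<subseteq> \<Omega> \<longrightarrow> set_integrable lebesgue K u)"

text \<open>\<open>\<nabla>\<^sup>k u = v\<close> in the sense of distributions; each of the \<open>k\<close> integrations by
  parts contributes a factor \<open>-1\<close>. Testing the identically zero component of \<open>nabla k \<phi>\<close> makes the
  corresponding component of \<open>v\<close> vanish a.e.\<close>

definition weak_nabla ::
  "'a::euclidean_space set \<Rightarrow> nat \<Rightarrow> ('a \<Rightarrow> real) \<Rightarrow> ('a \<Rightarrow> real \<times> 'a) \<Rightarrow> bool" where
  "weak_nabla \<Omega> k u v \<longleftrightarrow>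
     locally_integrable \<Omega> u \<and> locally_integrable \<Omega> v \<and>
     (\<forall>\<phi>\<in>test_functions \<Omega>.
        (LINT x|lebesgue_on \<Omega>. \<phi> x *\<^sub>R v x) =
        (-1) ^ k *\<^sub>R (LINT x|lebesgue_on \<Omega>. u x *\<^sub>R nabla k \<phi> x))"

text \<open>A representative of the weak \<open>\<nabla>\<^sup>k u\<close>, which is determined up to null sets (and is
  meaningful only where it exists).\<close>

definition wnabla ::
  "'a::euclidean_space set \<Rightarrow> nat \<Rightarrow> ('a \<Rightarrow> real) \<Rightarrow> 'a \<Rightarrow> real \<times> 'a" where
  "wnabla \<Omega> k u = (SOME v. weak_nabla \<Omega> k u v)"


section \<open>Musielak--Orlicz and Musielak--Orlicz--Sobolev spaces\<close>

text \<open>Elements of the function spaces are represented by functions on the whole space; only the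
  values on \<open>\<Omega>\<close>, up to null sets, matter.\<close>

definition Hfun :: "real \<Rightarrow> real \<Rightarrow> ('a \<Rightarrow> real) \<Rightarrow> 'a \<Rightarrow> real \<Rightarrow> real" where
  "Hfun p q a x t = t powr p + a x * t powr q"

definition modular ::
  "real \<Rightarrow> real \<Rightarrow> ('a::euclidean_space \<Rightarrow> real) \<Rightarrow> 'a set \<Rightarrow> ('a \<Rightarrow> 'b::euclidean_space) \<Rightarrow> ennreal" where
  "modular p q a \<Omega> u = (\<integral>\<^sup>+ x. ennreal (Hfun p q a x (norm (u x))) \<partial>lebesgue_on \<Omega>)"

definition LH ::
  "real \<Rightarrow> real \<Rightarrow> ('a::euclidean_space \<Rightarrow> real) \<Rightarrow> 'a set \<Rightarrow> ('a \<Rightarrow> 'b::euclidean_space) set" where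
  "LH p q a \<Omega> = {u \<in> borel_measurable (lebesgue_on \<Omega>). modular p q a \<Omega> u < \<infinity>}"

definition norm_H ::
  "real \<Rightarrow> real \<Rightarrow> ('a::euclidean_space \<Rightarrow> real) \<Rightarrow> 'a set \<Rightarrow> ('a \<Rightarrow> 'b::euclidean_space) \<Rightarrow> real" where
  "norm_H p q a \<Omega> u = Inf {l. l > 0 \<and> modular p q a \<Omega> (\<lambda>x. u x /\<^sub>R l) \<le> 1}"

definition WmH ::
  "nat \<Rightarrow> real \<Rightarrow> real \<Rightarrow> ('a::euclidean_space \<Rightarrow> real) \<Rightarrow> 'a set \<Rightarrow> ('a \<Rightarrow> real) set" where
  "WmH m p q a \<Omega> = {u \<in> LH p q a \<Omega>. \<forall>k\<le>m. \<exists>v\<in>LH p q a \<Omega>. weak_nabla \<Omega> k u v}"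

definition norm_WmH ::
  "nat \<Rightarrow> real \<Rightarrow> real \<Rightarrow> ('a::euclidean_space \<Rightarrow> real) \<Rightarrow> 'a set \<Rightarrow> ('a \<Rightarrow> real) \<Rightarrow> real" where
  "norm_WmH m p q a \<Omega> u = (\<Sum>k\<le>m. norm_H p q a \<Omega> (wnabla \<Omega> k u))"

text \<open>The completion of the test functions, realized as their closure in the complete
  space \<open>WmH\<close>.\<close>

definition W0mH ::
  "nat \<Rightarrow> real \<Rightarrow> real \<Rightarrow> ('a::euclidean_space \<Rightarrow> real) \<Rightarrow> 'a set \<Rightarrow> ('a \<Rightarrow> real) set" where
  "W0mH m p q a \<Omega> =
     {u \<in> WmH m p q a \<Omega>. \<exists>\<phi> :: nat \<Rightarrow> 'a \<Rightarrow> real. (\<forall>n. \<phi> n \<in> test_functions \<Omega>) \<and>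
        (\<lambda>n. norm_WmH m p q a \<Omega> (\<lambda>x. u x - \<phi> n x)) \<longlonglongrightarrow> 0}"

definition norm_W0mH ::
  "nat \<Rightarrow> real \<Rightarrow> real \<Rightarrow> ('a::euclidean_space \<Rightarrow> real) \<Rightarrow> 'a set \<Rightarrow> ('a \<Rightarrow> real) \<Rightarrow> real" where
  "norm_W0mH m p q a \<Omega> u = norm_H p q a \<Omega> (wnabla \<Omega> m u)"

definition zero_ae :: "'a::euclidean_space set \<Rightarrow> ('a \<Rightarrow> real) \<Rightarrow> bool" where
  "zero_ae \<Omega> u \<longleftrightarrow> (AE x in lebesgue_on \<Omega>. u x = 0)"


section \<open>The Kirchhoff functional, the eigenvalue and weak solutions\<close>

text \<open>The integral from 0 to \<open>t\<close>, oriented, so that it is correct for negative \<open>t\<close> as well.\<close>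

definition prim :: "(real \<Rightarrow> real) \<Rightarrow> real \<Rightarrow> real" where
  "prim f t = (LBINT s=0..ereal t. f s)"

definition sobolev_exponent :: "nat \<Rightarrow> nat \<Rightarrow> real \<Rightarrow> real" where
  "sobolev_exponent N m p = real N * p / (real N - real m * p)"

definition Phi_H ::
  "real \<Rightarrow> real \<Rightarrow> ('a::euclidean_space \<Rightarrow> real) \<Rightarrow> 'a set \<Rightarrow> ('a \<Rightarrow> 'b::euclidean_space) \<Rightarrow> real" where
  "Phi_H p q a \<Omega> v =
     (LINT x|lebesgue_on \<Omega>. norm (v x) powr p / p + a x * (norm (v x) powr q / q))"

definition lambda_H ::
  "nat \<Rightarrow> real \<Rightarrow> real \<Rightarrow> ('a::euclidean_space \<Rightarrow> real) \<Rightarrow> 'a set \<Rightarrow> (real \<Rightarrow> real) \<Rightarrow> real \<Rightarrow> real" where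
  "lambda_H m p q a \<Omega> M \<gamma> =
     (INF u\<in>{u \<in> W0mH m p q a \<Omega>. \<not> zero_ae \<Omega> u}.
        prim M (Phi_H p q a \<Omega> (wnabla \<Omega> m u)) /
        (LINT x|lebesgue_on \<Omega>. \<bar>u x\<bar> powr (\<gamma> * p)))"

definition J_functional ::
  "nat \<Rightarrow> real \<Rightarrow> real \<Rightarrow> ('a::euclidean_space \<Rightarrow> real) \<Rightarrow> 'a set \<Rightarrow> (real \<Rightarrow> real) \<Rightarrow>
   ('a \<Rightarrow> real \<Rightarrow> real) \<Rightarrow> ('a \<Rightarrow> real) \<Rightarrow> real" where
  "J_functional m p q a \<Omega> M h u =
     prim M (Phi_H p q a \<Omega> (wnabla \<Omega> m u)) - (LINT x|lebesgue_on \<Omega>. prim (h x) (u x))"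

definition dphase_flux ::
  "real \<Rightarrow> real \<Rightarrow> ('a \<Rightarrow> real) \<Rightarrow> 'a \<Rightarrow> 'b::euclidean_space \<Rightarrow> 'b" where
  "dphase_flux p q a x w = norm w powr (p - 2) *\<^sub>R w + (a x * norm w powr (q - 2)) *\<^sub>R w"

text \<open>The boundary conditions are encoded in membership in \<open>W0mH\<close>.\<close>

definition weak_solution ::
  "nat \<Rightarrow> real \<Rightarrow> real \<Rightarrow> ('a::euclidean_space \<Rightarrow> real) \<Rightarrow> 'a set \<Rightarrow> (real \<Rightarrow> real) \<Rightarrow>
   ('a \<Rightarrow> real \<Rightarrow> real) \<Rightarrow> ('a \<Rightarrow> real) \<Rightarrow> bool" where
  "weak_solution m p q a \<Omega> M h u \<longleftrightarrow>
     u \<in> W0mH m p q a \<Omega> \<and>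
     (\<forall>\<phi>\<in>W0mH m p q a \<Omega>.
        M (Phi_H p q a \<Omega> (wnabla \<Omega> m u)) *
          (LINT x|lebesgue_on \<Omega>. dphase_flux p q a x (wnabla \<Omega> m u x) \<bullet> wnabla \<Omega> m \<phi> x) =
        (LINT x|lebesgue_on \<Omega>. h x (u x) * \<phi> x))"


section \<open>Critical points of functionals on normed spaces of functions\<close>

text \<open>\<open>L\<close> is the Frechet derivative at \<open>u\<close> of \<open>J\<close> on the function space \<open>W\<close> normed by \<open>nrm\<close>.\<close>

definition has_frechet_derivative_on ::
  "('a \<Rightarrow> real) set \<Rightarrow> (('a \<Rightarrow> real) \<Rightarrow> real) \<Rightarrow> (('a \<Rightarrow> real) \<Rightarrow> real) \<Rightarrow>
   ('a \<Rightarrow> real) \<Rightarrow> (('a \<Rightarrow> real) \<Rightarrow> real) \<Rightarrow> bool" where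
  "has_frechet_derivative_on W nrm J u L \<longleftrightarrow>
     (\<forall>v\<in>W. \<forall>w\<in>W. L (\<lambda>x. v x + w x) = L v + L w) \<and>
     (\<forall>c. \<forall>v\<in>W. L (\<lambda>x. c * v x) = c * L v) \<and>
     (\<exists>K. \<forall>v\<in>W. \<bar>L v\<bar> \<le> K * nrm v) \<and>
     (\<forall>\<epsilon>>0. \<exists>\<delta>>0. \<forall>v\<in>W. nrm v < \<delta> \<longrightarrow> \<bar>J (\<lambda>x. u x + v x) - J u - L v\<bar> \<le> \<epsilon> * nrm v)"

definition critical_point ::
  "('a \<Rightarrow> real) set \<Rightarrow> (('a \<Rightarrow> real) \<Rightarrow> real) \<Rightarrow> (('a \<Rightarrow> real) \<Rightarrow> real) \<Rightarrow> ('a \<Rightarrow> real) \<Rightarrow> bool" where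
  "critical_point W nrm J u \<longleftrightarrow> u \<in> W \<and> has_frechet_derivative_on W nrm J u (\<lambda>_. 0)"

definition critical_value ::
  "('a \<Rightarrow> real) set \<Rightarrow> (('a \<Rightarrow> real) \<Rightarrow> real) \<Rightarrow> (('a \<Rightarrow> real) \<Rightarrow> real) \<Rightarrow> real \<Rightarrow> bool" where
  "critical_value W nrm J c \<longleftrightarrow> (\<exists>u. critical_point W nrm J u \<and> J u = c)"

end

theory Submission
  imports Defs "HOL-Complex_Analysis.Great_Picard" "HOL-Library.Diagonal_Subsequence"
begin

text \<open>Since \<open>a\<close> lies between positive constants, \<open>L\<^sup>H\<close> is \<open>L\<^sup>q\<close> with an equivalent norm, so elements of
  \<open>W0mH\<close> are \<open>L\<^sup>q\<close>-limits of pairs \<open>(f\<^sub>n, \<nabla>\<^sup>m f\<^sub>n)\<close> of test functions. Convolution with the gradient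
  kernel \<open>z / |z|\<^sup>N\<close>, truncated near the origin, recovers \<open>\<nabla>\<^sup>k f\<close> from \<open>\<nabla>\<^sup>k\<^sup>+\<^sup>1 f\<close>; iterating a Young type
  inequality \<open>m\<close> times gives the subcritical embedding, and equicontinuity of the truncated averages its compactness.

  By (h6) and the definition of the eigenvalue, \<open>J\<close> dominates a positive multiple of the Kirchhoff term up to a constant,
  hence is bounded below and coercive. By (h8), \<open>J (\<theta> u) < 0\<close> for an almost optimal \<open>u\<close> in the Rayleigh quotient
  and small \<open>\<theta>\<close>, because (M5) makes the Kirchhoff term scale at most like \<open>\<theta>\<close> to the power \<open>\<gamma> p\<close>. A minimizing sequence
  converges by compactness and lower semicontinuity of \<open>\<Phi>\<close>, and \<open>J\<close> is Frechet differentiable at the minimizer.\<close>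

section \<open>Smooth functions\<close>

text \<open>The norm of the space controls only the polyharmonic gradients and not all partial
  derivatives, so the classical embeddings would first call for singular integral estimates. The
  kernel avoids this: it is a gradient field, hence convolution with it undoes both the passage from
  a function to its gradient and the passage from a gradient to its divergence, and one estimate
  from \<open>nabla (Suc k)\<close> to \<open>nabla k\<close> can be iterated regardless of parity.
  The crude form of Young's inequality loses the endpoint. This is affordable because the lower
  order term is measured in \<open>L^s\<close> with s the Sobolev exponent of p, which lies strictly
  below that of q, while r and \<gamma> p lie strictly below s. Weak convergence is bypassed: a
  strongly convergent sequence of gradients is produced by uniform convexity of the energy on convex
  sets of pairs that shrink towards the strong limit of the functions. Gradients travel as a second
  component of a pair, because \<open>wnabla\<close> is a choice that is fixed only up to null
  sets.\<close>

definition smooth :: "('a::euclidean_space => real) => bool" where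
  "smooth f \<longleftrightarrow> (\<forall>k. Ck k f)"

lemma pderiv_dir_eq: "(f has_derivative D) (at x) ==> pderiv_dir i f x = D i"
  unfolding pderiv_dir_def using frechet_derivative_at by metis

lemma pderiv_dir_add:
  assumes "f differentiable at x" "g differentiable at x"
  shows "pderiv_dir i (\<lambda>y. f y + g y) x = pderiv_dir i f x + pderiv_dir i g x"
  using pderiv_dir_eq[OF has_derivative_add[OF assms[unfolded frechet_derivative_works]], of i]
  by (simp add: pderiv_dir_def)

lemma pderiv_dir_cmult:
  assumes "f differentiable at x"
  shows "pderiv_dir i (\<lambda>y. c * f y) x = c * pderiv_dir i f x"
  using pderiv_dir_eq[OF has_derivative_mult_right[OF assms[unfolded frechet_derivative_works]], of i c]
  by (simp add: pderiv_dir_def)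

lemma Ck_Suc_differentiable: "Ck (Suc k) f ==> f differentiable at x"
  by (simp add: differentiable_on_eq_differentiable_at)

lemma Ck_add: "Ck k f ==> Ck k g ==> Ck k (\<lambda>x. f x + g x)"
proof (induction k arbitrary: f g)
  case 0
  then show ?case by (auto intro: continuous_on_add)
next
  case (Suc k)
  have eq: "pderiv_dir i (\<lambda>x. f x + g x) = (\<lambda>x. pderiv_dir i f x + pderiv_dir i g x)" for i
    using Suc.prems by (intro ext pderiv_dir_add Ck_Suc_differentiable)
  show ?case
    using Suc by (auto simp: eq intro: differentiable_on_add)
qed

lemma Ck_cmult: "Ck k f ==> Ck k (\<lambda>x. c * f x)"
proof (induction k arbitrary: f)
  case 0
  then show ?case by (auto intro: continuous_intros)
next
  case (Suc k)
  have eq: "pderiv_dir i (\<lambda>x. c * f x) = (\<lambda>x. c * pderiv_dir i f x)" for i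
    using Suc.prems by (intro ext pderiv_dir_cmult Ck_Suc_differentiable)
  show ?case
    using Suc by (auto simp: eq intro: differentiable_on_mult differentiable_on_const)
qed

lemma Ck_const: "Ck k (\<lambda>x. c)"
proof (induction k arbitrary: c)
  case (Suc k)
  have "pderiv_dir i (\<lambda>x::'a. c) = (\<lambda>x. 0)" for i
    using pderiv_dir_eq[OF has_derivative_const] by (intro ext)
  then show ?case using Suc by simp
qed simp

lemma smooth_add: "smooth f ==> smooth g ==> smooth (\<lambda>x. f x + g x)"
  and smooth_cmult: "smooth f ==> smooth (\<lambda>x. c * f x)"
  and smooth_const: "smooth (\<lambda>x. c)"
  by (simp_all add: smooth_def Ck_add Ck_cmult Ck_const)

lemma smooth_sum: "(\<And>i. i \<in> I ==> smooth (f i)) ==> smooth (\<lambda>x. \<Sum>i\<in>I. f i x)"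
  by (induction I rule: infinite_finite_induct) (auto intro: smooth_add smooth_const)

lemma smooth_pderiv_dir: "smooth f ==> i \<in> Basis ==> smooth (pderiv_dir i f)"
  unfolding smooth_def by (metis Ck.simps(2))

lemma smooth_differentiable: "smooth f ==> f differentiable at x"
  unfolding smooth_def using Ck_Suc_differentiable by blast

lemma smooth_continuous: "smooth f ==> continuous_on S f"
  by (meson Ck.simps(1) continuous_on_subset smooth_def subset_UNIV)

lemma smooth_laplacian: "smooth f ==> smooth (laplacian f)"
  unfolding laplacian_def[abs_def] by (intro smooth_sum smooth_pderiv_dir)

lemma smooth_laplacian_funpow: "smooth f ==> smooth ((laplacian ^^ k) f)"
  by (induction k) (auto intro: smooth_laplacian)

lemma has_derivative_smooth:
  assumes "smooth f"
  shows "(f has_derivative (\<lambda>h. \<Sum>i\<in>Basis. (h \<bullet> i) * pderiv_dir i f x)) (at x)"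
proof -
  let ?D = "frechet_derivative f (at x)"
  have D: "(f has_derivative ?D) (at x)"
    using smooth_differentiable[OF assms] frechet_derivative_works by blast
  then have lin: "linear ?D" by (rule has_derivative_linear)
  have "?D h = (\<Sum>i\<in>Basis. (h \<bullet> i) * pderiv_dir i f x)" for h
    unfolding pderiv_dir_def
    by (subst euclidean_representation[of h, symmetric])
       (simp add: linear_sum[OF lin] linear_cmul[OF lin])
  with D show ?thesis by (metis (no_types, lifting) ext)
qed

lemma has_real_derivative_line:
  assumes "smooth f" "i \<in> Basis"
  shows "((\<lambda>t. f (x + t *\<^sub>R i)) has_real_derivative pderiv_dir i f (x + t *\<^sub>R i)) (at t)"
proof -
  have "((\<lambda>t. x + t *\<^sub>R i) has_derivative (\<lambda>s. s *\<^sub>R i)) (at t)"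
    by (auto intro!: derivative_eq_intros)
  then have "((\<lambda>t. f (x + t *\<^sub>R i)) has_derivative
      (\<lambda>s. \<Sum>j\<in>Basis. ((s *\<^sub>R i) \<bullet> j) * pderiv_dir j f (x + t *\<^sub>R i))) (at t)"
    by (rule has_derivative_compose[OF _ has_derivative_smooth[OF assms(1)]])
  moreover have "(\<lambda>s. \<Sum>j\<in>Basis. ((s *\<^sub>R i) \<bullet> j) * pderiv_dir j f (x + t *\<^sub>R i))
      = (\<lambda>s. s * pderiv_dir i f (x + t *\<^sub>R i))"
  proof
    fix s
    have "(\<Sum>j\<in>Basis. ((s *\<^sub>R i) \<bullet> j) * pderiv_dir j f (x + t *\<^sub>R i))
        = (\<Sum>j\<in>Basis. if j = i then s * pderiv_dir i f (x + t *\<^sub>R i) else 0)"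
      using assms(2) by (intro sum.cong) (auto simp: inner_Basis)
    then show "(\<Sum>j\<in>Basis. ((s *\<^sub>R i) \<bullet> j) * pderiv_dir j f (x + t *\<^sub>R i))
        = s * pderiv_dir i f (x + t *\<^sub>R i)"
      using assms(2) by simp
  qed
  ultimately show ?thesis
    by (simp add: has_field_derivative_def mult_commute_abs)
qed

section \<open>Symmetry of mixed second derivatives\<close>

lemma second_difference_mean_value:
  assumes "smooth f" "i \<in> Basis" "j \<in> Basis" "0 < s"
  shows "\<exists>\<xi> c. 0 < \<xi> \<and> \<xi> < s \<and> 0 < c \<and> c < s \<and>
    f (x + s *\<^sub>R i + s *\<^sub>R j) - f (x + s *\<^sub>R i) - f (x + s *\<^sub>R j) + f x
      = s * s * pderiv_dir j (pderiv_dir i f) (x + \<xi> *\<^sub>R i + c *\<^sub>R j)"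
proof -
  \<comment> \<open>The difference in direction \<open>j\<close> is viewed as a function of the
    displacement in direction \<open>i\<close>; a second mean value step in direction
    \<open>j\<close> follows.\<close>
  let ?g = "\<lambda>t. f ((x + s *\<^sub>R j) + t *\<^sub>R i) - f (x + t *\<^sub>R i)"
  have "(?g has_real_derivative
      pderiv_dir i f ((x + s *\<^sub>R j) + t *\<^sub>R i) - pderiv_dir i f (x + t *\<^sub>R i)) (at t)" for t
    using assms by (intro DERIV_diff has_real_derivative_line)
  then obtain \<xi> where xi: "0 < \<xi>" "\<xi> < s"
    "?g s - ?g 0 = (s - 0) * (pderiv_dir i f ((x + s *\<^sub>R j) + \<xi> *\<^sub>R i) - pderiv_dir i f (x + \<xi> *\<^sub>R i))"
    using MVT2[OF assms(4), of ?g "\<lambda>t. pderiv_dir i f ((x + s *\<^sub>R j) + t *\<^sub>R i) - pderiv_dir i f (x + t *\<^sub>R i)"] by blast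
  let ?k = "\<lambda>t. pderiv_dir i f ((x + \<xi> *\<^sub>R i) + t *\<^sub>R j)"
  have "(?k has_real_derivative pderiv_dir j (pderiv_dir i f) ((x + \<xi> *\<^sub>R i) + t *\<^sub>R j)) (at t)" for t
    using assms by (intro has_real_derivative_line smooth_pderiv_dir)
  then obtain c where eta: "0 < c" "c < s"
    "?k s - ?k 0 = (s - 0) * pderiv_dir j (pderiv_dir i f) ((x + \<xi> *\<^sub>R i) + c *\<^sub>R j)"
    using MVT2[OF assms(4), of ?k "\<lambda>t. pderiv_dir j (pderiv_dir i f) ((x + \<xi> *\<^sub>R i) + t *\<^sub>R j)"] by blast
  show ?thesis
    using xi eta by (intro exI[of _ \<xi>] exI[of _ c]) (simp add: algebra_simps)
qed

text \<open>The intermediate points of the mean value theorem lie within 2s of \<open>x\<close>, so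
  continuity of the mixed derivative at \<open>x\<close> suffices. The quotient itself does not
  distinguish \<open>i\<close> from \<open>j\<close>, which is what gives Schwarz's theorem.\<close>

lemma second_difference_tendsto:
  assumes "smooth f" "i \<in> Basis" "j \<in> Basis"
  shows "((\<lambda>s. (f (x + s *\<^sub>R i + s *\<^sub>R j) - f (x + s *\<^sub>R i) - f (x + s *\<^sub>R j) + f x) / (s * s))
    \<longlongrightarrow> pderiv_dir j (pderiv_dir i f) x) (at_right 0)"
proof (rule tendstoI)
  fix e :: real assume "0 < e"
  let ?h = "pderiv_dir j (pderiv_dir i f)"
  have "isCont ?h x"
    using smooth_continuous[OF smooth_pderiv_dir[OF smooth_pderiv_dir[OF assms(1,2)] assms(3)], of UNIV]
    by (simp add: continuous_on_eq_continuous_at)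
  then obtain d where d: "0 < d" "\<And>y. dist y x < d ==> dist (?h y) (?h x) < e"
    using \<open>0 < e\<close> unfolding continuous_at_eps_delta by blast
  have "\<forall>\<^sub>F s in at_right 0. s < d / 2 \<and> 0 < (s::real)"
    using d(1) by (auto simp: eventually_at_right_field intro!: exI[of _ "d/2"])
  then show "\<forall>\<^sub>F s in at_right 0. dist ((f (x + s *\<^sub>R i + s *\<^sub>R j) - f (x + s *\<^sub>R i)
      - f (x + s *\<^sub>R j) + f x) / (s * s)) (?h x) < e"
  proof (rule eventually_mono)
    fix s :: real assume s: "s < d / 2 \<and> 0 < s"
    obtain \<xi> c where *: "0 < \<xi>" "\<xi> < s" "0 < c" "c < s"
      "f (x + s *\<^sub>R i + s *\<^sub>R j) - f (x + s *\<^sub>R i) - f (x + s *\<^sub>R j) + f x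
      = s * s * ?h (x + \<xi> *\<^sub>R i + c *\<^sub>R j)"
      using second_difference_mean_value[OF assms, of s x] s by blast
    have "dist (x + \<xi> *\<^sub>R i + c *\<^sub>R j) x = norm (\<xi> *\<^sub>R i + c *\<^sub>R j)"
      by (simp add: dist_norm add.assoc)
    also have "... \<le> \<xi> + c"
      using assms * by (intro norm_triangle_le) simp
    also have "... < d" using * s by simp
    finally show "dist ((f (x + s *\<^sub>R i + s *\<^sub>R j) - f (x + s *\<^sub>R i)
      - f (x + s *\<^sub>R j) + f x) / (s * s)) (?h x) < e"
      using d(2) * s by simp
  qed
qed

lemma pderiv_dir_commute:
  assumes "smooth f" "i \<in> Basis" "j \<in> Basis"
  shows "pderiv_dir i (pderiv_dir j f) x = pderiv_dir j (pderiv_dir i f) x"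
proof -
  have eq: "(\<lambda>s. (f (x + s *\<^sub>R j + s *\<^sub>R i) - f (x + s *\<^sub>R j) - f (x + s *\<^sub>R i) + f x) / (s * s))
    = (\<lambda>s. (f (x + s *\<^sub>R i + s *\<^sub>R j) - f (x + s *\<^sub>R i) - f (x + s *\<^sub>R j) + f x) / (s * s))"
    by (simp add: add.commute add.left_commute diff_diff_add)
  show ?thesis
    using second_difference_tendsto[OF assms(1,3,2), of x] unfolding eq
    by (rule tendsto_unique[OF trivial_limit_at_right_real _ second_difference_tendsto[OF assms]])
qed

lemma pderiv_dir_sum:
  assumes "\<And>i. i \<in> I ==> smooth (f i)"
  shows "pderiv_dir j (\<lambda>x. \<Sum>i\<in>I. f i x) x = (\<Sum>i\<in>I. pderiv_dir j (f i) x)"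
  using assms
proof (induction I rule: infinite_finite_induct)
  case (insert k I)
  then show ?case
    by (simp add: pderiv_dir_add smooth_differentiable smooth_sum)
qed (auto simp: pderiv_dir_eq[OF has_derivative_const])

lemma pderiv_dir_laplacian_commute:
  assumes "smooth f" "i \<in> Basis"
  shows "pderiv_dir i (laplacian f) = laplacian (pderiv_dir i f)"
proof
  fix x
  have "pderiv_dir i (laplacian f) x = (\<Sum>j\<in>Basis. pderiv_dir i (pderiv_dir j (pderiv_dir j f)) x)"
    unfolding laplacian_def[abs_def] using assms by (intro pderiv_dir_sum smooth_pderiv_dir)
  also have "... = (\<Sum>j\<in>Basis. pderiv_dir j (pderiv_dir j (pderiv_dir i f)) x)"
  proof (intro sum.cong refl)
    fix j :: 'a assume j: "j \<in> Basis"
    have "pderiv_dir i (pderiv_dir j f) = pderiv_dir j (pderiv_dir i f)"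
      using assms j by (intro ext pderiv_dir_commute)
    then show "pderiv_dir i (pderiv_dir j (pderiv_dir j f)) x = pderiv_dir j (pderiv_dir j (pderiv_dir i f)) x"
      using pderiv_dir_commute[OF smooth_pderiv_dir[OF assms(1) j] assms(2) j] by simp
  qed
  finally show "pderiv_dir i (laplacian f) x = laplacian (pderiv_dir i f) x"
    by (simp add: laplacian_def)
qed

lemma pderiv_dir_laplacian_funpow_commute:
  "smooth f ==> i \<in> Basis ==> pderiv_dir i ((laplacian ^^ k) f) = (laplacian ^^ k) (pderiv_dir i f)"
  by (induction k) (auto simp: pderiv_dir_laplacian_commute smooth_laplacian_funpow)

section \<open>Linearity of iterated Laplacians and polyharmonic gradients\<close>

lemma laplacian_add: "smooth f ==> smooth g ==> laplacian (\<lambda>x. f x + g x) = (\<lambda>x. laplacian f x + laplacian g x)"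
proof
  fix x assume fg: "smooth f" "smooth g"
  have "pderiv_dir i (\<lambda>x. f x + g x) = (\<lambda>x. pderiv_dir i f x + pderiv_dir i g x)" for i
    using fg by (intro ext pderiv_dir_add smooth_differentiable)
  then show "laplacian (\<lambda>x. f x + g x) x = laplacian f x + laplacian g x"
    unfolding laplacian_def using fg
    by (simp add: pderiv_dir_add smooth_pderiv_dir smooth_differentiable sum.distrib)
qed

lemma laplacian_cmult: "smooth f ==> laplacian (\<lambda>x. c * f x) = (\<lambda>x. c * laplacian f x)"
proof
  fix x assume f: "smooth f"
  have "pderiv_dir i (\<lambda>x. c * f x) = (\<lambda>x. c * pderiv_dir i f x)" for i
    using f by (intro ext pderiv_dir_cmult smooth_differentiable)
  then show "laplacian (\<lambda>x. c * f x) x = c * laplacian f x"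
    unfolding laplacian_def using f
    by (simp add: pderiv_dir_cmult smooth_pderiv_dir smooth_differentiable sum_distrib_left)
qed

lemma laplacian_funpow_add:
  "smooth f ==> smooth g ==> (laplacian ^^ k) (\<lambda>x. f x + g x) = (\<lambda>x. (laplacian ^^ k) f x + (laplacian ^^ k) g x)"
  by (induction k) (auto simp: laplacian_add smooth_laplacian_funpow)

lemma laplacian_funpow_cmult:
  "smooth f ==> (laplacian ^^ k) (\<lambda>x. c * f x) = (\<lambda>x. c * (laplacian ^^ k) f x)"
  by (induction k) (auto simp: laplacian_cmult smooth_laplacian_funpow)

lemma nabla_add:
  assumes "smooth f" "smooth g"
  shows "nabla k (\<lambda>x. f x + g x) x = nabla k f x + nabla k g x"
  using assms by (simp add: nabla_def laplacian_funpow_add pderiv_dir_add smooth_differentiable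
      smooth_laplacian_funpow scaleR_left_distrib sum.distrib)

lemma nabla_cmult:
  assumes "smooth f"
  shows "nabla k (\<lambda>x. c * f x) x = c *\<^sub>R nabla k f x"
  using assms by (simp add: nabla_def laplacian_funpow_cmult pderiv_dir_cmult smooth_differentiable
      smooth_laplacian_funpow scaleR_sum_right)

lemma nabla_diff:
  assumes "smooth f" "smooth g"
  shows "nabla k (\<lambda>x. f x - g x) x = nabla k f x - nabla k g x"
  using nabla_add[OF assms(1) smooth_cmult[OF assms(2)], of k "-1"] nabla_cmult[OF assms(2), of k "-1"]
  by simp

lemma nabla_continuous: "smooth f ==> continuous_on S (nabla k f)"
  unfolding nabla_def
  by (cases "even k") (auto intro!: continuous_intros smooth_continuous smooth_laplacian_funpow smooth_pderiv_dir)

lemma nabla_0: "nabla 0 f x = (f x, 0)"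
  by (simp add: nabla_def)

section \<open>Test functions and their supports\<close>

lemma test_functions_smooth: "f \<in> test_functions \<Omega> ==> smooth f"
  by (simp add: test_functions_def smooth_def)

lemma test_functionsI:
  assumes "smooth f" "compact K" "K \<subseteq> \<Omega>" "\<And>x. x \<notin> K ==> f x = 0"
  shows "f \<in> test_functions \<Omega>"
proof -
  have "closure {x. f x \<noteq> 0} \<subseteq> K"
    using assms by (intro closure_minimal) (auto simp: compact_imp_closed)
  then have "compact (closure {x. f x \<noteq> 0})"
    using closed_Int_compact[OF closed_closure assms(2), of "{x. f x \<noteq> 0}"] by (simp add: Int_absorb2)
  with \<open>closure {x. f x \<noteq> 0} \<subseteq> K\<close> show ?thesis
    using assms(1,3) unfolding test_functions_def smooth_def by blast
qed

lemma test_functionsE: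
  assumes "f \<in> test_functions \<Omega>"
  obtains K where "compact K" "K \<subseteq> \<Omega>" "\<And>x. x \<notin> K ==> f x = 0"
proof (rule that[of "closure {x. f x \<noteq> 0}"])
  show "f x = 0" if "x \<notin> closure {x. f x \<noteq> 0}" for x
    using that subsetD[OF closure_subset, of x "{x. f x \<noteq> 0}"] by blast
  show "compact (closure {x. f x \<noteq> 0})" "closure {x. f x \<noteq> 0} \<subseteq> \<Omega>"
    using assms unfolding test_functions_def by blast+
qed

lemma test_functions_add: 
  assumes "f \<in> test_functions \<Omega>" "g \<in> test_functions \<Omega>"
  shows "(\<lambda>x. f x + g x) \<in> test_functions \<Omega>"
proof -
  obtain K L where "compact K" "K \<subseteq> \<Omega>" "\<And>x. x \<notin> K ==> f x = 0" "compact L" "L \<subseteq> \<Omega>" "\<And>x. x \<notin> L ==> g x = 0"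
    using assms test_functionsE by metis
  then show ?thesis
    using assms by (intro test_functionsI[of _ "K \<union> L"]) (auto intro: smooth_add test_functions_smooth)
qed

lemma test_functions_cmult: 
  assumes "f \<in> test_functions \<Omega>"
  shows "(\<lambda>x. c * f x) \<in> test_functions \<Omega>"
proof -
  obtain K where "compact K" "K \<subseteq> \<Omega>" "\<And>x. x \<notin> K ==> f x = 0"
    using assms test_functionsE by metis
  then show ?thesis
    using assms by (intro test_functionsI[of _ "K"]) (auto intro: smooth_cmult test_functions_smooth)
qed

lemma test_functions_diff: 
  "f \<in> test_functions \<Omega> ==> g \<in> test_functions \<Omega> ==> (\<lambda>x. f x - g x) \<in> test_functions \<Omega>"
  using test_functions_add[OF _ test_functions_cmult, of f \<Omega> g "-1"] by simp

lemma test_functions_zero: "(\<lambda>x. 0) \<in> test_functions \<Omega>"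
  by (intro test_functionsI[of _ "{}"]) (auto intro: smooth_const)

lemma pderiv_dir_zero_outside:
  assumes "closed K" "\<And>x. x \<notin> K ==> f x = 0" "x \<notin> K"
  shows "pderiv_dir i f x = 0"
proof -
  have "((\<lambda>x. 0) has_derivative (\<lambda>x. 0)) (at x)" by simp
  then have "(f has_derivative (\<lambda>x. 0)) (at x)"
    using has_derivative_transform_within_open[of "\<lambda>x. 0" "\<lambda>x. 0" x UNIV "- K" f] assms
    by (simp add: open_Compl)
  then show ?thesis by (simp add: pderiv_dir_eq)
qed

lemma test_functions_pderiv_dir:
  assumes "f \<in> test_functions \<Omega>" "i \<in> Basis"
  shows "pderiv_dir i f \<in> test_functions \<Omega>"
proof -
  obtain K where K: "compact K" "K \<subseteq> \<Omega>" "\<And>x. x \<notin> K ==> f x = 0"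
    using assms test_functionsE by metis
  have "smooth (pderiv_dir i f)"
    using assms by (intro smooth_pderiv_dir test_functions_smooth)
  then show ?thesis
    using K pderiv_dir_zero_outside[OF compact_imp_closed[OF K(1)] K(3)]
    by (intro test_functionsI[of _ "K"])
qed

lemma test_functions_sum:
  "(\<And>i. i \<in> I ==> f i \<in> test_functions \<Omega>) ==> (\<lambda>x. \<Sum>i\<in>I. f i x) \<in> test_functions \<Omega>"
  by (induction I rule: infinite_finite_induct) (auto intro: test_functions_add test_functions_zero)

lemma test_functions_laplacian: "f \<in> test_functions \<Omega> ==> laplacian f \<in> test_functions \<Omega>"
  unfolding laplacian_def[abs_def] by (intro test_functions_sum test_functions_pderiv_dir)

lemma test_functions_laplacian_funpow: "f \<in> test_functions \<Omega> ==> (laplacian ^^ k) f \<in> test_functions \<Omega>"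
  by (induction k) (auto intro: test_functions_laplacian)

text \<open>A derivative vanishes on the open complement of a closed set carrying the function, so a
  single compact set serves for the function and all its derivatives.\<close>

lemma nabla_zero_outside:
  assumes "f \<in> test_functions \<Omega>"
  obtains K where "compact K" "K \<subseteq> \<Omega>" "\<And>x. x \<notin> K ==> nabla k f x = 0" "\<And>x. x \<notin> K ==> f x = 0"
proof -
  obtain K where K: "compact K" "K \<subseteq> \<Omega>" "\<And>x. x \<notin> K ==> f x = 0"
    using assms test_functionsE by metis
  have L: "(laplacian ^^ j) f x = 0" if "x \<notin> K" for j x
    using that
  proof (induction j arbitrary: x)
    case (Suc j)
    have "pderiv_dir i ((laplacian ^^ j) f) y = 0" if "y \<notin> K" for i y
      using Suc.IH compact_imp_closed[OF K(1)] that pderiv_dir_zero_outside by blast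
    then have "pderiv_dir i (pderiv_dir i ((laplacian ^^ j) f)) y = 0" if "y \<notin> K" for i y
      using compact_imp_closed[OF K(1)] that pderiv_dir_zero_outside by blast
    then have "laplacian ((laplacian ^^ j) f) x = 0"
      using Suc.prems by (subst laplacian_def) simp
    then show ?case by simp
  qed (simp add: K)
  have "nabla k f x = 0" if "x \<notin> K" for x
    using L that pderiv_dir_zero_outside[OF compact_imp_closed[OF K(1)] L]
    by (auto simp: nabla_def zero_prod_def)
  with K that show ?thesis by blast
qed

section \<open>The truncated gradient kernel\<close>

lemma lborel_integral_translation:
  fixes f :: "'a::euclidean_space => 'b::euclidean_space"
  assumes "f \<in> borel_measurable borel"
  shows "(LINT x|lborel. f (c + x)) = (LINT x|lborel. f x)"
proof -
  have "(LINT x|lborel. f x) = (LINT x|distr lborel borel ((+) c). f x)"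
    by (simp add: lborel_distr_plus)
  also have "... = (LINT x|lborel. f (c + x))"
    using assms by (intro integral_distr) auto
  finally show ?thesis ..
qed

lemma lborel_integrable_translation:
  fixes f :: "'a::euclidean_space => 'b::euclidean_space"
  assumes "integrable lborel f"
  shows "integrable lborel (\<lambda>x. f (c + x))"
proof -
  have "integrable (distr lborel borel ((+) c)) f"
    using assms by (simp add: lborel_distr_plus)
  then show ?thesis
    using assms by (subst (asm) integrable_distr_eq) auto
qed

lemma integrable_bounded_support:
  fixes f :: "'a::euclidean_space => 'b::euclidean_space"
  assumes "f \<in> borel_measurable borel" "\<And>x. norm (f x) \<le> B" "\<And>x. x \<notin> cball 0 R ==> f x = 0"
  shows "integrable lborel f"
proof (rule Bochner_Integration.integrable_bound)
  show "integrable lborel (\<lambda>x. B * indicator (cball (0::'a) R) x :: real)"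
    by (intro integrable_mult_right integrable_real_indicator) (auto simp: emeasure_lborel_cball_finite[unfolded infinity_ennreal_def])
  show "AE x in lborel. norm (f x) \<le> norm (B * indicator (cball (0::'a) R) x :: real)"
    using assms(2,3) by (intro always_eventually allI) (auto simp: indicator_def intro: order_trans[OF _ abs_ge_self])
qed (use assms in auto)

text \<open>By translation invariance every difference quotient has integral zero, and the Lipschitz
  bound together with bounded support dominates the quotients. Differentiability is asked only
  almost everywhere because the truncated kernel has a corner on a sphere.\<close>

lemma integral_directional_derivative_eq_0:
  fixes f :: "'a::euclidean_space => real"
  assumes lip: "\<And>x y. \<bar>f x - f y\<bar> \<le> L * norm (x - y)"
    and supp: "\<And>x. x \<notin> cball 0 R ==> f x = 0"
    and D: "AE x in lborel. ((\<lambda>t. f (x + t *\<^sub>R e)) has_real_derivative D x) (at 0)"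
    and meas: "D \<in> borel_measurable borel"
  shows "(LINT x|lborel. D x) = 0"
proof -
  define t where "t n = 1 / real (Suc n)" for n
  define s where "s n x = (f (x + t n *\<^sub>R e) - f x) / t n" for n x
  have t: "0 < t n" "t n \<le> 1" for n by (auto simp: t_def)
  have t0: "t \<longlonglongrightarrow> 0" unfolding t_def by (rule LIMSEQ_Suc[OF lim_1_over_n])
  have "L-lipschitz_on UNIV f" if "0 \<le> L"
    using lip that by (auto simp: lipschitz_on_def dist_norm)
  moreover have "0 \<le> L"
  proof -
    obtain b :: 'a where "b \<in> Basis" using nonempty_Basis by blast
    then have "0 \<le> L * norm b" using lip[of b 0] by (simp add: order_trans[OF abs_ge_zero])
    then show ?thesis using \<open>b \<in> Basis\<close> by simp
  qed
  ultimately have cont: "continuous_on UNIV f" by (metis lipschitz_on_continuous_on)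
  have fm[measurable]: "f \<in> borel_measurable borel"
    by (rule borel_measurable_continuous_onI[OF cont])
  have "(\<lambda>n. LINT x|lborel. s n x) \<longlonglongrightarrow> (LINT x|lborel. D x)"
  proof (rule integral_dominated_convergence)
    show "integrable lborel (\<lambda>x. L * norm e * indicator (cball (0::'a) (R + norm e)) x :: real)"
      by (intro integrable_mult_right integrable_real_indicator) (auto simp: emeasure_lborel_cball_finite[unfolded infinity_ennreal_def])
    show "AE x in lborel. (\<lambda>n. s n x) \<longlonglongrightarrow> D x"
      using D
    proof eventually_elim
      case (elim x)
      then have "((\<lambda>h. (f (x + h *\<^sub>R e) - f x) / h) \<longlongrightarrow> D x) (at 0)"
        by (simp add: has_field_derivative_iff)
      moreover have "filterlim t (at 0) sequentially"
        using t0 t by (auto simp: filterlim_at less_le intro!: always_eventually)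
      ultimately show ?case
        unfolding s_def by (rule filterlim_compose)
    qed
    show "AE x in lborel. norm (s n x) \<le> L * norm e * indicator (cball (0::'a) (R + norm e)) x" for n
    proof (intro always_eventually allI)
      fix x
      show "norm (s n x) \<le> L * norm e * indicator (cball (0::'a) (R + norm e)) x"
      proof (cases "x \<in> cball 0 (R + norm e)")
        case True
        have "\<bar>f (x + t n *\<^sub>R e) - f x\<bar> \<le> L * (t n * norm e)"
          using lip[of "x + t n *\<^sub>R e" x] t[of n] by simp
        then show ?thesis using True t[of n] by (simp add: s_def field_simps)
      next
        case False
        have "norm x \<le> norm (x + t n *\<^sub>R e) + norm (t n *\<^sub>R e)"
          using norm_triangle_ineq4[of "x + t n *\<^sub>R e" "t n *\<^sub>R e"] by simp
        also have "norm (t n *\<^sub>R e) \<le> norm e"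
          using t[of n] by (simp add: mult_left_le_one_le)
        finally have "norm x \<le> norm (x + t n *\<^sub>R e) + norm e" by simp
        moreover have "R + norm e < norm x" "0 \<le> norm e" using False by auto
        ultimately have "R < norm (x + t n *\<^sub>R e)" "R < norm x" by linarith+
        then have "x + t n *\<^sub>R e \<notin> cball 0 R" "x \<notin> cball 0 R" by auto
        then show ?thesis using supp \<open>0 \<le> L\<close> by (simp add: s_def)
      qed
    qed
  qed (use meas in \<open>auto simp: s_def\<close>)
  moreover have "(LINT x|lborel. s n x) = 0" for n
  proof -
    have B: "\<bar>f x\<bar> \<le> L * (norm x + norm z)" if "z \<notin> cball 0 R" for x z :: 'a
    proof -
      have "\<bar>f x\<bar> \<le> L * norm (x - z)"
        using lip[of x z] supp[OF that] by simp
      also have "... \<le> L * (norm x + norm z)"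
        using \<open>0 \<le> L\<close> by (intro mult_left_mono norm_triangle_ineq4)
      finally show ?thesis .
    qed
    \<comment> \<open>A point outside the ball, where \<open>f\<close> vanishes, turns the Lipschitz
      estimate into a global bound and hence into integrability.\<close>
    obtain b :: 'a where b: "b \<in> Basis" using nonempty_Basis by blast
    define z where "z = (\<bar>R\<bar> + 1) *\<^sub>R b"
    have z: "z \<notin> cball 0 R" using b by (simp add: z_def)
    have "\<bar>f x\<bar> \<le> L * (\<bar>R\<bar> + norm z)" for x
    proof (cases "x \<in> cball 0 R")
      case True
      then have "L * (norm x + norm z) \<le> L * (\<bar>R\<bar> + norm z)"
        using \<open>0 \<le> L\<close> by (intro mult_left_mono) auto
      then show ?thesis using B[OF z, of x] by simp
    qed (use supp \<open>0 \<le> L\<close> in auto)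
    then have int: "integrable lborel f"
      by (intro integrable_bounded_support[of f _ R]) (auto simp: supp)
    have "(LINT x|lborel. f (x + t n *\<^sub>R e)) = (LINT x|lborel. f x)"
      using lborel_integral_translation[OF fm, of "t n *\<^sub>R e"] by (simp add: add.commute)
    moreover have "integrable lborel (\<lambda>x. f (x + t n *\<^sub>R e))"
      using lborel_integrable_translation[OF int, of "t n *\<^sub>R e"] by (simp add: add.commute)
    ultimately show ?thesis
      using int by (simp add: s_def)
  qed
  ultimately show ?thesis
    by (simp add: LIMSEQ_const_iff)
qed

text \<open>The field z / |z|^N with the modulus in the denominator frozen below \<epsilon>. It is
  linear near the origin, hence globally Lipschitz, and its divergence is the constant N /
  \<epsilon>^N in the ball of radius \<epsilon> and zero outside: a spread-out Dirac mass.\<close>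

definition tkernel :: "real => 'a::euclidean_space => 'a" where
  "tkernel \<epsilon> z = (1 / max (norm z) \<epsilon> ^ DIM('a)) *\<^sub>R z"

text \<open>Bernoulli's inequality applied to A / B. The resulting constant depends on the cutoff
  \<open>e\<close> alone, which is what makes the truncated kernel Lipschitz with an explicit
  constant.\<close>

lemma inverse_power_diff_le:
  fixes A B :: real
  assumes "0 < e" "e \<le> A" "A \<le> B"
  shows "A * (1 / A ^ n - 1 / B ^ n) \<le> real n / e ^ n * (B - A)"
proof -
  have pos: "0 < A" "0 < B" using assms by auto
  have "1 + real n * (A / B - 1) \<le> (1 + (A / B - 1)) ^ n"
    using pos by (intro Bernoulli_inequality) simp
  then have "1 - (A / B) ^ n \<le> real n * (1 - A / B)"
    by (simp add: algebra_simps)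
  also have "1 - A / B \<le> (B - A) / A"
  proof -
    have "1 - A / B = (B - A) / B" using pos by (simp add: field_simps)
    also have "... \<le> (B - A) / A" using assms pos by (intro divide_left_mono) auto
    finally show ?thesis .
  qed
  finally have *: "1 - (A / B) ^ n \<le> real n * ((B - A) / A)" by (simp add: mult_left_mono)
  have "A * (1 / A ^ n - 1 / B ^ n) = A / A ^ n * (1 - (A / B) ^ n)"
    using pos by (simp add: field_simps power_divide)
  also have "... \<le> A / A ^ n * (real n * ((B - A) / A))"
    using * pos by (intro mult_left_mono) auto
  also have "... = real n * (B - A) * (1 / A ^ n)" using pos by simp
  also have "... \<le> real n * (B - A) * (1 / e ^ n)"
    using assms by (intro mult_left_mono divide_left_mono power_mono) auto
  finally show ?thesis by simp
qed

lemma tkernel_lipschitz: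
  fixes z w :: "'a::euclidean_space"
  assumes "0 < e"
  shows "norm (tkernel e w - tkernel e z) \<le> (1 + real DIM('a)) / e ^ DIM('a) * norm (w - z)"
proof -
  have *: "norm (tkernel e w - tkernel e z) \<le> (1 + real DIM('a)) / e ^ DIM('a) * norm (w - z)"
    if le: "norm z \<le> norm w" for w z :: 'a
  proof -
    let ?A = "max (norm z) e" and ?B = "max (norm w) e" and ?N = "DIM('a)"
    have AB: "0 < ?A" "?A \<le> ?B" "0 < ?B" "?B - ?A \<le> norm (w - z)"
      using le assms norm_triangle_ineq2[of w z] by auto
    have g: "0 \<le> 1 / ?A ^ ?N - 1 / ?B ^ ?N"
      using AB by (simp add: frac_le power_mono)
    \<comment> \<open>One part moves the point with the coefficient of the larger modulus, the other
      changes the coefficient at the point of smaller modulus.\<close>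
    have "tkernel e w - tkernel e z = (1 / ?B ^ ?N) *\<^sub>R (w - z) - (1 / ?A ^ ?N - 1 / ?B ^ ?N) *\<^sub>R z"
      by (simp add: tkernel_def algebra_simps)
    also have "norm ... \<le> norm ((1 / ?B ^ ?N) *\<^sub>R (w - z)) + norm ((1 / ?A ^ ?N - 1 / ?B ^ ?N) *\<^sub>R z)"
      by (rule norm_triangle_ineq4)
    also have "norm ((1 / ?A ^ ?N - 1 / ?B ^ ?N) *\<^sub>R z) = (1 / ?A ^ ?N - 1 / ?B ^ ?N) * norm z"
      using g by simp
    also have "... \<le> (1 / ?A ^ ?N - 1 / ?B ^ ?N) * ?A"
      using g by (intro mult_left_mono) auto
    also have "... \<le> real ?N / e ^ ?N * (?B - ?A)"
      using inverse_power_diff_le[OF assms, of ?A ?B ?N] AB by (simp add: mult.commute)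
    also have "... \<le> real ?N / e ^ ?N * norm (w - z)"
      using AB assms by (intro mult_left_mono) auto
    also have "norm ((1 / ?B ^ ?N) *\<^sub>R (w - z)) \<le> 1 / e ^ ?N * norm (w - z)"
      using assms AB by (simp add: divide_right_mono mult_right_mono frac_le power_mono)
    finally show ?thesis by (simp add: add_divide_distrib distrib_right)
  qed
  show ?thesis
  proof (cases "norm z \<le> norm w")
    case False
    then show ?thesis using *[of w z] by (simp add: norm_minus_commute)
  qed (rule *)
qed

lemma tkernel_continuous:
  assumes "0 < e"
  shows "continuous_on S (tkernel e :: 'a::euclidean_space => 'a)"
proof -
  have "((1 + real DIM('a)) / e ^ DIM('a))-lipschitz_on S (tkernel e :: 'a => 'a)"
    using tkernel_lipschitz[OF assms] assms by (auto simp: lipschitz_on_def dist_norm)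
  then show ?thesis by (rule lipschitz_on_continuous_on)
qed

text \<open>Truncation only lowers the modulus, so the bound by the singular kernel is uniform in
  \<open>e\<close> and survives the limit in which the truncation is removed.\<close>

lemma norm_tkernel_le:
  fixes z :: "'a::euclidean_space"
  shows "norm (tkernel e z) \<le> norm z powr (1 - real DIM('a))"
proof (cases "z = 0")
  case False
  then have "norm z / max (norm z) e ^ DIM('a) \<le> norm z / norm z ^ DIM('a)"
    by (intro divide_left_mono power_mono mult_pos_pos zero_less_power) (auto simp: less_max_iff_disj)
  also have "... = norm z powr (1 - real DIM('a))"
    using False by (simp add: powr_diff powr_realpow)
  finally show ?thesis using False by (simp add: tkernel_def abs_of_pos less_max_iff_disj)
qed (simp add: tkernel_def)

text \<open>The modulus grows linearly up to radius \<open>e\<close> and then does not increase.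
  Writing the bound as e / e^N avoids a subtraction in the exponent.\<close>

lemma norm_tkernel_le_const:
  fixes z :: "'a::euclidean_space"
  assumes "0 < e"
  shows "norm (tkernel e z) \<le> e / e ^ DIM('a)"
proof -
  let ?M = "max (norm z) e"
  have M: "e \<le> ?M" "0 < ?M" "norm z \<le> ?M" using assms by auto
  obtain n where n: "DIM('a) = Suc n" using DIM_positive[where 'a='a] by (cases "DIM('a)") auto
  have "norm (tkernel e z) = norm z / ?M ^ DIM('a)"
    using M by (simp add: tkernel_def)
  also have "... \<le> ?M / ?M ^ DIM('a)"
    using M by (intro divide_right_mono) auto
  also have "... = 1 / ?M ^ n" using M by (simp add: n)
  also have "... \<le> 1 / e ^ n" using M assms by (intro divide_left_mono power_mono) auto
  also have "... = e / e ^ DIM('a)" using assms by (simp add: n)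
  finally show ?thesis .
qed

text \<open>An entry of the Jacobian matrix of \<open>tkernel\<close>. On the sphere of radius
  \<epsilon>, where the kernel is not differentiable, the exterior formula is taken; that set is
  null. The symmetry in \<open>i\<close> and \<open>j\<close> reflects that the kernel is a gradient
  field.\<close>

definition dtkernel :: "real => 'a::euclidean_space => 'a => 'a => real" where
  "dtkernel \<epsilon> i j z = (if norm z < \<epsilon> then (i \<bullet> j) / \<epsilon> ^ DIM('a)
     else (i \<bullet> j) / norm z ^ DIM('a) - real DIM('a) * (z \<bullet> i) * (z \<bullet> j) / norm z ^ (DIM('a) + 2))"

lemma dtkernel_commute: "dtkernel e i j z = dtkernel e j i z"
  by (simp add: dtkernel_def inner_commute mult_ac)

lemma dtkernel_measurable[measurable]: "dtkernel e i j \<in> borel_measurable borel"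
  unfolding dtkernel_def[abs_def] by measurable

text \<open>The trace is the divergence of the kernel. Outside the ball the field is a multiple of
  the gradient of the fundamental solution, hence divergence free.\<close>

lemma sum_dtkernel:
  fixes z :: "'a::euclidean_space"
  assumes "0 < e"
  shows "(\<Sum>i\<in>Basis. dtkernel e i i z) = (if norm z < e then real DIM('a) / e ^ DIM('a) else 0)"
proof (cases "norm z < e")
  case False
  then have z: "norm z > 0" using assms by linarith
  define c where "c = real DIM('a) / norm z ^ (DIM('a) + 2)"
  have "(\<Sum>i\<in>Basis. dtkernel e i i z) =
      (\<Sum>i\<in>(Basis::'a set). 1 / norm z ^ DIM('a) - c * ((z \<bullet> i) * (z \<bullet> i)))"
    using False by (intro sum.cong) (auto simp: dtkernel_def inner_Basis c_def)
  also have "... = real DIM('a) * (1 / norm z ^ DIM('a)) - c * (z \<bullet> z)"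
    by (simp add: sum_subtractf sum_distrib_left[symmetric] euclidean_inner[of z z])
  also have "z \<bullet> z = norm z ^ 2" by (simp add: power2_norm_eq_inner)
  also have "c * norm z ^ 2 = real DIM('a) / norm z ^ DIM('a)"
    using z by (simp add: c_def power_add power2_eq_square del: zero_less_norm_iff)
  finally show ?thesis using False by simp
qed (simp add: dtkernel_def inner_Basis)

text \<open>Off the sphere of truncation the kernel agrees near \<open>z\<close> either with a
  linear field or with the untruncated one, and both regions are open along the line.\<close>

lemma has_derivative_tkernel:
  fixes z e i :: "'a::euclidean_space"
  assumes "0 < d" "norm z \<noteq> d"
  shows "((\<lambda>t. tkernel d (z + t *\<^sub>R e) \<bullet> i) has_real_derivative dtkernel d i e z) (at 0)"
proof (cases "norm z < d")
  case True
  have "((\<lambda>t. (z \<bullet> i + t * (e \<bullet> i)) / d ^ DIM('a)) has_real_derivative dtkernel d i e z) (at 0)"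
    using True assms by (auto intro!: derivative_eq_intros simp: dtkernel_def inner_commute[of i e])
  moreover have "open ((\<lambda>t. norm (z + t *\<^sub>R e)) -` {..<d})"
    by (auto intro!: continuous_open_vimage continuous_intros)
  ultimately show ?thesis
    by (rule has_field_derivative_transform_within_open) (use True in \<open>auto simp: tkernel_def max_def inner_add_left\<close>)
next
  case False
  with assms have *: "d < norm z" "z \<noteq> 0" by auto
  have n: "((\<lambda>t. norm (z + t *\<^sub>R e)) has_real_derivative (sgn z \<bullet> e)) (at 0)"
  proof -
    have "(norm has_derivative (\<lambda>h. h \<bullet> sgn (z + 0 *\<^sub>R e))) (at (z + 0 *\<^sub>R e))"
      using * by (intro has_derivative_norm) auto
    moreover have "((\<lambda>t. z + t *\<^sub>R e) has_derivative (\<lambda>s. s *\<^sub>R e)) (at 0)"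
      by (auto intro!: derivative_eq_intros)
    ultimately have "((\<lambda>t. norm (z + t *\<^sub>R e)) has_derivative (\<lambda>s. (s *\<^sub>R e) \<bullet> sgn (z + 0 *\<^sub>R e))) (at 0)"
      by (intro has_derivative_compose[of "\<lambda>t. z + t *\<^sub>R e" _ 0 UNIV norm])
    then show ?thesis
      by (simp add: has_field_derivative_def mult_commute_abs inner_commute)
  qed
  have "((\<lambda>t. (1 / norm (z + t *\<^sub>R e) ^ DIM('a)) * ((z + t *\<^sub>R e) \<bullet> i)) has_real_derivative dtkernel d i e z) (at 0)"
  proof -
    obtain k where k: "DIM('a) = Suc k" using DIM_positive[where 'a='a] by (cases "DIM('a)") auto
    have "((\<lambda>t. (1 / norm (z + t *\<^sub>R e) ^ DIM('a)) * ((z + t *\<^sub>R e) \<bullet> i)) has_real_derivative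
        (- (real DIM('a) * norm z ^ k * (sgn z \<bullet> e)) / (norm z ^ DIM('a) * norm z ^ DIM('a))) * (z \<bullet> i)
          + (1 / norm z ^ DIM('a)) * (e \<bullet> i)) (at 0)"
    proof -
      have P: "((\<lambda>t. norm (z + t *\<^sub>R e) ^ DIM('a)) has_real_derivative real DIM('a) * norm z ^ k * (sgn z \<bullet> e)) (at 0)"
        using DERIV_power[OF n, of "DIM('a)"] by (simp add: k mult_ac)
      have Q: "((\<lambda>t. (z + t *\<^sub>R e) \<bullet> i) has_real_derivative e \<bullet> i) (at 0)"
        by (auto intro!: derivative_eq_intros simp: inner_add_left)
      have "norm (z + 0 *\<^sub>R e) ^ DIM('a) \<noteq> 0" using * by simp
      from DERIV_mult[OF DERIV_inverse_fun[OF P this] Q] show ?thesis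
        using * by (simp add: divide_inverse mult_ac)
    qed
    moreover have "(- (real DIM('a) * norm z ^ k * (sgn z \<bullet> e)) / (norm z ^ DIM('a) * norm z ^ DIM('a))) * (z \<bullet> i)
          + (1 / norm z ^ DIM('a)) * (e \<bullet> i) = dtkernel d i e z"
      using False * by (simp add: dtkernel_def k sgn_div_norm inner_commute field_simps)
    ultimately show ?thesis by simp
  qed
  moreover have "open ((\<lambda>t. norm (z + t *\<^sub>R e)) -` {d<..})"
    by (auto intro!: continuous_open_vimage continuous_intros)
  ultimately show ?thesis
    by (rule has_field_derivative_transform_within_open) (use * in \<open>auto simp: tkernel_def max_def\<close>)
qed

text \<open>The Lipschitz constant is the sum of sup bounds of the partial derivatives, each of
  which is again a test function.\<close>

lemma test_function_bounds:
  assumes "g \<in> test_functions \<Omega>"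
  obtains B L R where "0 \<le> B" "0 \<le> L" "\<And>x. \<bar>g x\<bar> \<le> B" "\<And>x y. \<bar>g x - g y\<bar> \<le> L * norm (x - y)"
    "\<And>x. x \<notin> cball 0 R ==> g x = 0"
proof -
  have bdd: "\<exists>B\<ge>0. \<forall>x. \<bar>f x\<bar> \<le> B" if phi: "f \<in> test_functions \<Omega>" for f :: "'a => real"
  proof -
    obtain K where K: "compact K" "K \<subseteq> \<Omega>" "\<And>x. x \<notin> K ==> f x = 0"
      using test_functionsE[OF phi] by blast
    have "bounded (f ` K)"
      using K(1) smooth_continuous[OF test_functions_smooth[OF phi]]
      by (intro compact_imp_bounded compact_continuous_image)
    then obtain B where "\<forall>x\<in>K. \<bar>f x\<bar> \<le> B" by (auto simp: bounded_iff)
    then show ?thesis using K(3) by (intro exI[of _ "\<bar>B\<bar>"]) (metis abs_ge_self abs_ge_zero abs_zero order_trans)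
  qed
  obtain B where B: "B \<ge> 0" "\<forall>x. \<bar>g x\<bar> \<le> B" using bdd[OF assms] by blast
  have "\<forall>i\<in>Basis. \<exists>b\<ge>0. \<forall>x. \<bar>pderiv_dir i g x\<bar> \<le> b"
    using bdd test_functions_pderiv_dir[OF assms] by blast
  then obtain b where b: "\<And>i. i \<in> Basis ==> 0 \<le> b i" "\<And>i x. i \<in> Basis ==> \<bar>pderiv_dir i g x\<bar> \<le> b i"
    by metis
  let ?L = "\<Sum>i\<in>(Basis::'a set). b i"
  have lip: "norm (g x - g y) \<le> ?L * norm (x - y)" for x y
  proof (rule differentiable_bound[of UNIV g "\<lambda>x h. \<Sum>i\<in>Basis. (h \<bullet> i) * pderiv_dir i g x"])
    show "(g has_derivative (\<lambda>h. \<Sum>i\<in>Basis. (h \<bullet> i) * pderiv_dir i g x)) (at x)" for x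
      by (rule has_derivative_smooth[OF test_functions_smooth[OF assms]])
    show "onorm (\<lambda>h. \<Sum>i\<in>Basis. (h \<bullet> i) * pderiv_dir i g x) \<le> ?L" for x
    proof (rule onorm_le)
      fix h :: 'a
      have "norm (\<Sum>i\<in>Basis. (h \<bullet> i) * pderiv_dir i g x) \<le> (\<Sum>i\<in>Basis. norm h * b i)"
        using b by (intro sum_norm_le) (auto simp: abs_mult intro!: mult_mono Basis_le_norm)
      then show "norm (\<Sum>i\<in>Basis. (h \<bullet> i) * pderiv_dir i g x) \<le> ?L * norm h"
        by (simp add: sum_distrib_left mult.commute)
    qed
  qed auto
  obtain K where K: "compact K" "K \<subseteq> \<Omega>" "\<And>x. x \<notin> K ==> g x = 0"
    using test_functionsE[OF assms] by blast
  obtain R where "\<forall>x\<in>K. norm x \<le> R"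
    using compact_imp_bounded[OF K(1)] unfolding bounded_iff by blast
  then have "K \<subseteq> cball 0 R" by auto
  show ?thesis
  proof (rule that[of B ?L R])
    show "0 \<le> ?L" using b(1) by (intro sum_nonneg) auto
    show "g x = 0" if "x \<notin> cball 0 R" for x
      using K(3) \<open>K \<subseteq> cball 0 R\<close> that by blast
    show "\<bar>g x - g y\<bar> \<le> ?L * norm (x - y)" for x y using lip[of x y] by simp
  qed (use B in auto)
qed

lemma measurable_smooth[measurable_dest]: "smooth f ==> f \<in> borel_measurable borel"
  by (intro borel_measurable_continuous_onI smooth_continuous)

lemma test_function_integrable:
  "g \<in> test_functions \<Omega> ==> integrable lborel g"
  by (metis integrable_bounded_support measurable_smooth real_norm_def test_function_bounds test_functions_smooth)

lemma test_function_product_integrable: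
  assumes "\<psi> \<in> test_functions \<Omega>" "g \<in> borel_measurable borel" "\<And>x. \<bar>g x\<bar> \<le> C"
  shows "integrable lborel (\<lambda>x. g x * \<psi> x)"
proof -
  obtain B L R where *: "0 \<le> B" "0 \<le> L" "\<And>x. \<bar>\<psi> x\<bar> \<le> B" "\<And>x y. \<bar>\<psi> x - \<psi> y\<bar> \<le> L * norm (x - y)"
    "\<And>x. x \<notin> cball 0 R ==> \<psi> x = 0"
    using test_function_bounds[OF assms(1)] by metis
  have [measurable]: "\<psi> \<in> borel_measurable borel"
    using assms(1) by (intro measurable_smooth test_functions_smooth)
  show ?thesis
  proof (rule integrable_bounded_support[where R=R])
    show "norm (g x * \<psi> x) \<le> C * B" for x
      unfolding real_norm_def abs_mult using *(3)[of x] assms(3)[of x] by (intro mult_mono) auto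
  qed (use assms * in auto)
qed

text \<open>The product of \<open>g\<close> with a test function is Lipschitz with bounded support,
  so its directional derivative has integral zero. The factor \<open>g\<close> itself may be
  globally spread out, as the kernel is.\<close>

lemma integral_by_parts_lipschitz:
  fixes g :: "'a::euclidean_space => real"
  assumes \<psi>: "\<psi> \<in> test_functions \<Omega>" and j: "j \<in> Basis"
    and lip: "\<And>x y. \<bar>g x - g y\<bar> \<le> L * norm (x - y)" and bnd: "\<And>x. \<bar>g x\<bar> \<le> C"
    and D: "AE x in lborel. ((\<lambda>t. g (x + t *\<^sub>R j)) has_real_derivative D x) (at 0)"
    and meas: "D \<in> borel_measurable borel" "g \<in> borel_measurable borel" and DC: "\<And>x. \<bar>D x\<bar> \<le> C'"
  shows "(LINT x|lborel. D x * \<psi> x) = - (LINT x|lborel. g x * pderiv_dir j \<psi> x)"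
proof -
  obtain B L' R where *: "0 \<le> B" "0 \<le> L'" "\<And>x. \<bar>\<psi> x\<bar> \<le> B" "\<And>x y. \<bar>\<psi> x - \<psi> y\<bar> \<le> L' * norm (x - y)"
    "\<And>x. x \<notin> cball 0 R ==> \<psi> x = 0"
    using test_function_bounds[OF \<psi>] by metis
  have [measurable]: "\<psi> \<in> borel_measurable borel" "pderiv_dir j \<psi> \<in> borel_measurable borel"
    using test_functions_smooth[OF \<psi>] j by (auto intro!: measurable_smooth smooth_pderiv_dir)
  have "(LINT x|lborel. D x * \<psi> x + g x * pderiv_dir j \<psi> x) = 0"
  proof (rule integral_directional_derivative_eq_0[of "\<lambda>x. g x * \<psi> x"])
    show "\<bar>g x * \<psi> x - g y * \<psi> y\<bar> \<le> (L * B + C * L') * norm (x - y)" for x y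
    proof -
      have "g x * \<psi> x - g y * \<psi> y = (g x - g y) * \<psi> x + g y * (\<psi> x - \<psi> y)"
        by (simp add: algebra_simps)
      also have "\<bar>...\<bar> \<le> \<bar>g x - g y\<bar> * \<bar>\<psi> x\<bar> + \<bar>g y\<bar> * \<bar>\<psi> x - \<psi> y\<bar>"
        by (simp add: abs_mult[symmetric])
      also have "... \<le> (L * norm (x - y)) * B + C * (L' * norm (x - y))"
        using * lip[of x y] bnd[of y]
        by (intro add_mono mult_mono) (auto intro: order_trans[OF abs_ge_zero])
      finally show ?thesis by (simp add: algebra_simps)
    qed
    show "AE x in lborel. ((\<lambda>t. g (x + t *\<^sub>R j) * \<psi> (x + t *\<^sub>R j)) has_real_derivative
      D x * \<psi> x + g x * pderiv_dir j \<psi> x) (at 0)"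
      using D
    proof eventually_elim
      case (elim x)
      have "((\<lambda>t. \<psi> (x + t *\<^sub>R j)) has_real_derivative pderiv_dir j \<psi> (x + 0 *\<^sub>R j)) (at 0)"
        using \<psi> j by (intro has_real_derivative_line test_functions_smooth)
      from DERIV_mult[OF elim this] show ?case by (simp add: mult.commute add.commute)
    qed
  qed (use * meas in auto)
  moreover have "integrable lborel (\<lambda>x. D x * \<psi> x)" "integrable lborel (\<lambda>x. g x * pderiv_dir j \<psi> x)"
    using test_function_product_integrable[OF \<psi> meas(1) DC]
      test_function_product_integrable[OF test_functions_pderiv_dir[OF \<psi> j] meas(2) bnd] by auto
  ultimately show ?thesis by simp
qed

text \<open>No sign appears: the one from differentiating in \<open>y\<close>, which enters as x -
  y, cancels the one from the integration by parts.\<close>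

lemma tkernel_by_parts:
  fixes x :: "'a::euclidean_space"
  assumes g: "g \<in> test_functions \<Omega>" and i: "i \<in> Basis" and j: "j \<in> Basis" and eps: "0 < e"
  shows "(LINT y|lborel. (tkernel e (x - y) \<bullet> i) * pderiv_dir j g y) =
    (LINT y|lborel. dtkernel e i j (x - y) * g y)"
    and "integrable lborel (\<lambda>y. dtkernel e i j (x - y) * g y)"
proof -
  have tk[measurable]: "tkernel e \<in> borel_measurable (borel :: 'a measure)"
    by (intro borel_measurable_continuous_onI tkernel_continuous eps)
  have bnd: "\<bar>dtkernel e i j z\<bar> \<le> (1 + real DIM('a)) / e ^ DIM('a)" for z :: 'a
  proof (cases "norm z < e")
    case False
    then have z: "e \<le> norm z" "0 < norm z" using eps by linarith+
    have "\<bar>(z \<bullet> i) * (z \<bullet> j)\<bar> \<le> norm z * norm z"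
      unfolding abs_mult using i j by (intro mult_mono Basis_le_norm) auto
    then have "real DIM('a) * \<bar>(z \<bullet> i) * (z \<bullet> j)\<bar> / norm z ^ (DIM('a) + 2) \<le> real DIM('a) * (norm z * norm z) / norm z ^ (DIM('a) + 2)"
      by (intro divide_right_mono mult_left_mono) auto
    also have "... = real DIM('a) / norm z ^ DIM('a)"
      using z by (simp add: power_add power2_eq_square field_simps del: zero_less_norm_iff)
    finally have 1: "\<bar>real DIM('a) * (z \<bullet> i) * (z \<bullet> j) / norm z ^ (DIM('a) + 2)\<bar> \<le> real DIM('a) / norm z ^ DIM('a)"
      by (simp add: abs_mult mult.assoc)
    have 2: "\<bar>(i \<bullet> j) / norm z ^ DIM('a)\<bar> \<le> 1 / norm z ^ DIM('a)"
      using i j by (simp add: inner_Basis)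
    have "\<bar>dtkernel e i j z\<bar> \<le> 1 / norm z ^ DIM('a) + real DIM('a) / norm z ^ DIM('a)"
      using False 1 2 unfolding dtkernel_def by (simp add: abs_triangle_ineq4[THEN order_trans])
    also have "... = (1 + real DIM('a)) / norm z ^ DIM('a)" by (simp add: add_divide_distrib)
    also have "... \<le> (1 + real DIM('a)) / e ^ DIM('a)"
      using z eps by (intro divide_left_mono power_mono mult_pos_pos zero_less_power) auto
    finally show ?thesis .
  qed (use eps i j in \<open>auto simp: dtkernel_def inner_Basis divide_right_mono\<close>)
  have ae: "AE y in lborel. ((\<lambda>t. tkernel e (x - (y + t *\<^sub>R j)) \<bullet> i) has_real_derivative - dtkernel e i j (x - y)) (at 0)"
  proof -
    \<comment> \<open>Only the sphere of truncation has to be excluded.\<close>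
    have "sphere x e \<in> null_sets lborel"
      using negligible_sphere[of x e] by (auto simp: null_sets_completion_iff negligible_iff_null_sets)
    from AE_not_in[OF this] show ?thesis
    proof eventually_elim
      case (elim y)
      then have "norm (x - y) \<noteq> e" by (auto simp: dist_norm)
      \<comment> \<open>Moving \<open>y\<close> along \<open>j\<close> moves x - y along the
        opposite direction.\<close>
      from has_derivative_tkernel[OF eps this, of "- j" i]
      have "((\<lambda>t. tkernel e (x - (y + t *\<^sub>R j)) \<bullet> i) has_real_derivative dtkernel e i (- j) (x - y)) (at 0)"
        by (simp add: diff_diff_eq)
      moreover have "dtkernel e i (- j) (x - y) = - dtkernel e i j (x - y)"
        by (simp add: dtkernel_def)
      ultimately show ?case by simp
    qed
  qed
  have lip: "\<bar>tkernel e (x - y) \<bullet> i - tkernel e (x - y') \<bullet> i\<bar> \<le> (1 + real DIM('a)) / e ^ DIM('a) * norm (y - y')" for y y'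
  proof -
    have "\<bar>(tkernel e (x - y) - tkernel e (x - y')) \<bullet> i\<bar> \<le> norm (tkernel e (x - y) - tkernel e (x - y'))"
      using i by (rule Basis_le_norm)
    also have "... \<le> (1 + real DIM('a)) / e ^ DIM('a) * norm ((x - y) - (x - y'))"
      by (rule tkernel_lipschitz[OF eps])
    finally show ?thesis by (simp add: inner_diff_left norm_minus_commute)
  qed
  have tb: "\<bar>tkernel e (x - y) \<bullet> i\<bar> \<le> e / e ^ DIM('a)" for y
    using Basis_le_norm[OF i] norm_tkernel_le_const[OF eps] order_trans by blast
  have "(LINT y|lborel. - dtkernel e i j (x - y) * g y) = - (LINT y|lborel. (tkernel e (x - y) \<bullet> i) * pderiv_dir j g y)"
    using bnd by (intro integral_by_parts_lipschitz[OF g j lip tb ae]) auto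
  then show "(LINT y|lborel. (tkernel e (x - y) \<bullet> i) * pderiv_dir j g y) = (LINT y|lborel. dtkernel e i j (x - y) * g y)"
    by simp
  show "integrable lborel (\<lambda>y. dtkernel e i j (x - y) * g y)"
    using bnd by (intro test_function_product_integrable[OF g]) auto
qed

lemma tkernel_product_integrable:
  fixes x :: "'a::euclidean_space"
  assumes g: "g \<in> test_functions \<Omega>" and i: "i \<in> Basis" and eps: "0 < e"
  shows "integrable lborel (\<lambda>y. (tkernel e (x - y) \<bullet> i) * g y)"
proof (rule test_function_product_integrable[OF g])
  have "tkernel e \<in> borel_measurable (borel :: 'a measure)"
    by (intro borel_measurable_continuous_onI tkernel_continuous eps)
  then show "(\<lambda>y. tkernel e (x - y) \<bullet> i) \<in> borel_measurable borel" by measurable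
  show "\<bar>tkernel e (x - y) \<bullet> i\<bar> \<le> e / e ^ DIM('a)" for y
    using Basis_le_norm[OF i] norm_tkernel_le_const[OF eps] order_trans by blast
qed

text \<open>Summation over the coordinates leaves the trace of the Jacobian matrix, that is, a
  multiple of the average over a ball. This is the smoothed form of the representation of a function
  by its gradient.\<close>

lemma tkernel_gradient:
  fixes x :: "'a::euclidean_space"
  assumes g: "g \<in> test_functions \<Omega>" and eps: "0 < e"
  shows "(\<Sum>i\<in>Basis. LINT y|lborel. (tkernel e (x - y) \<bullet> i) * pderiv_dir i g y) =
    real DIM('a) / e ^ DIM('a) * (LINT y|lborel. indicator (ball x e) y * g y)"
proof -
  have "(\<Sum>i\<in>Basis. LINT y|lborel. (tkernel e (x - y) \<bullet> i) * pderiv_dir i g y) =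
      (\<Sum>i\<in>Basis. LINT y|lborel. dtkernel e i i (x - y) * g y)"
    using tkernel_by_parts(1)[OF g _ _ eps] by (intro sum.cong) auto
  also have "... = (LINT y|lborel. (\<Sum>i\<in>Basis. dtkernel e i i (x - y) * g y))"
    using tkernel_by_parts(2)[OF g _ _ eps] by (intro Bochner_Integration.integral_sum[symmetric]) auto
  also have "(\<lambda>y. \<Sum>i\<in>Basis. dtkernel e i i (x - y) * g y) =
      (\<lambda>y. real DIM('a) / e ^ DIM('a) * (indicator (ball x e) y * g y))"
    by (simp add: sum_distrib_right[symmetric] sum_dtkernel[OF eps] fun_eq_iff indicator_def dist_norm)
  finally show ?thesis by simp
qed

text \<open>The kernel is a gradient, so its derivative matrix is symmetric and the roles of the two
  indices can be exchanged after an integration by parts.\<close>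

lemma tkernel_laplacian:
  fixes x :: "'a::euclidean_space"
  assumes g: "g \<in> test_functions \<Omega>" and eps: "0 < e" and i: "i \<in> Basis"
  shows "(LINT y|lborel. (tkernel e (x - y) \<bullet> i) * laplacian g y) =
    real DIM('a) / e ^ DIM('a) * (LINT y|lborel. indicator (ball x e) y * pderiv_dir i g y)"
proof -
  have d: "pderiv_dir j g \<in> test_functions \<Omega>" if "j \<in> Basis" for j
    using g that by (rule test_functions_pderiv_dir)
  have "(LINT y|lborel. (tkernel e (x - y) \<bullet> i) * laplacian g y) =
      (\<Sum>j\<in>Basis. LINT y|lborel. (tkernel e (x - y) \<bullet> i) * pderiv_dir j (pderiv_dir j g) y)"
    unfolding laplacian_def sum_distrib_left
    using tkernel_product_integrable[OF test_functions_pderiv_dir[OF d] i eps]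
    by (intro Bochner_Integration.integral_sum) auto
  also have "... = (\<Sum>j\<in>Basis. LINT y|lborel. dtkernel e i j (x - y) * pderiv_dir j g y)"
    using tkernel_by_parts(1)[OF d i _ eps] by (intro sum.cong) auto
  also have "... = (\<Sum>j\<in>Basis. LINT y|lborel. dtkernel e j i (x - y) * pderiv_dir j g y)"
    by (simp add: dtkernel_commute[of e i])
  also have "... = (\<Sum>j\<in>Basis. LINT y|lborel. (tkernel e (x - y) \<bullet> j) * pderiv_dir i (pderiv_dir j g) y)"
    using tkernel_by_parts(1)[OF d _ i eps] by (intro sum.cong) auto
  also have "... = (\<Sum>j\<in>Basis. LINT y|lborel. (tkernel e (x - y) \<bullet> j) * pderiv_dir j (pderiv_dir i g) y)"
    using pderiv_dir_commute[OF test_functions_smooth[OF g] i] by (intro sum.cong refl) simp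
  also have "... = real DIM('a) / e ^ DIM('a) * (LINT y|lborel. indicator (ball x e) y * pderiv_dir i g y)"
    by (rule tkernel_gradient[OF d[OF i] eps])
  finally show ?thesis .
qed

text \<open>The pairing of the kernel with a polyharmonic gradient inside
  \<open>real \<times> 'a\<close>: an inner product turns a vector into a scalar, a scalar multiple
  turns a scalar into a vector. It thus switches the parity of the order, and one formula covers
  even and odd orders.\<close>

definition nablamult :: "'a::euclidean_space => real \<times> 'a => real \<times> 'a" where
  "nablamult z G = (z \<bullet> snd G, fst G *\<^sub>R z)"

lemma nablamult_diff: "nablamult (z - w) G = nablamult z G - nablamult w G"
  by (simp add: nablamult_def inner_diff_left scaleR_diff_right)

lemma norm_nablamult_le: "norm (nablamult z G) \<le> norm z * norm G"
proof -
  have "(norm (nablamult z G))\<^sup>2 = (z \<bullet> snd G)\<^sup>2 + (fst G)\<^sup>2 * (norm z)\<^sup>2"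
    by (simp add: nablamult_def norm_Pair power_mult_distrib)
  also have "(z \<bullet> snd G)\<^sup>2 \<le> (norm z * norm (snd G))\<^sup>2"
    using Cauchy_Schwarz_ineq2[of z "snd G"] by (simp add: abs_le_square_iff[symmetric])
  also have "(norm z * norm (snd G))\<^sup>2 + (fst G)\<^sup>2 * (norm z)\<^sup>2 = (norm z * norm G)\<^sup>2"
    by (simp add: norm_prod_def power_mult_distrib algebra_simps)
  finally have "(norm (nablamult z G))\<^sup>2 \<le> (norm z * norm G)\<^sup>2" by simp
  then show ?thesis by (rule power2_le_imp_le) simp
qed

lemma continuous_on_nablamult[continuous_intros]:
  "continuous_on S f ==> continuous_on S g ==> continuous_on S (\<lambda>x. nablamult (f x) (g x))"
  unfolding nablamult_def by (intro continuous_intros)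

lemma continuous_compact_support_integrable:
  fixes f :: "'a::euclidean_space => 'b::euclidean_space"
  assumes f: "continuous_on UNIV f" and K: "compact K" "\<And>x. x \<notin> K ==> f x = 0"
  shows "integrable lborel f" and "\<exists>B\<ge>0. \<forall>x. norm (f x) \<le> B"
proof -
  have "bounded (f ` K)"
    using K f by (intro compact_imp_bounded compact_continuous_image) (auto intro: continuous_on_subset)
  then obtain B where B: "\<forall>x\<in>K. norm (f x) \<le> B" by (auto simp: bounded_iff)
  have bnd: "norm (f x) \<le> \<bar>B\<bar>" for x using B K(2)[of x] by (cases "x \<in> K") auto
  obtain R where "\<forall>x\<in>K. norm x \<le> R"
    using compact_imp_bounded[OF K(1)] unfolding bounded_iff by blast
  then show "integrable lborel f"
    using K(2) f by (intro integrable_bounded_support[of f "\<bar>B\<bar>" R] bnd borel_measurable_continuous_onI) fastforce+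
  show "\<exists>B\<ge>0. \<forall>x. norm (f x) \<le> B" using bnd by (intro exI[of _ "\<bar>B\<bar>"]) auto
qed

lemma nabla_measurable[measurable]: "g \<in> test_functions \<Omega> ==> nabla k g \<in> borel_measurable borel"
  by (intro borel_measurable_continuous_onI nabla_continuous test_functions_smooth)

lemma nabla_integrable: "g \<in> test_functions \<Omega> ==> integrable lborel (nabla k g)"
  by (metis continuous_compact_support_integrable(1) nabla_continuous nabla_zero_outside test_functions_smooth)

lemma nabla_bounded: "g \<in> test_functions \<Omega> ==> \<exists>B\<ge>0. \<forall>x. norm (nabla k g x) \<le> B"
  by (metis continuous_compact_support_integrable(2) nabla_continuous nabla_zero_outside test_functions_smooth)

lemma indicator_mult_integrable:
  assumes "integrable lborel (f :: 'a::euclidean_space => 'b::euclidean_space)" "A \<in> sets borel"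
  shows "integrable lborel (\<lambda>y. indicator A y *\<^sub>R f y)"
  using assms by (intro integrable_mult_indicator) auto

lemma tkernel_nabla_integrable:
  fixes x :: "'a::euclidean_space"
  assumes g: "g \<in> test_functions \<Omega>" and eps: "0 < e"
  shows "integrable lborel (\<lambda>y. nablamult (tkernel e (x - y)) (nabla k g y))"
proof -
  obtain K where K: "compact K" "K \<subseteq> \<Omega>" "\<And>x. x \<notin> K ==> nabla k g x = 0" "\<And>x. x \<notin> K ==> g x = 0"
    using nabla_zero_outside[OF g] by metis
  show ?thesis
  proof (rule continuous_compact_support_integrable(1)[OF _ K(1)])
    show "continuous_on UNIV (\<lambda>y. nablamult (tkernel e (x - y)) (nabla k g y))"
      using nabla_continuous[OF test_functions_smooth[OF g]]
      by (intro continuous_intros continuous_on_compose2[OF tkernel_continuous[OF eps, of UNIV]]) auto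
  qed (simp add: K(3) nablamult_def zero_prod_def)
qed

text \<open>For even \<open>k\<close> this is the identity for gradients, for odd \<open>k\<close>
  the one for Laplacians, coordinate by coordinate. It is the only link between consecutive orders
  that the estimates below use.\<close>

lemma tkernel_nabla:
  fixes x :: "'a::euclidean_space"
  assumes g: "g \<in> test_functions \<Omega>" and eps: "0 < e"
  shows "(LINT y|lborel. nablamult (tkernel e (x - y)) (nabla (Suc k) g y)) =
    (real DIM('a) / e ^ DIM('a)) *\<^sub>R (LINT y|lborel. indicator (ball x e) y *\<^sub>R nabla k g y)"
proof (cases "even k")
  case True
  define f where "f = (laplacian ^^ (k div 2)) g"
  have f: "f \<in> test_functions \<Omega>" unfolding f_def by (rule test_functions_laplacian_funpow[OF g])
  have 1: "nabla k g = (\<lambda>y. (f y, 0))" "nabla (Suc k) g = (\<lambda>y. (0, \<Sum>i\<in>Basis. pderiv_dir i f y *\<^sub>R i))"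
    using True by (auto simp: nabla_def f_def fun_eq_iff)
  have bl: "bounded_linear (\<lambda>a::real. (a, 0::'a))" by (intro bounded_linear_Pair bounded_linear_ident bounded_linear_zero)
  have int: "integrable lborel (\<lambda>y. (tkernel e (x - y) \<bullet> i) * pderiv_dir i f y)" if "i \<in> Basis" for i
    using tkernel_product_integrable[OF test_functions_pderiv_dir[OF f that] that eps] .
  have "(LINT y|lborel. nablamult (tkernel e (x - y)) (nabla (Suc k) g y)) =
      (LINT y|lborel. (\<Sum>i\<in>Basis. (tkernel e (x - y) \<bullet> i) * pderiv_dir i f y, 0::'a))"
    by (simp add: 1 nablamult_def inner_sum_right zero_prod_def mult.commute)
  also have "... = (LINT y|lborel. (\<Sum>i\<in>Basis. (tkernel e (x - y) \<bullet> i) * pderiv_dir i f y), 0)"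
    using int by (intro integral_bounded_linear[OF bl]) auto
  also have "... = (real DIM('a) / e ^ DIM('a) * (LINT y|lborel. indicator (ball x e) y * f y), 0)"
    using int by (simp add: tkernel_gradient[OF f eps])
  also have "... = (real DIM('a) / e ^ DIM('a)) *\<^sub>R (LINT y|lborel. indicator (ball x e) y * f y, 0)"
    by simp
  also have "(LINT y|lborel. indicator (ball x e) y * f y, 0) = (LINT y|lborel. (indicator (ball x e) y * f y, 0::'a))"
    using indicator_mult_integrable[OF test_function_integrable[OF f], of "ball x e"]
    by (intro integral_bounded_linear[OF bl, symmetric]) auto
  finally show ?thesis by (simp add: 1)
next
  case False
  define f where "f = (laplacian ^^ ((k - 1) div 2)) g"
  have f: "f \<in> test_functions \<Omega>" unfolding f_def by (rule test_functions_laplacian_funpow[OF g])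
  have "Suc k div 2 = Suc ((k - 1) div 2)" using False by (elim oddE) simp
  then have 1: "nabla k g = (\<lambda>y. (0, \<Sum>i\<in>Basis. pderiv_dir i f y *\<^sub>R i))" "nabla (Suc k) g = (\<lambda>y. (laplacian f y, 0))"
    using False by (auto simp: nabla_def f_def fun_eq_iff)
  have bl: "bounded_linear (\<lambda>a::real. (0::real, a *\<^sub>R i))" for i :: 'a
    by (intro bounded_linear_Pair bounded_linear_scaleR_left bounded_linear_zero)
  have lap: "laplacian f \<in> test_functions \<Omega>" using f by (rule test_functions_laplacian)
  have int: "integrable lborel (\<lambda>y. (tkernel e (x - y) \<bullet> i) * laplacian f y)" if "i \<in> Basis" for i
    using tkernel_product_integrable[OF lap that eps] .
  have int2: "integrable lborel (\<lambda>y. indicator (ball x e) y * pderiv_dir i f y)" if "i \<in> Basis" for i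
    using indicator_mult_integrable[OF test_function_integrable[OF test_functions_pderiv_dir[OF f that]], of "ball x e"] by simp
  have "nablamult (tkernel e (x - y)) (nabla (Suc k) g y) =
      (\<Sum>i\<in>Basis. (0::real, ((tkernel e (x - y) \<bullet> i) * laplacian f y) *\<^sub>R i))" for y
  proof -
    have "laplacian f y *\<^sub>R tkernel e (x - y) = (\<Sum>i\<in>Basis. ((tkernel e (x - y) \<bullet> i) * laplacian f y) *\<^sub>R i)"
      by (subst euclidean_representation[of "tkernel e (x - y)", symmetric])
         (simp add: scaleR_sum_right mult.commute)
    then show ?thesis by (simp add: 1 nablamult_def sum_prod)
  qed
  then have "(LINT y|lborel. nablamult (tkernel e (x - y)) (nabla (Suc k) g y)) =
      (LINT y|lborel. (\<Sum>i\<in>Basis. (0::real, ((tkernel e (x - y) \<bullet> i) * laplacian f y) *\<^sub>R i)))"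
    by simp
  also have "... = (\<Sum>i\<in>Basis. LINT y|lborel. (0::real, ((tkernel e (x - y) \<bullet> i) * laplacian f y) *\<^sub>R i))"
    by (intro Bochner_Integration.integral_sum integrable_bounded_linear[OF bl] int)
  also have "... = (\<Sum>i\<in>Basis. (0::real, (LINT y|lborel. (tkernel e (x - y) \<bullet> i) * laplacian f y) *\<^sub>R i))"
    by (intro sum.cong refl integral_bounded_linear[OF bl] int)
  also have "... = (\<Sum>i\<in>Basis. (0::real, (real DIM('a) / e ^ DIM('a) * (LINT y|lborel. indicator (ball x e) y * pderiv_dir i f y)) *\<^sub>R i))"
    by (intro sum.cong refl) (simp add: tkernel_laplacian[OF f eps])
  also have "... = (real DIM('a) / e ^ DIM('a)) *\<^sub>R (\<Sum>i\<in>Basis. (0::real, (LINT y|lborel. indicator (ball x e) y * pderiv_dir i f y) *\<^sub>R i))"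
    by (simp add: scaleR_sum_right)
  also have "(\<Sum>i\<in>Basis. (0::real, (LINT y|lborel. indicator (ball x e) y * pderiv_dir i f y) *\<^sub>R i)) =
      (\<Sum>i\<in>Basis. (LINT y|lborel. (0::real, (indicator (ball x e) y * pderiv_dir i f y) *\<^sub>R i)))"
    by (intro sum.cong refl integral_bounded_linear[OF bl, symmetric] int2)
  also have "... = (LINT y|lborel. (\<Sum>i\<in>Basis. (0::real, (indicator (ball x e) y * pderiv_dir i f y) *\<^sub>R i)))"
    by (intro Bochner_Integration.integral_sum[symmetric] integrable_bounded_linear[OF bl] int2)
  also have "(\<lambda>y. \<Sum>i\<in>Basis. (0::real, (indicator (ball x e) y * pderiv_dir i f y) *\<^sub>R i)) =
      (\<lambda>y. indicator (ball x e) y *\<^sub>R nabla k g y)"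
    by (simp add: 1 sum_prod scaleR_sum_right)
  finally show ?thesis .
qed

text \<open>The Riesz kernel of order one restricted to a ball; at the origin it is 0 by the
  convention for \<open>powr\<close>.\<close>

definition rkernel :: "real => 'a::euclidean_space => real" where
  "rkernel \<epsilon> z = (if norm z < \<epsilon> then norm z powr (1 - real DIM('a)) else 0)"

lemma rkernel_measurable[measurable]: "rkernel e \<in> borel_measurable borel"
  unfolding rkernel_def[abs_def] by measurable

lemma rkernel_nonneg: "0 \<le> rkernel e z"
  by (simp add: rkernel_def)

text \<open>Kernels with different truncations agree outside the larger ball. Inside, both are
  nonnegative multiples of \<open>z\<close>, so the difference is at most the larger one.\<close>

lemma tkernel_diff_le:
  fixes z :: "'a::euclidean_space"
  assumes "0 < \<epsilon>'" "\<epsilon>' \<le> \<epsilon>"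
  shows "norm (tkernel \<epsilon> z - tkernel \<epsilon>' z) \<le> rkernel \<epsilon> z"
proof (cases "norm z < \<epsilon>")
  case True
  define g g' where "g = 1 / max (norm z) \<epsilon> ^ DIM('a)" and "g' = 1 / max (norm z) \<epsilon>' ^ DIM('a)"
  have g: "0 \<le> g" "g \<le> g'" unfolding g_def g'_def
    using assms by (auto intro!: divide_left_mono power_mono mult_pos_pos zero_less_power simp: less_max_iff_disj)
  have "norm (tkernel \<epsilon> z - tkernel \<epsilon>' z) = \<bar>g - g'\<bar> * norm z"
    by (simp add: tkernel_def g_def[symmetric] g'_def[symmetric] scaleR_left_diff_distrib[symmetric])
  also have "... \<le> g' * norm z" using g by (intro mult_right_mono) auto
  also have "... = norm (tkernel \<epsilon>' z)" using g by (simp add: tkernel_def g'_def[symmetric])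
  also have "... \<le> norm z powr (1 - real DIM('a))" by (rule norm_tkernel_le)
  finally show ?thesis using True by (simp add: rkernel_def)
next
  case False
  then have "max (norm z) \<epsilon> = norm z" "max (norm z) \<epsilon>' = norm z" using assms by auto
  then show ?thesis by (simp add: rkernel_def tkernel_def)
qed

text \<open>A ball of radius \<epsilon> has volume \<open>unit_ball_vol\<close> times \<epsilon>^N,
  so the prefactor makes the expression a fixed multiple of a mean value; continuity of
  \<open>nabla k g\<close> does the rest.\<close>

lemma nabla_average_tendsto:
  fixes x :: "'a::euclidean_space"
  assumes g: "g \<in> test_functions \<Omega>"
  shows "((\<lambda>\<epsilon>. (real DIM('a) / \<epsilon> ^ DIM('a)) *\<^sub>R (LINT y|lborel. indicator (ball x \<epsilon>) y *\<^sub>R nabla k g y))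
    \<longlongrightarrow> (real DIM('a) * unit_ball_vol (real DIM('a))) *\<^sub>R nabla k g x) (at_right 0)"
proof (rule tendstoI)
  fix e :: real assume "0 < e"
  let ?F = "nabla k g" and ?N = "real DIM('a)" and ?w = "unit_ball_vol (real DIM('a))"
  \<comment> \<open>The total mass of the weighted ball is N times \<open>unit_ball_vol\<close>, so
    this oscillation contributes e / 2.\<close>
  define e' where "e' = e / (2 * ?N * ?w)"
  have pos: "0 < ?w" "0 < ?N" by auto
  have e': "0 < e'" "?N * ?w * e' < e" using pos \<open>0 < e\<close> unfolding e'_def by (auto simp: field_simps)
  have "isCont ?F x"
    using nabla_continuous[OF test_functions_smooth[OF g], of UNIV] by (simp add: continuous_on_eq_continuous_at)
  then obtain d where d: "0 < d" "\<And>y. dist y x < d ==> dist (?F y) (?F x) < e'"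
    using e'(1) unfolding continuous_at_eps_delta by blast
  have "\<forall>\<^sub>F s in at_right 0. s < d \<and> 0 < (s::real)"
    using d(1) by (auto simp: eventually_at_right_field intro!: exI[of _ d])
  then show "\<forall>\<^sub>F \<epsilon> in at_right 0. dist ((?N / \<epsilon> ^ DIM('a)) *\<^sub>R (LINT y|lborel. indicator (ball x \<epsilon>) y *\<^sub>R ?F y))
      ((?N * ?w) *\<^sub>R ?F x) < e"
  proof (rule eventually_mono)
    fix \<epsilon> :: real assume eps: "\<epsilon> < d \<and> 0 < \<epsilon>"
    let ?c = "?N / \<epsilon> ^ DIM('a)"
    have vol: "measure lborel (ball x \<epsilon>) = ?w * \<epsilon> ^ DIM('a)" using eps by (intro content_ball) auto
    have int: "integrable lborel (\<lambda>y. indicator (ball x \<epsilon>) y *\<^sub>R ?F y)"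
      by (intro indicator_mult_integrable nabla_integrable[OF g]) auto
    have ii: "integrable lborel (indicator (ball x \<epsilon>) :: 'a => real)"
      using emeasure_lborel_ball_finite[of x \<epsilon>] by (intro integrable_real_indicator) auto
    have int2: "integrable lborel (\<lambda>y. indicator (ball x \<epsilon>) y *\<^sub>R ?F x)"
      using ii by (rule integrable_scaleR_left)
    have "(LINT y|lborel. indicator (ball x \<epsilon>) y *\<^sub>R ?F x) = (?w * \<epsilon> ^ DIM('a)) *\<^sub>R ?F x"
      using ii vol by simp
    then have "(?N * ?w) *\<^sub>R ?F x = ?c *\<^sub>R (LINT y|lborel. indicator (ball x \<epsilon>) y *\<^sub>R ?F x)"
      using eps by simp
    then have "dist (?c *\<^sub>R (LINT y|lborel. indicator (ball x \<epsilon>) y *\<^sub>R ?F y)) ((?N * ?w) *\<^sub>R ?F x) =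
        norm (?c *\<^sub>R (LINT y|lborel. indicator (ball x \<epsilon>) y *\<^sub>R ?F y - indicator (ball x \<epsilon>) y *\<^sub>R ?F x))"
      using int int2 by (simp add: dist_norm scaleR_diff_right)
    also have "... = ?c * norm (LINT y|lborel. indicator (ball x \<epsilon>) y *\<^sub>R ?F y - indicator (ball x \<epsilon>) y *\<^sub>R ?F x)"
      using eps by simp
    also have "... \<le> ?c * (LINT y|lborel. e' * indicator (ball x \<epsilon>) y)"
    proof (intro mult_left_mono integral_norm_bound[THEN order_trans] integral_mono)
      show "norm (indicator (ball x \<epsilon>) y *\<^sub>R ?F y - indicator (ball x \<epsilon>) y *\<^sub>R ?F x) \<le> e' * indicator (ball x \<epsilon>) y" for y
        using d(2)[of y] eps by (auto simp: indicator_def dist_norm norm_minus_commute)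
    qed (use int int2 ii eps in auto)
    also have "... = ?N * ?w * e'" using ii vol eps by simp
    finally show "dist (?c *\<^sub>R (LINT y|lborel. indicator (ball x \<epsilon>) y *\<^sub>R ?F y)) ((?N * ?w) *\<^sub>R ?F x) < e"
      using e'(2) by simp
  qed
qed

text \<open>The difference of averages at two radii is a convolution with the difference of two
  kernels, dominated by \<open>rkernel\<close> uniformly in the smaller radius, which is then sent
  to zero. This error bound drives the compactness proof.\<close>

lemma nabla_average_diff_le:
  fixes x :: "'a::euclidean_space"
  assumes g: "g \<in> test_functions \<Omega>" and eps: "0 < \<epsilon>"
  shows "ennreal (norm ((real DIM('a) / \<epsilon> ^ DIM('a)) *\<^sub>R (LINT y|lborel. indicator (ball x \<epsilon>) y *\<^sub>R nabla k g y)
      - (real DIM('a) * unit_ball_vol (real DIM('a))) *\<^sub>R nabla k g x))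
    \<le> (\<integral>\<^sup>+y. ennreal (rkernel \<epsilon> (x - y) * norm (nabla (Suc k) g y)) \<partial>lborel)" (is "_ \<le> ?I")
proof -
  let ?A = "\<lambda>\<epsilon>. (real DIM('a) / \<epsilon> ^ DIM('a)) *\<^sub>R (LINT y|lborel. indicator (ball x \<epsilon>) y *\<^sub>R nabla k g y)"
  let ?G = "nabla (Suc k) g"
  show ?thesis
  proof (rule tendsto_upperbound)
    show "((\<lambda>\<epsilon>'. ennreal (norm (?A \<epsilon> - ?A \<epsilon>'))) \<longlongrightarrow> ennreal (norm (?A \<epsilon> - (real DIM('a) * unit_ball_vol (real DIM('a))) *\<^sub>R nabla k g x))) (at_right 0)"
      by (intro tendsto_ennrealI tendsto_norm tendsto_diff tendsto_const nabla_average_tendsto[OF g])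
    have "\<forall>\<^sub>F s in at_right 0. s \<le> \<epsilon> \<and> 0 < (s::real)"
      using eps by (auto simp: eventually_at_right_field intro!: exI[of _ \<epsilon>])
    then show "\<forall>\<^sub>F \<epsilon>' in at_right 0. ennreal (norm (?A \<epsilon> - ?A \<epsilon>')) \<le> ?I"
    proof (rule eventually_mono)
      fix \<epsilon>' assume eps': "\<epsilon>' \<le> \<epsilon> \<and> 0 < \<epsilon>'"
      have i: "integrable lborel (\<lambda>y. nablamult (tkernel e (x - y)) (?G y))" if "0 < e" for e
        using tkernel_nabla_integrable[OF g that] .
      have "?A \<epsilon> - ?A \<epsilon>' = (LINT y|lborel. nablamult (tkernel \<epsilon> (x - y)) (?G y)) - (LINT y|lborel. nablamult (tkernel \<epsilon>' (x - y)) (?G y))"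
        using eps eps' by (simp add: tkernel_nabla[OF g])
      also have "... = (LINT y|lborel. nablamult (tkernel \<epsilon> (x - y) - tkernel \<epsilon>' (x - y)) (?G y))"
        using i eps eps' by (simp add: nablamult_diff)
      finally have "ennreal (norm (?A \<epsilon> - ?A \<epsilon>')) \<le> (\<integral>\<^sup>+y. norm (nablamult (tkernel \<epsilon> (x - y) - tkernel \<epsilon>' (x - y)) (?G y)) \<partial>lborel)"
        using integral_norm_bound_ennreal[OF Bochner_Integration.integrable_diff[OF i[OF eps] i[of \<epsilon>']]] eps'
        by (simp add: nablamult_diff)
      also have "... \<le> ?I"
      proof (intro nn_integral_mono ennreal_leI order_trans[OF norm_nablamult_le] mult_right_mono)
        show "norm (tkernel \<epsilon> (x - y) - tkernel \<epsilon>' (x - y)) \<le> rkernel \<epsilon> (x - y)" for y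
          using eps' by (intro tkernel_diff_le) auto
      qed auto
      finally show "ennreal (norm (?A \<epsilon> - ?A \<epsilon>')) \<le> ?I" .
    qed
  qed simp
qed

text \<open>Here the average at the small radius is itself bounded by the potential. Since the
  gradient lives in \<Omega>, which lies within distance \<open>R\<close> of \<open>x\<close>,
  cutting the Riesz kernel at \<open>R\<close> loses nothing.\<close>

lemma norm_nabla_le_potential:
  fixes x :: "'a::euclidean_space"
  assumes g: "g \<in> test_functions \<Omega>" and R: "\<And>y. y \<in> \<Omega> ==> norm (x - y) < R"
  shows "ennreal ((real DIM('a) * unit_ball_vol (real DIM('a))) * norm (nabla k g x))
    \<le> (\<integral>\<^sup>+y. ennreal (rkernel R (x - y) * norm (nabla (Suc k) g y)) \<partial>lborel)" (is "_ \<le> ?I")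
proof -
  let ?A = "\<lambda>\<epsilon>. (real DIM('a) / \<epsilon> ^ DIM('a)) *\<^sub>R (LINT y|lborel. indicator (ball x \<epsilon>) y *\<^sub>R nabla k g y)"
  let ?G = "nabla (Suc k) g"
  obtain K where K: "compact K" "K \<subseteq> \<Omega>" "\<And>x. x \<notin> K ==> ?G x = 0" "\<And>x. x \<notin> K ==> g x = 0"
    using nabla_zero_outside[OF g] by metis
  have "ennreal (norm ((real DIM('a) * unit_ball_vol (real DIM('a))) *\<^sub>R nabla k g x)) \<le> ?I"
  proof (rule tendsto_upperbound)
    show "((\<lambda>\<epsilon>'. ennreal (norm (?A \<epsilon>'))) \<longlongrightarrow> ennreal (norm ((real DIM('a) * unit_ball_vol (real DIM('a))) *\<^sub>R nabla k g x))) (at_right 0)"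
      by (intro tendsto_ennrealI tendsto_norm nabla_average_tendsto[OF g])
    have "\<forall>\<^sub>F s in at_right 0. 0 < (s::real)"
      by (auto simp: eventually_at_right_field intro!: exI[of _ 1])
    then show "\<forall>\<^sub>F \<epsilon>' in at_right 0. ennreal (norm (?A \<epsilon>')) \<le> ?I"
    proof (rule eventually_mono)
      fix \<epsilon>' :: real assume eps': "0 < \<epsilon>'"
      have i: "integrable lborel (\<lambda>y. nablamult (tkernel \<epsilon>' (x - y)) (?G y))"
        using tkernel_nabla_integrable[OF g eps'] .
      have "ennreal (norm (?A \<epsilon>')) \<le> (\<integral>\<^sup>+y. norm (nablamult (tkernel \<epsilon>' (x - y)) (?G y)) \<partial>lborel)"
        using integral_norm_bound_ennreal[OF i] by (simp only: tkernel_nabla[OF g eps'])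
      also have "... \<le> ?I"
      proof (intro nn_integral_mono ennreal_leI)
        fix y
        show "norm (nablamult (tkernel \<epsilon>' (x - y)) (?G y)) \<le> rkernel R (x - y) * norm (?G y)"
        proof (cases "y \<in> K")
          case True
          then have "norm (x - y) < R" using R K(2) by auto
          then show ?thesis
            using norm_tkernel_le[of \<epsilon>' "x - y"] 
            by (intro order_trans[OF norm_nablamult_le] mult_right_mono) (auto simp: rkernel_def)
        qed (simp add: K(3) nablamult_def)
      qed
      finally show "ennreal (norm (?A \<epsilon>')) \<le> ?I" .
    qed
  qed simp
  then show ?thesis by simp
qed

text \<open>A dyadic decomposition takes the place of polar coordinates: the ball of radius e / 2^j
  contributes a term of a geometric series whose ratio is below one exactly because \<beta> <
  N.\<close>

lemma nn_integral_norm_powr_ball: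
  fixes \<beta> :: real
  assumes "0 < \<beta>" "\<beta> < real DIM('a::euclidean_space)"
  obtains C where "0 \<le> C" "\<And>e. 0 < e ==> (\<integral>\<^sup>+z. ennreal (indicator (ball (0::'a) e) z * norm z powr (- \<beta>)) \<partial>lborel) \<le> ennreal (C * e powr (real DIM('a) - \<beta>))"
proof -
  let ?N = "real DIM('a)" and ?w = "unit_ball_vol (real DIM('a))"
  \<comment> \<open>The ratio between the contributions of consecutive dyadic balls: the volume
    shrinks by 2^N while the integrand grows by 2^\<beta>.\<close>
  define r where "r = 2 powr (\<beta> - ?N)"
  have r: "0 < r" "r < 1" using assms by (auto simp: r_def powr_less_one)
  define C where "C = ?w * 2 powr \<beta> / (1 - r)"
  have "0 \<le> C" using r by (simp add: C_def)
  moreover have "(\<integral>\<^sup>+z. ennreal (indicator (ball (0::'a) e) z * norm z powr (- \<beta>)) \<partial>lborel) \<le> ennreal (C * e powr (?N - \<beta>))"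
    if eps: "0 < e" for e
  proof -
    define b where "b j = (e / 2 ^ Suc j) powr (- \<beta>)" for j
    have b0: "0 \<le> b j" for j by (simp add: b_def)
    have pw: "ennreal (indicator (ball 0 e) z * norm z powr (- \<beta>)) \<le> (\<Sum>j. ennreal (b j) * indicator (ball 0 (e / 2 ^ j)) z)"
      if "z \<noteq> 0" for z :: 'a
    proof (cases "norm z < e")
      case True
      have "\<exists>j. e / 2 ^ Suc j \<le> norm z"
      proof -
        have "0 < norm z / e" using that eps by simp
        then obtain n where "(1/2) ^ n < norm z / e"
          using real_arch_pow_inv[of "norm z / e" "1/2"] by auto
        then have "e / 2 ^ n < norm z" using eps by (simp add: field_simps power_one_over)
        moreover have "e / 2 ^ Suc n \<le> e / 2 ^ n" using eps by (simp add: field_simps)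
        ultimately show ?thesis by (intro exI[of _ n]) linarith
      qed
      \<comment> \<open>The least index places \<open>z\<close> in the shell between e / 2^(j+1) and
        e / 2^j. The whole ball of the outer radius is used as its cover, at the price of a
        constant.\<close>
      then obtain j where j: "e / 2 ^ Suc j \<le> norm z" "\<And>i. i < j ==> \<not> e / 2 ^ Suc i \<le> norm z"
        using exists_least_iff[of "\<lambda>j. e / 2 ^ Suc j \<le> norm z"] by blast
      have "norm z < e / 2 ^ j"
        using j(2)[of "j - 1"] True by (cases j) auto
      then have "ennreal (indicator (ball 0 e) z * norm z powr (- \<beta>)) \<le> ennreal (b j) * indicator (ball 0 (e / 2 ^ j)) z"
        using True j(1) eps assms that unfolding b_def
        by (auto intro!: ennreal_leI powr_mono2' divide_pos_pos)
      also have "... \<le> (\<Sum>j. ennreal (b j) * indicator (ball 0 (e / 2 ^ j)) z)"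
      proof -
        define f where "f j = ennreal (b j) * indicator (ball 0 (e / 2 ^ j)) z" for j
        have "sum f {j} \<le> suminf f" by (intro sum_le_suminf) auto
        then have "f j \<le> suminf f" by simp
        then show ?thesis unfolding f_def[abs_def] .
      qed
      finally show ?thesis .
    qed simp
    have "(\<integral>\<^sup>+z. ennreal (indicator (ball (0::'a) e) z * norm z powr (- \<beta>)) \<partial>lborel)
        \<le> (\<integral>\<^sup>+z. (\<Sum>j. ennreal (b j) * indicator (ball (0::'a) (e / 2 ^ j)) z) \<partial>lborel)"
      using AE_lborel_singleton[of "0::'a"] by (intro nn_integral_mono_AE) (auto elim!: eventually_mono intro!: pw)
    also have "... = (\<Sum>j. \<integral>\<^sup>+z. ennreal (b j) * indicator (ball (0::'a) (e / 2 ^ j)) z \<partial>lborel)"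
      by (intro nn_integral_suminf borel_measurable_times_ennreal borel_measurable_const borel_measurable_indicator) auto
    also have "... = (\<Sum>j. ennreal (?w * 2 powr \<beta> * e powr (?N - \<beta>) * r ^ j))"
    proof (intro suminf_cong)
      fix j
      have "(\<integral>\<^sup>+z. ennreal (b j) * indicator (ball (0::'a) (e / 2 ^ j)) z \<partial>lborel) = ennreal (b j) * ennreal (?w * (e / 2 ^ j) ^ DIM('a))"
        using eps by (subst nn_integral_cmult_indicator) (auto simp: emeasure_ball)
      also have "... = ennreal (b j * (?w * (e / 2 ^ j) ^ DIM('a)))"
        using b0 by (simp add: ennreal_mult')
      also have "b j * (?w * (e / 2 ^ j) ^ DIM('a)) = ?w * 2 powr \<beta> * e powr (?N - \<beta>) * r ^ j"
      proof -
        have "(2::real) ^ Suc j = 2 powr (1 + real j)" by (simp add: powr_add powr_realpow)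
        then have "b j = e powr (-\<beta>) / (2 powr (1 + real j)) powr (-\<beta>)"
          using eps by (simp only: b_def powr_divide)
        also have "(2 powr (1 + real j)) powr (-\<beta>) = inverse (2 powr ((1 + real j) * \<beta>))"
          unfolding powr_powr by (simp add: powr_minus)
        finally have 1: "b j = e powr (-\<beta>) * (2 powr \<beta> * 2 powr (real j * \<beta>))"
          by (simp add: distrib_right powr_add divide_inverse)
        have "(e / 2 ^ j) ^ DIM('a) = (e / 2 powr (real j)) powr ?N"
          using eps by (simp add: powr_realpow)
        also have "... = e powr ?N / (2 powr (real j)) powr ?N"
          by (rule powr_divide)
        finally have 2: "(e / 2 ^ j) ^ DIM('a) = e powr ?N / 2 powr (real j * ?N)"
          by (simp only: powr_powr)
        have "r ^ j = (2 powr (\<beta> - ?N)) powr (real j)"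
          using r unfolding r_def by (simp add: powr_realpow)
        also have "... = 2 powr (real j * \<beta> - real j * ?N)"
          unfolding powr_powr by (simp add: algebra_simps)
        finally have 3: "r ^ j = 2 powr (real j * \<beta>) / 2 powr (real j * ?N)"
          by (simp only: powr_diff)
        have 4: "e powr (?N - \<beta>) = e powr (-\<beta>) * e powr ?N"
          by (simp add: powr_add[symmetric])
        show ?thesis unfolding 1 2 3 4 by (simp add: mult_ac)
      qed
      finally show "(\<integral>\<^sup>+z. ennreal (b j) * indicator (ball (0::'a) (e / 2 ^ j)) z \<partial>lborel) = ennreal (?w * 2 powr \<beta> * e powr (?N - \<beta>) * r ^ j)" .
    qed
    also have "... = ennreal (C * e powr (?N - \<beta>))"
    proof (rule suminf_ennreal_eq)
      have "(\<lambda>j. ?w * 2 powr \<beta> * e powr (?N - \<beta>) * r ^ j) sums (?w * 2 powr \<beta> * e powr (?N - \<beta>) * (1 / (1 - r)))"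
        using r by (intro sums_mult geometric_sums) auto
      then show "(\<lambda>j. ?w * 2 powr \<beta> * e powr (?N - \<beta>) * r ^ j) sums (C * e powr (?N - \<beta>))"
        by (simp add: C_def mult_ac)
    qed (use r in auto)
    finally show ?thesis .
  qed
  ultimately show ?thesis using that by blast
qed

section \<open>Polyharmonic Sobolev inequality\<close>

text \<open>The product is a weighted geometric mean of the three summands on the right, with
  weights 1/s, 1/t - 1/s and 1/q - 1/s that add up to one, so it is at most their sum. The parameter
  \<mu> cancels from the mean and is free to be optimized pointwise later.\<close>

lemma product_le_weighted_sum:
  fixes k f \<mu> :: real
  assumes "0 \<le> k" "0 \<le> f" "0 < \<mu>" "1 \<le> q" "0 < t" "0 < s"
    and w: "1 / t + 1 / q = 1 + 1 / s" "1 / s \<le> 1 / t" "1 / s \<le> 1 / q"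
  shows "k * f \<le> k powr t * f powr q * \<mu> powr (1 - s) + (k powr t + f powr q) * \<mu>"
proof (cases "k = 0 \<or> f = 0")
  case False
  then have pos: "0 < k" "0 < f" using assms by auto
  define P0 P1 P2 where "P0 = k powr t * f powr q * \<mu> powr (1 - s)" and "P1 = k powr t * \<mu>" and "P2 = f powr q * \<mu>"
  define S where "S = P0 + P1 + P2"
  have P: "0 < P0" "0 < P1" "0 < P2" using pos assms by (auto simp: P0_def P1_def P2_def)
  have le: "P0 \<le> S" "P1 \<le> S" "P2 \<le> S" using P by (auto simp: S_def)
  have ln_P: "ln P0 = t * ln k + q * ln f + (1 - s) * ln \<mu>" "ln P1 = t * ln k + ln \<mu>" "ln P2 = q * ln f + ln \<mu>"
    using pos assms by (auto simp: P0_def P1_def P2_def ln_mult ln_powr)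
  have sum1: "1 / s + (1 / t - 1 / s) + (1 / q - 1 / s) = 1" using w by simp
  have "ln (k * f) = 1 / s * ln P0 + (1 / t - 1 / s) * ln P1 + (1 / q - 1 / s) * ln P2"
  proof -
    define a b c where "a = 1 / s" and "b = 1 / t" and "c = 1 / q"
    have abc: "a * s = 1" "b * t = 1" "c * q = 1" using assms by (auto simp: a_def b_def c_def)
    have "a * ln P0 + (b - a) * ln P1 + (c - a) * ln P2 =
        (b * t) * ln k + (c * q) * ln f + (b + c - (a * s) - a) * ln \<mu>"
      unfolding ln_P by (simp add: algebra_simps)
    also have "b + c - (a * s) - a = 0" using w abc by (simp add: a_def b_def c_def)
    finally show ?thesis using pos abc by (simp add: ln_mult a_def b_def c_def)
  qed
  also have "... \<le> 1 / s * ln S + (1 / t - 1 / s) * ln S + (1 / q - 1 / s) * ln S"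
    using P le assms by (intro add_mono mult_left_mono) auto
  also have "... = (1 / s + (1 / t - 1 / s) + (1 / q - 1 / s)) * ln S"
    by (simp add: algebra_simps)
  also have "... = ln S" unfolding sum1 by simp
  finally have "k * f \<le> S" using pos P by (simp add: S_def)
  then show ?thesis by (simp add: S_def P0_def P1_def P2_def algebra_simps)
qed (use assms in auto)

lemma nn_integral_reflect:
  fixes f :: "'a::euclidean_space => ennreal"
  assumes [measurable]: "f \<in> borel_measurable borel"
  shows "(\<integral>\<^sup>+y. f (x - y) \<partial>lborel) = (\<integral>\<^sup>+y. f y \<partial>lborel)"
proof -
  have "(lborel :: 'a measure) = density (distr lborel borel (\<lambda>y. x + (-1) *\<^sub>R y)) (\<lambda>_. \<bar>-1::real\<bar> ^ DIM('a))"
    by (rule lborel_affine) simp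
  then have "(\<integral>\<^sup>+y. f y \<partial>lborel) = (\<integral>\<^sup>+y. f y \<partial>distr lborel borel (\<lambda>y. x + (-1) *\<^sub>R y))"
    by (simp add: density_1)
  also have "... = (\<integral>\<^sup>+y. f (x - y) \<partial>lborel)"
    by (subst nn_integral_distr) auto
  finally show ?thesis ..
qed

lemma nn_integral_convolution:
  fixes g h :: "'a::euclidean_space => ennreal"
  assumes [measurable]: "g \<in> borel_measurable borel" "h \<in> borel_measurable borel"
  shows "(\<integral>\<^sup>+x. (\<integral>\<^sup>+y. g (x - y) * h y \<partial>lborel) \<partial>lborel) = (\<integral>\<^sup>+z. g z \<partial>lborel) * (\<integral>\<^sup>+y. h y \<partial>lborel)"
proof -
  have "(\<integral>\<^sup>+x. (\<integral>\<^sup>+y. g (x - y) * h y \<partial>lborel) \<partial>lborel) = (\<integral>\<^sup>+y. (\<integral>\<^sup>+x. g (x - y) * h y \<partial>lborel) \<partial>lborel)"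
    by (rule lborel_pair.Fubini') measurable
  also have "... = (\<integral>\<^sup>+y. (\<integral>\<^sup>+z. g z \<partial>lborel) * h y \<partial>lborel)"
  proof (intro nn_integral_cong)
    fix y
    have "(\<integral>\<^sup>+x. g (x - y) \<partial>lborel) = (\<integral>\<^sup>+x. g x \<partial>distr lborel borel ((+) (- y)))"
      by (subst nn_integral_distr) auto
    then show "(\<integral>\<^sup>+x. g (x - y) * h y \<partial>lborel) = (\<integral>\<^sup>+z. g z \<partial>lborel) * h y"
      by (subst nn_integral_multc) (auto simp: lborel_distr_plus)
  qed
  also have "... = (\<integral>\<^sup>+z. g z \<partial>lborel) * (\<integral>\<^sup>+y. h y \<partial>lborel)"
    by (rule nn_integral_cmult) measurable
  finally show ?thesis .
qed

text \<open>A form of Young's convolution inequality sufficient for subcritical embeddings; it avoids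
  Hoelder's inequality by optimizing the pointwise bound over the free parameter \<open>\<mu>\<close>.\<close>

lemma young_convolution_bound:
  fixes k f F :: "'a::euclidean_space => real"
  assumes [measurable]: "k \<in> borel_measurable borel" "f \<in> borel_measurable borel" "A \<in> sets borel"
    and nonneg: "\<And>z. 0 \<le> k z" "\<And>z. 0 \<le> f z" "\<And>z. 0 \<le> F z"
    and exps: "1 \<le> q" "0 < t" "0 < s" "1 / t + 1 / q = 1 + 1 / s" "1 / s \<le> 1 / t" "1 / s \<le> 1 / q"
    and F: "\<And>x. x \<in> A ==> ennreal (F x) \<le> (\<integral>\<^sup>+y. ennreal (k (x - y) * f y) \<partial>lborel)"
    and K: "(\<integral>\<^sup>+z. ennreal (k z powr t) \<partial>lborel) \<le> ennreal K" "0 \<le> K"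
    and B: "(\<integral>\<^sup>+z. ennreal (f z powr q) \<partial>lborel) \<le> ennreal B" "0 \<le> B"
    and V: "emeasure lborel A \<le> ennreal V" "0 \<le> V"
  shows "(\<integral>\<^sup>+x. ennreal (F x powr s) * indicator A x \<partial>lborel) \<le> ennreal ((1 + K + B) powr s * (K * B + V))"
proof -
  define X where "X x = (\<integral>\<^sup>+y. ennreal (k (x - y) powr t) * ennreal (f y powr q) \<partial>lborel)" for x
  have [measurable]: "X \<in> borel_measurable borel" unfolding X_def by measurable
  have "(\<integral>\<^sup>+x. X x \<partial>lborel) = (\<integral>\<^sup>+z. ennreal (k z powr t) \<partial>lborel) * (\<integral>\<^sup>+z. ennreal (f z powr q) \<partial>lborel)"
    unfolding X_def by (rule nn_integral_convolution) measurable
  also have "... \<le> ennreal K * ennreal B" using K B by (intro mult_mono) auto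
  finally have X: "(\<integral>\<^sup>+x. X x \<partial>lborel) \<le> ennreal (K * B)" using K B by (simp add: ennreal_mult)
  let ?D = "1 + K + B"
  have pw: "ennreal (F x powr s) \<le> ennreal (?D powr s) * (X x + 1)" if x: "x \<in> A" for x
  \<comment> \<open>Where the convolution of the powers is infinite there is nothing to
    prove.\<close>
  proof (cases "X x = top")
    case True
    then show ?thesis using K B by (simp add: ennreal_mult_top)
  next
    case False
    then obtain X' where X': "X x = ennreal X'" "0 \<le> X'" by (cases "X x") auto
    \<comment> \<open>With this choice X' is below \<mu>^s, so the first term of the pointwise bound
      is at most \<mu> like the others. Adding 1 keeps \<mu> positive and is paid for by the volume
      of \<open>A\<close>.\<close>
    define \<mu> where "\<mu> = (X' + 1) powr (1 / s)"
    have mu: "0 < \<mu>" "\<mu> powr s = X' + 1" using X' exps by (auto simp: \<mu>_def powr_powr)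
    have "ennreal (F x) \<le> (\<integral>\<^sup>+y. ennreal (k (x - y) * f y) \<partial>lborel)" by (rule F[OF x])
    also have "... \<le> (\<integral>\<^sup>+y. (ennreal (k (x - y) powr t) * ennreal (f y powr q)) * ennreal (\<mu> powr (1 - s)) +
        (ennreal (k (x - y) powr t) + ennreal (f y powr q)) * ennreal \<mu> \<partial>lborel)"
    proof (intro nn_integral_mono)
      fix y
      have "k (x - y) * f y \<le> k (x - y) powr t * f y powr q * \<mu> powr (1 - s) + (k (x - y) powr t + f y powr q) * \<mu>"
        using nonneg exps mu by (intro product_le_weighted_sum) auto
      then show "ennreal (k (x - y) * f y) \<le> (ennreal (k (x - y) powr t) * ennreal (f y powr q)) * ennreal (\<mu> powr (1 - s)) +
        (ennreal (k (x - y) powr t) + ennreal (f y powr q)) * ennreal \<mu>"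
        using mu by (simp add: ennreal_mult[symmetric] ennreal_plus[symmetric] del: ennreal_plus)
    qed
    also have "... = X x * ennreal (\<mu> powr (1 - s)) +
        ((\<integral>\<^sup>+y. ennreal (k (x - y) powr t) \<partial>lborel) + (\<integral>\<^sup>+y. ennreal (f y powr q) \<partial>lborel)) * ennreal \<mu>"
      unfolding X_def by (simp add: nn_integral_add nn_integral_multc)
    also have "(\<integral>\<^sup>+y. ennreal (k (x - y) powr t) \<partial>lborel) = (\<integral>\<^sup>+y. ennreal (k y powr t) \<partial>lborel)"
      by (rule nn_integral_reflect[where f="\<lambda>z. ennreal (k z powr t)"]) measurable
    also have "X x * ennreal (\<mu> powr (1 - s)) +
        ((\<integral>\<^sup>+y. ennreal (k y powr t) \<partial>lborel) + (\<integral>\<^sup>+y. ennreal (f y powr q) \<partial>lborel)) * ennreal \<mu>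
        \<le> ennreal X' * ennreal (\<mu> powr (1 - s)) + (ennreal K + ennreal B) * ennreal \<mu>"
      using K B X' by (intro add_mono mult_right_mono) auto
    also have "... = ennreal (X' * \<mu> powr (1 - s) + (K + B) * \<mu>)"
      using K B X' mu by (simp add: ennreal_mult[symmetric] ennreal_plus[symmetric] del: ennreal_plus)
    finally have "F x \<le> X' * \<mu> powr (1 - s) + (K + B) * \<mu>"
      using K B X' mu by (subst (asm) ennreal_le_iff) auto
    also have "X' * \<mu> powr (1 - s) \<le> \<mu> powr s * \<mu> powr (1 - s)"
      using mu by (intro mult_right_mono) auto
    also have "\<mu> powr s * \<mu> powr (1 - s) = \<mu>" using mu(1) by (simp add: powr_add[symmetric])
    finally have "F x \<le> ?D * \<mu>" by (simp add: algebra_simps)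
    then have "F x powr s \<le> (?D * \<mu>) powr s" using nonneg exps by (intro powr_mono2) auto
    also have "... = ?D powr s * (X' + 1)" using K B mu by (simp add: powr_mult)
    finally have "ennreal (F x powr s) \<le> ennreal (?D powr s * (X' + 1))" by (rule ennreal_leI)
    also have "... = ennreal (?D powr s) * (X x + 1)" using X' by (simp add: ennreal_mult)
    finally show ?thesis .
  qed
  have "(\<integral>\<^sup>+x. ennreal (F x powr s) * indicator A x \<partial>lborel) \<le> (\<integral>\<^sup>+x. ennreal (?D powr s) * (X x + indicator A x) \<partial>lborel)"
    using pw by (intro nn_integral_mono) (auto simp: indicator_def)
  also have "... = ennreal (?D powr s) * ((\<integral>\<^sup>+x. X x \<partial>lborel) + emeasure lborel A)"
    by (simp add: nn_integral_cmult nn_integral_add)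
  also have "... \<le> ennreal (?D powr s) * (ennreal (K * B) + ennreal V)"
    using X V by (intro mult_left_mono add_mono) auto
  also have "... = ennreal (?D powr s * (K * B + V))"
    using K B V by (simp add: ennreal_mult[symmetric] ennreal_plus[symmetric] del: ennreal_plus)
  finally show ?thesis .
qed

text \<open>The t-th power of the kernel is |z| to the power -(N-1)t near the origin, which is
  integrable when (N-1)t < N.\<close>

lemma rkernel_powr_integral:
  assumes "0 < t" "(real DIM('a::euclidean_space) - 1) * t < real DIM('a)" "2 \<le> DIM('a)" "0 < R"
  shows "\<exists>K\<ge>0. (\<integral>\<^sup>+z. ennreal (rkernel R (z::'a) powr t) \<partial>lborel) \<le> ennreal K"
proof -
  let ?b = "(real DIM('a) - 1) * t"
  have "0 < ?b" using assms by simp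
  then obtain C where C: "0 \<le> C" "\<And>e. 0 < e ==> (\<integral>\<^sup>+z. ennreal (indicator (ball (0::'a) e) z * norm z powr (- ?b)) \<partial>lborel) \<le> ennreal (C * e powr (real DIM('a) - ?b))"
    using nn_integral_norm_powr_ball[of ?b] assms by blast
  have "rkernel R z powr t = indicator (ball 0 R) z * norm z powr (- ?b)" for z :: 'a
    using assms by (simp add: rkernel_def indicator_def powr_powr algebra_simps)
  then show ?thesis using C assms by (intro exI[of _ "C * R powr (real DIM('a) - ?b)"]) auto
qed

text \<open>One derivative buys a decrease of the reciprocal exponent by anything less than 1/N:
  this is precisely the range in which the power of the Riesz kernel demanded by Young's inequality
  is integrable.\<close>

lemma nabla_estimate_step:
  fixes \<Omega> :: "'a::euclidean_space set"
  assumes \<Omega>: "open \<Omega>" "bounded \<Omega>" and N: "2 \<le> DIM('a)"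
    and exps: "1 \<le> q" "0 < s" "1 / s \<le> 1 / q" "1 / q - 1 / s < 1 / real DIM('a)" and B: "0 \<le> B"
  shows "\<exists>C\<ge>0. \<forall>g\<in>test_functions \<Omega>. (\<integral>\<^sup>+x. ennreal (norm (nabla (Suc k) g x) powr q) \<partial>lborel) \<le> ennreal B \<longrightarrow>
    (\<integral>\<^sup>+x. ennreal (norm (nabla k g x) powr s) \<partial>lborel) \<le> ennreal C"
proof -
  let ?N = "real DIM('a)"
  define c where "c = ?N * unit_ball_vol ?N"
  have c: "0 < c" by (simp add: c_def)
  obtain r where "\<forall>x\<in>\<Omega>. norm x \<le> r" using \<Omega>(2) unfolding bounded_iff by blast
  \<comment> \<open>Larger than the diameter of \<Omega>.\<close>
  define R where "R = 2 * \<bar>r\<bar> + 1"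
  have R: "0 < R" "\<And>x y. x \<in> \<Omega> ==> y \<in> \<Omega> ==> norm (x - y) < R"
  proof -
    fix x y assume "x \<in> \<Omega>" "y \<in> \<Omega>"
    then have "norm x \<le> r" "norm y \<le> r" using \<open>\<forall>x\<in>\<Omega>. norm x \<le> r\<close> by auto
    then show "norm (x - y) < R" using norm_triangle_ineq4[of x y] by (simp add: R_def)
  qed (simp add: R_def)
  \<comment> \<open>The exponent for the kernel is dictated by 1/t + 1/q = 1 + 1/s.\<close>
  define t where "t = 1 / (1 - (1 / q - 1 / s))"
  have N1: "1 / ?N \<le> 1 / 2" using N by (simp add: field_simps)
  have d: "0 < 1 - (1 / q - 1 / s)" using exps(4) N1 by linarith
  then have t: "0 < t" "1 / t = 1 - (1 / q - 1 / s)" by (auto simp: t_def)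
  have "(?N - 1) * t < ?N"
  proof -
    have "?N - 1 < ?N * (1 - (1 / q - 1 / s))"
      using exps(4) N by (simp add: field_simps)
    then show ?thesis using d by (simp add: t_def field_simps)
  qed
  then obtain K where K: "0 \<le> K" "(\<integral>\<^sup>+z. ennreal (rkernel R (z::'a) powr t) \<partial>lborel) \<le> ennreal K"
    using rkernel_powr_integral[OF t(1) _ N R(1)] by blast
  have "emeasure lborel \<Omega> < \<infinity>" using emeasure_bounded_finite[OF \<Omega>(2)] by simp
  then obtain V where V: "0 \<le> V" "emeasure lborel \<Omega> \<le> ennreal V"
    by (cases "emeasure lborel \<Omega>") auto
  define C where "C = (1 / c) powr s * ((1 + K + B) powr s * (K * B + V))"
  have "(\<integral>\<^sup>+x. ennreal (norm (nabla k g x) powr s) \<partial>lborel) \<le> ennreal C"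
    if g: "g \<in> test_functions \<Omega>" and le: "(\<integral>\<^sup>+x. ennreal (norm (nabla (Suc k) g x) powr q) \<partial>lborel) \<le> ennreal B" for g
  proof -
    note nabla_measurable[OF g, measurable]
    obtain L where L: "compact L" "L \<subseteq> \<Omega>" "\<And>x. x \<notin> L ==> nabla k g x = 0" "\<And>x. x \<notin> L ==> g x = 0"
      using nabla_zero_outside[OF g] by metis
    have "(\<integral>\<^sup>+x. ennreal ((c * norm (nabla k g x)) powr s) * indicator \<Omega> x \<partial>lborel) \<le> ennreal ((1 + K + B) powr s * (K * B + V))"
    proof (rule young_convolution_bound[where k="rkernel R" and f="\<lambda>y. norm (nabla (Suc k) g y)" and t=t and q=q])
      show "ennreal (c * norm (nabla k g x)) \<le> (\<integral>\<^sup>+y. ennreal (rkernel R (x - y) * norm (nabla (Suc k) g y)) \<partial>lborel)" if "x \<in> \<Omega>" for x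
        unfolding c_def using R(2)[OF that] by (rule norm_nabla_le_potential[OF g])
      show "1 / t + 1 / q = 1 + 1 / s" using t by simp
      have "1 / q \<le> 1" using exps by simp
      then show "1 / s \<le> 1 / t" using t by simp
    qed (use le K B V \<Omega> exps t c in \<open>auto simp: rkernel_nonneg\<close>)
    moreover have "ennreal (norm (nabla k g x) powr s) = ennreal ((1 / c) powr s) * (ennreal ((c * norm (nabla k g x)) powr s) * indicator \<Omega> x)" for x
    proof (cases "x \<in> \<Omega>")
      case True
      have "norm (nabla k g x) powr s = (1 / c) powr s * (c * norm (nabla k g x)) powr s"
        using c by (simp add: powr_mult[symmetric])
      then show ?thesis using True by (simp add: ennreal_mult)
    next
      case False
      then have "nabla k g x = 0" using L by auto
      then show ?thesis using False by simp
    qed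
    ultimately have "(\<integral>\<^sup>+x. ennreal (norm (nabla k g x) powr s) \<partial>lborel) \<le> ennreal ((1 / c) powr s) * ennreal ((1 + K + B) powr s * (K * B + V))"
      using \<Omega>(1) by (simp add: nn_integral_cmult mult_left_mono)
    also have "... = ennreal C" using K B V by (simp add: C_def ennreal_mult)
    finally show ?thesis .
  qed
  moreover have "0 \<le> C" using K B V by (simp add: C_def)
  ultimately show ?thesis by blast
qed

text \<open>The total gain is spread evenly: every order lowers the reciprocal exponent by the same
  \<tau> < 1/N, so that each single step stays in the admissible range.\<close>

lemma nabla_estimate_chain:
  fixes \<Omega> :: "'a::euclidean_space set"
  assumes \<Omega>: "open \<Omega>" "bounded \<Omega>" and N: "2 \<le> DIM('a)"
    and q: "1 \<le> q" and \<tau>: "0 \<le> \<tau>" "\<tau> < 1 / real DIM('a)" "0 < 1 / q - real m * \<tau>" and B: "0 \<le> B"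
    and j: "j \<le> m"
  shows "\<exists>C\<ge>0. \<forall>g\<in>test_functions \<Omega>. (\<integral>\<^sup>+x. ennreal (norm (nabla m g x) powr q) \<partial>lborel) \<le> ennreal B \<longrightarrow>
    (\<integral>\<^sup>+x. ennreal (norm (nabla (m - j) g x) powr (1 / (1 / q - real j * \<tau>))) \<partial>lborel) \<le> ennreal C"
  using j
proof (induction j)
  case 0
  then show ?case using B by auto
next
  case (Suc j)
  then obtain C where C: "0 \<le> C" "\<And>g. g\<in>test_functions \<Omega> ==> (\<integral>\<^sup>+x. ennreal (norm (nabla m g x) powr q) \<partial>lborel) \<le> ennreal B ==>
    (\<integral>\<^sup>+x. ennreal (norm (nabla (m - j) g x) powr (1 / (1 / q - real j * \<tau>))) \<partial>lborel) \<le> ennreal C"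
    by auto
  let ?a = "1 / q - real j * \<tau>" and ?b = "1 / q - real (Suc j) * \<tau>"
  have b: "0 < ?b" 
  proof -
    have "real (Suc j) * \<tau> \<le> real m * \<tau>" using Suc.prems \<tau> by (intro mult_right_mono) auto
    then show ?thesis using \<tau> by linarith
  qed
  have a: "?a = ?b + \<tau>" by (simp add: algebra_simps)
  have "?a \<le> 1 / q" "1 / q \<le> 1" using \<tau> q by auto
  then have "?a \<le> 1" by linarith
  have "\<exists>C'\<ge>0. \<forall>g\<in>test_functions \<Omega>. (\<integral>\<^sup>+x. ennreal (norm (nabla (Suc (m - Suc j)) g x) powr (1 / ?a)) \<partial>lborel) \<le> ennreal C \<longrightarrow>
    (\<integral>\<^sup>+x. ennreal (norm (nabla (m - Suc j) g x) powr (1 / ?b)) \<partial>lborel) \<le> ennreal C'"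
    using b \<tau> a \<open>?a \<le> 1\<close> C(1) by (intro nabla_estimate_step[OF \<Omega> N]) auto
  moreover have "Suc (m - Suc j) = m - j" using Suc.prems by simp
  ultimately show ?case using C(2) by metis
qed

text \<open>The iterated estimate only maps bounds to bounds, without homogeneity, because of the
  additive form of the Young inequality. Normalizing the top-order integral and scaling back
  restores the correct powers of \<open>A\<close>.\<close>

theorem polyharmonic_sobolev:
  fixes \<Omega> :: "'a::euclidean_space set"
  assumes \<Omega>: "open \<Omega>" "bounded \<Omega>" and N: "2 \<le> DIM('a)"
    and q: "1 \<le> q" "q \<le> s" "1 / q - real m / real DIM('a) < 1 / s" and m: "1 \<le> m"
  obtains C where "0 \<le> C"
    "\<And>g A. g \<in> test_functions \<Omega> ==> 0 < A ==> (\<integral>\<^sup>+x. ennreal (norm (nabla m g x) powr q) \<partial>lborel) \<le> ennreal (A powr q) ==>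
       (\<integral>\<^sup>+x. ennreal (\<bar>g x\<bar> powr s) \<partial>lborel) \<le> ennreal (C * A powr s)"
    "\<And>g A k. g \<in> test_functions \<Omega> ==> 0 < A ==> k \<le> m ==> (\<integral>\<^sup>+x. ennreal (norm (nabla m g x) powr q) \<partial>lborel) \<le> ennreal (A powr q) ==>
       (\<integral>\<^sup>+x. ennreal (norm (nabla k g x) powr q) \<partial>lborel) \<le> ennreal (C * A powr q)"
proof -
  \<comment> \<open>Proved by applying the chain of estimates to g / A with bound 1.\<close>
  have scale: "\<exists>C\<ge>0. \<forall>g\<in>test_functions \<Omega>. \<forall>A>0. (\<integral>\<^sup>+x. ennreal (norm (nabla m g x) powr q) \<partial>lborel) \<le> ennreal (A powr q) \<longrightarrow>
       (\<integral>\<^sup>+x. ennreal (norm (nabla k g x) powr s') \<partial>lborel) \<le> ennreal (C * A powr s')"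
    if k: "k \<le> m" and s': "q \<le> s'" "1 / q - real m / real DIM('a) < 1 / s'" "1 / s' = 1 / q - real (m - k) * \<tau>" "0 \<le> \<tau>" "\<tau> < 1 / real DIM('a)" "0 < 1 / q - real m * \<tau>" for k s' \<tau>
  proof -
    obtain C where C: "0 \<le> C" "\<And>g. g\<in>test_functions \<Omega> ==> (\<integral>\<^sup>+x. ennreal (norm (nabla m g x) powr q) \<partial>lborel) \<le> ennreal 1 ==>
      (\<integral>\<^sup>+x. ennreal (norm (nabla (m - (m - k)) g x) powr (1 / (1 / q - real (m - k) * \<tau>))) \<partial>lborel) \<le> ennreal C"
      using nabla_estimate_chain[OF \<Omega> N q(1) s'(4-6), of 1 "m - k"] by auto
    have eq: "m - (m - k) = k" "1 / (1 / q - real (m - k) * \<tau>) = s'"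
      unfolding s'(3)[symmetric] using k by auto
    have "(\<integral>\<^sup>+x. ennreal (norm (nabla k g x) powr s') \<partial>lborel) \<le> ennreal (C * A powr s')"
      if g: "g \<in> test_functions \<Omega>" and A: "0 < A" and le: "(\<integral>\<^sup>+x. ennreal (norm (nabla m g x) powr q) \<partial>lborel) \<le> ennreal (A powr q)" for g A
    proof -
      note nabla_measurable[OF g, measurable]
      have sc: "(\<integral>\<^sup>+x. ennreal (norm (nabla j (\<lambda>x. c * g x) x) powr e) \<partial>lborel) = ennreal (c powr e) * (\<integral>\<^sup>+x. ennreal (norm (nabla j g x) powr e) \<partial>lborel)"
        if "0 < c" for j c e
        using that nabla_cmult[OF test_functions_smooth[OF g], of j c]
        by (simp add: powr_mult ennreal_mult nn_integral_cmult)
      have "(\<integral>\<^sup>+x. ennreal (norm (nabla m (\<lambda>x. (1 / A) * g x) x) powr q) \<partial>lborel) \<le> ennreal ((1 / A) powr q) * ennreal (A powr q)"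
        using A le by (subst sc) (auto intro!: mult_left_mono)
      also have "... = ennreal 1" using A by (simp add: ennreal_mult[symmetric] powr_mult[symmetric])
      finally have "(\<integral>\<^sup>+x. ennreal (norm (nabla k (\<lambda>x. (1 / A) * g x) x) powr s') \<partial>lborel) \<le> ennreal C"
        using C(2)[OF test_functions_cmult[OF g, of "1 / A"]] by (simp add: eq)
      then have *: "ennreal ((1 / A) powr s') * (\<integral>\<^sup>+x. ennreal (norm (nabla k g x) powr s') \<partial>lborel) \<le> ennreal C"
        using A by (subst (asm) sc) auto
      have "(\<integral>\<^sup>+x. ennreal (norm (nabla k g x) powr s') \<partial>lborel) = ennreal (A powr s') * (ennreal ((1 / A) powr s') * (\<integral>\<^sup>+x. ennreal (norm (nabla k g x) powr s') \<partial>lborel))"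
        using A by (simp add: mult.assoc[symmetric] ennreal_mult[symmetric] powr_mult[symmetric])
      also have "... \<le> ennreal (A powr s') * ennreal C" using * by (rule mult_left_mono) simp
      also have "... = ennreal (C * A powr s')" using C(1) by (simp add: ennreal_mult[symmetric] mult.commute)
      finally show ?thesis .
    qed
    with C(1) show ?thesis by blast
  qed
  \<comment> \<open>An equal share per order of the drop from 1/q to 1/s; strict subcriticality
    makes each share smaller than 1/N.\<close>
  define \<tau> where "\<tau> = (1 / q - 1 / s) / real m"
  have tau: "1 / s = 1 / q - real m * \<tau>" "0 \<le> \<tau>" "\<tau> < 1 / real DIM('a)"
  proof -
    show "1 / s = 1 / q - real m * \<tau>" using m by (simp add: \<tau>_def)
    show "0 \<le> \<tau>" using q m by (simp add: \<tau>_def frac_le)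
    have "1 / q - 1 / s < real m / real DIM('a)" using q by linarith
    then have "(1 / q - 1 / s) / real m < real m / real DIM('a) / real m" using m by (intro divide_strict_right_mono) auto
    then show "\<tau> < 1 / real DIM('a)" using m by (simp add: \<tau>_def)
  qed
  have s0: "0 < 1 / s" using q by simp
  obtain C0 where C0: "0 \<le> C0" "\<And>g A. g \<in> test_functions \<Omega> ==> 0 < A ==> (\<integral>\<^sup>+x. ennreal (norm (nabla m g x) powr q) \<partial>lborel) \<le> ennreal (A powr q) ==>
       (\<integral>\<^sup>+x. ennreal (norm (nabla 0 g x) powr s) \<partial>lborel) \<le> ennreal (C0 * A powr s)"
    using scale[of 0 s \<tau>] tau q s0 by auto
  \<comment> \<open>Taking \<tau> = 0 gives up the gain and controls all intermediate orders in the
    same exponent q.\<close>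
  have "\<forall>k\<in>{..m}. \<exists>C\<ge>0. \<forall>g\<in>test_functions \<Omega>. \<forall>A>0. (\<integral>\<^sup>+x. ennreal (norm (nabla m g x) powr q) \<partial>lborel) \<le> ennreal (A powr q) \<longrightarrow>
       (\<integral>\<^sup>+x. ennreal (norm (nabla k g x) powr q) \<partial>lborel) \<le> ennreal (C * A powr q)"
    using scale[where \<tau>=0 and s'=q] q m N by simp
  then obtain c where c: "\<And>k. k \<le> m ==> 0 \<le> c k" "\<And>k g A. k \<le> m ==> g\<in>test_functions \<Omega> ==> 0 < A ==> (\<integral>\<^sup>+x. ennreal (norm (nabla m g x) powr q) \<partial>lborel) \<le> ennreal (A powr q) ==>
       (\<integral>\<^sup>+x. ennreal (norm (nabla k g x) powr q) \<partial>lborel) \<le> ennreal (c k * A powr q)"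
    by (metis atMost_iff)
  define C where "C = C0 + (\<Sum>k\<le>m. c k)"
  have C: "C0 \<le> C" "\<And>k. k \<le> m ==> c k \<le> C"
  proof -
    have "0 \<le> (\<Sum>k\<le>m. c k)" using c(1) by (intro sum_nonneg) auto
    then show "C0 \<le> C" by (simp add: C_def)
    fix k assume "k \<le> m"
    then have "c k \<le> (\<Sum>k\<le>m. c k)" using c(1) by (intro member_le_sum) auto
    then show "c k \<le> C" using C0 by (simp add: C_def)
  qed
  show ?thesis
  proof (rule that[of C])
    show "0 \<le> C" using C C0 by linarith
    fix g A assume *: "g \<in> test_functions \<Omega>" "0 < A" "(\<integral>\<^sup>+x. ennreal (norm (nabla m g x) powr q) \<partial>lborel) \<le> ennreal (A powr q)"
    show "(\<integral>\<^sup>+x. ennreal (\<bar>g x\<bar> powr s) \<partial>lborel) \<le> ennreal (C * A powr s)"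
      using order_trans[OF C0(2)[OF *] ennreal_leI[OF mult_right_mono[OF C(1)]]] by (simp add: nabla_0)
    fix k assume "k \<le> m"
    show "(\<integral>\<^sup>+x. ennreal (norm (nabla k g x) powr q) \<partial>lborel) \<le> ennreal (C * A powr q)"
      by (rule order_trans[OF c(2)[OF \<open>k \<le> m\<close> *] ennreal_leI[OF mult_right_mono[OF C(2)[OF \<open>k \<le> m\<close>]]]]) simp
  qed
qed

section \<open>Power integrals\<close>

text \<open>The power of the \<open>L^\<sigma>\<close> norm without the root, with values in
  \<open>ennreal\<close>. Limits, finiteness and completeness can be read off from it, and the
  factor 2^\<sigma> in the inequality for sums stands in for Minkowski's inequality.\<close>

definition lpm :: "'a measure => real => ('a => 'b::euclidean_space) => ennreal" where
  "lpm M \<sigma> f = (\<integral>\<^sup>+x. ennreal (norm (f x) powr \<sigma>) \<partial>M)"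

lemma ennreal_neq_infinityE:
  assumes "x \<noteq> (\<infinity> :: ennreal)"
  obtains r where "x = ennreal r" "0 \<le> r"
  using assms by (cases x) auto

lemma norm_add_powr_le:
  fixes a b :: "'b::real_normed_vector"
  assumes "0 \<le> k"
  shows "norm (a + b) powr k \<le> 2 powr k * (norm a powr k + norm b powr k)"
proof -
  let ?m = "max (norm a) (norm b)"
  have "norm (a + b) powr k \<le> (2 * ?m) powr k"
    using norm_triangle_ineq[of a b] assms by (intro powr_mono2) auto
  also have "... = 2 powr k * ?m powr k" by (simp add: powr_mult)
  also have "?m powr k \<le> norm a powr k + norm b powr k" by (simp add: max_def)
  finally show ?thesis by simp
qed

lemma lpm_add_le:
  assumes "0 \<le> k" "f \<in> borel_measurable M" "g \<in> borel_measurable M"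
  shows "lpm M k (\<lambda>x. f x + g x) \<le> ennreal (2 powr k) * (lpm M k f + lpm M k g)"
proof -
  have "lpm M k (\<lambda>x. f x + g x) \<le> (\<integral>\<^sup>+x. ennreal (2 powr k) * (ennreal (norm (f x) powr k) + ennreal (norm (g x) powr k)) \<partial>M)"
    unfolding lpm_def using norm_add_powr_le[OF assms(1)]
    by (intro nn_integral_mono) (simp add: ennreal_mult[symmetric] ennreal_plus[symmetric] del: ennreal_plus)
  also have "... = ennreal (2 powr k) * (lpm M k f + lpm M k g)"
    unfolding lpm_def using assms(2,3) by (simp add: nn_integral_cmult nn_integral_add)
  finally show ?thesis .
qed

lemma lpm_minus: "lpm M k (\<lambda>x. - f x) = lpm M k f"
  by (simp add: lpm_def)

lemma lpm_minus_commute: "lpm M k (\<lambda>x. f x - g x) = lpm M k (\<lambda>x. g x - f x)"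
  by (simp add: lpm_def norm_minus_commute)

lemma lpm_diff_le:
  assumes "0 \<le> k" "f \<in> borel_measurable M" "g \<in> borel_measurable M"
  shows "lpm M k (\<lambda>x. f x - g x) \<le> ennreal (2 powr k) * (lpm M k f + lpm M k g)"
  using lpm_add_le[OF assms(1,2), of "\<lambda>x. - g x"] assms(3) by (simp add: lpm_minus)

lemma lpm_triangle_le:
  assumes "0 \<le> k" "f \<in> borel_measurable M" "g \<in> borel_measurable M" "h \<in> borel_measurable M"
  shows "lpm M k (\<lambda>x. f x - h x) \<le> ennreal (2 powr k) * (lpm M k (\<lambda>x. f x - g x) + lpm M k (\<lambda>x. g x - h x))"
  using lpm_add_le[OF assms(1), of "\<lambda>x. f x - g x" M "\<lambda>x. g x - h x"] assms by simp

lemma lpm_cmult: "f \<in> borel_measurable M ==> lpm M k (\<lambda>x. c *\<^sub>R f x) = ennreal (\<bar>c\<bar> powr k) * lpm M k f"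
  unfolding lpm_def by (simp add: powr_mult ennreal_mult nn_integral_cmult)

lemma lpm_cong_AE: "AE x in M. f x = g x ==> lpm M k f = lpm M k g"
  unfolding lpm_def by (intro nn_integral_cong_AE) auto

lemma lpm_eq_0_AE:
  assumes "f \<in> borel_measurable M" "lpm M k f = 0"
  shows "AE x in M. f x = 0"
proof -
  have "AE x in M. ennreal (norm (f x) powr k) = 0"
    using assms unfolding lpm_def by (subst (asm) nn_integral_0_iff_AE) auto
  then show ?thesis by eventually_elim (simp add: ennreal_eq_0_iff)
qed

lemma lpm_fatou:
  assumes [measurable]: "\<And>n. f n \<in> borel_measurable M" "g \<in> borel_measurable M"
    and lim: "AE x in M. (\<lambda>n. f n x) \<longlonglongrightarrow> g x" and k: "0 < k" and le: "\<forall>\<^sub>F n in sequentially. lpm M k (f n) \<le> C"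
  shows "lpm M k g \<le> C"
proof -
  have "lpm M k g = (\<integral>\<^sup>+x. liminf (\<lambda>n. ennreal (norm (f n x) powr k)) \<partial>M)"
    unfolding lpm_def
  proof (rule nn_integral_cong_AE)
    show "AE x in M. ennreal (norm (g x) powr k) = liminf (\<lambda>n. ennreal (norm (f n x) powr k))"
      using lim
    proof eventually_elim
      case (elim x)
      have "(\<lambda>n. ennreal (norm (f n x) powr k)) \<longlonglongrightarrow> ennreal (norm (g x) powr k)"
        using k by (intro tendsto_ennrealI tendsto_powr' tendsto_norm elim tendsto_const) auto
      then show ?case by (rule lim_imp_Liminf[OF trivial_limit_sequentially, symmetric])
    qed
  qed
  also have "... \<le> liminf (\<lambda>n. lpm M k (f n))"
    unfolding lpm_def by (intro nn_integral_liminf) measurable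
  also have "... \<le> C"
  proof -
    have "liminf (\<lambda>n. lpm M k (f n)) \<le> limsup (\<lambda>n. lpm M k (f n))"
      by (intro Liminf_le_Limsup) simp
    also have "... \<le> C" by (rule Limsup_bounded[OF le])
    finally show ?thesis .
  qed
  finally show ?thesis .
qed

text \<open>The Riesz-Fischer argument. A subsequence with rapidly decreasing increments converges
  absolutely almost everywhere, and Fatou's lemma carries the Cauchy condition of the whole sequence
  to the limit.\<close>

lemma lpm_complete:
  fixes f :: "nat => 'a => 'b::euclidean_space"
  assumes meas[measurable]: "\<And>n. f n \<in> borel_measurable M" and \<sigma>: "0 < \<sigma>"
    and cauchy: "\<And>e. 0 < e ==> \<exists>N. \<forall>n\<ge>N. \<forall>k\<ge>N. lpm M \<sigma> (\<lambda>x. f n x - f k x) \<le> ennreal e"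
  obtains g r where "g \<in> borel_measurable M" "strict_mono (r :: nat => nat)"
    "AE x in M. (\<lambda>n. f (r n) x) \<longlonglongrightarrow> g x" "(\<lambda>n. lpm M \<sigma> (\<lambda>x. f n x - g x)) \<longlonglongrightarrow> 0"
proof -
  \<comment> \<open>The exponent \<sigma> + 1 is chosen so that, after multiplying the increments by
    2^k, their power integrals are still at most 2^(-k).\<close>
  define e where "e k = ((1/2) ^ k) powr (\<sigma> + 1)" for k :: nat
  have "\<forall>k. \<exists>N. \<forall>n\<ge>N. \<forall>l\<ge>N. lpm M \<sigma> (\<lambda>x. f n x - f l x) \<le> ennreal (e k)"
    using cauchy by (simp add: e_def)
  then obtain N where N: "\<And>k n l. N k \<le> n ==> N k \<le> l ==> lpm M \<sigma> (\<lambda>x. f n x - f l x) \<le> ennreal (e k)" by metis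
  define r where "r = rec_nat (N 0) (\<lambda>k rk. max (Suc rk) (N (Suc k)))"
  have r_Suc: "r (Suc k) = max (Suc (r k)) (N (Suc k))" for k by (simp add: r_def)
  have rN: "N k \<le> r k" for k by (cases k) (auto simp: r_Suc, simp add: r_def)
  have r: "strict_mono r" unfolding strict_mono_Suc_iff r_Suc by auto
  define d where "d k x = f (r (Suc k)) x - f (r k) x" for k x
  have [measurable]: "d k \<in> borel_measurable M" for k unfolding d_def by measurable
  have "lpm M \<sigma> (d k) \<le> ennreal (e k)" for k
    unfolding d_def using rN[of k] r_Suc[of k] by (intro N) auto
  have tail_le: "(\<integral>\<^sup>+x. ennreal ((2 ^ k * norm (d k x)) powr \<sigma>) \<partial>M) \<le> ennreal ((1/2) ^ k)" for k
  proof -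
    have "(\<integral>\<^sup>+x. ennreal ((2 ^ k * norm (d k x)) powr \<sigma>) \<partial>M) = ennreal ((2 ^ k) powr \<sigma>) * lpm M \<sigma> (d k)"
      unfolding lpm_def by (simp add: powr_mult ennreal_mult nn_integral_cmult)
    also have "... \<le> ennreal ((2 ^ k) powr \<sigma>) * ennreal (e k)"
      using \<open>lpm M \<sigma> (d k) \<le> ennreal (e k)\<close> by (rule mult_left_mono) simp
    also have "... = ennreal ((2 ^ k) powr \<sigma> * (((1/2) ^ k) powr \<sigma> * (1/2) ^ k))"
      by (simp add: e_def ennreal_mult[symmetric] powr_add)
    also have "(2 ^ k) powr \<sigma> * (((1/2) ^ k) powr \<sigma> * (1/2) ^ k) = ((2 ^ k * (1/2) ^ k) powr \<sigma>) * ((1/2) ^ k :: real)"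
      by (simp only: powr_mult mult.assoc)
    also have "(2 ^ k * (1/2) ^ k :: real) = 1" by (simp add: power_mult_distrib[symmetric])
    finally show ?thesis by simp
  qed
  have "(\<integral>\<^sup>+x. (\<Sum>k. ennreal ((2 ^ k * norm (d k x)) powr \<sigma>)) \<partial>M) = (\<Sum>k. \<integral>\<^sup>+x. ennreal ((2 ^ k * norm (d k x)) powr \<sigma>) \<partial>M)"
    by (intro nn_integral_suminf) measurable
  also have "... \<le> (\<Sum>k. ennreal ((1/2) ^ k))"
    using tail_le by (intro suminf_le) auto
  also have "... = ennreal (1 / (1 - 1/2))"
    by (intro suminf_ennreal_eq geometric_sums) auto
  also have "... < \<infinity>" by simp
  finally have fin: "AE x in M. (\<Sum>k. ennreal ((2 ^ k * norm (d k x)) powr \<sigma>)) \<noteq> \<infinity>"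
    by (intro nn_integral_PInf_AE) auto
  have conv: "AE x in M. convergent (\<lambda>n. f (r n) x)"
    using fin
  proof eventually_elim
    case (elim x)
    let ?a = "\<lambda>k. ennreal ((2 ^ k * norm (d k x)) powr \<sigma>)"
    obtain S where S: "suminf ?a = ennreal S" "0 \<le> S"
      using ennreal_neq_infinityE[OF elim] by metis
    have "norm (d k x) \<le> S powr (1 / \<sigma>) * (1/2) ^ k" for k
    proof -
      have "sum ?a {k} \<le> suminf ?a" by (rule sum_le_suminf) (rule summableI, simp_all)
      then have "ennreal ((2 ^ k * norm (d k x)) powr \<sigma>) \<le> ennreal S" unfolding S(1) by simp
      then have "(2 ^ k * norm (d k x)) powr \<sigma> \<le> S" using S(2) by (simp only: ennreal_le_iff)
      then have "((2 ^ k * norm (d k x)) powr \<sigma>) powr (1 / \<sigma>) \<le> S powr (1 / \<sigma>)"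
        using \<sigma> by (intro powr_mono2) auto
      then show ?thesis using \<sigma> by (simp add: powr_powr field_simps power_one_over)
    qed
    moreover have "summable (\<lambda>k. S powr (1 / \<sigma>) * (1/2::real) ^ k)"
      by (rule summable_mult) (rule summable_geometric, simp)
    ultimately have "summable (\<lambda>k. d k x)"
      using summable_comparison_test'[of "\<lambda>k. S powr (1 / \<sigma>) * (1/2) ^ k" 0 "\<lambda>k. d k x"] by blast
    from tendsto_add[OF tendsto_const[of "f (r 0) x"] summable_LIMSEQ[OF this]]
    have "convergent (\<lambda>n. f (r 0) x + (\<Sum>k<n. d k x))" by (rule convergentI)
    moreover have "f (r 0) x + (\<Sum>k<n. d k x) = f (r n) x" for n
      by (simp add: d_def sum_lessThan_telescope[of "\<lambda>k. f (r k) x"])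
    ultimately show ?case by simp
  qed
  \<comment> \<open>The value of \<open>lim\<close> on the null set of divergence is arbitrary, but
    the function is measurable as a whole.\<close>
  define g where "g x = lim (\<lambda>n. f (r n) x)" for x
  have gm[measurable]: "g \<in> borel_measurable M" unfolding g_def[abs_def] by measurable
  have lim: "AE x in M. (\<lambda>n. f (r n) x) \<longlonglongrightarrow> g x"
    using conv by eventually_elim (simp add: g_def convergent_LIMSEQ_iff)
  have "(\<lambda>n. lpm M \<sigma> (\<lambda>x. f n x - g x)) \<longlonglongrightarrow> 0"
  proof (rule tendsto_zero_ennreal)
    fix \<epsilon> :: real assume "0 < \<epsilon>"
    then obtain N where N: "\<And>n k. N \<le> n ==> N \<le> k ==> lpm M \<sigma> (\<lambda>x. f n x - f k x) \<le> ennreal (\<epsilon> / 2)"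
      using cauchy[of "\<epsilon> / 2"] by auto
    have "lpm M \<sigma> (\<lambda>x. f n x - g x) < ennreal \<epsilon>" if "N \<le> n" for n
    proof -
      have "lpm M \<sigma> (\<lambda>x. f n x - g x) \<le> ennreal (\<epsilon> / 2)"
      proof (rule lpm_fatou[where f="\<lambda>k x. f n x - f (r k) x"])
        show "AE x in M. (\<lambda>k. f n x - f (r k) x) \<longlonglongrightarrow> f n x - g x"
          using lim by eventually_elim (intro tendsto_diff tendsto_const)
        show "\<forall>\<^sub>F k in sequentially. lpm M \<sigma> (\<lambda>x. f n x - f (r k) x) \<le> ennreal (\<epsilon> / 2)"
          using that seq_suble[OF r] by (intro eventually_sequentiallyI[of N] N) (auto intro: le_trans)
      qed (use \<sigma> in auto)
      also have "... < ennreal \<epsilon>" using \<open>0 < \<epsilon>\<close> by (simp add: ennreal_lessI)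
      finally show ?thesis .
    qed
    then show "\<forall>\<^sub>F n in sequentially. lpm M \<sigma> (\<lambda>x. f n x - g x) < ennreal \<epsilon>"
      by (intro eventually_sequentiallyI[of N])
  qed
  with gm r lim show ?thesis using that by blast
qed

lemma lpm_tendsto_cauchy:
  fixes f :: "nat => 'a => 'b::euclidean_space"
  assumes [measurable]: "\<And>n. f n \<in> borel_measurable M" "g \<in> borel_measurable M" and \<sigma>: "0 < \<sigma>"
    and lim: "(\<lambda>n. lpm M \<sigma> (\<lambda>x. f n x - g x)) \<longlonglongrightarrow> 0" and e: "0 < e"
  shows "\<exists>N. \<forall>n\<ge>N. \<forall>k\<ge>N. lpm M \<sigma> (\<lambda>x. f n x - f k x) \<le> ennreal e"
proof -
  define d where "d = e / (2 * 2 powr \<sigma>)"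
  have d: "0 < d" "2 powr \<sigma> * (d + d) = e" using e by (auto simp: d_def field_simps)
  have "\<forall>\<^sub>F n in sequentially. lpm M \<sigma> (\<lambda>x. f n x - g x) < ennreal d"
    using order_tendstoD(2)[OF lim, of "ennreal d"] d by simp
  then obtain N where N: "\<And>n. N \<le> n ==> lpm M \<sigma> (\<lambda>x. f n x - g x) < ennreal d"
    by (auto simp: eventually_sequentially)
  have "lpm M \<sigma> (\<lambda>x. f n x - f k x) \<le> ennreal e" if "N \<le> n" "N \<le> k" for n k
  proof -
    have "lpm M \<sigma> (\<lambda>x. f n x - f k x) \<le> ennreal (2 powr \<sigma>) * (lpm M \<sigma> (\<lambda>x. f n x - g x) + lpm M \<sigma> (\<lambda>x. g x - f k x))"
      using \<sigma> by (intro lpm_triangle_le) auto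
    also have "... \<le> ennreal (2 powr \<sigma>) * (ennreal d + ennreal d)"
      using N[OF that(1)] N[OF that(2)] by (intro mult_left_mono add_mono) (auto simp: lpm_minus_commute[of M \<sigma> g])
    also have "... = ennreal e" using d by (simp add: ennreal_mult[symmetric] ennreal_plus[symmetric] del: ennreal_plus)
    finally show ?thesis .
  qed
  then show ?thesis by blast
qed

lemma lpm_tendsto_unique:
  fixes f :: "nat => 'a => 'b::euclidean_space"
  assumes [measurable]: "\<And>n. f n \<in> borel_measurable M" "g \<in> borel_measurable M" "h \<in> borel_measurable M" and k: "0 < k"
    and "(\<lambda>n. lpm M k (\<lambda>x. f n x - g x)) \<longlonglongrightarrow> 0" "(\<lambda>n. lpm M k (\<lambda>x. f n x - h x)) \<longlonglongrightarrow> 0"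
  shows "AE x in M. g x = h x"
proof -
  have "lpm M k (\<lambda>x. g x - h x) \<le> ennreal (2 powr k) * (lpm M k (\<lambda>x. f n x - g x) + lpm M k (\<lambda>x. f n x - h x))" for n
    using lpm_triangle_le[of k g M "f n" h] k by (simp add: lpm_minus_commute[of M k g])
  moreover have "(\<lambda>n. ennreal (2 powr k) * (lpm M k (\<lambda>x. f n x - g x) + lpm M k (\<lambda>x. f n x - h x))) \<longlonglongrightarrow> ennreal (2 powr k) * (0 + 0)"
    using assms by (intro ennreal_tendsto_cmult tendsto_add) auto
  ultimately have "lpm M k (\<lambda>x. g x - h x) \<le> 0"
    by (intro LIMSEQ_le_const[of "\<lambda>n. ennreal (2 powr k) * (lpm M k (\<lambda>x. f n x - g x) + lpm M k (\<lambda>x. f n x - h x))"]) auto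
  then have "AE x in M. g x - h x = 0" by (intro lpm_eq_0_AE[of _ M k]) auto
  then show ?thesis by auto
qed

text \<open>Completeness yields an almost everywhere convergent subsequence with some limit;
  uniqueness of limits identifies it with \<open>g\<close>.\<close>

lemma lpm_tendsto_AE_subseq:
  fixes f :: "nat => 'a => 'b::euclidean_space"
  assumes [measurable]: "\<And>n. f n \<in> borel_measurable M" "g \<in> borel_measurable M" and \<sigma>: "0 < \<sigma>"
    and lim: "(\<lambda>n. lpm M \<sigma> (\<lambda>x. f n x - g x)) \<longlonglongrightarrow> 0"
  obtains r where "strict_mono (r :: nat => nat)" "AE x in M. (\<lambda>n. f (r n) x) \<longlonglongrightarrow> g x"
proof -
  have "\<exists>N. \<forall>n\<ge>N. \<forall>k\<ge>N. lpm M \<sigma> (\<lambda>x. f n x - f k x) \<le> ennreal e" if "0 < e" for e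
    using that assms by (intro lpm_tendsto_cauchy) auto
  then obtain g' r where g': "g' \<in> borel_measurable M" "strict_mono (r :: nat => nat)"
    "AE x in M. (\<lambda>n. f (r n) x) \<longlonglongrightarrow> g' x" "(\<lambda>n. lpm M \<sigma> (\<lambda>x. f n x - g' x)) \<longlonglongrightarrow> 0"
    using lpm_complete[of f M \<sigma>] assms by blast
  have "AE x in M. g x = g' x"
    using lpm_tendsto_unique[of f M g g' \<sigma>] g' assms by blast
  with g'(3) have "AE x in M. (\<lambda>n. f (r n) x) \<longlonglongrightarrow> g x" by eventually_elim simp
  with g'(2) show ?thesis using that by blast
qed

text \<open>An additive substitute for interpolation by Hoelder's inequality: below a threshold the
  linear term dominates, above it the higher power does with an arbitrarily small
  coefficient.\<close>

lemma powr_interpolation: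
  fixes k s c :: real
  assumes "1 \<le> k" "k < s" "0 < c"
  obtains C where "0 \<le> C" "\<And>t. 0 \<le> t ==> t powr k \<le> c * t powr s + C * t"
proof -
  \<comment> \<open>The threshold solves T^(k-s) = c.\<close>
  define T where "T = c powr (1 / (k - s))"
  have T: "0 < T" "T powr (k - s) = c" using assms by (auto simp: T_def powr_powr)
  have "t powr k \<le> c * t powr s + T powr (k - 1) * t" if t: "0 \<le> t" for t
  proof (cases "t \<le> T")
    case True
    have "t powr k = t powr (k - 1) * t" using t assms by (cases "t = 0") (auto simp: powr_diff)
    also have "... \<le> T powr (k - 1) * t" using True t assms by (intro mult_right_mono powr_mono2) auto
    finally show ?thesis using assms by (simp add: add_increasing)
  next
    case False
    have "t powr k = t powr (k - s) * t powr s" using False T by (simp add: powr_add[symmetric])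
    also have "... \<le> T powr (k - s) * t powr s" using False T assms by (intro mult_right_mono powr_mono2') auto
    finally have "t powr k \<le> c * t powr s" using T by simp
    moreover have "0 \<le> T powr (k - 1) * t" using t by simp
    ultimately show ?thesis by linarith
  qed
  then show ?thesis using that[of "T powr (k - 1)"] by simp
qed

lemma lpm_interpolation_tendsto:
  fixes f :: "nat => 'a => 'b::euclidean_space"
  assumes [measurable]: "\<And>n. f n \<in> borel_measurable M" and k: "1 \<le> k" "k < s"
    and lim: "(\<lambda>n. lpm M 1 (f n)) \<longlonglongrightarrow> 0" and bnd: "\<And>n. lpm M s (f n) \<le> ennreal B" and B: "0 \<le> B"
  shows "(\<lambda>n. lpm M k (f n)) \<longlonglongrightarrow> 0"
proof (rule tendsto_zero_ennreal)
  fix e :: real assume e: "0 < e"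
  \<comment> \<open>Small enough that the uniformly bounded higher power integral contributes less
    than e / 2.\<close>
  define c where "c = e / (2 * (B + 1))"
  have c: "0 < c" "c * B < e / 2" using e B by (auto simp: c_def field_simps)
  obtain C where C: "0 \<le> C" "\<And>t. 0 \<le> t ==> t powr k \<le> c * t powr s + C * t"
    using powr_interpolation[OF k c(1)] by blast
  have *: "lpm M k (f n) \<le> ennreal (c * B) + ennreal C * lpm M 1 (f n)" for n
  proof -
    have "lpm M k (f n) \<le> (\<integral>\<^sup>+x. ennreal c * ennreal (norm (f n x) powr s) + ennreal C * ennreal (norm (f n x) powr 1) \<partial>M)"
      unfolding lpm_def using C c
      by (intro nn_integral_mono) (simp add: ennreal_mult[symmetric] ennreal_plus[symmetric] del: ennreal_plus)
    also have "... = ennreal c * lpm M s (f n) + ennreal C * lpm M 1 (f n)"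
      unfolding lpm_def by (simp add: nn_integral_add nn_integral_cmult)
    also have "ennreal c * lpm M s (f n) \<le> ennreal (c * B)"
      using mult_left_mono[OF bnd[of n], of "ennreal c"] c(1) B by (simp add: ennreal_mult)
    finally show ?thesis by (simp add: add_right_mono)
  qed
  have "(\<lambda>n. ennreal (c * B) + ennreal C * lpm M 1 (f n)) \<longlonglongrightarrow> ennreal (c * B) + ennreal C * 0"
    using lim by (intro tendsto_add tendsto_const ennreal_tendsto_cmult) auto
  moreover have "ennreal (c * B) + ennreal C * 0 < ennreal e"
    using c e by (simp add: ennreal_lessI)
  ultimately have "\<forall>\<^sub>F n in sequentially. ennreal (c * B) + ennreal C * lpm M 1 (f n) < ennreal e"
    by (rule order_tendstoD(2))
  then show "\<forall>\<^sub>F n in sequentially. lpm M k (f n) < ennreal e"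
    by eventually_elim (rule order.strict_trans1[OF *])
qed

text \<open>Dominated convergence with a majorant that may vary by a term of vanishing integral. It
  is the form suited to Nemytskii-type integrands, where the growth of the n-th function is split
  into that of the limit and that of the difference.\<close>

lemma integral_tendsto_dominated_perturbation:
  fixes f :: "nat => 'a => real"
  assumes [measurable]: "\<And>n. f n \<in> borel_measurable M" "g \<in> borel_measurable M"
    and G: "integrable M G" and e: "\<And>n. integrable M (e n)" "\<And>n x. 0 \<le> e n x" "(\<lambda>n. LINT x|M. e n x) \<longlonglongrightarrow> 0"
    and lim: "AE x in M. (\<lambda>n. f n x) \<longlonglongrightarrow> g x"
    and bnd: "\<And>n. AE x in M. \<bar>f n x\<bar> \<le> G x + e n x" "AE x in M. \<bar>g x\<bar> \<le> G x"
  shows "(\<lambda>n. LINT x|M. f n x) \<longlonglongrightarrow> (LINT x|M. g x)"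
proof -
  have [measurable]: "G \<in> borel_measurable M" using G by simp
  \<comment> \<open>Truncation to the fixed majorant: the truncated functions fall under ordinary
    dominated convergence, and what is cut off is at most \<open>e n\<close>.\<close>
  define c where "c n x = max (- G x) (min (G x) (f n x))" for n x
  have G0: "AE x in M. 0 \<le> G x" using bnd(2) by eventually_elim auto
  have cb: "AE x in M. norm (c n x) \<le> G x" for n
    using G0 by eventually_elim (auto simp: c_def)
  have [measurable]: "c n \<in> borel_measurable M" for n unfolding c_def by measurable
  have fi: "integrable M (f n)" for n
  proof (rule Bochner_Integration.integrable_bound)
    show "integrable M (\<lambda>x. G x + e n x)" using G e by auto
    show "AE x in M. norm (f n x) \<le> norm (G x + e n x)" using bnd(1)[of n] by eventually_elim auto
  qed measurable
  have ci: "integrable M (c n)" for n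
    using cb[of n] by (intro Bochner_Integration.integrable_bound[OF G]) (auto elim!: eventually_mono)
  have c: "(\<lambda>n. LINT x|M. c n x) \<longlonglongrightarrow> (LINT x|M. g x)"
  proof (rule integral_dominated_convergence[OF _ _ G])
    show "AE x in M. (\<lambda>n. c n x) \<longlonglongrightarrow> g x"
      using lim bnd(2)
    proof eventually_elim
      case (elim x)
      then have "g x = max (- G x) (min (G x) (g x))" by auto
      moreover have "(\<lambda>n. c n x) \<longlonglongrightarrow> max (- G x) (min (G x) (g x))"
        unfolding c_def by (intro tendsto_max tendsto_min tendsto_const elim)
      ultimately show ?case by simp
    qed
  qed (use cb in auto)
  have "(\<lambda>n. (LINT x|M. f n x) - (LINT x|M. c n x)) \<longlonglongrightarrow> 0"
  proof (rule Lim_null_comparison[OF _ e(3)])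
    show "\<forall>\<^sub>F n in sequentially. norm ((LINT x|M. f n x) - (LINT x|M. c n x)) \<le> (LINT x|M. e n x)"
    proof (intro always_eventually allI)
      fix n
      have "norm ((LINT x|M. f n x) - (LINT x|M. c n x)) = norm (LINT x|M. f n x - c n x)"
        using fi ci by simp
      also have "... \<le> (LINT x|M. norm (f n x - c n x))" by (rule integral_norm_bound)
      also have "... \<le> (LINT x|M. e n x)"
      proof (rule integral_mono_AE)
        show "AE x in M. norm (f n x - c n x) \<le> e n x"
          using bnd(1)[of n] G0
        proof eventually_elim
          case (elim x)
          then show ?case using e(2)[of n x] by (auto simp: c_def max_def min_def abs_le_iff)
        qed
      qed (use fi ci e in auto)
      finally show "norm ((LINT x|M. f n x) - (LINT x|M. c n x)) \<le> (LINT x|M. e n x)" .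
    qed
  qed
  from tendsto_add[OF this c] show ?thesis by simp
qed

section \<open>Rellich compactness\<close>

lemma nn_integral_lebesgue_on_zero_outside:
  fixes g :: "'a::euclidean_space => ennreal"
  assumes "open \<Omega>" "g \<in> borel_measurable borel" "\<And>x. x \<notin> \<Omega> ==> g x = 0"
  shows "(\<integral>\<^sup>+x. g x \<partial>lebesgue_on \<Omega>) = (\<integral>\<^sup>+x. g x \<partial>lborel)"
proof -
  have "\<Omega> \<in> sets lebesgue" using assms(1) by simp
  then have "(\<integral>\<^sup>+x. g x \<partial>lebesgue_on \<Omega>) = (\<integral>\<^sup>+x. g x * indicator \<Omega> x \<partial>lebesgue)"
    by (intro nn_integral_restrict_space) auto
  also have "(\<lambda>x. g x * indicator \<Omega> x) = g" using assms(3) by (auto simp: fun_eq_iff indicator_def)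
  finally show ?thesis by (simp add: nn_integral_completion)
qed

lemma lint_lebesgue_on_zero_outside:
  fixes g :: "'a::euclidean_space => 'b::euclidean_space"
  assumes "open \<Omega>" "g \<in> borel_measurable borel" "\<And>x. x \<notin> \<Omega> ==> g x = 0"
  shows "(LINT x|lebesgue_on \<Omega>. g x) = (LINT x|lborel. g x)"
proof -
  have "\<Omega> \<in> sets lebesgue" using assms(1) by simp
  then have "(LINT x|lebesgue_on \<Omega>. g x) = (LINT x|lebesgue. indicator \<Omega> x *\<^sub>R g x)"
    by (intro integral_restrict_space) auto
  also have "(\<lambda>x. indicator \<Omega> x *\<^sub>R g x) = g" using assms(3) by (auto simp: fun_eq_iff indicator_def)
  finally show ?thesis using assms(2) by (simp add: integral_completion)
qed

lemma nabla_zero_outside_domain: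
  "g \<in> test_functions \<Omega> ==> x \<notin> \<Omega> ==> nabla k g x = 0"
  by (metis nabla_zero_outside subsetD)

lemma test_function_zero_outside_domain: "g \<in> test_functions \<Omega> ==> x \<notin> \<Omega> ==> g x = 0"
  by (metis test_functionsE subsetD)

lemma lpm_nabla:
  assumes "open \<Omega>" "g \<in> test_functions \<Omega>"
  shows "lpm (lebesgue_on \<Omega>) \<sigma> (nabla k g) = (\<integral>\<^sup>+x. ennreal (norm (nabla k g x) powr \<sigma>) \<partial>lborel)"
  unfolding lpm_def using assms nabla_measurable[OF assms(2)]
  by (intro nn_integral_lebesgue_on_zero_outside) (auto simp: nabla_zero_outside_domain)

lemma lpm_test_function:
  assumes "open \<Omega>" "g \<in> test_functions \<Omega>"
  shows "lpm (lebesgue_on \<Omega>) k g = (\<integral>\<^sup>+x. ennreal (norm (g x) powr k) \<partial>lborel)"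
proof -
  have [measurable]: "g \<in> borel_measurable borel"
    using assms(2) by (intro measurable_smooth test_functions_smooth)
  show ?thesis
    unfolding lpm_def using assms
    by (intro nn_integral_lebesgue_on_zero_outside) (auto simp: test_function_zero_outside_domain)
qed

lemma rkernel_integral_le:
  assumes "2 \<le> DIM('a::euclidean_space)"
  obtains C where "0 \<le> C" "\<And>e. 0 < e ==> (\<integral>\<^sup>+z. ennreal (rkernel e (z::'a)) \<partial>lborel) \<le> ennreal (C * e)"
proof -
  obtain C where C: "0 \<le> C" "\<And>e. 0 < e ==> (\<integral>\<^sup>+z. ennreal (indicator (ball (0::'a) e) z * norm z powr (- (real DIM('a) - 1))) \<partial>lborel) \<le> ennreal (C * e powr (real DIM('a) - (real DIM('a) - 1)))"
    using nn_integral_norm_powr_ball[where 'a='a and \<beta>="real DIM('a) - 1"] assms by auto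
  have "rkernel e z = indicator (ball 0 e) z * norm z powr (- (real DIM('a) - 1))" for e and z :: 'a
    by (simp add: rkernel_def indicator_def)
  with C show ?thesis using that by auto
qed

text \<open>By the kernel identity an average at a fixed radius is a convolution of the next
  gradient with a bounded Lipschitz kernel, so an \<open>L^1\<close> bound on that gradient yields
  uniform bounds and equicontinuity.\<close>

lemma nabla_average_bounds:
  fixes \<Omega> :: "'a::euclidean_space set"
  assumes g: "g \<in> test_functions \<Omega>" and eps: "0 < e"
    and B: "(\<integral>\<^sup>+x. ennreal (norm (nabla (Suc k) g x)) \<partial>lborel) \<le> ennreal B" "0 \<le> B"
  defines "A \<equiv> \<lambda>x. (real DIM('a) / e ^ DIM('a)) *\<^sub>R (LINT y|lborel. indicator (ball x e) y *\<^sub>R nabla k g y)"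
  shows "norm (A x) \<le> e / e ^ DIM('a) * B"
    and "norm (A x - A x') \<le> (1 + real DIM('a)) / e ^ DIM('a) * norm (x - x') * B"
proof -
  let ?G = "nabla (Suc k) g"
  have i: "integrable lborel (\<lambda>y. nablamult (tkernel e (x - y)) (?G y))" for x
    using tkernel_nabla_integrable[OF g eps] .
  have A: "A x = (LINT y|lborel. nablamult (tkernel e (x - y)) (?G y))" for x
    unfolding A_def tkernel_nabla[OF g eps] ..
  have G: "integrable lborel (\<lambda>y. norm (?G y))" by (intro integrable_norm nabla_integrable[OF g])
  have GB: "(LINT y|lborel. norm (?G y)) \<le> B"
  proof -
    have "ennreal (LINT y|lborel. norm (?G y)) \<le> ennreal B"
      using B(1) nn_integral_eq_integral[OF G] by simp
    then show ?thesis using B(2) by simp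
  qed
  have est: "norm (LINT y|lborel. F y) \<le> c * B"
    if F: "integrable lborel F" "\<And>y. norm (F y) \<le> c * norm (?G y)" and c: "0 \<le> c" for F :: "'a => real \<times> 'a" and c
  proof -
    have "norm (LINT y|lborel. F y) \<le> (LINT y|lborel. norm (F y))" by (rule integral_norm_bound)
    also have "... \<le> (LINT y|lborel. c * norm (?G y))"
      using F G by (intro integral_mono) auto
    also have "... = c * (LINT y|lborel. norm (?G y))" by simp
    also have "... \<le> c * B" using GB c by (rule mult_left_mono)
    finally show ?thesis .
  qed
  show "norm (A x) \<le> e / e ^ DIM('a) * B"
    unfolding A using eps
    by (intro est i order_trans[OF norm_nablamult_le] mult_right_mono norm_tkernel_le_const) auto
  have "A x - A x' = (LINT y|lborel. nablamult (tkernel e (x - y) - tkernel e (x' - y)) (?G y))"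
    unfolding A using i by (simp add: nablamult_diff)
  also have "norm ... \<le> ((1 + real DIM('a)) / e ^ DIM('a) * norm (x - x')) * B"
  proof (intro est order_trans[OF norm_nablamult_le] mult_right_mono)
    show "integrable lborel (\<lambda>y. nablamult (tkernel e (x - y) - tkernel e (x' - y)) (?G y))"
      using i by (simp add: nablamult_diff)
    show "norm (tkernel e (x - y) - tkernel e (x' - y)) \<le> (1 + real DIM('a)) / e ^ DIM('a) * norm (x - x')" for y
      using tkernel_lipschitz[OF eps, of "x - y" "x' - y"] by simp
  qed (use eps in auto)
  finally show "norm (A x - A x') \<le> (1 + real DIM('a)) / e ^ DIM('a) * norm (x - x') * B" .
qed

lemma test_function_average_distance:
  fixes \<Omega> :: "'a::euclidean_space set"
  assumes g: "g \<in> test_functions \<Omega>" and eps: "0 < e"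
    and B: "(\<integral>\<^sup>+x. ennreal (norm (nabla (Suc k) g x)) \<partial>lborel) \<le> ennreal B" "0 \<le> B"
    and K: "(\<integral>\<^sup>+z. ennreal (rkernel e (z::'a)) \<partial>lborel) \<le> ennreal K" "0 \<le> K"
  shows "(\<integral>\<^sup>+x. (\<integral>\<^sup>+y. ennreal (rkernel e (x - y) * norm (nabla (Suc k) g y)) \<partial>lborel) \<partial>lborel) \<le> ennreal (K * B)"
proof -
  note nabla_measurable[OF g, measurable]
  have "(\<integral>\<^sup>+x. (\<integral>\<^sup>+y. ennreal (rkernel e (x - y) * norm (nabla (Suc k) g y)) \<partial>lborel) \<partial>lborel) =
    (\<integral>\<^sup>+x. (\<integral>\<^sup>+y. ennreal (rkernel e (x - y)) * ennreal (norm (nabla (Suc k) g y)) \<partial>lborel) \<partial>lborel)"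
    by (simp add: ennreal_mult rkernel_nonneg)
  also have "... = (\<integral>\<^sup>+z. ennreal (rkernel e (z::'a)) \<partial>lborel) * (\<integral>\<^sup>+x. ennreal (norm (nabla (Suc k) g x)) \<partial>lborel)"
    by (rule nn_integral_convolution) measurable
  also have "... \<le> ennreal K * ennreal B" using K B by (intro mult_mono) auto
  finally show ?thesis using K B by (simp add: ennreal_mult)
qed

text \<open>At each fixed radius the averages are precompact in the uniform norm by Arzela-Ascoli; a
  diagonal subsequence handles all radii. Since functions differ from their averages by a multiple
  of the radius in \<open>L^1\<close>, the functions themselves form a Cauchy sequence.\<close>

lemma rellich_L1:
  fixes \<Omega> :: "'a::euclidean_space set"
  assumes \<Omega>: "open \<Omega>" "bounded \<Omega>" and N: "2 \<le> DIM('a)"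
    and f: "\<And>n. f n \<in> test_functions \<Omega>"
    and B: "\<And>n. (\<integral>\<^sup>+x. ennreal (norm (nabla 1 (f n) x)) \<partial>lborel) \<le> ennreal B" "0 \<le> B"
  obtains r where "strict_mono (r :: nat => nat)"
    "\<And>e. 0 < e ==> \<exists>N. \<forall>n\<ge>N. \<forall>k\<ge>N. lpm (lebesgue_on \<Omega>) 1 (\<lambda>x. f (r n) x - f (r k) x) \<le> ennreal e"
proof -
  define A where "A l n x = (real DIM('a) / (1 / real (Suc l)) ^ DIM('a)) *\<^sub>R (LINT y|lborel. indicator (ball x (1 / real (Suc l))) y *\<^sub>R nabla 0 (f n) y)" for l n x
  \<comment> \<open>The averages at the l-th radius are uniformly Cauchy along the subsequence
    \<open>s\<close>.\<close>
  define P where "P l s \<longleftrightarrow> (\<forall>e>0. \<exists>N. \<forall>n\<ge>N. \<forall>k\<ge>N. \<forall>x\<in>\<Omega>. norm (A l (s n) x - A l (s k) x) < e)" for l and s :: "nat => nat"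
  have eps: "0 < 1 / real (Suc l)" for l by simp
  have B': "(\<integral>\<^sup>+x. ennreal (norm (nabla (Suc 0) (f n) x)) \<partial>lborel) \<le> ennreal B" for n using B(1) by simp
  have ex: "\<exists>r'. strict_mono r' \<and> P l (s \<circ> r')" if "strict_mono s" for l and s :: "nat => nat"
  proof -
    define L where "L = (1 + real DIM('a)) / (1 / real (Suc l)) ^ DIM('a) * B"
    have L0: "0 \<le> L" using B by (simp add: L_def)
    have lip: "norm (A l n x - A l n y) \<le> L * norm (x - y)" for n x y
      using nabla_average_bounds(2)[OF f[of n] eps[of l] B'[of n] B(2), of x y] unfolding A_def L_def by (simp only: mult_ac)
    have cpt: "compact (closure \<Omega>)" using \<Omega>(2) by (simp add: compact_closure)
    obtain g k where gk: "continuous_on (closure \<Omega>) g" "strict_mono (k :: nat => nat)"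
      "\<And>e. 0 < e ==> \<exists>N. \<forall>n x. N \<le> n \<and> x \<in> closure \<Omega> \<longrightarrow> norm (A l (s (k n)) x - g x) < e"
    proof (rule Arzela_Ascoli[OF cpt, of "\<lambda>n. A l (s n)"])
      show "norm (A l (s n) x) \<le> (1 / real (Suc l)) / (1 / real (Suc l)) ^ DIM('a) * B" for n x
        using nabla_average_bounds(1)[OF f[of "s n"] eps[of l] B'[of "s n"] B(2), of x] unfolding A_def .
      show "\<exists>d>0. \<forall>n y. y \<in> closure \<Omega> \<and> norm (x - y) < d \<longrightarrow> norm (A l (s n) x - A l (s n) y) < e" if "0 < e" for x e
      proof (intro exI[of _ "e / (L + 1)"] conjI allI impI)
        show "0 < e / (L + 1)" using that L0 by simp
        fix n y assume "y \<in> closure \<Omega> \<and> norm (x - y) < e / (L + 1)"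
        then have "(L + 1) * norm (x - y) < e" using L0 by (simp add: field_simps)
        moreover have "L * norm (x - y) \<le> (L + 1) * norm (x - y)" by (intro mult_right_mono) auto
        ultimately show "norm (A l (s n) x - A l (s n) y) < e" using lip[of "s n" x y] by linarith
      qed
    qed blast
    have "P l (s \<circ> k)"
      unfolding P_def
    proof (intro allI impI)
      fix e :: real assume "0 < e"
      then obtain N where N: "\<And>n x. N \<le> n ==> x \<in> closure \<Omega> ==> norm (A l (s (k n)) x - g x) < e / 2"
        using gk(3)[of "e / 2"] by auto
      have "norm (A l (s (k n)) x - A l (s (k j)) x) < e" if "N \<le> n" "N \<le> j" "x \<in> \<Omega>" for n j x
      proof -
        have x: "x \<in> closure \<Omega>" using that closure_subset by blast
        have "norm (A l (s (k n)) x - A l (s (k j)) x) \<le> norm (A l (s (k n)) x - g x) + norm (A l (s (k j)) x - g x)"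
          using norm_triangle_ineq4[of "A l (s (k n)) x - g x" "A l (s (k j)) x - g x"] by simp
        then show ?thesis using N[OF that(1) x] N[OF that(2) x] by linarith
      qed
      then show "\<exists>N. \<forall>n\<ge>N. \<forall>j\<ge>N. \<forall>x\<in>\<Omega>. norm (A l ((s \<circ> k) n) x - A l ((s \<circ> k) j) x) < e"
        by (intro exI[of _ N]) auto
    qed
    with gk(2) show ?thesis by blast
  qed
  interpret subseqs P by unfold_locales (rule ex)
  have stable: "P l (s \<circ> r)" if "strict_mono r" "P l s" for r s l
    using that(2) unfolding P_def o_def by (meson le_trans seq_suble[OF that(1)])
  have Pd: "P l diagseq" for l
  proof -
    \<comment> \<open>The diagonal sequence is a subsequence of the l-th one only after finitely
      many terms are dropped; the Cauchy property does not see them.\<close>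
    have "P l (diagseq \<circ> ((+) (Suc l)))" using stable by (rule diagseq_holds)
    show ?thesis
    proof (rule iffD2[OF P_def], intro allI impI)
      fix e :: real assume "0 < e"
      then obtain N where *: "\<forall>n\<ge>N. \<forall>k\<ge>N. \<forall>x\<in>\<Omega>. norm (A l ((diagseq \<circ> (+) (Suc l)) n) x - A l ((diagseq \<circ> (+) (Suc l)) k) x) < e"
        using iffD1[OF P_def \<open>P l (diagseq \<circ> ((+) (Suc l)))\<close>] by blast
      have "norm (A l (diagseq n) x - A l (diagseq k) x) < e" if "N + Suc l \<le> n" "N + Suc l \<le> k" "x \<in> \<Omega>" for n k x
        using *[rule_format, of "n - Suc l" "k - Suc l" x] that by (simp add: o_def)
      then show "\<exists>N. \<forall>n\<ge>N. \<forall>k\<ge>N. \<forall>x\<in>\<Omega>. norm (A l (diagseq n) x - A l (diagseq k) x) < e" by blast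
    qed
  qed
  obtain C where C: "0 \<le> C" "\<And>\<epsilon>. 0 < \<epsilon> ==> (\<integral>\<^sup>+z. ennreal (rkernel \<epsilon> (z::'a)) \<partial>lborel) \<le> ennreal (C * \<epsilon>)"
    using rkernel_integral_le[OF N] by blast
  have "emeasure lborel \<Omega> < \<infinity>" using emeasure_bounded_finite[OF \<Omega>(2)] by simp
  then obtain V where V: "0 \<le> V" "emeasure lborel \<Omega> = ennreal V"
    by (cases "emeasure lborel \<Omega>") auto
  define c where "c = real DIM('a) * unit_ball_vol (real DIM('a))"
  have c: "0 < c" by (simp add: c_def)
  have main: "\<exists>N. \<forall>n\<ge>N. \<forall>k\<ge>N. lpm (lebesgue_on \<Omega>) 1 (\<lambda>x. f (diagseq n) x - f (diagseq k) x) \<le> ennreal e" if e: "0 < e" for e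
  proof -
    \<comment> \<open>With a radius below e / (2D) the two distances between functions and averages
      together cost at most half of the budget c * e.\<close>
    define D where "D = 2 * (C * B) / c + 1"
    have D: "0 < D" using C B c by (simp add: D_def add_nonneg_pos)
    obtain l where l: "1 / real (Suc l) < e / (2 * D)"
      using reals_Archimedean[of "e / (2 * D)"] D e by (auto simp: inverse_eq_divide)
    let ?\<epsilon> = "1 / real (Suc l)"
    define I where "I n x = (\<integral>\<^sup>+y. ennreal (rkernel ?\<epsilon> (x - y) * norm (nabla (Suc 0) (f n) y)) \<partial>lborel)" for n x
    note nabla_measurable[OF f, measurable]
    have [measurable]: "I n \<in> borel_measurable borel" for n unfolding I_def by measurable
    have I: "(\<integral>\<^sup>+x. I n x \<partial>lborel) \<le> ennreal (C * ?\<epsilon> * B)" for n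
      unfolding I_def using C by (intro test_function_average_distance[OF f eps B' B(2)] C) auto
    \<comment> \<open>The uniform distance of the averages, integrated over \<Omega> of volume
      \<open>V\<close>, takes the other half of the budget.\<close>
    define d where "d = c * e / (2 * (V + 1))"
    have d: "0 < d" "d * V \<le> c * e / 2" 
    proof -
      show "0 < d" using c e V by (simp add: d_def)
      have "c * e * V \<le> c * e * (V + 1)" using c e by (intro mult_left_mono) auto
      then show "d * V \<le> c * e / 2" using V by (simp add: d_def field_simps)
    qed
    obtain N where N: "\<And>n k x. N \<le> n ==> N \<le> k ==> x \<in> \<Omega> ==> norm (A l (diagseq n) x - A l (diagseq k) x) < d"
      using iffD1[OF P_def Pd[of l]] d(1) by blast
    have "lpm (lebesgue_on \<Omega>) 1 (\<lambda>x. f (diagseq n) x - f (diagseq k) x) \<le> ennreal e" if nk: "N \<le> n" "N \<le> k" for n k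
    proof -
      let ?u = "f (diagseq n)" and ?v = "f (diagseq k)"
      have [measurable]: "?u \<in> borel_measurable borel" "?v \<in> borel_measurable borel"
        using f by (auto intro!: measurable_smooth test_functions_smooth)
      \<comment> \<open>The triangle inequality through the two averages, with the common factor
        \<open>c\<close> from the normalization of the kernel.\<close>
      have pw: "ennreal (c * \<bar>?u x - ?v x\<bar>) \<le> I (diagseq n) x + I (diagseq k) x + ennreal d * indicator \<Omega> x" for x
      proof (cases "x \<in> \<Omega>")
        case True
        have 1: "ennreal (norm (A l j x - c *\<^sub>R nabla 0 (f j) x)) \<le> I j x" for j
          unfolding A_def I_def c_def by (rule nabla_average_diff_le[OF f eps])
        have "c * \<bar>?u x - ?v x\<bar> = norm (c *\<^sub>R nabla 0 ?u x - c *\<^sub>R nabla 0 ?v x)"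
          using c by (simp add: nabla_0 norm_Pair abs_mult right_diff_distrib[symmetric] scaleR_diff_right[symmetric] del: scaleR_diff_right)
        also have "... \<le> norm (A l (diagseq n) x - c *\<^sub>R nabla 0 ?u x) + norm (A l (diagseq k) x - c *\<^sub>R nabla 0 ?v x) + norm (A l (diagseq n) x - A l (diagseq k) x)"
        proof -
          have eq: "c *\<^sub>R nabla 0 ?u x - c *\<^sub>R nabla 0 ?v x = (A l (diagseq k) x - c *\<^sub>R nabla 0 ?v x) - (A l (diagseq n) x - c *\<^sub>R nabla 0 ?u x) + (A l (diagseq n) x - A l (diagseq k) x)" by simp
          have tri: "norm (a - b + d) \<le> norm b + norm a + norm d" for a b d :: "real \<times> 'a"
            using norm_triangle_ineq[of "a - b" d] norm_triangle_ineq4[of a b] by linarith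
          show ?thesis unfolding eq by (rule tri)
        qed
        finally have "ennreal (c * \<bar>?u x - ?v x\<bar>) \<le> ennreal (norm (A l (diagseq n) x - c *\<^sub>R nabla 0 ?u x)) + ennreal (norm (A l (diagseq k) x - c *\<^sub>R nabla 0 ?v x)) + ennreal (norm (A l (diagseq n) x - A l (diagseq k) x))"
          by (simp add: ennreal_plus[symmetric] ennreal_leI del: ennreal_plus)
        also have "... \<le> I (diagseq n) x + I (diagseq k) x + ennreal d"
          using N[OF nk True] by (intro add_mono 1 ennreal_leI) auto
        finally show ?thesis using True by simp
      qed (simp add: test_function_zero_outside_domain[OF f])
      have "ennreal c * lpm (lebesgue_on \<Omega>) 1 (\<lambda>x. ?u x - ?v x) = (\<integral>\<^sup>+x. ennreal (c * \<bar>?u x - ?v x\<bar>) \<partial>lborel)"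
        using c lpm_test_function[OF \<Omega>(1) test_functions_diff[OF f f], of 1 "diagseq n" "diagseq k"]
        by (simp add: ennreal_mult nn_integral_cmult)
      also have "... \<le> (\<integral>\<^sup>+x. I (diagseq n) x + I (diagseq k) x + ennreal d * indicator \<Omega> x \<partial>lborel)"
        by (intro nn_integral_mono pw)
      also have "... = (\<integral>\<^sup>+x. I (diagseq n) x \<partial>lborel) + (\<integral>\<^sup>+x. I (diagseq k) x \<partial>lborel) + ennreal d * ennreal V"
        using \<Omega>(1) V by (simp add: nn_integral_add nn_integral_cmult)
      also have "... \<le> ennreal (C * ?\<epsilon> * B) + ennreal (C * ?\<epsilon> * B) + ennreal d * ennreal V"
        by (intro add_mono I order_refl)
      also have "... = ennreal (C * ?\<epsilon> * B + C * ?\<epsilon> * B + d * V)"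
        using C B d V by (simp add: ennreal_mult[symmetric] ennreal_plus[symmetric] del: ennreal_plus)
      also have "... \<le> ennreal (c * e)"
      proof (rule ennreal_leI)
        have "2 * (C * B) \<le> c * D" using c by (simp add: D_def field_simps)
        then have "?\<epsilon> * (2 * (C * B)) \<le> ?\<epsilon> * (c * D)" by (intro mult_left_mono) auto
        also have "... \<le> e / (2 * D) * (c * D)" using l c D by (intro mult_right_mono) auto
        also have "... = c * e / 2" using D by simp
        finally have "?\<epsilon> * (2 * (C * B)) \<le> c * e / 2" .
        moreover have "C * ?\<epsilon> * B + C * ?\<epsilon> * B = ?\<epsilon> * (2 * (C * B))" by algebra
        ultimately show "C * ?\<epsilon> * B + C * ?\<epsilon> * B + d * V \<le> c * e" using d(2) by linarith
      qed
      also have "... = ennreal c * ennreal e" using c e by (simp add: ennreal_mult)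
      finally show ?thesis using c by (subst (asm) ennreal_mult_le_mult_iff) auto
    qed
    then show ?thesis by blast
  qed
  show ?thesis by (rule that[OF subseq_diagseq main])
qed

text \<open>The one-variable counterpart of \<open>Ck\<close>, with the derivative as a witness;
  smooth functions of several variables are built as products of functions of one
  coordinate.\<close>

primrec CkR :: "nat => (real => real) => bool" where
  "CkR 0 f \<longleftrightarrow> continuous_on UNIV f"
| "CkR (Suc k) f \<longleftrightarrow> (\<exists>f'. (\<forall>t. (f has_real_derivative f' t) (at t)) \<and> CkR k f')"

section \<open>Bump functions and the fundamental lemma\<close>

lemma CkR_Suc_imp: "CkR (Suc k) f ==> CkR k f"
proof (induction k arbitrary: f)
  case 0
  then obtain f' where "\<forall>t. (f has_real_derivative f' t) (at t)" by auto
  then have "continuous_on UNIV f" by (intro DERIV_continuous_on[of UNIV f f']) auto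
  then show ?case by simp
next
  case (Suc k)
  then show ?case by (metis CkR.simps(2))
qed

lemma CkR_add: "CkR k f ==> CkR k g ==> CkR k (\<lambda>t. f t + g t)"
proof (induction k arbitrary: f g)
  case 0
  then show ?case by (auto intro: continuous_on_add)
next
  case (Suc k)
  then obtain f' g' where "\<forall>t. (f has_real_derivative f' t) (at t)" "CkR k f'"
    "\<forall>t. (g has_real_derivative g' t) (at t)" "CkR k g'" by auto
  then show ?case using Suc.IH by (auto intro!: exI[of _ "\<lambda>t. f' t + g' t"] DERIV_add)
qed

lemma CkR_mult: "CkR k f ==> CkR k g ==> CkR k (\<lambda>t. f t * g t)"
proof (induction k arbitrary: f g)
  case 0
  then show ?case by (auto intro: continuous_on_mult)
next
  case (Suc k)
  then obtain f' g' where *: "\<forall>t. (f has_real_derivative f' t) (at t)" "CkR k f'"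
    "\<forall>t. (g has_real_derivative g' t) (at t)" "CkR k g'" by auto
  have "CkR k (\<lambda>t. f' t * g t + g' t * f t)"
    by (intro CkR_add Suc.IH *(2) *(4) CkR_Suc_imp[OF Suc.prems(1)] CkR_Suc_imp[OF Suc.prems(2)])
  then show ?case using * DERIV_mult
    unfolding CkR.simps by (intro exI[of _ "\<lambda>t. f' t * g t + g' t * f t"] conjI allI) blast+
qed

lemma CkR_const: "CkR k (\<lambda>t. c)"
proof (induction k arbitrary: c)
  case (Suc k)
  then show ?case by (auto intro!: exI[of _ "\<lambda>t. 0"])
qed simp

lemma CkR_affine: "CkR k f ==> CkR k (\<lambda>t. f (c * t + d))"
proof (induction k arbitrary: f)
  case 0
  then show ?case by (auto intro!: continuous_on_compose2[of UNIV f] continuous_intros)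
next
  case (Suc k)
  then obtain f' where *: "\<forall>t. (f has_real_derivative f' t) (at t)" "CkR k f'" by auto
  have "((\<lambda>t. f (c * t + d)) has_real_derivative f' (c * t + d) * c) (at t)" for t
  proof (rule DERIV_chain2[of f])
    show "(f has_real_derivative f' (c * t + d)) (at (c * t + d))" using * by blast
    show "((\<lambda>t. c * t + d) has_real_derivative c) (at t)" by (auto intro!: derivative_eq_intros)
  qed
  moreover have "CkR k (\<lambda>t. f' (c * t + d) * c)" using Suc.IH[OF *(2)] CkR_const by (rule CkR_mult)
  ultimately show ?case
    unfolding CkR.simps by (intro exI[of _ "\<lambda>t. f' (c * t + d) * c"] conjI allI)
qed

text \<open>The flat function exp(-1/t) with a polynomial factor in 1/t. The factor makes the family
  closed under differentiation, so that smoothness follows by induction on the order.\<close>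

definition expinv :: "real poly => real => real" where
  "expinv P t = (if 0 < t then poly P (1 / t) * exp (- (1 / t)) else 0)"

lemma poly_div_exp_tendsto_0: "((\<lambda>y. poly P y * exp (- y)) \<longlongrightarrow> (0::real)) at_top"
proof -
  have "((\<lambda>y. \<Sum>i\<le>degree P. coeff P i * (y ^ i / exp y)) \<longlongrightarrow> (\<Sum>i\<le>degree P. coeff P i * 0)) at_top"
    by (intro tendsto_sum tendsto_mult tendsto_const tendsto_power_div_exp_0)
  then show ?thesis
    by (simp add: poly_altdef exp_minus sum_distrib_right divide_inverse mult.assoc)
qed

lemma expinv_tendsto_0: "((\<lambda>t. poly P (1 / t) * exp (- (1 / t))) \<longlongrightarrow> (0::real)) (at_right 0)"
  using filterlim_compose[OF poly_div_exp_tendsto_0 filterlim_inverse_at_top_right]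
  by (simp add: inverse_eq_divide)

text \<open>With y = 1/t the derivative in \<open>t\<close> is -y^2 times the derivative in
  \<open>y\<close>, and the latter maps P exp(-y) to (P' - P) exp(-y). The polynomial
  \<open>[:0, 0, 1:]\<close> is y^2.\<close>

lemma has_derivative_expinv:
  "(expinv P has_real_derivative expinv ([:0, 0, 1:] * (P - pderiv P)) t) (at t)"
proof -
  let ?Q = "[:0, 0, 1:] * (P - pderiv P)"
  consider "0 < t" | "t < 0" | "t = 0" by linarith
  then show ?thesis
  proof cases
    case 1
    have "((\<lambda>t. poly P (1 / t) * exp (- (1 / t))) has_real_derivative expinv ?Q t) (at t)"
      using 1 by (auto intro!: derivative_eq_intros poly_DERIV[THEN DERIV_chain2] simp: expinv_def field_simps power2_eq_square)
    then show ?thesis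
      by (rule has_field_derivative_transform_within_open[of _ _ _ "{0<..}"]) (use 1 in \<open>auto simp: expinv_def\<close>)
  next
    case 2
    have "((\<lambda>t. 0) has_real_derivative expinv ?Q t) (at t)" using 2 by (auto simp: expinv_def)
    then show ?thesis
      by (rule has_field_derivative_transform_within_open[of _ _ _ "{..<0}"]) (use 2 in \<open>auto simp: expinv_def\<close>)
  next
    case 3
    \<comment> \<open>Division by \<open>h\<close> is multiplication by 1/h, so the difference
      quotient at 0 is a function of the same family with one more power in the polynomial.\<close>
    have r: "((\<lambda>h. expinv P h / h) \<longlongrightarrow> 0) (at_right 0)"
    proof (rule Lim_transform_eventually[OF expinv_tendsto_0[of "pCons 0 P"]])
      have "\<forall>\<^sub>F h in at_right 0. 0 < (h::real)" by (auto simp: eventually_at_right_field intro!: exI[of _ 1])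
      then show "\<forall>\<^sub>F h in at_right 0. poly (pCons 0 P) (1 / h) * exp (- (1 / h)) = expinv P h / h"
        by eventually_elim (simp add: expinv_def)
    qed
    have l: "((\<lambda>h. expinv P h / h) \<longlongrightarrow> 0) (at_left 0)"
    proof (rule Lim_transform_eventually[OF tendsto_const])
      have "\<forall>\<^sub>F h in at_left 0. (h::real) < 0" by (auto simp: eventually_at_left_field intro!: exI[of _ "-1"])
      then show "\<forall>\<^sub>F h in at_left 0. 0 = expinv P h / h"
        by eventually_elim (simp add: expinv_def)
    qed
    from r l have "((\<lambda>h. expinv P h / h) \<longlongrightarrow> 0) (at 0)" by (simp add: filterlim_split_at)
    then show ?thesis using 3 by (simp add: has_field_derivative_iff expinv_def)
  qed
qed

lemma CkR_expinv: "CkR k (expinv P)"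
proof (induction k arbitrary: P)
  case 0
  have "continuous_on UNIV (expinv P)"
    using has_derivative_expinv by (intro DERIV_continuous_on) auto
  then show ?case by simp
next
  case (Suc k)
  then show ?case using has_derivative_expinv by auto
qed

text \<open>A partial derivative replaces one factor by its derivative and keeps the product form,
  so the induction must range over arbitrary families of factors.\<close>

lemma Ck_prod:
  "(\<And>i. i \<in> Basis ==> CkR k (F i)) ==> Ck k (\<lambda>x::'a::euclidean_space. \<Prod>i\<in>Basis. F i (x \<bullet> i))"
proof (induction k arbitrary: F)
  case 0
  have "continuous_on UNIV (\<lambda>x::'a. F i (x \<bullet> i))" if "i \<in> Basis" for i
    using 0[OF that] by (auto intro!: continuous_on_compose2[of UNIV "F i"] continuous_intros)
  then show ?case by (auto intro: continuous_on_prod)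
next
  case (Suc k)
  then have "\<forall>i\<in>Basis. \<exists>f'. (\<forall>t. (F i has_real_derivative f' t) (at t)) \<and> CkR k f'" by simp
  then obtain F' where F': "\<And>i t. i \<in> Basis ==> (F i has_real_derivative F' i t) (at t)" "\<And>i. i \<in> Basis ==> CkR k (F' i)"
    by metis
  let ?f = "\<lambda>x::'a. \<Prod>i\<in>Basis. F i (x \<bullet> i)"
  have D: "(?f has_derivative (\<lambda>h. \<Sum>i\<in>Basis. (F' i (x \<bullet> i) * (h \<bullet> i)) * (\<Prod>j\<in>Basis - {i}. F j (x \<bullet> j)))) (at x)" for x
  proof (rule has_derivative_prod)
    fix i :: 'a assume i: "i \<in> Basis"
    have "(F i has_derivative (\<lambda>s. F' i (x \<bullet> i) * s)) (at (x \<bullet> i))"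
      using F'(1)[OF i] by (simp add: has_field_derivative_def)
    then show "((\<lambda>x. F i (x \<bullet> i)) has_derivative (\<lambda>h. F' i (x \<bullet> i) * (h \<bullet> i))) (at x)"
      by (rule has_derivative_compose[rotated]) (auto intro!: derivative_eq_intros)
  qed
  have "pderiv_dir j ?f = (\<lambda>x. \<Prod>i\<in>Basis. (if i = j then F' i else F i) (x \<bullet> i))" if j: "j \<in> Basis" for j
  proof
    fix x
    have "pderiv_dir j ?f x = (\<Sum>i\<in>Basis. (F' i (x \<bullet> i) * (j \<bullet> i)) * (\<Prod>j\<in>Basis - {i}. F j (x \<bullet> j)))"
      by (rule pderiv_dir_eq[OF D])
    also have "... = (\<Sum>i\<in>Basis. if i = j then F' i (x \<bullet> i) * (\<Prod>j\<in>Basis - {i}. F j (x \<bullet> j)) else 0)"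
      using j by (intro sum.cong) (auto simp: inner_Basis)
    also have "... = F' j (x \<bullet> j) * (\<Prod>i\<in>Basis - {j}. F i (x \<bullet> i))" using j by simp
    also have "... = (\<Prod>i\<in>Basis. (if i = j then F' i else F i) (x \<bullet> i))"
      using j by (subst prod.remove[of Basis j]) (auto intro!: prod.cong)
    finally show "pderiv_dir j ?f x = (\<Prod>i\<in>Basis. (if i = j then F' i else F i) (x \<bullet> i))" .
  qed
  moreover have "Ck k (\<lambda>x::'a. \<Prod>i\<in>Basis. (if i = j then F' i else F i) (x \<bullet> i))" for j
    using F'(2) CkR_Suc_imp[OF Suc.prems] by (intro Suc.IH) auto
  ultimately show ?case
    using D by (auto simp: differentiable_on_def differentiable_def)
qed

text \<open>With the constant polynomial, \<open>expinv 1 t\<close> is exp(-1/t) for positive t.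
  Multiplying the distance to each face by \<open>n\<close> makes the factors tend to 1 inside the
  box while the support stays in the closed box.\<close>

definition bump :: "nat => 'a::euclidean_space => 'a => 'a => real" where
  "bump n a b x = (\<Prod>i\<in>Basis. expinv 1 (real n * (x \<bullet> i - a \<bullet> i)) * expinv 1 (real n * (b \<bullet> i - x \<bullet> i)))"

lemma smooth_bump: "smooth (bump n a b)"
  unfolding smooth_def bump_def[abs_def]
proof (intro allI Ck_prod CkR_mult)
  fix k and i :: 'a
  have "(\<lambda>t. expinv 1 (real n * (t - a \<bullet> i))) = (\<lambda>t. expinv 1 (real n * t + (- real n * (a \<bullet> i))))"
    by (simp add: algebra_simps)
  then show "CkR k (\<lambda>t. expinv 1 (real n * (t - a \<bullet> i)))"
    by (simp only: CkR_affine[OF CkR_expinv])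
  have "(\<lambda>t. expinv 1 (real n * (b \<bullet> i - t))) = (\<lambda>t. expinv 1 ((- real n) * t + real n * (b \<bullet> i)))"
    by (simp add: algebra_simps)
  then show "CkR k (\<lambda>t. expinv 1 (real n * (b \<bullet> i - t)))"
    by (simp only: CkR_affine[OF CkR_expinv])
qed

lemma expinv_1_bounds: "0 \<le> expinv 1 t" "expinv 1 t \<le> 1"
  by (auto simp: expinv_def)

lemma bump_bounds: "0 \<le> bump n a b x" "bump n a b x \<le> 1"
  unfolding bump_def
  by (auto intro!: prod_nonneg prod_le_1 mult_nonneg_nonneg mult_le_one simp: expinv_1_bounds)

lemma bump_eq_0: "x \<notin> box a b ==> bump n a b x = 0"
proof -
  assume "x \<notin> box a b"
  then obtain i where i: "i \<in> Basis" "x \<bullet> i \<le> a \<bullet> i \<or> b \<bullet> i \<le> x \<bullet> i"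
    by (auto simp: box_def not_less)
  then have "expinv 1 (real n * (x \<bullet> i - a \<bullet> i)) * expinv 1 (real n * (b \<bullet> i - x \<bullet> i)) = 0"
    by (auto simp: expinv_def zero_less_mult_iff)
  then show ?thesis
    unfolding bump_def using i(1) by (intro prod_zero) auto
qed

lemma bump_test_function: "cbox a b \<subseteq> \<Omega> ==> bump n a b \<in> test_functions \<Omega>"
  by (intro test_functionsI[of _ "cbox a b"] smooth_bump bump_eq_0) (use box_subset_cbox in auto)

lemma bump_tendsto: "(\<lambda>n. bump n a b x) \<longlonglongrightarrow> indicator (box a b) x"
proof (cases "x \<in> box a b")
  case True
  have e: "(\<lambda>n. expinv 1 (real n * c)) \<longlonglongrightarrow> 1" if "0 < c" for c
  proof (rule Lim_transform_eventually)
    have "(\<lambda>n. exp (- (inverse c * (1 / real n)))) \<longlonglongrightarrow> exp (- (inverse c * 0))"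
      by (intro tendsto_intros lim_1_over_n)
    then show "(\<lambda>n. exp (- (inverse c * (1 / real n)))) \<longlonglongrightarrow> 1" by simp
    show "\<forall>\<^sub>F n in sequentially. exp (- (inverse c * (1 / real n))) = expinv 1 (real n * c)"
      using that by (intro eventually_sequentiallyI[of 1]) (auto simp: expinv_def divide_inverse)
  qed
  have "(\<lambda>n. bump n a b x) \<longlonglongrightarrow> (\<Prod>i\<in>(Basis::'a set). 1 * 1)"
    unfolding bump_def using True by (intro tendsto_prod tendsto_mult e) (auto simp: box_def)
  then show ?thesis using True by simp
qed (simp add: bump_eq_0)

section \<open>The fundamental lemma of the calculus of variations\<close>

lemma locally_integrable_mult_test:
  fixes v :: "'a::euclidean_space => 'b::euclidean_space"
  assumes \<Omega>: "open \<Omega>" and v: "locally_integrable \<Omega> v"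
    and g: "g \<in> borel_measurable borel" "\<And>x. \<bar>g x\<bar> \<le> B" and K: "compact K" "K \<subseteq> \<Omega>" "\<And>x. x \<notin> K ==> g x = 0"
  shows "integrable (lebesgue_on \<Omega>) (\<lambda>x. g x *\<^sub>R v x)" "integrable lebesgue (\<lambda>x. g x *\<^sub>R v x)"
proof -
  have iv: "integrable lebesgue (\<lambda>x. indicator K x *\<^sub>R v x)"
    using v K unfolding locally_integrable_def set_integrable_def by blast
  have gm: "g \<in> borel_measurable lebesgue"
    using measurable_completion[of g lborel borel] g(1) by simp
  have eq: "g x *\<^sub>R v x = g x *\<^sub>R (indicator K x *\<^sub>R v x)" for x
    using K(3)[of x] by (auto simp: indicator_def)
  have vm: "(\<lambda>x. indicator K x *\<^sub>R v x) \<in> borel_measurable lebesgue"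
    using borel_measurable_integrable[OF iv] .
  show I: "integrable lebesgue (\<lambda>x. g x *\<^sub>R v x)"
  proof (rule Bochner_Integration.integrable_bound)
    show "integrable lebesgue (\<lambda>x. B * norm (indicator K x *\<^sub>R v x))"
      by (rule integrable_mult_right) (rule integrable_norm[OF iv])
    show "(\<lambda>x. g x *\<^sub>R v x) \<in> borel_measurable lebesgue"
      unfolding eq using gm vm by (rule borel_measurable_scaleR)
    show "AE x in lebesgue. norm (g x *\<^sub>R v x) \<le> norm (B * norm (indicator K x *\<^sub>R v x))"
    proof (intro AE_I2)
      fix x
      have "norm (g x *\<^sub>R v x) = \<bar>g x\<bar> * norm (indicator K x *\<^sub>R v x)" unfolding eq[of x] by (simp add: abs_mult)
      also have "... \<le> B * norm (indicator K x *\<^sub>R v x)" using g(2) by (intro mult_right_mono) auto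
      finally show "norm (g x *\<^sub>R v x) \<le> norm (B * norm (indicator K x *\<^sub>R v x))" by simp
    qed
  qed
  have "(\<lambda>x. indicator \<Omega> x *\<^sub>R (g x *\<^sub>R v x)) = (\<lambda>x. g x *\<^sub>R v x)"
    using K by (auto simp: fun_eq_iff indicator_def)
  with I show "integrable (lebesgue_on \<Omega>) (\<lambda>x. g x *\<^sub>R v x)"
    using \<Omega> by (subst integrable_restrict_space) auto
qed

lemma test_function_mult_integrable:
  fixes v :: "'a::euclidean_space => 'b::euclidean_space"
  assumes \<Omega>: "open \<Omega>" and v: "locally_integrable \<Omega> v" and f: "f \<in> test_functions \<Omega>"
  shows "integrable (lebesgue_on \<Omega>) (\<lambda>x. f x *\<^sub>R v x)"
proof -
  obtain B L R where "0 \<le> B" "0 \<le> L" "\<And>x. \<bar>f x\<bar> \<le> B" "\<And>x y. \<bar>f x - f y\<bar> \<le> L * norm (x - y)" "\<And>x. x \<notin> cball 0 R ==> f x = 0"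
    using test_function_bounds[OF f] by metis
  moreover obtain K where "compact K" "K \<subseteq> \<Omega>" "\<And>x. x \<notin> K ==> f x = 0" using test_functionsE[OF f] by metis
  moreover have "f \<in> borel_measurable borel" using f by (intro measurable_smooth test_functions_smooth)
  ultimately show ?thesis using locally_integrable_mult_test(1)[OF \<Omega> v] by blast
qed

text \<open>The bump functions are bounded by 1 and converge to the indicator of the open box, so
  dominated convergence passes the orthogonality to the limit.\<close>

lemma integral_box_eq_0:
  fixes v :: "'a::euclidean_space => 'b::euclidean_space"
  assumes \<Omega>: "open \<Omega>" and v: "locally_integrable \<Omega> v"
    and 0: "\<And>f. f \<in> test_functions \<Omega> ==> (LINT x|lebesgue_on \<Omega>. f x *\<^sub>R v x) = 0"
    and ab: "cbox a b \<subseteq> \<Omega>"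
  shows "(LINT x|lebesgue. indicator (box a b) x *\<^sub>R v x) = 0"
proof -
  have iv: "integrable lebesgue (\<lambda>x. indicator (cbox a b) x *\<^sub>R v x)"
    using v ab unfolding locally_integrable_def set_integrable_def by (metis compact_cbox)
  have I: "integrable lebesgue (\<lambda>x. bump n a b x *\<^sub>R v x)" "integrable lebesgue (\<lambda>x. indicator (box a b) x *\<^sub>R v x)" for n
  proof -
    show "integrable lebesgue (\<lambda>x. bump n a b x *\<^sub>R v x)"
      using bump_bounds[of n a b] bump_eq_0[of _ a b n] box_subset_cbox[of a b]
      by (intro locally_integrable_mult_test(2)[OF \<Omega> v, of _ 1 "cbox a b"] measurable_smooth smooth_bump ab) auto
    show "integrable lebesgue (\<lambda>x. indicator (box a b) x *\<^sub>R v x)"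
      using box_subset_cbox[of a b]
      by (intro locally_integrable_mult_test(2)[OF \<Omega> v, of _ 1 "cbox a b"] ab) (auto simp: indicator_def)
  qed
  have "(\<lambda>n. LINT x|lebesgue. bump n a b x *\<^sub>R v x) \<longlonglongrightarrow> (LINT x|lebesgue. indicator (box a b) x *\<^sub>R v x)"
  proof (rule integral_dominated_convergence)
    show "integrable lebesgue (\<lambda>x. norm (indicator (cbox a b) x *\<^sub>R v x))"
      by (rule integrable_norm[OF iv])
    show "AE x in lebesgue. norm (bump n a b x *\<^sub>R v x) \<le> norm (indicator (cbox a b) x *\<^sub>R v x)" for n
    proof (intro AE_I2)
      fix x
      show "norm (bump n a b x *\<^sub>R v x) \<le> norm (indicator (cbox a b) x *\<^sub>R v x)"
      proof (cases "x \<in> cbox a b")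
        case True
        then show ?thesis using bump_bounds[of n a b x] by (simp add: mult_left_le_one_le)
      next
        case False
        then have "x \<notin> box a b" using box_subset_cbox[of a b] by blast
        then show ?thesis by (simp add: bump_eq_0)
      qed
    qed
    show "AE x in lebesgue. (\<lambda>n. bump n a b x *\<^sub>R v x) \<longlonglongrightarrow> indicator (box a b) x *\<^sub>R v x"
      by (intro AE_I2 tendsto_scaleR bump_tendsto tendsto_const)
  qed (use I in auto)
  moreover have "(LINT x|lebesgue. bump n a b x *\<^sub>R v x) = 0" for n
  proof -
    have "(LINT x|lebesgue_on \<Omega>. bump n a b x *\<^sub>R v x) = (LINT x|lebesgue. indicator \<Omega> x *\<^sub>R (bump n a b x *\<^sub>R v x))"
      using \<Omega> by (intro integral_restrict_space) auto
    also have "(\<lambda>x. indicator \<Omega> x *\<^sub>R (bump n a b x *\<^sub>R v x)) = (\<lambda>x. bump n a b x *\<^sub>R v x)"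
      using test_function_zero_outside_domain[OF bump_test_function[OF ab]] by (auto simp: fun_eq_iff indicator_def)
    finally show ?thesis using 0[OF bump_test_function[OF ab], of n] by simp
  qed
  ultimately show ?thesis by (simp add: LIMSEQ_const_iff)
qed

text \<open>Boxes form an intersection-stable generator of the Borel sets. The vanishing of the full
  integral serves the complement step of the Dynkin induction.\<close>

lemma integral_borel_eq_0:
  fixes F :: "'a::euclidean_space => 'b::euclidean_space"
  assumes F: "integrable lebesgue F" and F0: "(LINT x|lebesgue. F x) = 0"
    and box: "\<And>c d. (LINT x|lebesgue. indicator (box c d) x *\<^sub>R F x) = 0" and A: "A \<in> sets borel"
  shows "(LINT x|lebesgue. indicator A x *\<^sub>R F x) = 0"
proof -
  have "Int_stable (range (\<lambda>(a, b). box a b :: 'a set))"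
    by (auto simp: Int_stable_def box_Int_box)
  moreover have "range (\<lambda>(a, b). box a b :: 'a set) \<subseteq> Pow UNIV" by auto
  moreover have A': "A \<in> sigma_sets UNIV (range (\<lambda>(a, b). box a b))"
    using A unfolding borel_eq_box by simp
  ultimately show ?thesis
  proof (induction rule: sigma_sets_induct_disjoint)
    case (basic A)
    then show ?case using box by auto
  next
    case (compl A)
    then have "A \<in> sets borel" by (simp add: borel_eq_box)
    then have "integrable lebesgue (\<lambda>x. indicator A x *\<^sub>R F x)"
      using F by (intro integrable_mult_indicator) auto
    moreover have "(\<lambda>x. indicator (UNIV - A) x *\<^sub>R F x) = (\<lambda>x. F x - indicator A x *\<^sub>R F x)"
      by (auto simp: fun_eq_iff indicator_def)
    ultimately show ?case using F F0 compl by simp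
  next
    case (union A)
    then have Am: "A i \<in> sets borel" for i by (auto simp: borel_eq_box)
    then have "A i \<in> sets lebesgue" for i by auto
    moreover have "set_integrable lebesgue (\<Union>i. A i) F"
      unfolding set_integrable_def using F Am by (intro integrable_mult_indicator) auto
    ultimately have "(LINT x:(\<Union>i. A i)|lebesgue. F x) = (\<Sum>i. (LINT x:(A i)|lebesgue. F x))"
      using union by (intro lebesgue_integral_countable_add) (auto simp: disjoint_family_on_def)
    then show ?case using union by (simp add: set_lebesgue_integral_def)
  qed simp
qed

text \<open>On a compact box the locally integrable function is integrable. Its integrals over boxes
  vanish, then over Borel sets, then over Lebesgue sets, and a function with this property is zero
  almost everywhere.\<close>

lemma fundamental_lemma_box:
  fixes v :: "'a::euclidean_space => 'b::euclidean_space"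
  assumes \<Omega>: "open \<Omega>" and v: "locally_integrable \<Omega> v"
    and 0: "\<And>f. f \<in> test_functions \<Omega> ==> (LINT x|lebesgue_on \<Omega>. f x *\<^sub>R v x) = 0"
    and ab: "cbox a b \<subseteq> \<Omega>"
  shows "AE x in lebesgue_on (cbox a b). v x = 0"
proof -
  define F where "F x = indicator (cbox a b) x *\<^sub>R v x" for x
  have F: "integrable lebesgue F"
    using v ab unfolding locally_integrable_def set_integrable_def F_def[abs_def] by (metis compact_cbox)
  have "negligible (cbox a b - box a b)" by (rule negligible_frontier_interval)
  then have null: "AE x in lebesgue. x \<notin> cbox a b - box a b"
    unfolding negligible_iff_null_sets by (rule AE_not_in)
  have boxF: "(LINT x|lebesgue. indicator (box c d) x *\<^sub>R F x) = 0" for c d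
  proof -
    \<comment> \<open>The corners of the intersection of the two boxes.\<close>
    define l u where "l = (\<Sum>i\<in>Basis. max (a \<bullet> i) (c \<bullet> i) *\<^sub>R i)" and "u = (\<Sum>i\<in>Basis. min (b \<bullet> i) (d \<bullet> i) *\<^sub>R i)"
    have int: "box l u = box a b \<inter> box c d" by (simp add: box_Int_box l_def u_def)
    have sub: "cbox l u \<subseteq> \<Omega>"
      using ab by (auto simp: mem_box l_def u_def subset_iff)
    have "(LINT x|lebesgue. indicator (box c d) x *\<^sub>R F x) = (LINT x|lebesgue. indicator (box l u) x *\<^sub>R v x)"
    proof (rule integral_cong_AE)
      have [measurable]: "F \<in> borel_measurable lebesgue" using F by auto
      show "(\<lambda>x. indicator (box c d) x *\<^sub>R F x) \<in> borel_measurable lebesgue"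
        by (intro borel_measurable_scaleR borel_measurable_indicator) auto
      have "integrable lebesgue (\<lambda>x. indicator (box l u) x *\<^sub>R v x)"
        using box_subset_cbox[of l u]
        by (intro locally_integrable_mult_test(2)[OF \<Omega> v, of _ 1 "cbox l u"] sub) (auto simp: indicator_def)
      then show "(\<lambda>x. indicator (box l u) x *\<^sub>R v x) \<in> borel_measurable lebesgue" by auto
      show "AE x in lebesgue. indicator (box c d) x *\<^sub>R F x = indicator (box l u) x *\<^sub>R v x"
        using null by eventually_elim (use box_subset_cbox[of a b] in \<open>auto simp: F_def int indicator_def\<close>)
    qed
    also have "... = 0" by (rule integral_box_eq_0[OF \<Omega> v 0 sub])
    finally show ?thesis .
  qed
  have "(LINT x|lebesgue. F x) = (LINT x|lebesgue. indicator (box a b) x *\<^sub>R F x)"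
  proof (rule integral_cong_AE)
    have [measurable]: "F \<in> borel_measurable lebesgue" using F by auto
    show "F \<in> borel_measurable lebesgue" by measurable
    show "(\<lambda>x. indicator (box a b) x *\<^sub>R F x) \<in> borel_measurable lebesgue"
      by (intro borel_measurable_scaleR borel_measurable_indicator) auto
    show "AE x in lebesgue. F x = indicator (box a b) x *\<^sub>R F x"
      using null by eventually_elim (auto simp: F_def indicator_def)
  qed
  then have F0: "(LINT x|lebesgue. F x) = 0" using boxF by simp
  have leb: "(LINT x|lebesgue. indicator A x *\<^sub>R F x) = 0" if "A \<in> sets lebesgue" for A
  proof -
    \<comment> \<open>A Lebesgue set is a Borel set up to a subset of a Borel null set.\<close>
    obtain S N N' where S: "A = S \<union> N" "N \<subseteq> N'" "N' \<in> null_sets lborel" "S \<in> sets lborel"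
      using sets_completionE[OF \<open>A \<in> sets lebesgue\<close>] by metis
    have "AE x in lborel. x \<notin> N'" using S(3) by (rule AE_not_in)
    then have N': "AE x in lebesgue. x \<notin> N'" by (rule AE_completion)
    have [measurable]: "F \<in> borel_measurable lebesgue" using F by auto
    have "(LINT x|lebesgue. indicator A x *\<^sub>R F x) = (LINT x|lebesgue. indicator S x *\<^sub>R F x)"
    proof (rule integral_cong_AE)
      show "AE x in lebesgue. indicator A x *\<^sub>R F x = indicator S x *\<^sub>R F x"
        using N' by eventually_elim (use S in \<open>auto simp: indicator_def\<close>)
      show "(\<lambda>x. indicator A x *\<^sub>R F x) \<in> borel_measurable lebesgue" "(\<lambda>x. indicator S x *\<^sub>R F x) \<in> borel_measurable lebesgue"
        using that S(4) by (auto intro!: borel_measurable_scaleR borel_measurable_indicator)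
    qed
    also have "... = 0" by (rule integral_borel_eq_0[OF F F0 boxF]) (use S(4) in auto)
    finally show ?thesis .
  qed
  let ?M = "lebesgue_on (cbox a b)"
  interpret finite_measure ?M by (rule finite_measure_lebesgue_on) simp
  have Fv: "integrable ?M v"
    using F unfolding F_def[abs_def] by (subst integrable_restrict_space) auto
  show ?thesis
  proof (rule density_zero[OF Fv])
    fix A assume "A \<in> sets ?M"
    then have A: "A \<in> sets lebesgue" "A \<subseteq> cbox a b" by (auto simp: sets_restrict_space)
    have "set_lebesgue_integral ?M A v = (LINT x|lebesgue. indicator (cbox a b) x *\<^sub>R (indicator A x *\<^sub>R v x))"
      unfolding set_lebesgue_integral_def by (intro integral_restrict_space) auto
    also have "(\<lambda>x. indicator (cbox a b) x *\<^sub>R (indicator A x *\<^sub>R v x)) = (\<lambda>x. indicator A x *\<^sub>R F x)"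
      by (auto simp: F_def fun_eq_iff indicator_def)
    finally show "set_lebesgue_integral ?M A v = 0" using leb[OF A(1)] by simp
  qed
qed

text \<open>An open set is a countable union of closed boxes, so the exceptional null sets can be
  collected.\<close>

lemma fundamental_lemma:
  fixes v :: "'a::euclidean_space => 'b::euclidean_space"
  assumes \<Omega>: "open \<Omega>" and v: "locally_integrable \<Omega> v"
    and 0: "\<And>f. f \<in> test_functions \<Omega> ==> (LINT x|lebesgue_on \<Omega>. f x *\<^sub>R v x) = 0"
  shows "AE x in lebesgue_on \<Omega>. v x = 0"
proof -
  obtain D where D: "countable D" "D \<subseteq> Pow \<Omega>" "\<And>X. X \<in> D ==> \<exists>a b. X = cbox a b" "\<Union>D = \<Omega>"
    using open_countable_Union_open_cbox[OF \<Omega>] by metis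
  have "AE x in lebesgue. \<forall>X\<in>D. x \<in> X \<longrightarrow> v x = 0"
  proof (intro AE_ball_countable[OF D(1), THEN iffD2] ballI)
    fix X assume X: "X \<in> D"
    then obtain a b where ab: "X = cbox a b" using D by blast
    then have "cbox a b \<subseteq> \<Omega>" using X D by auto
    then have "AE x in lebesgue_on (cbox a b). v x = 0"
      using 0 by (intro fundamental_lemma_box[OF \<Omega> v])
    then show "AE x in lebesgue. x \<in> X \<longrightarrow> v x = 0" by (subst (asm) AE_restrict_space_iff) (auto simp: ab)
  qed
  then have "AE x in lebesgue. x \<in> \<Omega> \<longrightarrow> v x = 0"
    using D(4) by (auto elim!: eventually_mono)
  then show ?thesis using \<Omega> by (subst AE_restrict_space_iff) auto
qed

section \<open>Weak polyharmonic gradients\<close>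

lemma test_integral_by_parts_dir:
  assumes f: "f \<in> test_functions \<Omega>" and g: "g \<in> test_functions \<Omega>" and i: "i \<in> Basis"
  shows "(LINT x|lborel. f x * pderiv_dir i g x) = - (LINT x|lborel. g x * pderiv_dir i f x)"
proof -
  obtain B L R where *: "0 \<le> B" "0 \<le> L" "\<And>x. \<bar>f x\<bar> \<le> B" "\<And>x y. \<bar>f x - f y\<bar> \<le> L * norm (x - y)"
    "\<And>x. x \<notin> cball 0 R ==> f x = 0"
    using test_function_bounds[OF f] by metis
  obtain B' L' R' where **: "0 \<le> B'" "0 \<le> L'" "\<And>x. \<bar>pderiv_dir i f x\<bar> \<le> B'" "\<And>x y. \<bar>pderiv_dir i f x - pderiv_dir i f y\<bar> \<le> L' * norm (x - y)"
    "\<And>x. x \<notin> cball 0 R' ==> pderiv_dir i f x = 0"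
    using test_function_bounds[OF test_functions_pderiv_dir[OF f i]] by metis
  note s = test_functions_smooth[OF f]
  have "AE x in lborel. ((\<lambda>t. f (x + t *\<^sub>R i)) has_real_derivative pderiv_dir i f x) (at 0)"
    using has_real_derivative_line[OF s i, where t=0] by (intro AE_I2) simp
  from integral_by_parts_lipschitz[OF g i *(4) *(3) this _ _ **(3)]
  have "(LINT x|lborel. pderiv_dir i f x * g x) = - (LINT x|lborel. f x * pderiv_dir i g x)"
    using measurable_smooth[OF s] measurable_smooth[OF smooth_pderiv_dir[OF s i]] by simp
  then show ?thesis by (simp add: mult.commute)
qed

lemma test_product_integrable:
  assumes f: "f \<in> test_functions \<Omega>" and g: "g \<in> test_functions \<Omega>"
  shows "integrable lborel (\<lambda>x. f x * g x)"
proof -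
  obtain B L R where *: "0 \<le> B" "0 \<le> L" "\<And>x. \<bar>f x\<bar> \<le> B" "\<And>x y. \<bar>f x - f y\<bar> \<le> L * norm (x - y)"
    "\<And>x. x \<notin> cball 0 R ==> f x = 0"
    using test_function_bounds[OF f] by metis
  show ?thesis
    by (rule test_function_product_integrable[OF g measurable_smooth[OF test_functions_smooth[OF f]] *(3)])
qed

lemma test_integral_by_parts_laplacian:
  assumes f: "f \<in> test_functions \<Omega>" and g: "g \<in> test_functions \<Omega>"
  shows "(LINT x|lborel. f x * laplacian g x) = (LINT x|lborel. g x * laplacian f x)"
proof -
  have d: "pderiv_dir i f \<in> test_functions \<Omega>" "pderiv_dir i g \<in> test_functions \<Omega>" if "i \<in> Basis" for i
    using f g that by (auto intro: test_functions_pderiv_dir)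
  have "(LINT x|lborel. f x * laplacian g x) = (\<Sum>i\<in>Basis. LINT x|lborel. f x * pderiv_dir i (pderiv_dir i g) x)"
    unfolding laplacian_def sum_distrib_left
    using test_product_integrable[OF f test_functions_pderiv_dir[OF d(2)]] by (intro Bochner_Integration.integral_sum) auto
  also have "... = (\<Sum>i\<in>Basis. - (LINT x|lborel. pderiv_dir i g x * pderiv_dir i f x))"
    using test_integral_by_parts_dir[OF f d(2)] by (intro sum.cong) auto
  also have "... = (\<Sum>i\<in>Basis. - (LINT x|lborel. pderiv_dir i f x * pderiv_dir i g x))"
    by (simp add: mult.commute)
  also have "... = (\<Sum>i\<in>Basis. LINT x|lborel. g x * pderiv_dir i (pderiv_dir i f) x)"
    using test_integral_by_parts_dir[OF g d(1)] by (intro sum.cong) auto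
  also have "... = (LINT x|lborel. g x * laplacian f x)"
    unfolding laplacian_def sum_distrib_left
    using test_product_integrable[OF g test_functions_pderiv_dir[OF d(1)]] by (intro Bochner_Integration.integral_sum[symmetric]) auto
  finally show ?thesis .
qed

text \<open>Each step moves the outermost Laplacian from \<open>g\<close> to \<open>f\<close>; the
  induction therefore generalizes over \<open>f\<close>.\<close>

lemma test_integral_by_parts_laplacian_funpow:
  "f \<in> test_functions \<Omega> ==> g \<in> test_functions \<Omega> ==>
    (LINT x|lborel. f x * (laplacian ^^ k) g x) = (LINT x|lborel. g x * (laplacian ^^ k) f x)"
proof (induction k arbitrary: f)
  case 0
  then show ?case by (simp add: mult.commute)
next
  case (Suc k)
  have "(LINT x|lborel. f x * (laplacian ^^ Suc k) g x) = (LINT x|lborel. (laplacian ^^ k) g x * laplacian f x)"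
    using test_integral_by_parts_laplacian[OF Suc.prems(1) test_functions_laplacian_funpow[OF Suc.prems(2)]] by simp
  also have "... = (LINT x|lborel. laplacian f x * (laplacian ^^ k) g x)" by (simp add: mult.commute)
  also have "... = (LINT x|lborel. g x * (laplacian ^^ k) (laplacian f) x)"
    by (intro Suc.IH test_functions_laplacian Suc.prems)
  finally show ?case by (simp add: funpow_swap1)
qed

text \<open>Laplacians move without a sign. For odd order the single remaining derivative
  contributes the sign, and it must be commuted past the Laplacians to become outermost
  again.\<close>

lemma test_integral_by_parts_nabla:
  assumes f: "f \<in> test_functions \<Omega>" and g: "g \<in> test_functions (\<Omega> :: 'a::euclidean_space set)"
  shows "(LINT x|lborel. f x *\<^sub>R nabla k g x) = (-1) ^ k *\<^sub>R (LINT x|lborel. g x *\<^sub>R nabla k f x)"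
proof (cases "even k")
  case True
  have bl: "bounded_linear (\<lambda>a::real. (a, 0::'a))" by (intro bounded_linear_Pair bounded_linear_ident bounded_linear_zero)
  have *: "(LINT x|lborel. f x *\<^sub>R nabla k g x) = (LINT x|lborel. f x * (laplacian ^^ (k div 2)) g x, 0)"
    if "f \<in> test_functions \<Omega>" "g \<in> test_functions \<Omega>" for f g :: "'a => real"
  proof -
    have "(LINT x|lborel. f x *\<^sub>R nabla k g x) = (LINT x|lborel. (f x * (laplacian ^^ (k div 2)) g x, 0::'a))"
      using True by (simp add: nabla_def)
    also have "... = (LINT x|lborel. f x * (laplacian ^^ (k div 2)) g x, 0)"
      by (rule integral_bounded_linear[OF bl test_product_integrable[OF that(1) test_functions_laplacian_funpow[OF that(2)]]])
    finally show ?thesis .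
  qed
  show ?thesis
    using True by (simp add: *[OF f g] *[OF g f] test_integral_by_parts_laplacian_funpow[OF f g])
next
  case False
  let ?j = "(k - 1) div 2"
  have bl: "bounded_linear (\<lambda>a::real. (0::real, a *\<^sub>R i))" for i :: 'a
    by (intro bounded_linear_Pair bounded_linear_scaleR_left bounded_linear_zero)
  have *: "(LINT x|lborel. f x *\<^sub>R nabla k g x) = (\<Sum>i\<in>Basis. (0, (LINT x|lborel. f x * pderiv_dir i ((laplacian ^^ ?j) g) x) *\<^sub>R i))"
    if "f \<in> test_functions \<Omega>" "g \<in> test_functions \<Omega>" for f g :: "'a => real"
  proof -
    have int: "integrable lborel (\<lambda>x. f x * pderiv_dir i ((laplacian ^^ ?j) g) x)" if "i \<in> Basis" for i
      by (intro test_product_integrable[OF \<open>f \<in> test_functions \<Omega>\<close>] test_functions_pderiv_dir test_functions_laplacian_funpow \<open>g \<in> test_functions \<Omega>\<close> that)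
    have "(LINT x|lborel. f x *\<^sub>R nabla k g x) = (LINT x|lborel. (\<Sum>i\<in>Basis. (0::real, (f x * pderiv_dir i ((laplacian ^^ ?j) g) x) *\<^sub>R i)))"
      using False by (simp add: nabla_def sum_prod scaleR_sum_right)
    also have "... = (\<Sum>i\<in>Basis. (LINT x|lborel. (0::real, (f x * pderiv_dir i ((laplacian ^^ ?j) g) x) *\<^sub>R i)))"
      by (intro Bochner_Integration.integral_sum integrable_bounded_linear[OF bl] int)
    also have "... = (\<Sum>i\<in>Basis. (0, (LINT x|lborel. f x * pderiv_dir i ((laplacian ^^ ?j) g) x) *\<^sub>R i))"
      by (intro sum.cong refl integral_bounded_linear[OF bl] int)
    finally show ?thesis .
  qed
  have "(LINT x|lborel. f x * pderiv_dir i ((laplacian ^^ ?j) g) x) = - (LINT x|lborel. g x * pderiv_dir i ((laplacian ^^ ?j) f) x)"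
    if i: "i \<in> Basis" for i
  proof -
    have "(LINT x|lborel. f x * pderiv_dir i ((laplacian ^^ ?j) g) x) = - (LINT x|lborel. (laplacian ^^ ?j) g x * pderiv_dir i f x)"
      by (rule test_integral_by_parts_dir[OF f test_functions_laplacian_funpow[OF g] i])
    also have "... = - (LINT x|lborel. pderiv_dir i f x * (laplacian ^^ ?j) g x)" by (simp add: mult.commute)
    also have "... = - (LINT x|lborel. g x * (laplacian ^^ ?j) (pderiv_dir i f) x)"
      by (simp add: test_integral_by_parts_laplacian_funpow[OF test_functions_pderiv_dir[OF f i] g])
    finally show ?thesis
      by (simp add: pderiv_dir_laplacian_funpow_commute[OF test_functions_smooth[OF f] i])
  qed
  then show ?thesis
    using False by (simp add: *[OF f g] *[OF g f] sum_prod sum_negf zero_prod_def[symmetric])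
qed

lemma locally_integrable_borel:
  fixes f :: "'a::euclidean_space => 'b::euclidean_space"
  assumes "integrable lborel f"
  shows "locally_integrable \<Omega> f"
  unfolding locally_integrable_def set_integrable_def
proof (intro allI impI)
  fix K assume "compact K \<and> K \<subseteq> \<Omega>"
  then have "integrable lborel (\<lambda>x. indicator K x *\<^sub>R f x)"
    using assms by (intro integrable_mult_indicator) (auto intro: borel_compact)
  then show "integrable lebesgue (\<lambda>x. indicator K x *\<^sub>R f x)"
    by (subst integrable_completion) auto
qed

lemma weak_nabla_test_function:
  assumes \<Omega>: "open \<Omega>" and g: "g \<in> test_functions \<Omega>"
  shows "weak_nabla \<Omega> k g (nabla k g)"
  unfolding weak_nabla_def
proof (intro conjI ballI)
  show "locally_integrable \<Omega> g" "locally_integrable \<Omega> (nabla k g)"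
    by (intro locally_integrable_borel test_function_integrable[OF g] nabla_integrable[OF g])+
  fix f assume f: "f \<in> test_functions \<Omega>"
  have m: "f \<in> borel_measurable borel" "g \<in> borel_measurable borel"
    using f g by (auto intro!: measurable_smooth test_functions_smooth)
  have "(LINT x|lebesgue_on \<Omega>. f x *\<^sub>R nabla k g x) = (LINT x|lborel. f x *\<^sub>R nabla k g x)"
    using f m nabla_measurable[OF g] by (intro lint_lebesgue_on_zero_outside[OF \<Omega>]) (auto simp: test_function_zero_outside_domain)
  also have "... = (-1) ^ k *\<^sub>R (LINT x|lborel. g x *\<^sub>R nabla k f x)"
    by (rule test_integral_by_parts_nabla[OF f g])
  also have "(LINT x|lborel. g x *\<^sub>R nabla k f x) = (LINT x|lebesgue_on \<Omega>. g x *\<^sub>R nabla k f x)"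
    using g m nabla_measurable[OF f] by (intro lint_lebesgue_on_zero_outside[OF \<Omega>, symmetric]) (auto simp: test_function_zero_outside_domain)
  finally show "(LINT x|lebesgue_on \<Omega>. f x *\<^sub>R nabla k g x) = (-1) ^ k *\<^sub>R (LINT x|lebesgue_on \<Omega>. g x *\<^sub>R nabla k f x)" .
qed

section \<open>Linearity and uniqueness of weak gradients\<close>

lemma locally_integrable_add:
  "locally_integrable \<Omega> f ==> locally_integrable \<Omega> g ==> locally_integrable \<Omega> (\<lambda>x. f x + g x)"
  unfolding locally_integrable_def by (auto intro: set_integral_add)

lemma locally_integrable_scaleR:
  "locally_integrable \<Omega> f ==> locally_integrable \<Omega> (\<lambda>x. c *\<^sub>R f x)"
  unfolding locally_integrable_def by (auto intro: set_integrable_scaleR_right)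

lemma nabla_test_mult_integrable:
  assumes \<Omega>: "open \<Omega>" and u: "locally_integrable \<Omega> u" and f: "f \<in> test_functions (\<Omega> :: 'a::euclidean_space set)"
  shows "integrable (lebesgue_on \<Omega>) (\<lambda>x. u x *\<^sub>R nabla k f x)"
proof -
  obtain K where K: "compact K" "K \<subseteq> \<Omega>" "\<And>x. x \<notin> K ==> nabla k f x = 0" "\<And>x. x \<notin> K ==> f x = 0"
    using nabla_zero_outside[OF f] by metis
  obtain B where B: "\<And>x. norm (nabla k f x) \<le> B" using nabla_bounded[OF f] by blast
  \<comment> \<open>The available integrability result has a scalar bounded factor, so the
    vector-valued factor is treated coordinate by coordinate.\<close>
  have "integrable (lebesgue_on \<Omega>) (\<lambda>x. (nabla k f x \<bullet> i) *\<^sub>R u x)" if i: "i \<in> Basis" for i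
  proof (rule locally_integrable_mult_test(1)[OF \<Omega> u _ _ K(1,2)])
    show "(\<lambda>x. nabla k f x \<bullet> i) \<in> borel_measurable borel" using nabla_measurable[OF f] by measurable
    show "\<bar>nabla k f x \<bullet> i\<bar> \<le> B" for x using Basis_le_norm[OF i] B order_trans by blast
  qed (simp add: K(3))
  then have "integrable (lebesgue_on \<Omega>) (\<lambda>x. \<Sum>i\<in>Basis. ((nabla k f x \<bullet> i) *\<^sub>R u x) *\<^sub>R i)"
    by (intro Bochner_Integration.integrable_sum integrable_scaleR_left) auto
  also have "(\<lambda>x. \<Sum>i\<in>Basis. ((nabla k f x \<bullet> i) *\<^sub>R u x) *\<^sub>R i) = (\<lambda>x. u x *\<^sub>R nabla k f x)"
  proof
    fix x
    have "u x *\<^sub>R nabla k f x = u x *\<^sub>R (\<Sum>i\<in>Basis. (nabla k f x \<bullet> i) *\<^sub>R i)" by (simp only: euclidean_representation)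
    then show "(\<Sum>i\<in>Basis. ((nabla k f x \<bullet> i) *\<^sub>R u x) *\<^sub>R i) = u x *\<^sub>R nabla k f x"
      by (simp add: scaleR_sum_right mult.commute del: sum_Basis_prod_eq)
  qed
  finally show ?thesis .
qed

lemma weak_nabla_add:
  assumes \<Omega>: "open \<Omega>" and "weak_nabla \<Omega> k u v" "weak_nabla \<Omega> k u' v'"
  shows "weak_nabla \<Omega> k (\<lambda>x. u x + u' x) (\<lambda>x. v x + v' x)"
proof -
  have l: "locally_integrable \<Omega> u" "locally_integrable \<Omega> v" "locally_integrable \<Omega> u'" "locally_integrable \<Omega> v'"
    using assms by (auto simp: weak_nabla_def)
  show ?thesis
    unfolding weak_nabla_def
  proof (intro conjI ballI locally_integrable_add l)
    fix f assume f: "f \<in> test_functions \<Omega>"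
    note i = test_function_mult_integrable[OF \<Omega> l(2) f] test_function_mult_integrable[OF \<Omega> l(4) f]
      nabla_test_mult_integrable[OF \<Omega> l(1) f] nabla_test_mult_integrable[OF \<Omega> l(3) f]
    show "(LINT x|lebesgue_on \<Omega>. f x *\<^sub>R (v x + v' x)) = (-1) ^ k *\<^sub>R (LINT x|lebesgue_on \<Omega>. (u x + u' x) *\<^sub>R nabla k f x)"
      using assms(2,3) f i by (simp add: weak_nabla_def scaleR_add_right scaleR_add_left)
  qed
qed

lemma weak_nabla_cmult:
  assumes w: "weak_nabla \<Omega> k u v"
  shows "weak_nabla \<Omega> k (\<lambda>x. c * u x) (\<lambda>x. c *\<^sub>R v x)"
proof -
  have "(LINT x|lebesgue_on \<Omega>. f x *\<^sub>R c *\<^sub>R v x) = (-1) ^ k *\<^sub>R (LINT x|lebesgue_on \<Omega>. (c * u x) *\<^sub>R nabla k f x)"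
    if f: "f \<in> test_functions \<Omega>" for f
  proof -
    have "(LINT x|lebesgue_on \<Omega>. f x *\<^sub>R c *\<^sub>R v x) = (LINT x|lebesgue_on \<Omega>. c *\<^sub>R (f x *\<^sub>R v x))"
      by (simp add: mult.commute)
    also have "... = c *\<^sub>R (LINT x|lebesgue_on \<Omega>. f x *\<^sub>R v x)"
      by (rule integral_scaleR_right)
    also have "... = (-1) ^ k *\<^sub>R (c *\<^sub>R (LINT x|lebesgue_on \<Omega>. u x *\<^sub>R nabla k f x))"
      using w f by (simp add: weak_nabla_def mult.commute)
    also have "c *\<^sub>R (LINT x|lebesgue_on \<Omega>. u x *\<^sub>R nabla k f x) = (LINT x|lebesgue_on \<Omega>. c *\<^sub>R (u x *\<^sub>R nabla k f x))"
      by (rule integral_scaleR_right[symmetric])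
    finally show ?thesis by simp
  qed
  then show ?thesis
    using w locally_integrable_scaleR[of \<Omega> u c] locally_integrable_scaleR[of \<Omega> v c] by (simp add: weak_nabla_def)
qed

lemma weak_nabla_diff:
  assumes \<Omega>: "open \<Omega>" and "weak_nabla \<Omega> k u v" "weak_nabla \<Omega> k u' v'"
  shows "weak_nabla \<Omega> k (\<lambda>x. u x - u' x) (\<lambda>x. v x - v' x)"
  using weak_nabla_add[OF \<Omega> assms(2) weak_nabla_cmult[OF assms(3), of "-1"]] by simp

lemma weak_nabla_unique:
  assumes \<Omega>: "open \<Omega>" and "weak_nabla \<Omega> k u v" "weak_nabla \<Omega> k u v'"
  shows "AE x in lebesgue_on \<Omega>. v x = v' x"
proof -
  have w: "weak_nabla \<Omega> k (\<lambda>x. u x - u x) (\<lambda>x. v x - v' x)"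
    by (rule weak_nabla_diff[OF assms])
  then have "locally_integrable \<Omega> (\<lambda>x. v x - v' x)" by (simp add: weak_nabla_def)
  moreover have "(LINT x|lebesgue_on \<Omega>. f x *\<^sub>R (v x - v' x)) = 0" if "f \<in> test_functions \<Omega>" for f
    using w that by (simp add: weak_nabla_def)
  ultimately have "AE x in lebesgue_on \<Omega>. v x - v' x = 0" by (rule fundamental_lemma[OF \<Omega>])
  then show ?thesis by simp
qed

text \<open>Rests on the completeness of Lebesgue measure. It supplies measurability of
  \<open>wnabla\<close>, which is a choice known only up to null sets.\<close>

lemma borel_measurable_lebesgue_on_AE:
  fixes f g :: "'a::euclidean_space => 'b::euclidean_space"
  assumes \<Omega>: "open \<Omega>" and f: "f \<in> borel_measurable (lebesgue_on \<Omega>)" and ae: "AE x in lebesgue_on \<Omega>. f x = g x"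
  shows "g \<in> borel_measurable (lebesgue_on \<Omega>)"
proof -
  have s: "\<Omega> \<in> sets lebesgue" using \<Omega> by simp
  have "(\<lambda>x. if x \<in> \<Omega> then f x else 0) \<in> borel_measurable lebesgue"
    using f by (rule borel_measurable_if_I) (rule s)
  moreover have "AE x in lebesgue. (if x \<in> \<Omega> then f x else 0) = (if x \<in> \<Omega> then g x else 0)"
    using ae s by (subst (asm) AE_restrict_space_iff) (auto elim!: eventually_mono)
  ultimately have "(\<lambda>x. if x \<in> \<Omega> then g x else 0) \<in> borel_measurable lebesgue"
    by (rule borel_measurable_AE)
  then show ?thesis by (rule borel_measurable_if_D)
qed

lemma wnabla_AE:
  assumes \<Omega>: "open \<Omega>" and w: "weak_nabla \<Omega> k u v"
  shows "weak_nabla \<Omega> k u (wnabla \<Omega> k u)" "AE x in lebesgue_on \<Omega>. wnabla \<Omega> k u x = v x"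
proof -
  show 1: "weak_nabla \<Omega> k u (wnabla \<Omega> k u)" unfolding wnabla_def by (rule someI[of "weak_nabla \<Omega> k u", OF w])
  show "AE x in lebesgue_on \<Omega>. wnabla \<Omega> k u x = v x" by (rule weak_nabla_unique[OF \<Omega> 1 w])
qed

section \<open>Comparison of exponents on finite measure spaces\<close>

lemma powr_lower_exponent_le:
  fixes \<sigma> \<sigma>' c t :: real
  assumes "0 \<le> \<sigma>'" "\<sigma>' \<le> \<sigma>" "0 < c" "0 \<le> t"
  shows "t powr \<sigma>' \<le> c powr \<sigma>' + c powr (\<sigma>' - \<sigma>) * t powr \<sigma>"
proof (cases "t \<le> c")
  case True
  then have "t powr \<sigma>' \<le> c powr \<sigma>'" using assms by (intro powr_mono2) auto
  then show ?thesis by (simp add: add_increasing2)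
next
  case False
  then have "t powr \<sigma>' = t powr (\<sigma>' - \<sigma>) * t powr \<sigma>" using assms by (simp add: powr_add[symmetric])
  also have "... \<le> c powr (\<sigma>' - \<sigma>) * t powr \<sigma>" using False assms by (intro mult_right_mono powr_mono2') auto
  finally show ?thesis by (simp add: add_increasing)
qed

text \<open>The threshold \<open>c\<close> stays free: 1 gives finiteness, a small value makes the
  contribution of the total measure small in limits, and a value tied to the size of the function
  gives the right scaling.\<close>

lemma lpm_lower_exponent_le:
  fixes f :: "'a => 'b::euclidean_space"
  assumes f: "f \<in> borel_measurable M" and "0 \<le> \<sigma>'" "\<sigma>' \<le> \<sigma>" "0 < c"
  shows "lpm M \<sigma>' f \<le> ennreal (c powr \<sigma>') * emeasure M (space M) + ennreal (c powr (\<sigma>' - \<sigma>)) * lpm M \<sigma> f"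
proof -
  have "lpm M \<sigma>' f \<le> (\<integral>\<^sup>+x. ennreal (c powr \<sigma>') + ennreal (c powr (\<sigma>' - \<sigma>)) * ennreal (norm (f x) powr \<sigma>) \<partial>M)"
    unfolding lpm_def using powr_lower_exponent_le[OF assms(2-4)]
    by (intro nn_integral_mono) (simp add: ennreal_mult[symmetric] ennreal_plus[symmetric] del: ennreal_plus)
  also have "... = ennreal (c powr \<sigma>') * emeasure M (space M) + ennreal (c powr (\<sigma>' - \<sigma>)) * lpm M \<sigma> f"
    unfolding lpm_def using f by (simp add: nn_integral_add nn_integral_cmult)
  finally show ?thesis .
qed

lemma lpm_lower_exponent_finite:
  fixes f :: "'a => 'b::euclidean_space"
  assumes "finite_measure M" "f \<in> borel_measurable M" "0 \<le> \<sigma>'" "\<sigma>' \<le> \<sigma>" "lpm M \<sigma> f < \<infinity>"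
  shows "lpm M \<sigma>' f < \<infinity>"
proof -
  have "emeasure M (space M) < \<infinity>"
    using finite_measure.emeasure_finite[OF assms(1), of "space M"] by (simp add: less_top)
  then have "ennreal (1 powr \<sigma>') * emeasure M (space M) + ennreal (1 powr (\<sigma>' - \<sigma>)) * lpm M \<sigma> f < \<infinity>"
    using assms(5) by simp
  then show ?thesis using lpm_lower_exponent_le[OF assms(2-4), of 1] by (rule order.strict_trans1[rotated]) simp
qed

lemma lpm_lower_exponent_tendsto:
  fixes f :: "nat => 'a => 'b::euclidean_space"
  assumes M: "finite_measure M" and f: "\<And>n. f n \<in> borel_measurable M" and s: "0 < \<sigma>'" "\<sigma>' \<le> \<sigma>"
    and lim: "(\<lambda>n. lpm M \<sigma> (f n)) \<longlonglongrightarrow> 0"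
  shows "(\<lambda>n. lpm M \<sigma>' (f n)) \<longlonglongrightarrow> 0"
proof (rule tendsto_zero_ennreal)
  fix e :: real assume e: "0 < e"
  have "emeasure M (space M) < \<infinity>"
    using finite_measure.emeasure_finite[OF M, of "space M"] by (simp add: less_top)
  then obtain V where V: "0 \<le> V" "emeasure M (space M) = ennreal V" by (cases "emeasure M (space M)") auto
  \<comment> \<open>Makes c^\<sigma>' times the measure of the space smaller than
    \<open>e\<close>.\<close>
  define c where "c = (e / (2 * (V + 1))) powr (1 / \<sigma>')"
  have c: "0 < c" "c powr \<sigma>' * V < e"
  proof -
    show "0 < c" using e V by (simp add: c_def)
    have "c powr \<sigma>' = e / (2 * (V + 1))" using s e V by (simp add: c_def powr_powr)
    then have "c powr \<sigma>' * V = e * (V / (2 * (V + 1)))" by simp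
    also have "... < e * 1" using e V by (intro mult_strict_left_mono) auto
    finally show "c powr \<sigma>' * V < e" by simp
  qed
  have "(\<lambda>n. ennreal (c powr \<sigma>') * emeasure M (space M) + ennreal (c powr (\<sigma>' - \<sigma>)) * lpm M \<sigma> (f n))
      \<longlonglongrightarrow> ennreal (c powr \<sigma>') * emeasure M (space M) + ennreal (c powr (\<sigma>' - \<sigma>)) * 0"
    using lim by (intro tendsto_add tendsto_const ennreal_tendsto_cmult) auto
  moreover have "ennreal (c powr \<sigma>') * emeasure M (space M) + ennreal (c powr (\<sigma>' - \<sigma>)) * 0 < ennreal e"
    using V c e by (simp add: ennreal_mult[symmetric] ennreal_lessI)
  ultimately have "\<forall>\<^sub>F n in sequentially. ennreal (c powr \<sigma>') * emeasure M (space M) + ennreal (c powr (\<sigma>' - \<sigma>)) * lpm M \<sigma> (f n) < ennreal e"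
    by (rule order_tendstoD(2))
  then show "\<forall>\<^sub>F n in sequentially. lpm M \<sigma>' (f n) < ennreal e"
    by eventually_elim (rule order.strict_trans1[OF lpm_lower_exponent_le[OF f _ s(2) c(1)]], use s in auto)
qed

lemma integrable_lpm_1:
  fixes f :: "'a => 'b::euclidean_space"
  shows "f \<in> borel_measurable M ==> lpm M 1 f < \<infinity> ==> integrable M f"
  by (simp add: integrable_iff_bounded lpm_def)

lemma locally_integrable_lpm:
  fixes f :: "'a::euclidean_space => 'b::euclidean_space"
  assumes "open \<Omega>" "f \<in> borel_measurable (lebesgue_on \<Omega>)" "lpm (lebesgue_on \<Omega>) 1 f < \<infinity>"
  shows "locally_integrable \<Omega> f"
  unfolding locally_integrable_def
proof (intro allI impI)
  fix K assume K: "compact K \<and> K \<subseteq> \<Omega>"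
  have "integrable (lebesgue_on \<Omega>) f" using assms by (intro integrable_lpm_1)
  then have "set_integrable lebesgue \<Omega> f"
    unfolding set_integrable_def using assms(1) by (subst (asm) integrable_restrict_space) auto
  then show "set_integrable lebesgue K f"
    by (rule set_integrable_subset) (use K in \<open>auto dest!: compact_imp_closed\<close>)
qed

text \<open>The abstract linear integrand \<open>B\<close> covers both sides of the weak derivative
  identity: a test function times a vector field, and a function times the gradient of a test
  function.\<close>

lemma lint_lpm_1_tendsto:
  fixes f :: "nat => 'a => 'b::euclidean_space" and B :: "'b => 'a => 'c::euclidean_space"
  assumes B: "\<And>x. linear (\<lambda>v. B v x)" "\<And>x v. norm (B v x) \<le> C * norm v"
    and m: "\<And>n. integrable M (\<lambda>x. B (f n x) x)" "integrable M (\<lambda>x. B (g x) x)" "\<And>n. f n \<in> borel_measurable M" "g \<in> borel_measurable M"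
    and lim: "(\<lambda>n. lpm M 1 (\<lambda>x. f n x - g x)) \<longlonglongrightarrow> 0" and C: "0 \<le> C"
  shows "(\<lambda>n. LINT x|M. B (f n x) x) \<longlonglongrightarrow> (LINT x|M. B (g x) x)"
proof -
  have "(\<lambda>n. norm ((LINT x|M. B (f n x) x) - (LINT x|M. B (g x) x))) \<longlonglongrightarrow> 0"
  proof (rule tendsto_ennrealD[where f="\<lambda>n. norm ((LINT x|M. B (f n x) x) - (LINT x|M. B (g x) x))" and x=0, simplified])
    have "(\<lambda>n. ennreal C * lpm M 1 (\<lambda>x. f n x - g x)) \<longlonglongrightarrow> ennreal C * 0"
      using lim by (intro ennreal_tendsto_cmult) auto
    then have l: "(\<lambda>n. ennreal C * lpm M 1 (\<lambda>x. f n x - g x)) \<longlonglongrightarrow> 0" by simp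
    have "ennreal (norm ((LINT x|M. B (f n x) x) - (LINT x|M. B (g x) x))) \<le> ennreal C * lpm M 1 (\<lambda>x. f n x - g x)" for n
    proof -
      have eq: "B (f n x) x - B (g x) x = B (f n x - g x) x" for x
        using linear_diff[OF B(1)] by simp
      have i: "integrable M (\<lambda>x. B (f n x) x - B (g x) x)" using m by auto
      have "(LINT x|M. B (f n x) x) - (LINT x|M. B (g x) x) = (LINT x|M. B (f n x) x - B (g x) x)"
        using m by simp
      then have "ennreal (norm ((LINT x|M. B (f n x) x) - (LINT x|M. B (g x) x))) \<le> (\<integral>\<^sup>+x. norm (B (f n x) x - B (g x) x) \<partial>M)"
        using integral_norm_bound_ennreal[OF i] by simp
      also have "... \<le> (\<integral>\<^sup>+x. ennreal C * ennreal (norm (f n x - g x) powr 1) \<partial>M)"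
        unfolding eq using B(2) C by (intro nn_integral_mono) (simp add: ennreal_mult[symmetric] ennreal_leI)
      also have "... = ennreal C * lpm M 1 (\<lambda>x. f n x - g x)"
        unfolding lpm_def using m by (intro nn_integral_cmult) auto
      finally show ?thesis .
    qed
    then show "(\<lambda>n. ennreal (norm ((LINT x|M. B (f n x) x) - (LINT x|M. B (g x) x)))) \<longlonglongrightarrow> 0"
      by (intro tendsto_sandwich[OF _ _ tendsto_const l]) auto
  qed
  then show ?thesis by (simp add: LIM_zero_iff tendsto_norm_zero_iff)
qed

section \<open>The space of the double phase operator\<close>

text \<open>The exponent \<open>s\<close> will be the Sobolev exponent of p. The last assumption
  says that it lies strictly below the one of q, which is the slack that the embedding theorem
  requires.\<close>

locale double_phase =
  fixes \<Omega> :: "'a::euclidean_space set" and m :: nat and p q a0 a1 s :: real and a :: "'a => real"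
  assumes open_dom: "open \<Omega>" and bounded_dom: "bounded \<Omega>" and nonempty_dom: "\<Omega> \<noteq> {}"
    and m_ge_1: "1 \<le> m" and p_gt_1: "1 < p" and p_less_q: "p < q" and mq_less: "real m * q < real DIM('a)"
    and a_measurable: "a \<in> borel_measurable (lebesgue_on \<Omega>)"
    and a0_pos: "0 < a0" and a_lower: "\<And>x. x \<in> \<Omega> ==> a0 \<le> a x" and a_upper: "\<And>x. x \<in> \<Omega> ==> a x \<le> a1"
    and q_less_s: "q < s" and s_subcritical: "1 / q - real m / real DIM('a) < 1 / s"
begin

abbreviation "\<mu> \<equiv> lebesgue_on \<Omega>"
abbreviation "meas \<equiv> borel_measurable \<mu>"
abbreviation "\<D> \<equiv> test_functions \<Omega>"
abbreviation "nH \<equiv> norm_H p q a \<Omega>"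
abbreviation "modH \<equiv> modular p q a \<Omega>"
abbreviation "Phi \<equiv> Phi_H p q a \<Omega>"
abbreviation "Lq \<equiv> lpm \<mu> q"

lemma q_gt_1: "1 < q" using p_gt_1 p_less_q by simp

lemma a1_pos: "0 < a1"
  using nonempty_dom a_lower a_upper a0_pos by (meson all_not_in_conv less_le_trans order_trans)

text \<open>From 1 < m q < N. The Riesz kernel is then genuinely singular, with positive exponent N
  - 1, as the dyadic estimate demands.\<close>

lemma dim_ge_2: "2 \<le> DIM('a)"
proof -
  have "1 < real m * q" using m_ge_1 q_gt_1 mult_less_le_imp_less[of 1 q 1 "real m"] by (simp add: mult.commute)
  then show ?thesis using mq_less by simp
qed

lemma finite_measure_dom: "finite_measure \<mu>"
  using open_dom bounded_dom by (intro finite_measure_lebesgue_on) (simp add: lmeasurable_open)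

lemma emeasure_dom: obtains V where "0 \<le> V" "emeasure \<mu> (space \<mu>) = ennreal V"
  using finite_measure.emeasure_finite[OF finite_measure_dom, of "space \<mu>"] ennreal_neq_infinityE[of "emeasure \<mu> (space \<mu>)"]
  by (metis infinity_ennreal_def)

lemma test_measurable: "f \<in> \<D> ==> f \<in> meas"
  by (metis measurable_completion measurable_lborel2 measurable_restrict_space1 measurable_smooth test_functions_smooth)

lemma nabla_measurable_dom: "f \<in> \<D> ==> nabla k f \<in> meas"
  by (metis measurable_completion measurable_lborel2 measurable_restrict_space1 nabla_measurable)

lemma lpm_nabla_finite:
  assumes "f \<in> \<D>" "0 \<le> \<sigma>" shows "lpm \<mu> \<sigma> (nabla k f) < \<infinity>"
proof -
  obtain B where B: "0 \<le> B" "\<And>x. norm (nabla k f x) \<le> B" using nabla_bounded[OF assms(1)] by blast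
  obtain V where V: "0 \<le> V" "emeasure \<mu> (space \<mu>) = ennreal V" by (rule emeasure_dom)
  have "lpm \<mu> \<sigma> (nabla k f) \<le> (\<integral>\<^sup>+x. ennreal (B powr \<sigma>) \<partial>\<mu>)"
    unfolding lpm_def using B assms(2) by (intro nn_integral_mono ennreal_leI powr_mono2) auto
  also have "... < \<infinity>" using V by (simp add: ennreal_mult_less_top)
  finally show ?thesis .
qed

lemma lpm_nabla_0: "lpm M k (\<lambda>x. (f x, 0::'a)) = lpm M k f"
  by (simp add: lpm_def norm_Pair)

lemma lpm_test_finite: "f \<in> \<D> ==> 0 \<le> k ==> lpm \<mu> k f < \<infinity>"
  using lpm_nabla_finite[of f k 0] by (simp add: nabla_0[abs_def] lpm_nabla_0)

lemma lpm_1_finite: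
  fixes f :: "'a => 'b::euclidean_space"
  shows "f \<in> meas ==> Lq f < \<infinity> ==> lpm \<mu> 1 f < \<infinity>"
  using lpm_lower_exponent_finite[OF finite_measure_dom, of f 1 q] q_gt_1 by simp

lemma test_sobolev:
  obtains C where "0 \<le> C"
    "\<And>g A. g \<in> \<D> ==> 0 < A ==> Lq (nabla m g) \<le> ennreal (A powr q) ==> lpm \<mu> s g \<le> ennreal (C * A powr s)"
    "\<And>g A k. g \<in> \<D> ==> 0 < A ==> k \<le> m ==> Lq (nabla m g) \<le> ennreal (A powr q) ==> Lq (nabla k g) \<le> ennreal (C * A powr q)"
proof -
  have q: "1 \<le> q" "q \<le> s" using q_gt_1 q_less_s by auto
  show ?thesis
    using polyharmonic_sobolev[OF open_dom bounded_dom dim_ge_2 q s_subcritical m_ge_1] that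
    by (simp add: lpm_nabla[OF open_dom] lpm_test_function[OF open_dom]) blast
qed

section \<open>Comparison of the modular and the Luxemburg norm with q-th power integrals\<close>

lemma Hfun_bounds:
  fixes t :: real
  assumes "x \<in> \<Omega>" "0 \<le> t"
  shows "a0 * t powr q \<le> Hfun p q a x t" "Hfun p q a x t \<le> t powr p + a1 * t powr q"
proof -
  have "a0 * t powr q \<le> a x * t powr q" "a x * t powr q \<le> a1 * t powr q"
    using a_lower[OF assms(1)] a_upper[OF assms(1)] by (auto intro: mult_right_mono)
  moreover have "0 \<le> t powr p" by simp
  ultimately show "a0 * t powr q \<le> Hfun p q a x t" "Hfun p q a x t \<le> t powr p + a1 * t powr q"
    unfolding Hfun_def by linarith+
qed

lemma modular_lower:
  fixes u :: "'a => 'b::euclidean_space"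
  assumes "u \<in> meas"
  shows "ennreal a0 * Lq u \<le> modH u"
proof -
  have "ennreal a0 * Lq u = (\<integral>\<^sup>+x. ennreal (a0 * norm (u x) powr q) \<partial>\<mu>)"
    unfolding lpm_def using assms a0_pos by (simp add: ennreal_mult nn_integral_cmult)
  also have "... \<le> modH u"
    unfolding modular_def by (intro nn_integral_mono ennreal_leI Hfun_bounds) auto
  finally show ?thesis .
qed

lemma modular_upper:
  fixes u :: "'a => 'b::euclidean_space"
  assumes "u \<in> meas"
  shows "modH u \<le> lpm \<mu> p u + ennreal a1 * Lq u"
proof -
  have "modH u \<le> (\<integral>\<^sup>+x. ennreal (norm (u x) powr p) + ennreal a1 * ennreal (norm (u x) powr q) \<partial>\<mu>)"
    unfolding modular_def
  proof (intro nn_integral_mono)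
    fix x assume "x \<in> space \<mu>"
    then have "Hfun p q a x (norm (u x)) \<le> norm (u x) powr p + a1 * norm (u x) powr q"
      by (intro Hfun_bounds) auto
    then show "ennreal (Hfun p q a x (norm (u x))) \<le> ennreal (norm (u x) powr p) + ennreal a1 * ennreal (norm (u x) powr q)"
      using a1_pos by (simp add: ennreal_mult[symmetric] ennreal_plus[symmetric] ennreal_leI del: ennreal_plus)
  qed
  also have "... = lpm \<mu> p u + ennreal a1 * Lq u"
    unfolding lpm_def using assms by (simp add: nn_integral_add nn_integral_cmult)
  finally show ?thesis .
qed

lemma LH_iff:
  fixes u :: "'a => 'b::euclidean_space"
  shows "u \<in> LH p q a \<Omega> \<longleftrightarrow> u \<in> meas \<and> Lq u < \<infinity>"
proof
  assume u: "u \<in> LH p q a \<Omega>"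
  then have m: "u \<in> meas" "modH u < \<infinity>" by (auto simp: LH_def)
  have "ennreal a0 * Lq u < \<infinity>" by (rule order.strict_trans1[OF modular_lower[OF m(1)] m(2)])
  then show "u \<in> meas \<and> Lq u < \<infinity>" using a0_pos m by (auto simp: ennreal_mult_less_top)
next
  assume u: "u \<in> meas \<and> Lq u < \<infinity>"
  then have "lpm \<mu> p u < \<infinity>"
    using p_gt_1 p_less_q by (intro lpm_lower_exponent_finite[OF finite_measure_dom, of u p q]) auto
  then have "lpm \<mu> p u + ennreal a1 * Lq u < \<infinity>" using u by (simp add: ennreal_mult_less_top)
  then have "modH u < \<infinity>" using modular_upper u by (metis order.strict_trans1)
  then show "u \<in> LH p q a \<Omega>" using u by (simp add: LH_def)
qed

text \<open>The modular bound is kept beside the norm bound: it shows that the set in the definition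
  of the norm is nonempty, without which its infimum would carry no information.\<close>

lemma norm_H_upper:
  obtains K where "0 < K"
    "\<And>(u :: 'a => 'b::euclidean_space) A. u \<in> meas ==> 0 < A ==> Lq u \<le> ennreal (A powr q) ==>
      modH (\<lambda>x. u x /\<^sub>R (K * A)) \<le> 1 \<and> nH u \<le> K * A"
proof -
  obtain V where V: "0 \<le> V" "emeasure \<mu> (space \<mu>) = ennreal V" by (rule emeasure_dom)
  \<comment> \<open>The threshold for trading the exponent p for q, small enough that the constant
    term uses only half of the allowed modular.\<close>
  define \<eta> where "\<eta> = (1 / (2 * (V + 1))) powr (1 / p)"
  have \<eta>: "0 < \<eta>" "\<eta> powr p * V \<le> 1 / 2"
  proof -
    show "0 < \<eta>" using V by (simp add: \<eta>_def)
    have "\<eta> powr p = 1 / (2 * (V + 1))" using p_gt_1 V by (simp add: \<eta>_def powr_powr)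
    moreover have "\<eta> powr p * V \<le> \<eta> powr p * (V + 1)" by (intro mult_left_mono) auto
    ultimately show "\<eta> powr p * V \<le> 1 / 2" using V by simp
  qed
  define c where "c = \<eta> powr (p - q) + a1"
  have c: "0 < c" using \<eta> a1_pos by (simp add: c_def add_pos_pos)
  \<comment> \<open>Scaling by \<open>K\<close> leaves the other half of the modular to the q-th
    powers.\<close>
  define K where "K = (2 * c) powr (1 / q)"
  have K: "0 < K" "K powr q = 2 * c" using c q_gt_1 by (auto simp: K_def powr_powr)
  have main: "modH (\<lambda>x. u x /\<^sub>R (K * A)) \<le> 1"
    if u: "u \<in> meas" and A: "0 < A" and le: "Lq u \<le> ennreal (A powr q)" for u :: "'a => 'b" and A
  proof -
    let ?v = "\<lambda>x. u x /\<^sub>R (K * A)"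
    have vm: "?v \<in> meas" using u by simp
    have "Lq ?v = ennreal ((1 / (K * A)) powr q) * Lq u"
      using lpm_cmult[OF u, of q "inverse (K * A)"] K A by (simp add: inverse_eq_divide)
    also have "... \<le> ennreal ((1 / (K * A)) powr q) * ennreal (A powr q)" using le by (rule mult_left_mono) simp
    also have "... = ennreal ((1 / (K * A) * A) powr q)" using K A by (simp only: ennreal_mult[symmetric] powr_ge_zero powr_mult)
    also have "1 / (K * A) * A = 1 / K" using A by simp
    also have "(1 / K) powr q = 1 / (2 * c)" using K by (simp add: powr_divide)
    finally have vq: "Lq ?v \<le> ennreal (1 / (2 * c))" .
    have "modH ?v \<le> lpm \<mu> p ?v + ennreal a1 * Lq ?v" by (rule modular_upper[OF vm])
    also have "lpm \<mu> p ?v \<le> ennreal (\<eta> powr p) * ennreal V + ennreal (\<eta> powr (p - q)) * Lq ?v"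
      using lpm_lower_exponent_le[OF vm, of p q \<eta>] p_gt_1 p_less_q \<eta> V by simp
    also have "ennreal (\<eta> powr p) * ennreal V + ennreal (\<eta> powr (p - q)) * Lq ?v + ennreal a1 * Lq ?v
        = ennreal (\<eta> powr p * V) + ennreal c * Lq ?v"
      using \<eta> V a1_pos by (simp add: ennreal_mult c_def distrib_right add.assoc)
    also have "... \<le> ennreal (1 / 2) + ennreal c * ennreal (1 / (2 * c))"
      using vq \<eta> by (intro add_mono mult_left_mono ennreal_leI) auto
    also have "... = ennreal (1 / 2 + c * (1 / (2 * c)))"
      using c by (simp only: ennreal_mult[symmetric] ennreal_plus[symmetric] less_imp_le divide_nonneg_pos zero_le_one zero_less_numeral mult_pos_pos mult_nonneg_nonneg)
    also have "... = 1" using c by simp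
    finally show ?thesis by (simp add: add_right_mono)
  qed
  have "nH u \<le> K * A"
    if u: "u \<in> meas" and A: "0 < A" and le: "Lq u \<le> ennreal (A powr q)" for u :: "'a => 'b" and A
    unfolding norm_H_def using main[OF that] K A
    by (intro cInf_lower bdd_belowI[of _ 0]) auto
  with main K(1) show ?thesis using that by blast
qed

lemma finite_lpm_bound:
  assumes "Lq u < \<infinity>" obtains A where "0 < A" "Lq u \<le> ennreal (A powr q)"
proof -
  have "Lq u \<noteq> \<infinity>" using assms by auto
  then obtain r where r: "Lq u = ennreal r" "0 \<le> r" by (rule ennreal_neq_infinityE)
  have "((r + 1) powr (1 / q)) powr q = r + 1" using r q_gt_1 by (simp add: powr_powr)
  then show ?thesis using r that[of "(r + 1) powr (1 / q)"] by (simp add: ennreal_leI)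
qed

lemma norm_H_set_nonempty:
  fixes u :: "'a => 'b::euclidean_space"
  assumes "u \<in> meas" "Lq u < \<infinity>"
  shows "{l. l > 0 \<and> modH (\<lambda>x. u x /\<^sub>R l) \<le> 1} \<noteq> {}"
proof -
  obtain K where K: "0 < K" "\<And>(u :: 'a => 'b) A. u \<in> meas ==> 0 < A ==> Lq u \<le> ennreal (A powr q) ==>
      modH (\<lambda>x. u x /\<^sub>R (K * A)) \<le> 1 \<and> nH u \<le> K * A"
    using norm_H_upper by blast
  obtain A where "0 < A" "Lq u \<le> ennreal (A powr q)" using finite_lpm_bound[OF assms(2)] by blast
  then have "0 < K * A \<and> modH (\<lambda>x. u x /\<^sub>R (K * A)) \<le> 1" using K assms by auto
  then show ?thesis by blast
qed

lemma norm_H_nonneg: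
  fixes u :: "'a => 'b::euclidean_space"
  assumes "u \<in> meas" "Lq u < \<infinity>"
  shows "0 \<le> nH u"
  unfolding norm_H_def by (intro cInf_greatest norm_H_set_nonempty assms) auto

text \<open>The strict inequality provides an admissible level below \<open>A\<close> straight from
  the infimum, so that attainment never has to be discussed.\<close>

lemma norm_H_lower:
  fixes u :: "'a => 'b::euclidean_space"
  assumes u: "u \<in> meas" "Lq u < \<infinity>" and A: "nH u < A"
  shows "Lq u \<le> ennreal (A powr q / a0)"
proof -
  obtain l where l: "0 < l" "modH (\<lambda>x. u x /\<^sub>R l) \<le> 1" "l < A"
    using cInf_lessD[OF norm_H_set_nonempty[OF u]] A unfolding norm_H_def by blast
  have "ennreal a0 * Lq (\<lambda>x. u x /\<^sub>R l) \<le> modH (\<lambda>x. u x /\<^sub>R l)"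
    using u by (intro modular_lower) simp
  also have "... \<le> 1" by (rule l)
  finally have *: "ennreal a0 * (ennreal ((1 / l) powr q) * Lq u) \<le> 1"
    using lpm_cmult[OF u(1), of q "inverse l"] l by (simp add: inverse_eq_divide)
  have "Lq u = ennreal (l powr q / a0) * (ennreal a0 * (ennreal ((1 / l) powr q) * Lq u))"
  proof -
    have "l powr q / a0 * (a0 * (1 / l) powr q) = 1" using l a0_pos by (simp add: powr_divide)
    moreover have "ennreal x * (ennreal y * (ennreal z * L)) = ennreal (x * (y * z)) * L" if "0 \<le> x" "0 \<le> y" "0 \<le> z" for x y z L
      using that by (simp add: ennreal_mult mult.assoc)
    then have "ennreal (l powr q / a0) * (ennreal a0 * (ennreal ((1 / l) powr q) * Lq u)) = ennreal (l powr q / a0 * (a0 * (1 / l) powr q)) * Lq u"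
      using a0_pos by simp
    ultimately show ?thesis by simp
  qed
  also have "... \<le> ennreal (l powr q / a0) * 1" using * by (rule mult_left_mono) simp
  also have "... \<le> ennreal (A powr q / a0)"
    using l a0_pos q_gt_1 by (auto intro!: ennreal_leI divide_right_mono powr_mono2)
  finally show ?thesis .
qed

lemma norm_H_tendsto_0_iff:
  fixes v :: "nat => 'a => 'b::euclidean_space"
  assumes v: "\<And>n. v n \<in> meas" "\<And>n. Lq (v n) < \<infinity>"
  shows "(\<lambda>n. nH (v n)) \<longlonglongrightarrow> 0 \<longleftrightarrow> (\<lambda>n. Lq (v n)) \<longlonglongrightarrow> 0"
proof
  assume lim: "(\<lambda>n. nH (v n)) \<longlonglongrightarrow> 0"
  show "(\<lambda>n. Lq (v n)) \<longlonglongrightarrow> 0"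
  proof (rule tendsto_zero_ennreal)
    fix e :: real assume e: "0 < e"
    define A where "A = (e / 2 * a0) powr (1 / q)"
    have A: "0 < A" "A powr q / a0 = e / 2" using e a0_pos q_gt_1 by (auto simp: A_def powr_powr)
    have "\<forall>\<^sub>F n in sequentially. nH (v n) < A" using order_tendstoD(2)[OF lim A(1)] .
    then show "\<forall>\<^sub>F n in sequentially. Lq (v n) < ennreal e"
    proof eventually_elim
      case (elim n)
      have "Lq (v n) \<le> ennreal (e / 2)" using norm_H_lower[OF v elim] A by simp
      also have "... < ennreal e" using e by (simp add: ennreal_lessI)
      finally show ?case .
    qed
  qed
next
  assume lim: "(\<lambda>n. Lq (v n)) \<longlonglongrightarrow> 0"
  obtain K where K: "0 < K" "\<And>(u :: 'a => 'b) A. u \<in> meas ==> 0 < A ==> Lq u \<le> ennreal (A powr q) ==>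
      modH (\<lambda>x. u x /\<^sub>R (K * A)) \<le> 1 \<and> nH u \<le> K * A"
    using norm_H_upper by blast
  show "(\<lambda>n. nH (v n)) \<longlonglongrightarrow> 0"
  proof (rule order_tendstoI)
    fix e :: real assume "e < 0"
    then show "\<forall>\<^sub>F n in sequentially. e < nH (v n)"
      using norm_H_nonneg[OF v] by (intro always_eventually allI) (rule less_le_trans)
  next
    fix e :: real assume e: "0 < e"
    define A where "A = e / (2 * K)"
    have A: "0 < A" "K * A < e" using e K by (auto simp: A_def)
    have "\<forall>\<^sub>F n in sequentially. Lq (v n) < ennreal (A powr q)" 
      using order_tendstoD(2)[OF lim, of "ennreal (A powr q)"] A by simp
    then show "\<forall>\<^sub>F n in sequentially. nH (v n) < e"
    proof eventually_elim
      case (elim n)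
      then show ?case using K(2)[OF v(1) A(1) less_imp_le[OF elim]] A(2) by linarith
    qed
  qed
qed

lemma norm_H_cong_AE:
  assumes "AE x in \<mu>. u x = v x" shows "nH u = nH v"
proof -
  have "modH (\<lambda>x. u x /\<^sub>R l) = modH (\<lambda>x. v x /\<^sub>R l)" for l
    unfolding modular_def using assms by (intro nn_integral_cong_AE) auto
  then show ?thesis by (simp add: norm_H_def)
qed

lemma wnabla_LH:
  assumes "weak_nabla \<Omega> k u v" "v \<in> LH p q a \<Omega>"
  shows "wnabla \<Omega> k u \<in> meas" "Lq (wnabla \<Omega> k u) < \<infinity>" "AE x in \<mu>. wnabla \<Omega> k u x = v x"
    "nH (wnabla \<Omega> k u) = nH v"
proof -
  show ae: "AE x in \<mu>. wnabla \<Omega> k u x = v x" by (rule wnabla_AE(2)[OF open_dom assms(1)])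
  then have ae': "AE x in \<mu>. v x = wnabla \<Omega> k u x" by eventually_elim simp
  show "wnabla \<Omega> k u \<in> meas"
    using assms(2) by (intro borel_measurable_lebesgue_on_AE[OF open_dom _ ae']) (simp add: LH_iff)
  show "Lq (wnabla \<Omega> k u) < \<infinity>"
    using assms(2) lpm_cong_AE[OF ae] by (simp add: LH_iff)
  show "nH (wnabla \<Omega> k u) = nH v" by (rule norm_H_cong_AE[OF ae])
qed

text \<open>Membership in \<open>W0mH\<close> together with the top-order derivative, in terms of \<open>L\<^sup>q\<close> limits of test
  functions only: since \<open>a\<close> lies between positive constants, the norm of \<open>L\<^sup>H\<close> is equivalent to that of
  \<open>L\<^sup>q\<close>, and the intermediate derivatives are controlled by the top-order one.\<close>

definition w0pair :: "('a => real) => ('a => real \<times> 'a) => bool" where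
  "w0pair u g \<longleftrightarrow> u \<in> meas \<and> g \<in> meas \<and>
    (\<exists>\<phi>. (\<forall>n. \<phi> n \<in> \<D>) \<and> (\<lambda>n. Lq (\<lambda>x. \<phi> n x - u x)) \<longlonglongrightarrow> 0 \<and>
      (\<lambda>n. Lq (\<lambda>x. nabla m (\<phi> n) x - g x)) \<longlonglongrightarrow> 0)"

lemma lpm_limit_finite:
  fixes f :: "nat => 'a => 'b::euclidean_space"
  assumes "\<And>n. f n \<in> meas" "g \<in> meas" "(\<lambda>n. Lq (\<lambda>x. f n x - g x)) \<longlonglongrightarrow> 0" "\<And>n. Lq (f n) < \<infinity>"
  shows "Lq g < \<infinity>"
proof -
  have "\<forall>\<^sub>F n in sequentially. Lq (\<lambda>x. f n x - g x) < 1"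
    using order_tendstoD(2)[OF assms(3), of 1] by simp
  then obtain n where n: "Lq (\<lambda>x. f n x - g x) < 1" by (auto simp: eventually_sequentially)
  have "Lq g \<le> ennreal (2 powr q) * (Lq (f n) + Lq (\<lambda>x. f n x - g x))"
    using lpm_diff_le[of q "f n" \<mu> "\<lambda>x. f n x - g x"] assms q_gt_1 by simp
  also have "... < \<infinity>" using assms(4)[of n] n by (simp add: ennreal_mult_less_top less_top order.strict_trans[OF n])
  finally show ?thesis .
qed

lemma w0pair_measurable: "w0pair u g ==> u \<in> meas" "w0pair u g ==> g \<in> meas"
  by (auto simp: w0pair_def)

lemma w0pair_finite:
  assumes "w0pair u g" shows "Lq u < \<infinity>" "Lq g < \<infinity>"
proof -
  obtain f where *: "\<And>n. f n \<in> \<D>" "(\<lambda>n. Lq (\<lambda>x. f n x - u x)) \<longlonglongrightarrow> 0" "(\<lambda>n. Lq (\<lambda>x. nabla m (f n) x - g x)) \<longlonglongrightarrow> 0"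
    using assms by (auto simp: w0pair_def)
  have "0 \<le> q" using q_gt_1 by simp
  then show "Lq u < \<infinity>" "Lq g < \<infinity>"
    using lpm_limit_finite[OF test_measurable[OF *(1)] w0pair_measurable(1)[OF assms] *(2) lpm_test_finite[OF *(1)]]
      lpm_limit_finite[OF nabla_measurable_dom[OF *(1)] w0pair_measurable(2)[OF assms] *(3) lpm_nabla_finite[OF *(1)]] by auto
qed

text \<open>All summands of the Sobolev norm are nonnegative, so convergence in the norm gives
  convergence of the orders 0 and m separately.\<close>

lemma W0mH_imp_w0pair:
  assumes "u \<in> W0mH m p q a \<Omega>" shows "w0pair u (wnabla \<Omega> m u)"
proof -
  obtain f where f: "\<And>n. f n \<in> \<D>" "(\<lambda>n. norm_WmH m p q a \<Omega> (\<lambda>x. u x - f n x)) \<longlonglongrightarrow> 0"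
    and W: "u \<in> WmH m p q a \<Omega>"
    using assms by (auto simp: W0mH_def)
  have u: "u \<in> meas" "Lq u < \<infinity>" using W by (auto simp: WmH_def LH_iff)
  have "\<forall>k\<le>m. \<exists>v\<in>LH p q a \<Omega>. weak_nabla \<Omega> k u v" using W by (simp add: WmH_def)
  then obtain v where v: "\<And>k. k \<le> m ==> v k \<in> LH p q a \<Omega>" "\<And>k. k \<le> m ==> weak_nabla \<Omega> k u (v k)" by metis
  have d: "weak_nabla \<Omega> k (\<lambda>x. u x - f n x) (\<lambda>x. v k x - nabla k (f n) x)" if "k \<le> m" for k n
    by (rule weak_nabla_diff[OF open_dom v(2)[OF that] weak_nabla_test_function[OF open_dom f(1)]])
  have dl: "(\<lambda>x. v k x - nabla k (f n) x) \<in> LH p q a \<Omega>" if "k \<le> m" for k n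
    unfolding LH_iff
  proof
    have m: "v k \<in> meas" "nabla k (f n) \<in> meas" "Lq (v k) < \<infinity>" "Lq (nabla k (f n)) < \<infinity>"
      using v(1)[OF that] nabla_measurable_dom[OF f(1)] lpm_nabla_finite[OF f(1)] q_gt_1 by (auto simp: LH_iff)
    then show "(\<lambda>x. v k x - nabla k (f n) x) \<in> meas" by simp
    have "Lq (\<lambda>x. v k x - nabla k (f n) x) \<le> ennreal (2 powr q) * (Lq (v k) + Lq (nabla k (f n)))"
      using m q_gt_1 by (intro lpm_diff_le) auto
    also have "... < \<infinity>" using m by (simp add: ennreal_mult_less_top)
    finally show "Lq (\<lambda>x. v k x - nabla k (f n) x) < \<infinity>" .
  qed
  have lim: "(\<lambda>n. Lq (\<lambda>x. v k x - nabla k (f n) x)) \<longlonglongrightarrow> 0" if k: "k \<le> m" for k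
  proof -
    have "(\<lambda>n. nH (\<lambda>x. v k x - nabla k (f n) x)) \<longlonglongrightarrow> 0"
    proof (rule tendsto_sandwich[OF _ _ tendsto_const f(2)])
      show "\<forall>\<^sub>F n in sequentially. 0 \<le> nH (\<lambda>x. v k x - nabla k (f n) x)"
        using dl[OF k] by (intro always_eventually allI norm_H_nonneg) (auto simp: LH_iff)
      show "\<forall>\<^sub>F n in sequentially. nH (\<lambda>x. v k x - nabla k (f n) x) \<le> norm_WmH m p q a \<Omega> (\<lambda>x. u x - f n x)"
      proof (intro always_eventually allI)
        fix n
        have "nH (\<lambda>x. v k x - nabla k (f n) x) = nH (wnabla \<Omega> k (\<lambda>x. u x - f n x))"
          using wnabla_LH(4)[OF d[OF k] dl[OF k]] by simp
        also have "... \<le> norm_WmH m p q a \<Omega> (\<lambda>x. u x - f n x)"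
          unfolding norm_WmH_def
          by (rule member_le_sum) (use k norm_H_nonneg[OF wnabla_LH(1,2)[OF d dl]] in auto)
        finally show "nH (\<lambda>x. v k x - nabla k (f n) x) \<le> norm_WmH m p q a \<Omega> (\<lambda>x. u x - f n x)" .
      qed
    qed
    then show ?thesis using dl[OF k] by (subst (asm) norm_H_tendsto_0_iff) (auto simp: LH_iff)
  qed
  \<comment> \<open>The weak gradient of order zero is the function itself in the scalar component;
    uniqueness identifies it with the abstract witness \<open>v 0\<close>.\<close>
  have w0: "weak_nabla \<Omega> 0 u (\<lambda>x. (u x, 0))"
  proof -
    have "locally_integrable \<Omega> u" using v(2)[of 0] by (simp add: weak_nabla_def)
    moreover have "locally_integrable \<Omega> (\<lambda>x. (u x, 0::'a))"
      using u lpm_1_finite[OF u] by (intro locally_integrable_lpm[OF open_dom]) (auto simp: lpm_nabla_0)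
    moreover have "(LINT x|\<mu>. f x *\<^sub>R (u x, 0::'a)) = (-1) ^ 0 *\<^sub>R (LINT x|\<mu>. u x *\<^sub>R nabla 0 f x)" for f
      by (simp add: nabla_0 mult.commute)
    ultimately show ?thesis by (simp add: weak_nabla_def)
  qed
  have v0: "AE x in \<mu>. v 0 x = (u x, 0)" by (rule weak_nabla_unique[OF open_dom v(2) w0]) simp
  have 1: "(\<lambda>n. Lq (\<lambda>x. f n x - u x)) \<longlonglongrightarrow> 0"
  proof -
    have "Lq (\<lambda>x. v 0 x - nabla 0 (f n) x) = Lq (\<lambda>x. f n x - u x)" for n
    proof -
      have "Lq (\<lambda>x. v 0 x - nabla 0 (f n) x) = Lq (\<lambda>x. (u x - f n x, 0::'a))"
        using v0 by (intro lpm_cong_AE) (auto simp: nabla_0 elim!: eventually_mono)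
      then show ?thesis by (simp add: lpm_nabla_0 lpm_minus_commute[of \<mu> q u])
    qed
    then show ?thesis using lim[of 0] by simp
  qed
  note wm = wnabla_LH[OF v(2)[OF order_refl] v(1)[OF order_refl]]
  have 2: "(\<lambda>n. Lq (\<lambda>x. nabla m (f n) x - wnabla \<Omega> m u x)) \<longlonglongrightarrow> 0"
  proof -
    have "Lq (\<lambda>x. v m x - nabla m (f n) x) = Lq (\<lambda>x. nabla m (f n) x - wnabla \<Omega> m u x)" for n
    proof -
      have "Lq (\<lambda>x. v m x - nabla m (f n) x) = Lq (\<lambda>x. wnabla \<Omega> m u x - nabla m (f n) x)"
        using wm(3) by (intro lpm_cong_AE) (auto elim!: eventually_mono)
      then show ?thesis by (simp add: lpm_minus_commute[of \<mu> q "wnabla \<Omega> m u"])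
    qed
    then show ?thesis using lim[of m] by simp
  qed
  show ?thesis unfolding w0pair_def using u(1) wm(1) f(1) 1 2 by blast
qed

lemma weak_nabla_limit:
  assumes f: "\<And>n. weak_nabla \<Omega> k (f n) (g n)" "\<And>n. f n \<in> meas" "\<And>n. g n \<in> meas"
    and u: "u \<in> meas" "Lq u < \<infinity>" and v: "v \<in> meas" "Lq v < \<infinity>"
    and lim: "(\<lambda>n. Lq (\<lambda>x. f n x - u x)) \<longlonglongrightarrow> 0" "(\<lambda>n. Lq (\<lambda>x. g n x - v x)) \<longlonglongrightarrow> 0"
  shows "weak_nabla \<Omega> k u v"
  unfolding weak_nabla_def
proof (intro conjI ballI)
  show lu: "locally_integrable \<Omega> u" by (intro locally_integrable_lpm[OF open_dom] lpm_1_finite u)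
  show lv: "locally_integrable \<Omega> v" by (intro locally_integrable_lpm[OF open_dom] lpm_1_finite v)
  have lf: "locally_integrable \<Omega> (f n)" "locally_integrable \<Omega> (g n)" for n using f(1) by (auto simp: weak_nabla_def)
  fix \<phi> assume \<phi>: "\<phi> \<in> \<D>"
  obtain B L R where b: "0 \<le> B" "0 \<le> L" "\<And>x. \<bar>\<phi> x\<bar> \<le> B" "\<And>x y. \<bar>\<phi> x - \<phi> y\<bar> \<le> L * norm (x - y)" "\<And>x. x \<notin> cball 0 R ==> \<phi> x = 0"
    using test_function_bounds[OF \<phi>] by metis
  obtain B' where b': "0 \<le> B'" "\<And>x. norm (nabla k \<phi> x) \<le> B'" using nabla_bounded[OF \<phi>] by blast
  have l1: "(\<lambda>n. lpm \<mu> 1 (\<lambda>x. f n x - u x)) \<longlonglongrightarrow> 0" "(\<lambda>n. lpm \<mu> 1 (\<lambda>x. g n x - v x)) \<longlonglongrightarrow> 0"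
    using f u v q_gt_1 lim by (auto intro!: lpm_lower_exponent_tendsto[OF finite_measure_dom _ _ _ lim(1)] lpm_lower_exponent_tendsto[OF finite_measure_dom _ _ _ lim(2)])
  have "(\<lambda>n. LINT x|\<mu>. \<phi> x *\<^sub>R g n x) \<longlonglongrightarrow> (LINT x|\<mu>. \<phi> x *\<^sub>R v x)"
  proof (rule lint_lpm_1_tendsto[where B="\<lambda>v x. \<phi> x *\<^sub>R v" and C=B])
    show "linear (\<lambda>v. \<phi> x *\<^sub>R v)" for x by (intro linearI) (auto simp: scaleR_add_right)
  qed (use f u v b l1 lf lv \<phi> in \<open>auto intro!: test_function_mult_integrable[OF open_dom] mult_right_mono\<close>)
  moreover have "(\<lambda>n. LINT x|\<mu>. f n x *\<^sub>R nabla k \<phi> x) \<longlonglongrightarrow> (LINT x|\<mu>. u x *\<^sub>R nabla k \<phi> x)"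
  proof (rule lint_lpm_1_tendsto[where B="\<lambda>v x. v *\<^sub>R nabla k \<phi> x" and C=B'])
    show "linear (\<lambda>v. v *\<^sub>R nabla k \<phi> x)" for x by (intro linearI) (auto simp: scaleR_add_left)
    show "norm (v *\<^sub>R nabla k \<phi> x) \<le> B' * norm v" for x v
      using mult_left_mono[OF b'(2)[of x], of "\<bar>v\<bar>"] by (simp add: mult.commute)
  qed (use f u v b' l1 lf lu \<phi> in \<open>auto intro!: nabla_test_mult_integrable[OF open_dom]\<close>)
  then have "(\<lambda>n. (-1) ^ k *\<^sub>R (LINT x|\<mu>. f n x *\<^sub>R nabla k \<phi> x)) \<longlonglongrightarrow> (-1) ^ k *\<^sub>R (LINT x|\<mu>. u x *\<^sub>R nabla k \<phi> x)"
    by (intro tendsto_scaleR tendsto_const)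
  moreover have "(LINT x|\<mu>. \<phi> x *\<^sub>R g n x) = (-1) ^ k *\<^sub>R (LINT x|\<mu>. f n x *\<^sub>R nabla k \<phi> x)" for n
    using f(1) \<phi> by (simp add: weak_nabla_def)
  ultimately show "(LINT x|\<mu>. \<phi> x *\<^sub>R v x) = (-1) ^ k *\<^sub>R (LINT x|\<mu>. u x *\<^sub>R nabla k \<phi> x)"
    by (simp only: LIMSEQ_unique)
qed

text \<open>The Sobolev inequality applied to differences of the approximating test functions makes
  every intermediate gradient a Cauchy sequence. Completeness gives limits, and these are weak
  gradients of \<open>u\<close> by passing to the limit in the defining identity.\<close>

lemma w0pair_imp_W0mH:
  assumes "w0pair u g" shows "u \<in> W0mH m p q a \<Omega>" "AE x in \<mu>. wnabla \<Omega> m u x = g x"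
proof -
  note um = w0pair_measurable[OF assms] note uf = w0pair_finite[OF assms]
  have q0: "0 \<le> q" "0 < q" using q_gt_1 by auto
  obtain f where f: "\<And>n. f n \<in> \<D>" "(\<lambda>n. Lq (\<lambda>x. f n x - u x)) \<longlonglongrightarrow> 0" "(\<lambda>n. Lq (\<lambda>x. nabla m (f n) x - g x)) \<longlonglongrightarrow> 0"
    using assms by (auto simp: w0pair_def)
  note nm = nabla_measurable_dom[OF f(1)] note tm = test_measurable[OF f(1)]
  obtain C where C: "0 \<le> C"
    "\<And>\<psi> A k. \<psi> \<in> \<D> ==> 0 < A ==> k \<le> m ==> Lq (nabla m \<psi>) \<le> ennreal (A powr q) ==> Lq (nabla k \<psi>) \<le> ennreal (C * A powr q)"
    using test_sobolev by metis
  have nd: "(\<lambda>x. nabla k (f n) x - nabla k (f j) x) = nabla k (\<lambda>x. f n x - f j x)" for k n j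
    by (intro ext nabla_diff[symmetric] test_functions_smooth[OF f(1)])
  have "\<exists>v. v \<in> meas \<and> (\<lambda>n. Lq (\<lambda>x. nabla k (f n) x - v x)) \<longlonglongrightarrow> 0" if k: "k \<le> m" for k
  proof -
    have "\<exists>N. \<forall>n\<ge>N. \<forall>j\<ge>N. Lq (\<lambda>x. nabla k (f n) x - nabla k (f j) x) \<le> ennreal e" if e: "0 < e" for e
    proof -
      define d where "d = e / (C + 1)"
      have d: "0 < d" "C * d \<le> e" using e C by (auto simp: d_def field_simps)
      obtain N where N: "\<And>n j. N \<le> n ==> N \<le> j ==> Lq (\<lambda>x. nabla m (f n) x - nabla m (f j) x) \<le> ennreal d"
        using lpm_tendsto_cauchy[OF nm um(2) q0(2) f(3) d(1)] by blast
      have "Lq (\<lambda>x. nabla k (f n) x - nabla k (f j) x) \<le> ennreal e" if "N \<le> n" "N \<le> j" for n j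
      proof -
        have "(d powr (1 / q)) powr q = d" using d q0 by (simp add: powr_powr)
        then have "Lq (nabla k (\<lambda>x. f n x - f j x)) \<le> ennreal (C * d)"
          using C(2)[OF test_functions_diff[OF f(1) f(1)] _ k, of "d powr (1 / q)" n j] N[OF that] d by (simp add: nd)
        also have "... \<le> ennreal e" using d by (intro ennreal_leI)
        finally show ?thesis by (simp add: nd)
      qed
      then show ?thesis by blast
    qed
    then show ?thesis
    proof (rule lpm_complete[OF nm q0(2)])
      fix g' :: "'a => real \<times> 'a" assume "g' \<in> meas" "(\<lambda>n. Lq (\<lambda>x. nabla k (f n) x - g' x)) \<longlonglongrightarrow> 0"
      then show ?thesis by (intro exI[of _ g'] conjI)
    qed
  qed
  then have "\<forall>k. \<exists>v. k \<le> m \<longrightarrow> v \<in> meas \<and> (\<lambda>n. Lq (\<lambda>x. nabla k (f n) x - v x)) \<longlonglongrightarrow> 0" by blast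
  from choice[OF this] obtain v where v: "\<And>k. k \<le> m ==> v k \<in> meas" "\<And>k. k \<le> m ==> (\<lambda>n. Lq (\<lambda>x. nabla k (f n) x - v k x)) \<longlonglongrightarrow> 0"
    by blast
  have vf: "Lq (v k) < \<infinity>" if "k \<le> m" for k
    by (rule lpm_limit_finite[OF nm v(1)[OF that] v(2)[OF that] lpm_nabla_finite[OF f(1) q0(1)]])
  have w: "weak_nabla \<Omega> k u (v k)" if k: "k \<le> m" for k
    by (rule weak_nabla_limit[OF weak_nabla_test_function[OF open_dom f(1)] tm nm um(1) uf(1) v(1)[OF k] vf[OF k] f(2) v(2)[OF k]])
  have LHv: "v k \<in> LH p q a \<Omega>" if "k \<le> m" for k using v vf that by (simp add: LH_iff)
  have W: "u \<in> WmH m p q a \<Omega>"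
  proof -
    have "u \<in> LH p q a \<Omega>" using um uf by (simp add: LH_iff)
    then show ?thesis unfolding WmH_def using w LHv by blast
  qed
  have d: "weak_nabla \<Omega> k (\<lambda>x. u x - f n x) (\<lambda>x. v k x - nabla k (f n) x)" if "k \<le> m" for k n
    by (rule weak_nabla_diff[OF open_dom w[OF that] weak_nabla_test_function[OF open_dom f(1)]])
  have dm: "(\<lambda>x. v k x - nabla k (f n) x) \<in> meas" if "k \<le> m" for k n
    using v(1)[OF that] nm by simp
  have df: "Lq (\<lambda>x. v k x - nabla k (f n) x) < \<infinity>" if "k \<le> m" for k n
  proof -
    have "Lq (\<lambda>x. v k x - nabla k (f n) x) \<le> ennreal (2 powr q) * (Lq (v k) + Lq (nabla k (f n)))"
      using v(1)[OF that] nm q0 by (intro lpm_diff_le) auto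
    also have "... < \<infinity>" using vf[OF that] lpm_nabla_finite[OF f(1) q0(1)] by (simp add: ennreal_mult_less_top)
    finally show ?thesis .
  qed
  have "(\<lambda>n. nH (wnabla \<Omega> k (\<lambda>x. u x - f n x))) \<longlonglongrightarrow> 0" if k: "k \<le> m" for k
  proof -
    have "(\<lambda>n. Lq (\<lambda>x. v k x - nabla k (f n) x)) \<longlonglongrightarrow> 0"
      using v(2)[OF k] by (simp add: lpm_minus_commute[of \<mu> q "v k"])
    then have "(\<lambda>n. nH (\<lambda>x. v k x - nabla k (f n) x)) \<longlonglongrightarrow> 0"
      by (subst norm_H_tendsto_0_iff[OF dm[OF k] df[OF k]])
    moreover have "nH (wnabla \<Omega> k (\<lambda>x. u x - f n x)) = nH (\<lambda>x. v k x - nabla k (f n) x)" for n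
      using dm[OF k] df[OF k] by (intro wnabla_LH(4)[OF d[OF k]]) (simp add: LH_iff)
    ultimately show ?thesis by simp
  qed
  then have "(\<lambda>n. norm_WmH m p q a \<Omega> (\<lambda>x. u x - f n x)) \<longlonglongrightarrow> (\<Sum>k\<le>m. 0)"
    unfolding norm_WmH_def by (intro tendsto_sum) auto
  then have "\<exists>f :: nat => 'a => real. (\<forall>n. f n \<in> \<D>) \<and> (\<lambda>n. norm_WmH m p q a \<Omega> (\<lambda>x. u x - f n x)) \<longlonglongrightarrow> 0"
    using f(1) by (intro exI[of _ f]) auto
  with W show "u \<in> W0mH m p q a \<Omega>" by (simp add: W0mH_def)
  have "AE x in \<mu>. wnabla \<Omega> m u x = v m x" by (rule wnabla_LH(3)[OF w[OF order_refl] LHv[OF order_refl]])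
  moreover have "AE x in \<mu>. v m x = g x"
    by (rule lpm_tendsto_unique[OF nm v(1)[OF order_refl] um(2) q0(2) v(2)[OF order_refl] f(3)])
  ultimately show "AE x in \<mu>. wnabla \<Omega> m u x = g x" by eventually_elim simp
qed

end

section \<open>Linearity, closedness, embedding and compactness for pairs\<close>

context double_phase
begin

lemma w0pair_test: "f \<in> \<D> ==> w0pair f (nabla m f)"
  unfolding w0pair_def
  by (intro conjI test_measurable nabla_measurable_dom exI[of _ "\<lambda>_. f"]) (auto simp: lpm_def)

lemma w0pair_add:
  assumes "w0pair u g" "w0pair u' g'"
  shows "w0pair (\<lambda>x. u x + u' x) (\<lambda>x. g x + g' x)"
proof -
  obtain \<phi> where \<phi>: "\<And>n. \<phi> n \<in> \<D>" "(\<lambda>n. Lq (\<lambda>x. \<phi> n x - u x)) \<longlonglongrightarrow> 0" "(\<lambda>n. Lq (\<lambda>x. nabla m (\<phi> n) x - g x)) \<longlonglongrightarrow> 0"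
    using assms(1) by (auto simp: w0pair_def)
  obtain \<psi> where \<psi>: "\<And>n. \<psi> n \<in> \<D>" "(\<lambda>n. Lq (\<lambda>x. \<psi> n x - u' x)) \<longlonglongrightarrow> 0" "(\<lambda>n. Lq (\<lambda>x. nabla m (\<psi> n) x - g' x)) \<longlonglongrightarrow> 0"
    using assms(2) by (auto simp: w0pair_def)
  note m = w0pair_measurable[OF assms(1)] w0pair_measurable[OF assms(2)]
  have sum: "(\<lambda>n. Lq (\<lambda>x. (f n x + f' n x) - (h x + h' x))) \<longlonglongrightarrow> 0"
    if "\<And>n. f n \<in> meas" "\<And>n. f' n \<in> meas" "h \<in> meas" "h' \<in> meas"
      "(\<lambda>n. Lq (\<lambda>x. f n x - h x)) \<longlonglongrightarrow> 0" "(\<lambda>n. Lq (\<lambda>x. f' n x - h' x)) \<longlonglongrightarrow> 0"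
    for f f' :: "nat => 'a => 'b::euclidean_space" and h h'
  proof (rule tendsto_sandwich[OF _ _ tendsto_const])
    have "(\<lambda>n. ennreal (2 powr q) * (Lq (\<lambda>x. f n x - h x) + Lq (\<lambda>x. f' n x - h' x))) \<longlonglongrightarrow> ennreal (2 powr q) * (0 + 0)"
      using that by (intro ennreal_tendsto_cmult tendsto_add) auto
    then show "(\<lambda>n. ennreal (2 powr q) * (Lq (\<lambda>x. f n x - h x) + Lq (\<lambda>x. f' n x - h' x))) \<longlonglongrightarrow> 0" by simp
    have "Lq (\<lambda>x. (f n x + f' n x) - (h x + h' x)) \<le> ennreal (2 powr q) * (Lq (\<lambda>x. f n x - h x) + Lq (\<lambda>x. f' n x - h' x))" for n
      using lpm_add_le[of q "\<lambda>x. f n x - h x" \<mu> "\<lambda>x. f' n x - h' x"] that q_gt_1 by (simp add: algebra_simps)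
    then show "\<forall>\<^sub>F n in sequentially. Lq (\<lambda>x. (f n x + f' n x) - (h x + h' x)) \<le> ennreal (2 powr q) * (Lq (\<lambda>x. f n x - h x) + Lq (\<lambda>x. f' n x - h' x))"
      by simp
  qed simp
  have "nabla m (\<lambda>x. \<phi> n x + \<psi> n x) = (\<lambda>x. nabla m (\<phi> n) x + nabla m (\<psi> n) x)" for n
    by (intro ext nabla_add test_functions_smooth[OF \<phi>(1)] test_functions_smooth[OF \<psi>(1)])
  then have "(\<lambda>n. Lq (\<lambda>x. nabla m (\<lambda>x. \<phi> n x + \<psi> n x) x - (g x + g' x))) \<longlonglongrightarrow> 0"
    using sum[OF nabla_measurable_dom[OF \<phi>(1)] nabla_measurable_dom[OF \<psi>(1)] m(2) m(4) \<phi>(3) \<psi>(3)] by simp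
  moreover have "(\<lambda>n. Lq (\<lambda>x. (\<phi> n x + \<psi> n x) - (u x + u' x))) \<longlonglongrightarrow> 0"
    by (rule sum[OF test_measurable[OF \<phi>(1)] test_measurable[OF \<psi>(1)] m(1) m(3) \<phi>(2) \<psi>(2)])
  ultimately show ?thesis
    unfolding w0pair_def using m by (intro conjI exI[of _ "\<lambda>n x. \<phi> n x + \<psi> n x"] allI test_functions_add \<phi>(1) \<psi>(1)) auto
qed

lemma w0pair_cmult:
  assumes "w0pair u g"
  shows "w0pair (\<lambda>x. c * u x) (\<lambda>x. c *\<^sub>R g x)"
proof -
  obtain \<phi> where \<phi>: "\<And>n. \<phi> n \<in> \<D>" "(\<lambda>n. Lq (\<lambda>x. \<phi> n x - u x)) \<longlonglongrightarrow> 0" "(\<lambda>n. Lq (\<lambda>x. nabla m (\<phi> n) x - g x)) \<longlonglongrightarrow> 0"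
    using assms by (auto simp: w0pair_def)
  note m = w0pair_measurable[OF assms]
  have sc: "(\<lambda>n. Lq (\<lambda>x. c *\<^sub>R f n x - c *\<^sub>R h x)) \<longlonglongrightarrow> 0"
    if "\<And>n. f n \<in> meas" "h \<in> meas" "(\<lambda>n. Lq (\<lambda>x. f n x - h x)) \<longlonglongrightarrow> 0"
    for f :: "nat => 'a => 'b::euclidean_space" and h
  proof -
    have "Lq (\<lambda>x. c *\<^sub>R f n x - c *\<^sub>R h x) = ennreal (\<bar>c\<bar> powr q) * Lq (\<lambda>x. f n x - h x)" for n
      using lpm_cmult[of "\<lambda>x. f n x - h x" \<mu> q c] that by (simp add: scaleR_diff_right)
    moreover have "(\<lambda>n. ennreal (\<bar>c\<bar> powr q) * Lq (\<lambda>x. f n x - h x)) \<longlonglongrightarrow> ennreal (\<bar>c\<bar> powr q) * 0"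
      using that by (intro ennreal_tendsto_cmult) auto
    ultimately show ?thesis by simp
  qed
  have "nabla m (\<lambda>x. c * \<phi> n x) = (\<lambda>x. c *\<^sub>R nabla m (\<phi> n) x)" for n
    by (intro ext nabla_cmult test_functions_smooth[OF \<phi>(1)])
  then have "(\<lambda>n. Lq (\<lambda>x. nabla m (\<lambda>x. c * \<phi> n x) x - c *\<^sub>R g x)) \<longlonglongrightarrow> 0"
    using sc[OF nabla_measurable_dom[OF \<phi>(1)] m(2) \<phi>(3)] by simp
  moreover have "(\<lambda>n. Lq (\<lambda>x. c * \<phi> n x - c * u x)) \<longlonglongrightarrow> 0"
    using sc[OF test_measurable[OF \<phi>(1)] m(1) \<phi>(2)] by simp
  ultimately show ?thesis
    unfolding w0pair_def using m by (intro conjI exI[of _ "\<lambda>n x. c * \<phi> n x"] allI test_functions_cmult \<phi>(1)) auto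
qed

lemma w0pair_approx:
  assumes "w0pair u g" "0 < e"
  obtains f where "f \<in> \<D>" "Lq (\<lambda>x. f x - u x) < ennreal e" "Lq (\<lambda>x. nabla m f x - g x) < ennreal e"
proof -
  obtain f where f: "\<And>n. f n \<in> \<D>" "(\<lambda>n. Lq (\<lambda>x. f n x - u x)) \<longlonglongrightarrow> 0" "(\<lambda>n. Lq (\<lambda>x. nabla m (f n) x - g x)) \<longlonglongrightarrow> 0"
    using assms(1) by (auto simp: w0pair_def)
  have "\<forall>\<^sub>F n in sequentially. Lq (\<lambda>x. f n x - u x) < ennreal e \<and> Lq (\<lambda>x. nabla m (f n) x - g x) < ennreal e"
    using order_tendstoD(2)[OF f(2), of "ennreal e"] order_tendstoD(2)[OF f(3), of "ennreal e"] assms(2)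
    by (intro eventually_conj) auto
  then obtain n where "Lq (\<lambda>x. f n x - u x) < ennreal e \<and> Lq (\<lambda>x. nabla m (f n) x - g x) < ennreal e"
    by (auto simp: eventually_sequentially)
  then show ?thesis using that f(1) by blast
qed

lemma lpm_tendsto_triangle:
  fixes f h :: "nat => 'a => 'b::euclidean_space"
  assumes "\<And>n. f n \<in> meas" "\<And>n. h n \<in> meas" "g \<in> meas"
    and "(\<lambda>n. Lq (\<lambda>x. f n x - h n x)) \<longlonglongrightarrow> 0" "(\<lambda>n. Lq (\<lambda>x. h n x - g x)) \<longlonglongrightarrow> 0"
  shows "(\<lambda>n. Lq (\<lambda>x. f n x - g x)) \<longlonglongrightarrow> 0"
proof (rule tendsto_sandwich[OF _ _ tendsto_const])
  have "(\<lambda>n. ennreal (2 powr q) * (Lq (\<lambda>x. f n x - h n x) + Lq (\<lambda>x. h n x - g x))) \<longlonglongrightarrow> ennreal (2 powr q) * (0 + 0)"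
    using assms by (intro ennreal_tendsto_cmult tendsto_add) auto
  then show "(\<lambda>n. ennreal (2 powr q) * (Lq (\<lambda>x. f n x - h n x) + Lq (\<lambda>x. h n x - g x))) \<longlonglongrightarrow> 0" by simp
  show "\<forall>\<^sub>F n in sequentially. Lq (\<lambda>x. f n x - g x) \<le> ennreal (2 powr q) * (Lq (\<lambda>x. f n x - h n x) + Lq (\<lambda>x. h n x - g x))"
    using assms q_gt_1 by (intro always_eventually allI lpm_triangle_le) auto
qed simp

lemma ennreal_less_inverse_tendsto_0:
  assumes "\<And>n. X n < ennreal (1 / real (Suc n))" shows "X \<longlonglongrightarrow> 0"
proof (rule tendsto_sandwich[OF _ _ tendsto_const])
  have "(\<lambda>n. ennreal (1 / real (Suc n))) \<longlonglongrightarrow> ennreal 0"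
    by (intro tendsto_ennrealI LIMSEQ_Suc lim_1_over_n)
  then show "(\<lambda>n. ennreal (1 / real (Suc n))) \<longlonglongrightarrow> 0" by simp
  show "\<forall>\<^sub>F n in sequentially. X n \<le> ennreal (1 / real (Suc n))"
    by (intro always_eventually allI less_imp_le assms)
qed simp

lemma w0pair_approx_seq:
  assumes "\<And>n. w0pair (u n) (g n)"
  obtains f where "\<And>n. f n \<in> \<D>" "\<And>n. Lq (\<lambda>x. f n x - u n x) < ennreal (1 / real (Suc n))"
    "\<And>n. Lq (\<lambda>x. nabla m (f n) x - g n x) < ennreal (1 / real (Suc n))"
proof -
  have "\<exists>f. f \<in> \<D> \<and> Lq (\<lambda>x. f x - u n x) < ennreal (1 / real (Suc n)) \<and>
      Lq (\<lambda>x. nabla m f x - g n x) < ennreal (1 / real (Suc n))" for n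
  proof -
    have "0 < 1 / real (Suc n)" by simp
    then obtain f where "f \<in> \<D>" "Lq (\<lambda>x. f x - u n x) < ennreal (1 / real (Suc n))"
      "Lq (\<lambda>x. nabla m f x - g n x) < ennreal (1 / real (Suc n))"
      by (rule w0pair_approx[OF assms])
    then show ?thesis by (intro exI[of _ f] conjI)
  qed
  then have "\<forall>n. \<exists>f. f \<in> \<D> \<and> Lq (\<lambda>x. f x - u n x) < ennreal (1 / real (Suc n)) \<and>
      Lq (\<lambda>x. nabla m f x - g n x) < ennreal (1 / real (Suc n))" ..
  from choice[OF this] show ?thesis using that by blast
qed

lemma w0pair_closed:
  assumes p: "\<And>n. w0pair (u n) (g n)" and u: "v \<in> meas" and g: "h \<in> meas"
    and lim: "(\<lambda>n. Lq (\<lambda>x. u n x - v x)) \<longlonglongrightarrow> 0" "(\<lambda>n. Lq (\<lambda>x. g n x - h x)) \<longlonglongrightarrow> 0"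
  shows "w0pair v h"
proof -
  obtain f where f: "\<And>n. f n \<in> \<D>" "\<And>n. Lq (\<lambda>x. f n x - u n x) < ennreal (1 / real (Suc n))"
    "\<And>n. Lq (\<lambda>x. nabla m (f n) x - g n x) < ennreal (1 / real (Suc n))"
    using w0pair_approx_seq[of u g, OF p] by blast
  have "(\<lambda>n. Lq (\<lambda>x. f n x - v x)) \<longlonglongrightarrow> 0"
    by (rule lpm_tendsto_triangle[OF test_measurable[OF f(1)] w0pair_measurable(1)[OF p] u ennreal_less_inverse_tendsto_0[OF f(2)] lim(1)])
  moreover have "(\<lambda>n. Lq (\<lambda>x. nabla m (f n) x - h x)) \<longlonglongrightarrow> 0"
    by (rule lpm_tendsto_triangle[OF nabla_measurable_dom[OF f(1)] w0pair_measurable(2)[OF p] g ennreal_less_inverse_tendsto_0[OF f(3)] lim(2)])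
  ultimately show ?thesis unfolding w0pair_def using f(1) u g by blast
qed

text \<open>The inequality for test functions passes to limits by Fatou's lemma along an almost
  everywhere convergent subsequence.\<close>

lemma w0pair_sobolev:
  obtains C where "0 \<le> C" "\<And>u g A. w0pair u g ==> 0 < A ==> Lq g \<le> ennreal (A powr q) ==> lpm \<mu> s u \<le> ennreal (C * A powr s)"
    "\<And>u g A. w0pair u g ==> 0 < A ==> Lq g \<le> ennreal (A powr q) ==> Lq u \<le> ennreal (C * A powr q)"
proof -
  obtain C where C: "0 \<le> C"
    "\<And>\<psi> A. \<psi> \<in> \<D> ==> 0 < A ==> Lq (nabla m \<psi>) \<le> ennreal (A powr q) ==> lpm \<mu> s \<psi> \<le> ennreal (C * A powr s)"
    "\<And>\<psi> A k. \<psi> \<in> \<D> ==> 0 < A ==> k \<le> m ==> Lq (nabla m \<psi>) \<le> ennreal (A powr q) ==> Lq (nabla k \<psi>) \<le> ennreal (C * A powr q)"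
    using test_sobolev by metis
  have C0: "Lq \<psi> \<le> ennreal (C * A powr q)" if "\<psi> \<in> \<D>" "0 < A" "Lq (nabla m \<psi>) \<le> ennreal (A powr q)" for \<psi> A
    using C(3)[OF that(1,2) _ that(3), of 0] by (simp add: nabla_0[abs_def] lpm_nabla_0)
  \<comment> \<open>The approximating gradients eventually satisfy the hypothesis with 4A in place
    of A, because the inequality for sums costs 2^q and two terms are added; the constant absorbs
    the factor 4.\<close>
  define C' where "C' = C * 4 powr s + C * 4 powr q"
  have q0: "0 < q" "0 < s" using q_gt_1 q_less_s by auto
  have main: "lpm \<mu> s u \<le> ennreal (C' * A powr s) \<and> Lq u \<le> ennreal (C' * A powr q)"
    if p: "w0pair u g" and A: "0 < A" and le: "Lq g \<le> ennreal (A powr q)" for u g A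
  proof -
    note m = w0pair_measurable[OF p]
    obtain f where f: "\<And>n. f n \<in> \<D>" "(\<lambda>n. Lq (\<lambda>x. f n x - u x)) \<longlonglongrightarrow> 0" "(\<lambda>n. Lq (\<lambda>x. nabla m (f n) x - g x)) \<longlonglongrightarrow> 0"
      using p by (auto simp: w0pair_def)
    obtain r where r: "strict_mono (r :: nat => nat)" "AE x in \<mu>. (\<lambda>n. f (r n) x) \<longlonglongrightarrow> u x"
      using lpm_tendsto_AE_subseq[OF test_measurable[OF f(1)] m(1) q0(1) f(2)] by metis
    have "\<forall>\<^sub>F n in sequentially. Lq (\<lambda>x. nabla m (f n) x - g x) < ennreal (A powr q)"
      using order_tendstoD(2)[OF f(3), of "ennreal (A powr q)"] A by simp
    then have "\<forall>\<^sub>F n in sequentially. Lq (\<lambda>x. nabla m (f (r n)) x - g x) < ennreal (A powr q)"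
      using eventually_compose_filterlim[OF _ filterlim_subseq[OF r(1)]] by blast
    then have ev: "\<forall>\<^sub>F n in sequentially. lpm \<mu> s (f (r n)) \<le> ennreal (C' * A powr s) \<and> Lq (f (r n)) \<le> ennreal (C' * A powr q)"
    proof eventually_elim
      case (elim n)
      have "Lq (nabla m (f (r n))) \<le> ennreal (2 powr q) * (Lq (\<lambda>x. nabla m (f (r n)) x - g x) + Lq g)"
        using lpm_add_le[of q "\<lambda>x. nabla m (f (r n)) x - g x" \<mu> g] nabla_measurable_dom[OF f(1)] m q0 by simp
      also have "... \<le> ennreal (2 powr q) * (ennreal (A powr q) + ennreal (A powr q))"
        using elim le by (intro mult_left_mono add_mono) auto
      also have "... = ennreal (2 powr q * (2 * A powr q))"
        by (simp add: ennreal_mult[symmetric] ennreal_plus[symmetric] del: ennreal_plus)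
      also have "... \<le> ennreal ((4 * A) powr q)"
      proof (rule ennreal_leI)
        have "2 powr 1 \<le> 2 powr q" using q_gt_1 by (intro powr_mono) auto
        then have "2 powr q * (2 * A powr q) \<le> 2 powr q * (2 powr q * A powr q)"
          by (intro mult_left_mono mult_right_mono) auto
        also have "... = (2 * (2 * A)) powr q" by (simp only: powr_mult)
        finally show "2 powr q * (2 * A powr q) \<le> (4 * A) powr q" by simp
      qed
      finally have le4: "Lq (nabla m (f (r n))) \<le> ennreal ((4 * A) powr q)" .
      have A4: "0 < 4 * A" using A by simp
      have *: "C * (4 * A) powr s \<le> C' * A powr s" "C * (4 * A) powr q \<le> C' * A powr q"
        using C(1) by (auto simp: C'_def powr_mult distrib_right)
      then show ?case
        using order_trans[OF C(2)[OF f(1) A4 le4] ennreal_leI[OF *(1)]] order_trans[OF C0[OF f(1) A4 le4] ennreal_leI[OF *(2)]] by blast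
    qed
    show ?thesis
      using ev by (intro conjI lpm_fatou[OF test_measurable[OF f(1)] m(1) r(2) q0(1)] lpm_fatou[OF test_measurable[OF f(1)] m(1) r(2) q0(2)])
        (auto elim: eventually_mono)
  qed
  have "0 \<le> C'" using C by (simp add: C'_def)
  then show ?thesis using that main by blast
qed

lemma w0pair_lpm_finite:
  assumes "w0pair u g" "0 \<le> k" "k \<le> s" shows "lpm \<mu> k u < \<infinity>"
proof -
  obtain C where C: "0 \<le> C" "\<And>u g A. w0pair u g ==> 0 < A ==> Lq g \<le> ennreal (A powr q) ==> lpm \<mu> s u \<le> ennreal (C * A powr s)"
    "\<And>u g A. w0pair u g ==> 0 < A ==> Lq g \<le> ennreal (A powr q) ==> Lq u \<le> ennreal (C * A powr q)"
    by (rule w0pair_sobolev) blast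
  obtain A where "0 < A" "Lq g \<le> ennreal (A powr q)" using finite_lpm_bound[OF w0pair_finite(2)[OF assms(1)]] .
  then have "lpm \<mu> s u \<le> ennreal (C * A powr s)" using C(2)[OF assms(1)] by blast
  then have "lpm \<mu> s u < \<infinity>" by (rule order.strict_trans1) simp
  then show ?thesis
    by (rule lpm_lower_exponent_finite[OF finite_measure_dom w0pair_measurable(1)[OF assms(1)] assms(2,3)])
qed

text \<open>The pairs are replaced by nearby test functions, for which Rellich's theorem gives
  \<open>L^1\<close> convergence; interpolation against the uniform \<open>L^s\<close> bound raises
  the exponent. That the limit has a gradient is not claimed here; it comes with lower
  semicontinuity.\<close>

lemma w0pair_compact:
  assumes p: "\<And>n. w0pair (u n) (g n)" and B: "\<And>n. Lq (g n) \<le> ennreal B" "0 \<le> B"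
  obtains v r where "v \<in> meas" "strict_mono (r :: nat => nat)" "AE x in \<mu>. (\<lambda>n. u (r n) x) \<longlonglongrightarrow> v x"
    "lpm \<mu> s v < \<infinity>" "\<And>\<sigma>. 1 \<le> \<sigma> ==> \<sigma> < s ==> (\<lambda>n. lpm \<mu> \<sigma> (\<lambda>x. u (r n) x - v x)) \<longlonglongrightarrow> 0"
proof -
  have q0: "0 < q" "0 < s" "0 \<le> q" "1 \<le> q" "1 \<le> s" using q_gt_1 q_less_s by auto
  obtain \<phi> where \<phi>: "\<And>n. \<phi> n \<in> \<D>" "\<And>n. Lq (\<lambda>x. \<phi> n x - u n x) < ennreal (1 / real (Suc n))"
    "\<And>n. Lq (\<lambda>x. nabla m (\<phi> n) x - g n x) < ennreal (1 / real (Suc n))"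
    using w0pair_approx_seq[of u g, OF p] by blast
  note um = w0pair_measurable[OF p]
  \<comment> \<open>The factor for sums applied to a distance of at most 1 and the bound
    \<open>B\<close>.\<close>
  define A where "A = (2 powr q * (1 + B)) powr (1 / q)"
  have A: "0 < A" "A powr q = 2 powr q * (1 + B)" using B q0 by (auto simp: A_def powr_powr)
  have mA: "Lq (nabla m (\<phi> n)) \<le> ennreal (A powr q)" for n
  proof -
    have "Lq (nabla m (\<phi> n)) \<le> ennreal (2 powr q) * (Lq (\<lambda>x. nabla m (\<phi> n) x - g n x) + Lq (g n))"
      using lpm_add_le[of q "\<lambda>x. nabla m (\<phi> n) x - g n x" \<mu> "g n"] nabla_measurable_dom[OF \<phi>(1)] um q0 by simp
    also have "... \<le> ennreal (2 powr q) * (ennreal 1 + ennreal B)"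
    proof (intro mult_left_mono add_mono B)
      have "Lq (\<lambda>x. nabla m (\<phi> n) x - g n x) \<le> ennreal (1 / real (Suc n))" using \<phi>(3) less_imp_le by blast
      also have "... \<le> ennreal 1" by (intro ennreal_leI) simp
      finally show "Lq (\<lambda>x. nabla m (\<phi> n) x - g n x) \<le> ennreal 1" .
    qed simp
    also have "... = ennreal (A powr q)" using B(2) unfolding A(2) by (simp add: ennreal_mult)
    finally show ?thesis .
  qed
  obtain C where C: "0 \<le> C"
    "\<And>\<psi> A. \<psi> \<in> \<D> ==> 0 < A ==> Lq (nabla m \<psi>) \<le> ennreal (A powr q) ==> lpm \<mu> s \<psi> \<le> ennreal (C * A powr s)"
    "\<And>\<psi> A k. \<psi> \<in> \<D> ==> 0 < A ==> k \<le> m ==> Lq (nabla m \<psi>) \<le> ennreal (A powr q) ==> Lq (nabla k \<psi>) \<le> ennreal (C * A powr q)"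
    using test_sobolev by metis
  obtain V where V: "0 \<le> V" "emeasure \<mu> (space \<mu>) = ennreal V" by (rule emeasure_dom)
  \<comment> \<open>Since m is at least 1, the Sobolev inequality controls the first-order gradient;
    finite measure turns the q-th power bound into an \<open>L^1\<close> bound.\<close>
  have grad: "(\<integral>\<^sup>+x. ennreal (norm (nabla 1 (\<phi> n) x)) \<partial>lborel) \<le> ennreal (V + C * A powr q)" for n
  proof -
    have "(\<integral>\<^sup>+x. ennreal (norm (nabla 1 (\<phi> n) x)) \<partial>lborel) = lpm \<mu> 1 (nabla 1 (\<phi> n))"
      by (simp add: lpm_nabla[OF open_dom \<phi>(1)])
    also have "... \<le> ennreal (1 powr 1) * emeasure \<mu> (space \<mu>) + ennreal (1 powr (1 - q)) * Lq (nabla 1 (\<phi> n))"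
      using q0 by (intro lpm_lower_exponent_le nabla_measurable_dom \<phi>(1)) auto
    also have "... \<le> ennreal V + ennreal (C * A powr q)"
      using C(3)[OF \<phi>(1) A(1) m_ge_1 mA] V by (simp add: add_left_mono)
    also have "... = ennreal (V + C * A powr q)" using V C(1) by simp
    finally show ?thesis .
  qed
  obtain r1 where r1: "strict_mono (r1 :: nat => nat)"
    "\<And>e. 0 < e ==> \<exists>N. \<forall>n\<ge>N. \<forall>k\<ge>N. lpm \<mu> 1 (\<lambda>x. \<phi> (r1 n) x - \<phi> (r1 k) x) \<le> ennreal e"
  proof (rule rellich_L1[where f=\<phi>, OF open_dom bounded_dom dim_ge_2 \<phi>(1) grad])
    show "0 \<le> V + C * A powr q" using V C(1) by simp
  qed blast
  obtain v r2 where v: "v \<in> meas" "strict_mono (r2 :: nat => nat)" "AE x in \<mu>. (\<lambda>n. \<phi> (r1 (r2 n)) x) \<longlonglongrightarrow> v x"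
    "(\<lambda>n. lpm \<mu> 1 (\<lambda>x. \<phi> (r1 n) x - v x)) \<longlonglongrightarrow> 0"
    using lpm_complete[of "\<lambda>n. \<phi> (r1 n)" \<mu> 1, OF test_measurable[OF \<phi>(1)] zero_less_one r1(2)] by blast
  have vs: "lpm \<mu> s v \<le> ennreal (C * A powr s)"
    using C(2)[OF \<phi>(1) A(1) mA] by (intro lpm_fatou[OF test_measurable[OF \<phi>(1)] v(1) v(3) q0(2)]) simp
  have vfin: "lpm \<mu> s v < \<infinity>" using vs by (rule order.strict_trans1) simp
  obtain Cs where Cs: "0 \<le> Cs" "\<And>u g A. w0pair u g ==> 0 < A ==> Lq g \<le> ennreal (A powr q) ==> lpm \<mu> s u \<le> ennreal (Cs * A powr s)"
    "\<And>u g A. w0pair u g ==> 0 < A ==> Lq g \<le> ennreal (A powr q) ==> Lq u \<le> ennreal (Cs * A powr q)"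
    by (rule w0pair_sobolev) blast
  have us: "lpm \<mu> s (u n) \<le> ennreal (Cs * A powr s)" for n
  proof -
    have "1 * B \<le> 2 powr q * (1 + B)"
      using B q0 ge_one_powr_ge_zero[of 2 q] by (intro mult_mono) auto
    then have "Lq (g n) \<le> ennreal (A powr q)" using B(1)[of n] A(2) by (auto intro: order_trans ennreal_leI)
    then show ?thesis by (rule Cs(2)[OF p A(1)])
  qed
  have uv1: "(\<lambda>n. lpm \<mu> 1 (\<lambda>x. u (r1 n) x - v x)) \<longlonglongrightarrow> 0"
  proof -
    have "(\<lambda>n. Lq (\<lambda>x. \<phi> n x - u n x)) \<longlonglongrightarrow> 0" by (rule ennreal_less_inverse_tendsto_0[OF \<phi>(2)])
    then have "(\<lambda>n. lpm \<mu> 1 (\<lambda>x. \<phi> n x - u n x)) \<longlonglongrightarrow> 0"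
      using test_measurable[OF \<phi>(1)] um q0 by (intro lpm_lower_exponent_tendsto[OF finite_measure_dom, of _ 1 q]) auto
    then have 1: "(\<lambda>n. lpm \<mu> 1 (\<lambda>x. \<phi> (r1 n) x - u (r1 n) x)) \<longlonglongrightarrow> 0"
      using LIMSEQ_subseq_LIMSEQ[OF _ r1(1), of "\<lambda>n. lpm \<mu> 1 (\<lambda>x. \<phi> n x - u n x)"] by (simp add: o_def)
    have "(\<lambda>n. ennreal (2 powr 1) * (lpm \<mu> 1 (\<lambda>x. \<phi> (r1 n) x - u (r1 n) x) + lpm \<mu> 1 (\<lambda>x. \<phi> (r1 n) x - v x))) \<longlonglongrightarrow> ennreal (2 powr 1) * (0 + 0)"
      by (intro ennreal_tendsto_cmult tendsto_add 1 v(4)) auto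
    then have 2: "(\<lambda>n. ennreal (2 powr 1) * (lpm \<mu> 1 (\<lambda>x. \<phi> (r1 n) x - u (r1 n) x) + lpm \<mu> 1 (\<lambda>x. \<phi> (r1 n) x - v x))) \<longlonglongrightarrow> 0" by simp
    have "lpm \<mu> 1 (\<lambda>x. u (r1 n) x - v x) \<le> ennreal (2 powr 1) * (lpm \<mu> 1 (\<lambda>x. \<phi> (r1 n) x - u (r1 n) x) + lpm \<mu> 1 (\<lambda>x. \<phi> (r1 n) x - v x))" for n
      using lpm_triangle_le[OF _ um(1) test_measurable[OF \<phi>(1)] v(1), of 1 "r1 n" "r1 n"]
      by (simp add: lpm_minus_commute[of \<mu> 1 "u (r1 n)"])
    then show ?thesis by (intro tendsto_sandwich[OF _ _ tendsto_const 2]) auto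
  qed
  obtain r4 where r4: "strict_mono (r4 :: nat => nat)" "AE x in \<mu>. (\<lambda>n. u (r1 (r4 n)) x) \<longlonglongrightarrow> v x"
    using lpm_tendsto_AE_subseq[OF um(1) v(1) _ uv1] by auto
  show ?thesis
  proof (rule that[of v "r1 \<circ> r4"])
    show "strict_mono (r1 \<circ> r4)" by (intro strict_mono_o r1 r4)
    show "AE x in \<mu>. (\<lambda>n. u ((r1 \<circ> r4) n) x) \<longlonglongrightarrow> v x" using r4(2) by simp
    fix \<sigma> :: real assume \<sigma>: "1 \<le> \<sigma>" "\<sigma> < s"
    show "(\<lambda>n. lpm \<mu> \<sigma> (\<lambda>x. u ((r1 \<circ> r4) n) x - v x)) \<longlonglongrightarrow> 0"
    proof (rule lpm_interpolation_tendsto[OF _ \<sigma>])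
      show "(\<lambda>n. lpm \<mu> 1 (\<lambda>x. u ((r1 \<circ> r4) n) x - v x)) \<longlonglongrightarrow> 0"
        using LIMSEQ_subseq_LIMSEQ[OF uv1 r4(1)] by (simp add: o_def)
      show "lpm \<mu> s (\<lambda>x. u ((r1 \<circ> r4) n) x - v x) \<le> ennreal (2 powr s * (Cs * A powr s + C * A powr s))" for n
      proof -
        have "lpm \<mu> s (\<lambda>x. u ((r1 \<circ> r4) n) x - v x) \<le> ennreal (2 powr s) * (lpm \<mu> s (u ((r1 \<circ> r4) n)) + lpm \<mu> s v)"
          using um v q0 by (intro lpm_diff_le) auto
        also have "... \<le> ennreal (2 powr s) * (ennreal (Cs * A powr s) + ennreal (C * A powr s))"
          by (intro mult_left_mono add_mono us vs) simp
        also have "... = ennreal (2 powr s * (Cs * A powr s + C * A powr s))"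
          using C(1) Cs(1) by (simp add: ennreal_mult)
        finally show ?thesis .
      qed
    qed (use um v C(1) Cs(1) in auto)
  qed (use v vfin in auto)
qed

end

section \<open>The double phase energy\<close>

lemma powr_tangent_strict:
  fixes c t q :: real
  assumes "0 < c" "0 \<le> t" "t \<noteq> c" "1 < q"
  shows "c powr q + q * c powr (q - 1) * (t - c) < t powr q"
proof -
  have d: "((\<lambda>t. t powr q) has_real_derivative q * x powr (q - 1)) (at x)" if "0 < x" for x
    using that by (auto intro!: derivative_eq_intros)
  consider "c < t" | "t < c" using assms(3) by linarith
  then show ?thesis
  proof cases
    case 1
    then obtain z where z: "c < z" "z < t" "t powr q - c powr q = (t - c) * (q * z powr (q - 1))"
      using MVT2[OF 1, of "\<lambda>t. t powr q" "\<lambda>x. q * x powr (q - 1)"] d assms(1) by force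
    have "c powr (q - 1) < z powr (q - 1)" using z assms by (intro powr_less_mono2) auto
    then have "(t - c) * (q * c powr (q - 1)) < (t - c) * (q * z powr (q - 1))"
      using 1 assms by (intro mult_strict_left_mono) auto
    then show ?thesis using z(3) by (simp add: mult_ac)
  next
    case 2
    have "continuous_on {t..c} (\<lambda>t. t powr q)"
      using assms by (intro continuous_on_powr' continuous_intros) auto
    moreover have "(\<lambda>t. t powr q) differentiable (at x)" if "t < x" "x < c" for x
      using d[of x] that assms by (auto simp: real_differentiable_def)
    ultimately obtain l z where z: "t < z" "z < c" "((\<lambda>t. t powr q) has_real_derivative l) (at z)" "c powr q - t powr q = (c - t) * l"
      using MVT[OF 2] by blast
    have l: "l = q * z powr (q - 1)" using DERIV_unique[OF z(3) d] z(1) assms by simp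
    have "z powr (q - 1) < c powr (q - 1)" using z assms by (intro powr_less_mono2) auto
    then have "(c - t) * (q * z powr (q - 1)) < (c - t) * (q * c powr (q - 1))"
      using 2 assms by (intro mult_strict_left_mono) auto
    then show ?thesis using z(4) l by (simp add: algebra_simps)
  qed
qed

lemma powr_tangent:
  fixes c t q :: real
  assumes "0 \<le> c" "0 \<le> t" "1 < q"
  shows "c powr q + q * c powr (q - 1) * (t - c) \<le> t powr q"
  using powr_tangent_strict[of c t q] assms by (cases "c = 0"; cases "t = c") auto

text \<open>Cauchy-Schwarz reduces the vector inequality to the scalar tangent inequality for the
  moduli.\<close>

lemma norm_powr_tangent:
  fixes w z :: "'b::real_inner"
  assumes "1 < q"
  shows "norm w powr q + q * norm w powr (q - 2) * (w \<bullet> (z - w)) \<le> norm z powr q"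
proof (cases "w = 0")
  case False
  have "w \<bullet> (z - w) \<le> norm w * (norm z - norm w)"
    using norm_cauchy_schwarz[of w z] by (simp add: inner_diff_right power2_norm_eq_inner[symmetric] power2_eq_square algebra_simps)
  then have "q * norm w powr (q - 2) * (w \<bullet> (z - w)) \<le> q * norm w powr (q - 2) * (norm w * (norm z - norm w))"
    using assms by (intro mult_left_mono) auto
  also have "... = q * (norm w powr (q - 2) * norm w powr 1) * (norm z - norm w)" using False by simp
  also have "... = q * norm w powr (q - 1) * (norm z - norm w)" by (simp only: powr_add[symmetric]) simp
  finally show ?thesis using powr_tangent[OF norm_ge_zero norm_ge_zero assms, of w z] by linarith
qed simp

text \<open>If a modulus differs from that of the midpoint, the tangent inequality there is strict.
  If all three moduli agree, the parallelogram identity forces the two points to coincide.\<close>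

lemma norm_powr_midpoint_strict:
  fixes a b :: "'b::real_inner"
  assumes "1 < q" "a \<noteq> b"
  shows "norm ((1/2) *\<^sub>R (a + b)) powr q < (norm a powr q + norm b powr q) / 2"
proof -
  let ?c = "(1/2) *\<^sub>R (a + b)"
  have sum0: "?c \<bullet> (a - ?c) + ?c \<bullet> (b - ?c) = 0"
    by (simp add: inner_add_right[symmetric] algebra_simps scaleR_2[symmetric])
  show ?thesis
  proof (cases "norm a = norm ?c \<and> norm b = norm ?c")
    case True
    then have e: "norm a = norm ?c" "norm b = norm ?c" by blast+
    have "norm a ^ 2 + norm b ^ 2 = norm ?c ^ 2 + norm ?c ^ 2" by (simp only: e)
    also have "... = norm (a + b) ^ 2 / 2" by (simp add: power_divide)
    finally have s: "norm a ^ 2 + norm b ^ 2 = norm (a + b) ^ 2 / 2" .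
    have "norm (a + b) ^ 2 + norm (a - b) ^ 2 = 2 * (norm a ^ 2 + norm b ^ 2)"
      by (simp add: power2_norm_eq_inner inner_add_left inner_add_right inner_diff_left inner_diff_right inner_commute)
    then have "norm (a - b) ^ 2 = 0" using s by simp
    then show ?thesis using assms by simp
  next
    case False
    have C: "?c \<bullet> (z - ?c) \<le> norm ?c * (norm z - norm ?c)" for z
      using norm_cauchy_schwarz[of ?c z] by (simp only: inner_diff_right power2_norm_eq_inner[symmetric] power2_eq_square right_diff_distrib)
    have s: "0 \<le> norm ?c * (norm a - norm ?c) + norm ?c * (norm b - norm ?c)"
      using C[of a] C[of b] sum0 by linarith
    show ?thesis
    proof (cases "?c = 0")
      case True
      then have "a \<noteq> 0" using assms(2) by auto
      then have "0 < norm a powr q" by simp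
      moreover have "0 \<le> norm b powr q" by simp
      ultimately have "0 < norm a powr q + norm b powr q" by linarith
      then show ?thesis using True by simp
    next
      case c0: False
      then have cp: "0 < norm ?c" by simp
      let ?T = "\<lambda>z. norm ?c powr q + q * norm ?c powr (q - 1) * (norm z - norm ?c)"
      have s': "0 \<le> (norm a - norm ?c) + (norm b - norm ?c)"
        using s cp by (simp only: distrib_left[symmetric] zero_le_mult_iff) linarith
      have le: "?T z \<le> norm z powr q" for z using powr_tangent[of "norm ?c" "norm z" q] assms by simp
      have lt: "?T a + ?T b < norm a powr q + norm b powr q"
      proof (cases "norm a = norm ?c")
        case True
        then have "norm b \<noteq> norm ?c" using False by blast
        then show ?thesis using le[of a] powr_tangent_strict[OF cp, of "norm b" q] assms by simp
      next
        case na: False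
        then show ?thesis using le[of b] powr_tangent_strict[OF cp, of "norm a" q] assms by simp
      qed
      define K where "K = q * norm ?c powr (q - 1)"
      have "0 \<le> K * ((norm a - norm ?c) + (norm b - norm ?c))"
        using s' assms unfolding K_def by (intro mult_nonneg_nonneg) auto
      then have "0 \<le> K * (norm a - norm ?c) + K * (norm b - norm ?c)" by (simp only: distrib_left)
      moreover have "n < (x + y) / 2" if "(n + k1) + (n + k2) < x + y" "0 \<le> k1 + k2" for n k1 k2 x y :: real
        using that by simp
      ultimately show ?thesis using lt unfolding K_def[symmetric] by blast
    qed
  qed
qed

lemma norm_powr_midpoint:
  fixes a b :: "'b::real_inner"
  assumes "1 < q"
  shows "norm ((1/2) *\<^sub>R (a + b)) powr q \<le> (norm a powr q + norm b powr q) / 2"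
proof (cases "a = b")
  case True
  have "(1/2) *\<^sub>R (b + b) = b" by (simp add: scaleR_2[symmetric])
  then show ?thesis using True by simp
qed (use norm_powr_midpoint_strict[OF assms] less_imp_le in blast)

text \<open>Uniform convexity in a form valid for all exponents \<open>q > 1\<close>: by homogeneity it suffices to
  compare both sides on the unit sphere of pairs, where the convexity defect is bounded away from zero
  as long as \<open>a\<close> and \<open>b\<close> are not close.\<close>

lemma norm_powr_uniformly_convex:
  fixes dummy :: "'b::euclidean_space"
  assumes q: "1 < q" and c: "0 < c"
  obtains C where "0 \<le> C" "\<And>a b :: 'b. norm (a - b) powr q \<le> c * (norm a powr q + norm b powr q)
    + C * ((norm a powr q + norm b powr q) / 2 - norm ((1/2) *\<^sub>R (a + b)) powr q)"
proof -
  define E where "E x = norm (fst x) powr q + norm (snd x) powr q" for x :: "'b \<times> 'b"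
  define P where "P x = norm (fst x - snd x) powr q" for x :: "'b \<times> 'b"
  define D where "D x = E x / 2 - norm ((1/2) *\<^sub>R (fst x + snd x)) powr q" for x :: "'b \<times> 'b"
  have cont: "continuous_on UNIV E" "continuous_on UNIV P" "continuous_on UNIV D"
    unfolding E_def[abs_def] P_def[abs_def] D_def[abs_def] using q
    by (intro continuous_intros continuous_on_powr'; simp)+
  have D0: "0 \<le> D x" for x using norm_powr_midpoint[OF q, of "fst x" "snd x"] by (simp add: D_def E_def)
  \<comment> \<open>The part of the unit sphere of pairs where the first term on the right does not
    already suffice. There the two points differ, so the convexity defect has a positive minimum by
    compactness.\<close>
  define T where "T = {x \<in> sphere 0 1. c * E x \<le> P x}"
  have "closed {x. c * E x \<le> P x}" by (intro closed_Collect_le continuous_intros cont)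
  then have "compact T" unfolding T_def
    using compact_Int_closed[OF compact_sphere, of "{x. c * E x \<le> P x}" "0 :: 'b \<times> 'b" 1] by (simp add: Int_def)
  have Dpos: "0 < D x" if "x \<in> T" for x
  proof -
    have "x \<noteq> 0" using that by (auto simp: T_def)
    then have "0 < E x" by (cases x) (auto simp: E_def zero_prod_def add_pos_nonneg add_nonneg_pos)
    then have "0 < P x" using that c by (auto simp: T_def intro: less_le_trans[OF mult_pos_pos])
    then have "fst x \<noteq> snd x" by (auto simp: P_def)
    then show ?thesis using norm_powr_midpoint_strict[OF q, of "fst x" "snd x"] by (simp add: D_def E_def)
  qed
  obtain d where d: "0 < d" "\<And>x. x \<in> T ==> d \<le> D x"
  proof (cases "T = {}")
    case False
    obtain x0 where "x0 \<in> T" "\<And>x. x \<in> T ==> D x0 \<le> D x"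
      using continuous_attains_inf[OF \<open>compact T\<close> False, of D] continuous_on_subset[OF cont(3)] by blast
    then show ?thesis using that[of "D x0"] Dpos by blast
  qed (use that[of 1] in auto)
  \<comment> \<open>On the unit sphere the left-hand side is at most 2^q, and \<open>d\<close>
    bounds the defect from below.\<close>
  define C where "C = 2 powr q / d"
  have sph: "P x \<le> c * E x + C * D x" if x: "norm x = 1" for x
  proof (cases "x \<in> T")
    case True
    have "norm (fst x - snd x) \<le> norm (fst x) + norm (snd x)" by (rule norm_triangle_ineq4)
    also have "... \<le> 1 + 1" using norm_fst_le[of "fst x" "snd x"] norm_snd_le[of "snd x" "fst x"] x by (intro add_mono) auto
    finally have "P x \<le> 2 powr q" unfolding P_def using q by (intro powr_mono2) auto
    also have "... = C * d" using d by (simp add: C_def)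
    also have "... \<le> C * D x" using d(1) d(2)[OF True] by (intro mult_left_mono) (auto simp: C_def)
    moreover have "0 \<le> c * E x" using c by (simp add: E_def)
    ultimately show ?thesis by linarith
  next
    case False
    then have "P x < c * E x" using x by (auto simp: T_def)
    moreover have "0 \<le> C * D x" using D0 d by (simp add: C_def)
    ultimately show ?thesis by linarith
  qed
  have main: "P x \<le> c * E x + C * D x" for x
  proof (cases "x = 0")
    case False
    define t where "t = norm x"
    define y where "y = (1 / t) *\<^sub>R x"
    have t: "0 < t" using False by (simp add: t_def)
    have xy: "x = t *\<^sub>R y" "norm y = 1" using t by (auto simp: y_def t_def)
    have "E x = t powr q * E y" "P x = t powr q * P y"
      using t by (auto simp: xy(1) E_def P_def powr_mult distrib_left scaleR_diff_right[symmetric] simp del: scaleR_diff_right)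
    moreover have "D x = t powr q * D y"
    proof -
      have "norm ((1/2) *\<^sub>R (fst x + snd x)) = t * norm ((1/2) *\<^sub>R (fst y + snd y))"
        using t by (simp add: xy(1) scaleR_add_right[symmetric] del: scaleR_add_right)
      then have "norm ((1/2) *\<^sub>R (fst x + snd x)) powr q = t powr q * norm ((1/2) *\<^sub>R (fst y + snd y)) powr q"
        by (simp only: powr_mult)
      then show ?thesis using \<open>E x = t powr q * E y\<close> by (simp add: D_def algebra_simps)
    qed
    moreover have "t powr q * P y \<le> t powr q * (c * E y + C * D y)"
      using sph[OF xy(2)] by (intro mult_left_mono) auto
    ultimately show ?thesis by (simp add: algebra_simps)
  qed (simp add: P_def E_def D_def)
  show ?thesis
  proof (rule that[of C])
    show "0 \<le> C" using d by (simp add: C_def)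
    show "norm (a - b) powr q \<le> c * (norm a powr q + norm b powr q)
    + C * ((norm a powr q + norm b powr q) / 2 - norm ((1/2) *\<^sub>R (a + b)) powr q)" for a b :: 'b
      using main[of "(a, b)"] by (simp add: P_def E_def D_def)
  qed
qed

text \<open>The gradient of |z|^q / q. At the origin it is 0 for every q, also for q below 2, where
  the scalar factor alone would be singular.\<close>

definition pflux :: "real => 'b::real_normed_vector => 'b" where
  "pflux q z = norm z powr (q - 2) *\<^sub>R z"

lemma norm_pflux: "norm (pflux q z) = norm z powr (q - 1)"
proof (cases "z = 0")
  case False
  then have "norm (pflux q z) = norm z powr (q - 2) * norm z powr 1" by (simp add: pflux_def)
  also have "... = norm z powr (q - 1)" by (simp only: powr_add[symmetric]) simp
  finally show ?thesis .
qed (simp add: pflux_def)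

lemma pflux_continuous:
  assumes "1 < q" shows "continuous_on UNIV (pflux q :: 'b::real_normed_vector => 'b)"
  unfolding continuous_on_eq_continuous_at[OF open_UNIV]
proof
  fix z :: 'b
  show "isCont (pflux q) z"
  proof (cases "z = 0")
    case False
    then show ?thesis unfolding pflux_def[abs_def] by (intro continuous_intros) auto
  next
    case True
    have "((\<lambda>x::'b. norm x powr (q - 1)) \<longlongrightarrow> norm (0::'b) powr (q - 1)) (at 0)"
      using assms by (intro tendsto_powr' tendsto_norm tendsto_ident_at tendsto_const) auto
    then have "((\<lambda>x::'b. norm (pflux q x)) \<longlongrightarrow> 0) (at 0)" by (simp add: norm_pflux)
    then have "((pflux q :: 'b => 'b) \<longlongrightarrow> 0) (at 0)" by (simp add: tendsto_norm_zero_iff)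
    then show ?thesis using True by (simp add: isCont_def pflux_def)
  qed
qed

lemma pflux_scaleR: "0 < t ==> pflux q (t *\<^sub>R z) = t powr (q - 1) *\<^sub>R pflux q z"
proof -
  assume t: "0 < t"
  have "t powr (q - 2) * t powr 1 = t powr (q - 1)" unfolding powr_add[symmetric] by simp
  then have "t powr (q - 2) * t = t powr (q - 1)" using t by simp
  then show ?thesis using t by (simp add: pflux_def powr_mult mult_ac)
qed

text \<open>By homogeneity |z| = 1. Small increments are covered by uniform continuity on a compact
  ball and large ones by growth, so one statement serves the exponents below and above 2.\<close>

lemma pflux_increment:
  fixes dummy :: "'b::euclidean_space"
  assumes q: "1 < q" and c: "0 < c"
  obtains C where "0 \<le> C" "\<And>z b :: 'b. norm (pflux q (z + b) - pflux q z) \<le> c * norm z powr (q - 1) + C * norm b powr (q - 1)"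
proof -
  have "uniformly_continuous_on (cball 0 2) (pflux q :: 'b => 'b)"
    by (intro compact_uniformly_continuous continuous_on_subset[OF pflux_continuous[OF q]]) auto
  then obtain d' where d': "0 < d'" "\<And>x y :: 'b. x \<in> cball 0 2 ==> y \<in> cball 0 2 ==> dist y x < d' ==> dist (pflux q y) (pflux q x) < c"
    using c unfolding uniformly_continuous_on_def by blast
  define d where "d = min d' 1"
  have d: "0 < d" "d \<le> 1" "d \<le> d'" using d' by (auto simp: d_def)
  \<comment> \<open>For increments of size at least \<open>d\<close> both |z| and |z + b| are
    bounded by multiples of |b|.\<close>
  define C where "C = (1 / d + 1) powr (q - 1) + (1 / d) powr (q - 1)"
  have C0: "0 \<le> C" by (simp add: C_def)
  have unit: "norm (pflux q (z + b) - pflux q z) \<le> c + C * norm b powr (q - 1)" if z: "norm z = 1" for z b :: 'b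
  proof (cases "norm b < d")
    case True
    have "norm (z + b) \<le> 2" using norm_triangle_ineq[of z b] z True d by linarith
    then have "z + b \<in> cball 0 2" by (simp only: mem_cball_0)
    then have "dist (pflux q (z + b)) (pflux q z) < c"
      using True d z by (intro d'(2)) (auto simp: dist_norm)
    then show ?thesis using C0 by (simp add: dist_norm add_increasing2)
  next
    case False
    then have b1: "1 \<le> 1 / d * norm b" using d by (simp add: field_simps)
    have 1: "norm (pflux q (z + b)) \<le> ((1 / d + 1) * norm b) powr (q - 1)"
    proof -
      have "norm (z + b) \<le> (1 / d + 1) * norm b" using norm_triangle_ineq[of z b] z b1 by (simp add: distrib_right)
      then show ?thesis unfolding norm_pflux using q by (intro powr_mono2) auto
    qed
    have 2: "norm (pflux q z) \<le> (1 / d * norm b) powr (q - 1)"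
      unfolding norm_pflux z using b1 q by (intro powr_mono2) auto
    have 3: "norm (pflux q (z + b) - pflux q z) \<le> norm (pflux q (z + b)) + norm (pflux q z)" by (rule norm_triangle_ineq4)
    have "norm (pflux q (z + b) - pflux q z) \<le> C * norm b powr (q - 1)"
    proof -
      have "C * norm b powr (q - 1) = ((1 / d + 1) * norm b) powr (q - 1) + (1 / d * norm b) powr (q - 1)"
        unfolding C_def powr_mult by (rule distrib_right)
      then show ?thesis using 1 2 3 by linarith
    qed
    then show ?thesis using c by linarith
  qed
  have main: "norm (pflux q (z + b) - pflux q z) \<le> c * norm z powr (q - 1) + (C + 1) * norm b powr (q - 1)" for z b :: 'b
  proof (cases "z = 0")
    case True
    have "pflux q (0::'b) = 0" by (simp add: pflux_def)
    then show ?thesis using True C0 by (simp add: norm_pflux distrib_right)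
  next
    case False
    define t where "t = norm z"
    have t: "0 < t" using False by (simp add: t_def)
    have zb: "pflux q z = t powr (q - 1) *\<^sub>R pflux q ((1 / t) *\<^sub>R z)"
      "pflux q (z + b) = t powr (q - 1) *\<^sub>R pflux q ((1 / t) *\<^sub>R z + (1 / t) *\<^sub>R b)"
      using pflux_scaleR[OF t, of q "(1 / t) *\<^sub>R z"] pflux_scaleR[OF t, of q "(1 / t) *\<^sub>R z + (1 / t) *\<^sub>R b"] t
      by (simp_all add: scaleR_add_right)
    have "pflux q (z + b) - pflux q z = t powr (q - 1) *\<^sub>R (pflux q ((1 / t) *\<^sub>R z + (1 / t) *\<^sub>R b) - pflux q ((1 / t) *\<^sub>R z))"
      by (simp only: zb scaleR_diff_right)
    then have "norm (pflux q (z + b) - pflux q z) = t powr (q - 1) * norm (pflux q ((1 / t) *\<^sub>R z + (1 / t) *\<^sub>R b) - pflux q ((1 / t) *\<^sub>R z))"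
      by simp
    also have "... \<le> t powr (q - 1) * (c + C * norm ((1 / t) *\<^sub>R b) powr (q - 1))"
      using t by (intro mult_left_mono unit) (auto simp: t_def)
    also have "... = c * t powr (q - 1) + C * (t * norm ((1 / t) *\<^sub>R b)) powr (q - 1)"
      using t by (simp only: powr_mult distrib_left mult_ac)
    also have "t * norm ((1 / t) *\<^sub>R b) = norm b" using t by simp
    finally have "norm (pflux q (z + b) - pflux q z) \<le> c * t powr (q - 1) + C * norm b powr (q - 1)" .
    also have "... \<le> c * t powr (q - 1) + (C + 1) * norm b powr (q - 1)" by (intro add_left_mono mult_right_mono) auto
    finally show ?thesis by (simp add: t_def)
  qed
  show ?thesis using that[of "C + 1"] C0 main by simp
qed

text \<open>The tangent inequality at \<open>z\<close> gives the lower bound and the one at z + b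
  gives the upper bound. No second derivative is involved.\<close>

lemma norm_powr_remainder:
  fixes z b :: "'b::euclidean_space"
  assumes q: "1 < q"
  shows "0 \<le> norm (z + b) powr q - norm z powr q - q * (pflux q z \<bullet> b)"
    and "norm (z + b) powr q - norm z powr q - q * (pflux q z \<bullet> b) \<le> q * (norm (pflux q (z + b) - pflux q z) * norm b)"
proof -
  have 1: "norm z powr q + q * (pflux q z \<bullet> b) \<le> norm (z + b) powr q"
    using norm_powr_tangent[OF q, of z "z + b"] by (simp add: pflux_def mult_ac)
  then show "0 \<le> norm (z + b) powr q - norm z powr q - q * (pflux q z \<bullet> b)" by simp
  have 2: "norm (z + b) powr q - q * (pflux q (z + b) \<bullet> b) \<le> norm z powr q"
    using norm_powr_tangent[OF q, of "z + b" z] by (simp add: pflux_def mult_ac)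
  have "norm (z + b) powr q - norm z powr q - q * (pflux q z \<bullet> b) \<le> q * ((pflux q (z + b) - pflux q z) \<bullet> b)"
    using 2 by (simp add: inner_diff_left right_diff_distrib)
  also have "... \<le> q * (norm (pflux q (z + b) - pflux q z) * norm b)"
    using q by (intro mult_left_mono norm_cauchy_schwarz) auto
  finally show "norm (z + b) powr q - norm z powr q - q * (pflux q z \<bullet> b) \<le> q * (norm (pflux q (z + b) - pflux q z) * norm b)" .
qed

lemma powr_mult_le_add:
  fixes x y k :: real
  assumes "0 \<le> x" "0 \<le> y" "1 \<le> k"
  shows "x powr (k - 1) * y \<le> x powr k + y powr k"
proof -
  let ?m = "max x y"
  have "x powr (k - 1) * y \<le> ?m powr (k - 1) * ?m"
    using assms by (intro mult_mono powr_mono2) auto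
  also have "... = ?m powr k" using assms by (cases "?m = 0") (auto simp: powr_diff)
  also have "... \<le> x powr k + y powr k" by (simp add: max_def)
  finally show ?thesis .
qed

lemma two_powr_convexity_helper:
  fixes x y :: "'b::euclidean_space"
  assumes "0 \<le> k"
  shows "norm x powr k \<le> 2 powr k * (norm y powr k + norm (x - y) powr k)"
  using norm_add_powr_le[OF assms, of y "x - y"] by simp

lemma dphase_flux_pflux: "dphase_flux p q a x w = pflux p w + a x *\<^sub>R pflux q w"
  by (simp add: dphase_flux_def pflux_def)

lemma half_sum_diff_le:
  fixes x y z w u j :: real
  assumes "x \<le> z + j" "y \<le> z + j" "w \<le> u"
  shows "(x + y) / 2 - u \<le> (z - w) + j"
  using assms by (simp add: field_simps)

section \<open>Continuity, uniform convexity and lower semicontinuity of the energy\<close>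

context double_phase
begin

lemma powr_integrable:
  fixes v :: "'a => 'b::euclidean_space"
  assumes "v \<in> meas" "lpm \<mu> \<sigma>' v < \<infinity>" "0 \<le> \<sigma>" "\<sigma> \<le> \<sigma>'"
  shows "integrable \<mu> (\<lambda>x. norm (v x) powr \<sigma>)"
proof -
  have "lpm \<mu> \<sigma> v < \<infinity>" by (rule lpm_lower_exponent_finite[OF finite_measure_dom assms(1,3,4,2)])
  then show ?thesis using assms(1) unfolding lpm_def by (intro integrableI_bounded) auto
qed

lemma lpm_eq_integral:
  fixes v :: "'a => 'b::euclidean_space"
  assumes "integrable \<mu> (\<lambda>x. norm (v x) powr k)"
  shows "lpm \<mu> k v = ennreal (LINT x|\<mu>. norm (v x) powr k)"
  unfolding lpm_def using assms by (intro nn_integral_eq_integral) auto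

lemma integral_le_of_lpm:
  fixes v :: "'a => 'b::euclidean_space"
  assumes "v \<in> meas" "lpm \<mu> k v \<le> ennreal B" "0 \<le> B" "0 \<le> k"
  shows "(LINT x|\<mu>. norm (v x) powr k) \<le> B"
proof -
  have "lpm \<mu> k v < \<infinity>" using assms(2) by (rule order.strict_trans1) simp
  then have "integrable \<mu> (\<lambda>x. norm (v x) powr k)" using assms by (intro powr_integrable[of v k]) auto
  from lpm_eq_integral[OF this] show ?thesis using assms by simp
qed

lemma a_mult_integrable: "integrable \<mu> f ==> integrable \<mu> (\<lambda>x. a x * f x)"
proof (rule Bochner_Integration.integrable_bound)
  assume f: "integrable \<mu> f"
  then show "integrable \<mu> (\<lambda>x. a1 * f x)" by simp
  show "(\<lambda>x. a x * f x) \<in> meas" using a_measurable f by measurable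
  show "AE x in \<mu>. norm (a x * f x) \<le> norm (a1 * f x)"
    using a_lower a_upper a0_pos a1_pos by (intro AE_I2) (fastforce simp: abs_mult intro!: mult_right_mono)
qed

lemma emeasure_const_integrable: "integrable \<mu> (\<lambda>x. c :: real)"
  using finite_measure_dom by (simp add: finite_measure.integrable_const)

definition energy :: "'a => 'b::euclidean_space => real" where
  "energy x w = norm w powr p / p + a x * (norm w powr q / q)"

lemma Phi_energy: "Phi v = (LINT x|\<mu>. energy x (v x))"
  by (simp add: Phi_H_def energy_def)

lemma energy_bounds:
  assumes "x \<in> \<Omega>"
  shows "0 \<le> energy x w" "a0 / q * norm w powr q \<le> energy x w" "energy x w \<le> norm w powr p + a1 * norm w powr q"
    "energy x w \<le> 1 + (1 + a1) * norm w powr q"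
proof -
  have pq: "1 < p" "1 < q" using p_gt_1 q_gt_1 by auto
  have 1: "0 \<le> norm w powr p / p" "norm w powr p / p \<le> norm w powr p" using pq by (auto simp: divide_le_eq mult_le_cancel_left1)
  have a: "a0 \<le> a x" "a x \<le> a1" "0 < a x" using a_lower[OF assms] a_upper[OF assms] a0_pos by auto
  have 2: "a0 / q * norm w powr q \<le> a x * (norm w powr q / q)" using a pq by (auto simp: divide_right_mono mult_right_mono)
  have 3: "a x * (norm w powr q / q) \<le> a1 * norm w powr q"
    using a pq by (intro mult_mono) (auto simp: divide_le_eq mult_le_cancel_left1)
  have 4: "0 \<le> a0 / q * norm w powr q" using a0_pos pq by simp
  show "0 \<le> energy x w" "a0 / q * norm w powr q \<le> energy x w" and u: "energy x w \<le> norm w powr p + a1 * norm w powr q"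
    using 1 2 3 4 unfolding energy_def by linarith+
  have "norm w powr p \<le> 1 powr p + 1 powr (p - q) * norm w powr q"
    using pq p_less_q by (intro powr_lower_exponent_le) auto
  then show "energy x w \<le> 1 + (1 + a1) * norm w powr q" using u by (simp add: distrib_right)
qed

lemma energy_integrable:
  fixes v :: "'a => 'b::euclidean_space"
  assumes "v \<in> meas" "Lq v < \<infinity>"
  shows "integrable \<mu> (\<lambda>x. energy x (v x))"
proof -
  have "integrable \<mu> (\<lambda>x. norm (v x) powr p)" "integrable \<mu> (\<lambda>x. norm (v x) powr q)"
    using assms p_gt_1 p_less_q by (auto intro!: powr_integrable)
  then show ?thesis unfolding energy_def by (intro Bochner_Integration.integrable_add a_mult_integrable integrable_divide) auto
qed

lemma Phi_nonneg: "0 \<le> Phi v"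
  unfolding Phi_energy by (intro integral_nonneg_AE AE_I2 energy_bounds) auto

lemma Phi_lower:
  fixes v :: "'a => 'b::euclidean_space"
  assumes "v \<in> meas" "Lq v < \<infinity>"
  shows "a0 / q * (LINT x|\<mu>. norm (v x) powr q) \<le> Phi v"
proof -
  have "integrable \<mu> (\<lambda>x. norm (v x) powr q)" using assms q_gt_1 by (intro powr_integrable) auto
  then have "(LINT x|\<mu>. a0 / q * norm (v x) powr q) \<le> Phi v"
    unfolding Phi_energy by (intro integral_mono energy_integrable assms energy_bounds) auto
  then show ?thesis by simp
qed

lemma lpm_le_Phi:
  fixes v :: "'a => 'b::euclidean_space"
  assumes "v \<in> meas" "Lq v < \<infinity>"
  shows "Lq v \<le> ennreal (q / a0 * Phi v)"
proof -
  have "integrable \<mu> (\<lambda>x. norm (v x) powr q)" using assms q_gt_1 by (intro powr_integrable) auto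
  then have "Lq v = ennreal (LINT x|\<mu>. norm (v x) powr q)" by (rule lpm_eq_integral)
  also have "... \<le> ennreal (q / a0 * Phi v)"
    using Phi_lower[OF assms] a0_pos q_gt_1 by (intro ennreal_leI) (simp add: field_simps)
  finally show ?thesis .
qed

lemma Phi_cong_AE: "AE x in \<mu>. v x = w x ==> v \<in> meas ==> Phi v = Phi w"
proof -
  assume ae: "AE x in \<mu>. v x = w x" and v: "v \<in> meas"
  have w: "w \<in> meas" by (rule borel_measurable_lebesgue_on_AE[OF open_dom v ae])
  have "(\<lambda>x. energy x (v x)) \<in> meas" "(\<lambda>x. energy x (w x)) \<in> meas"
    unfolding energy_def using a_measurable v w by measurable
  then show ?thesis
    unfolding Phi_energy by (rule integral_cong_AE) (use ae in \<open>auto elim!: eventually_mono\<close>)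
qed

text \<open>For \<theta> at most 1 the smaller exponent p governs the decay. Together with (M5) this
  produces the power \<gamma> p in the test of negativity.\<close>

lemma Phi_scale:
  fixes v :: "'a => 'b::euclidean_space"
  assumes v: "v \<in> meas" "Lq v < \<infinity>" and \<theta>: "0 < \<theta>" "\<theta> \<le> 1"
  shows "Phi (\<lambda>x. \<theta> *\<^sub>R v x) \<le> \<theta> powr p * Phi v"
proof -
  have le: "energy x (\<theta> *\<^sub>R v x) \<le> \<theta> powr p * energy x (v x)" if "x \<in> \<Omega>" for x
  proof -
    have "0 \<le> a x" using a_lower[OF that] a0_pos by simp
    have "\<theta> powr q \<le> \<theta> powr p" using \<theta> p_less_q by (intro powr_mono') auto
    then have "\<theta> powr q * (a x * (norm (v x) powr q / q)) \<le> \<theta> powr p * (a x * (norm (v x) powr q / q))"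
      using \<open>0 \<le> a x\<close> q_gt_1 by (intro mult_right_mono) auto
    then show ?thesis using \<theta> by (simp add: energy_def powr_mult distrib_left mult_ac)
  qed
  have "Lq (\<lambda>x. \<theta> *\<^sub>R v x) < \<infinity>" using v lpm_cmult[OF v(1), of q \<theta>] by (simp add: ennreal_mult_less_top)
  then have "Phi (\<lambda>x. \<theta> *\<^sub>R v x) \<le> (LINT x|\<mu>. \<theta> powr p * energy x (v x))"
    unfolding Phi_energy using v le
    by (intro integral_mono energy_integrable[where v="\<lambda>x. \<theta> *\<^sub>R v x"] integrable_mult_right energy_integrable) auto
  then show ?thesis by (simp add: Phi_energy)
qed

lemma Phi_uniformly_convex:
  fixes dummy :: "'b::euclidean_space"
  assumes c: "0 < c"
  obtains C where "0 \<le> C" "\<And>v w :: 'a => 'b. v \<in> meas ==> Lq v < \<infinity> ==> w \<in> meas ==> Lq w < \<infinity> ==>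
    (LINT x|\<mu>. norm (v x - w x) powr q) \<le> c * (Phi v + Phi w)
      + C * ((Phi v + Phi w) / 2 - Phi (\<lambda>x. (1/2) *\<^sub>R (v x + w x)))"
proof -
  define k where "k = a0 / q"
  have k: "0 < k" using a0_pos q_gt_1 by (simp add: k_def)
  have "0 < c * k" using c k by simp
  then obtain C where C: "0 \<le> C" "\<And>a b :: 'b. norm (a - b) powr q \<le> c * k * (norm a powr q + norm b powr q)
    + C * ((norm a powr q + norm b powr q) / 2 - norm ((1/2) *\<^sub>R (a + b)) powr q)"
    using norm_powr_uniformly_convex[OF q_gt_1] by metis
  have pw: "norm (v - w) powr q \<le> c * (energy x v + energy x w) + C / k * ((energy x v + energy x w) / 2 - energy x ((1/2) *\<^sub>R (v + w)))"
    if x: "x \<in> \<Omega>" for x and v w :: 'b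
  proof -
    let ?D = "(norm v powr q + norm w powr q) / 2 - norm ((1/2) *\<^sub>R (v + w)) powr q"
    let ?P = "(norm v powr p + norm w powr p) / 2 - norm ((1/2) *\<^sub>R (v + w)) powr p"
    have D: "0 \<le> ?D" "0 \<le> ?P" using norm_powr_midpoint[OF q_gt_1, of v w] norm_powr_midpoint[OF p_gt_1, of v w] by auto
    have "(energy x v + energy x w) / 2 - energy x ((1/2) *\<^sub>R (v + w)) = ?P / p + a x / q * ?D"
      unfolding energy_def by (simp only: diff_divide_distrib add_divide_distrib) (simp add: algebra_simps)
    moreover have "0 \<le> ?P / p" using D p_gt_1 by simp
    moreover have "k * ?D \<le> a x / q * ?D"
      using a_lower[OF x] q_gt_1 D unfolding k_def by (intro mult_right_mono divide_right_mono) auto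
    ultimately have "k * ?D \<le> (energy x v + energy x w) / 2 - energy x ((1/2) *\<^sub>R (v + w))" by linarith
    then have "C / k * (k * ?D) \<le> C / k * ((energy x v + energy x w) / 2 - energy x ((1/2) *\<^sub>R (v + w)))"
      using C k by (intro mult_left_mono) auto
    then have 1: "C * ?D \<le> C / k * ((energy x v + energy x w) / 2 - energy x ((1/2) *\<^sub>R (v + w)))" using k by simp
    have "k * (norm v powr q + norm w powr q) \<le> energy x v + energy x w"
      using energy_bounds(2)[OF x, of v] energy_bounds(2)[OF x, of w] unfolding k_def distrib_left by linarith
    then have "c * (k * (norm v powr q + norm w powr q)) \<le> c * (energy x v + energy x w)"
      using c by (intro mult_left_mono) auto
    then show ?thesis using C(2)[of v w] 1 unfolding mult.assoc by linarith
  qed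
  have main: "(LINT x|\<mu>. norm (v x - w x) powr q) \<le> c * (Phi v + Phi w)
      + C / k * ((Phi v + Phi w) / 2 - Phi (\<lambda>x. (1/2) *\<^sub>R (v x + w x)))"
    if v: "v \<in> meas" "Lq v < \<infinity>" and w: "w \<in> meas" "Lq w < \<infinity>" for v w :: "'a => 'b"
  proof -
    have "Lq (\<lambda>x. v x - w x) \<le> ennreal (2 powr q) * (Lq v + Lq w)" using v w q_gt_1 by (intro lpm_diff_le) auto
    also have "... < \<infinity>" using v w by (simp add: ennreal_mult_less_top)
    finally have d: "Lq (\<lambda>x. v x - w x) < \<infinity>" .
    have "Lq (\<lambda>x. v x + w x) \<le> ennreal (2 powr q) * (Lq v + Lq w)" using v w q_gt_1 by (intro lpm_add_le) auto
    also have "... < \<infinity>" using v w by (simp add: ennreal_mult_less_top)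
    finally have "Lq (\<lambda>x. (1/2) *\<^sub>R (v x + w x)) < \<infinity>"
      using lpm_cmult[of "\<lambda>x. v x + w x" \<mu> q "1/2"] v w by (simp add: ennreal_mult_less_top)
    then have i: "integrable \<mu> (\<lambda>x. energy x (v x))" "integrable \<mu> (\<lambda>x. energy x (w x))" "integrable \<mu> (\<lambda>x. energy x ((1/2) *\<^sub>R (v x + w x)))"
      using v w by (auto intro!: energy_integrable[where v=v] energy_integrable[where v=w] energy_integrable[where v="\<lambda>x. (1/2) *\<^sub>R (v x + w x)"])
    have "(LINT x|\<mu>. norm (v x - w x) powr q) \<le> (LINT x|\<mu>. c * (energy x (v x) + energy x (w x)) + C / k * ((energy x (v x) + energy x (w x)) / 2 - energy x ((1/2) *\<^sub>R (v x + w x))))"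
      using d v w q_gt_1 i by (intro integral_mono powr_integrable[where \<sigma>'=q] pw) auto
    also have "... = c * (Phi v + Phi w)
      + C / k * ((Phi v + Phi w) / 2 - Phi (\<lambda>x. (1/2) *\<^sub>R (v x + w x)))"
      unfolding Phi_energy using i by simp
    finally show ?thesis .
  qed
  show ?thesis by (rule that[of "C / k"]) (use C k main in auto)
qed

lemma lpm_tendsto_imp_integral_tendsto:
  fixes v :: "nat => 'a => 'b::euclidean_space"
  assumes "\<And>n. integrable \<mu> (\<lambda>x. norm (v n x) powr k)" "(\<lambda>n. lpm \<mu> k (v n)) \<longlonglongrightarrow> 0"
  shows "(\<lambda>n. LINT x|\<mu>. norm (v n x) powr k) \<longlonglongrightarrow> 0"
proof (rule tendsto_ennrealD)
  show "(\<lambda>n. ennreal (LINT x|\<mu>. norm (v n x) powr k)) \<longlonglongrightarrow> ennreal 0"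
    using assms(2) by (simp add: lpm_eq_integral[OF assms(1)])
qed auto

lemma lpm_add_finite:
  fixes v w :: "'a => 'b::euclidean_space"
  assumes "v \<in> meas" "lpm \<mu> k v < \<infinity>" "w \<in> meas" "lpm \<mu> k w < \<infinity>" "0 \<le> k"
  shows "lpm \<mu> k (\<lambda>x. v x + w x) < \<infinity>" "lpm \<mu> k (\<lambda>x. v x - w x) < \<infinity>"
proof -
  have fin: "ennreal (2 powr k) * (lpm \<mu> k v + lpm \<mu> k w) < \<infinity>" using assms by (simp add: ennreal_mult_less_top)
  show "lpm \<mu> k (\<lambda>x. v x + w x) < \<infinity>" by (rule order.strict_trans1[OF lpm_add_le[OF assms(5,1,3)] fin])
  show "lpm \<mu> k (\<lambda>x. v x - w x) < \<infinity>" by (rule order.strict_trans1[OF lpm_diff_le[OF assms(5,1,3)] fin])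
qed

text \<open>The growth of the energy along the sequence is split into that of the limit and a
  multiple of |v n - g|^q, whose integral vanishes.\<close>

lemma Phi_tendsto:
  fixes v :: "nat => 'a => 'b::euclidean_space"
  assumes v: "\<And>n. v n \<in> meas" "\<And>n. Lq (v n) < \<infinity>" and g: "g \<in> meas" "Lq g < \<infinity>"
    and lim: "(\<lambda>n. Lq (\<lambda>x. v n x - g x)) \<longlonglongrightarrow> 0" and ae: "AE x in \<mu>. (\<lambda>n. v n x) \<longlonglongrightarrow> g x"
  shows "(\<lambda>n. Phi (v n)) \<longlonglongrightarrow> Phi g"
  unfolding Phi_energy
proof (rule integral_tendsto_dominated_perturbation)
  let ?c = "(1 + a1) * 2 powr q"
  have c: "0 \<le> ?c" using a1_pos by simp
  have q0: "0 \<le> q" using q_gt_1 by simp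
  show "(\<lambda>x. energy x (v n x)) \<in> meas" "(\<lambda>x. energy x (g x)) \<in> meas" for n
    using energy_integrable[OF v] energy_integrable[OF g] by auto
  have ig: "integrable \<mu> (\<lambda>x. norm (g x) powr q)" using g q0 by (intro powr_integrable[where \<sigma>'=q]) auto
  then show "integrable \<mu> (\<lambda>x. 1 + ?c * norm (g x) powr q)"
    using emeasure_const_integrable by (intro Bochner_Integration.integrable_add integrable_mult_right) auto
  have id: "integrable \<mu> (\<lambda>x. norm (v n x - g x) powr q)" for n
    using lpm_add_finite(2)[OF v(1)[of n] v(2)[of n] g q0] v g q0 by (intro powr_integrable[where \<sigma>'=q]) auto
  then show "integrable \<mu> (\<lambda>x. ?c * norm (v n x - g x) powr q)" for n by (intro integrable_mult_right) auto
  show "0 \<le> ?c * norm (v n x - g x) powr q" for n x using c by simp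
  have "(\<lambda>n. ?c * (LINT x|\<mu>. norm (v n x - g x) powr q)) \<longlonglongrightarrow> ?c * 0"
    by (intro tendsto_mult tendsto_const lpm_tendsto_imp_integral_tendsto[OF id lim])
  then show "(\<lambda>n. LINT x|\<mu>. ?c * norm (v n x - g x) powr q) \<longlonglongrightarrow> 0" by simp
  show "AE x in \<mu>. (\<lambda>n. energy x (v n x)) \<longlonglongrightarrow> energy x (g x)"
    using ae
  proof eventually_elim
    case (elim x)
    show ?case unfolding energy_def using p_gt_1 q_gt_1
      by (intro tendsto_add tendsto_divide tendsto_mult tendsto_const tendsto_powr' tendsto_norm elim) auto
  qed
  have key: "energy x w \<le> 1 + ?c * norm y powr q + ?c * norm (w - y) powr q" if "x \<in> \<Omega>" for x and w y :: 'b
  proof -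
    have "(1 + a1) * norm w powr q \<le> (1 + a1) * (2 powr q * (norm y powr q + norm (w - y) powr q))"
      using a1_pos by (intro mult_left_mono two_powr_convexity_helper q0) auto
    then show ?thesis using energy_bounds(4)[OF that, of w] by (simp add: algebra_simps)
  qed
  show "AE x in \<mu>. \<bar>energy x (v n x)\<bar> \<le> 1 + ?c * norm (g x) powr q + ?c * norm (v n x - g x) powr q" for n
  proof (intro AE_I2)
    fix x assume "x \<in> space \<mu>"
    then show "\<bar>energy x (v n x)\<bar> \<le> 1 + ?c * norm (g x) powr q + ?c * norm (v n x - g x) powr q"
      using energy_bounds(1)[of x "v n x"] key[of x "v n x" "g x"] by auto
  qed
  show "AE x in \<mu>. \<bar>energy x (g x)\<bar> \<le> 1 + ?c * norm (g x) powr q"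
  proof (intro AE_I2)
    fix x assume "x \<in> space \<mu>"
    then show "\<bar>energy x (g x)\<bar> \<le> 1 + ?c * norm (g x) powr q"
      using energy_bounds(1)[of x "g x"] key[of x "g x" "g x"] q_gt_1 by auto
  qed
qed

text \<open>Weak lower semicontinuity without weak convergence: minimize the energy over the convex sets of
  pairs whose first component is close to \<open>u\<close>. Uniform convexity makes the minimizing sequence Cauchy.\<close>

lemma Phi_lower_semicontinuous:
  assumes pr: "\<And>n. w0pair (u n) (g n)" and v: "v \<in> meas"
    and lim: "(\<lambda>n. Lq (\<lambda>x. u n x - v x)) \<longlonglongrightarrow> 0" and L: "(\<lambda>n. Phi (g n)) \<longlonglongrightarrow> L"
  obtains h where "w0pair v h" "Phi h \<le> L"
proof -
  let ?Phi = "Phi :: ('a => real \<times> 'a) => real"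
  have q0: "0 \<le> q" "0 < q" using q_gt_1 by auto
  \<comment> \<open>Pairs close to \<open>v\<close> in the first component only. The sets are convex
    and decrease with n, so their least energies \<alpha> increase, and \<alpha> stays below
    \<open>L\<close> because the given sequence eventually enters each set.\<close>
  define S where "S n = {(w, f). w0pair w f \<and> Lq (\<lambda>x. w x - v x) \<le> ennreal (1 / real (Suc n))}" for n
  define \<alpha> where "\<alpha> n = (INF z\<in>S n. ?Phi (snd z))" for n
  have bdd: "bdd_below ((\<lambda>z. ?Phi (snd z)) ` S n)" for n using Phi_nonneg by (intro bdd_belowI[of _ 0]) auto
  have inS: "\<forall>\<^sub>F k in sequentially. (u k, g k) \<in> S n" for n
  proof -
    have "\<forall>\<^sub>F k in sequentially. Lq (\<lambda>x. u k x - v x) < ennreal (1 / real (Suc n))"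
      using order_tendstoD(2)[OF lim, of "ennreal (1 / real (Suc n))"] by simp
    then show ?thesis by eventually_elim (use pr in \<open>auto simp: S_def less_imp_le\<close>)
  qed
  have ne: "S n \<noteq> {}" for n using eventually_happens'[OF sequentially_bot inS[of n]] by blast
  have \<alpha>_le: "\<alpha> n \<le> ?Phi f" if "(w, f) \<in> S n" for n w f
    unfolding \<alpha>_def using cINF_lower[OF bdd that] by simp
  have \<alpha>L: "\<alpha> n \<le> L" for n
  proof (rule tendsto_lowerbound[OF L])
    show "\<forall>\<^sub>F k in sequentially. \<alpha> n \<le> ?Phi (g k)" using inS[of n] by eventually_elim (rule \<alpha>_le)
  qed simp
  have mono: "\<alpha> n \<le> \<alpha> k" if "n \<le> k" for n k
    unfolding \<alpha>_def
  proof (rule cINF_superset_mono[OF ne bdd])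
    show "S k \<subseteq> S n"
    proof (clarsimp simp: S_def)
      fix w assume "Lq (\<lambda>x. w x - v x) \<le> ennreal (1 / (1 + real k))"
      also have "... \<le> ennreal (1 / (1 + real n))" using that by (intro ennreal_leI divide_left_mono) auto
      finally show "Lq (\<lambda>x. w x - v x) \<le> ennreal (1 / (1 + real n))" .
    qed
  qed simp
  have "incseq \<alpha>" using mono by (simp add: incseq_def)
  then obtain A where A: "\<alpha> \<longlonglongrightarrow> A" "\<And>n. \<alpha> n \<le> A"
    using incseq_convergent[of \<alpha> L] \<alpha>L by blast
  have AL: "A \<le> L" by (rule tendsto_upperbound[OF A(1)]) (use \<alpha>L in auto)
  have "\<exists>z\<in>S n. ?Phi (snd z) < \<alpha> n + 1 / real (Suc n)" for n
    using cINF_less_iff[OF ne bdd, of n "\<alpha> n + 1 / real (Suc n)"] unfolding \<alpha>_def by simp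
  then have "\<forall>n. \<exists>z. z \<in> S n \<and> ?Phi (snd z) < \<alpha> n + 1 / real (Suc n)" by blast
  from choice[OF this] obtain z where z: "\<And>n. z n \<in> S n" "\<And>n. ?Phi (snd (z n)) < \<alpha> n + 1 / real (Suc n)" by blast
  define w f where "w n = fst (z n)" and "f n = snd (z n)" for n
  have wf: "w0pair (w n) (f n)" "Lq (\<lambda>x. w n x - v x) \<le> ennreal (1 / real (Suc n))" "(w n, f n) \<in> S n" for n
    using z(1)[of n] by (auto simp: S_def w_def f_def case_prod_beta)
  have Pf: "?Phi (f n) < \<alpha> n + 1 / real (Suc n)" for n using z(2) by (simp add: f_def)
  note fm = w0pair_measurable(2)[OF wf(1)] and ff = w0pair_finite(2)[OF wf(1)]
  \<comment> \<open>By convexity the average of two almost minimizers is a competitor in the larger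
    of their sets, so the midpoint defect of their energies is small.\<close>
  have mid: "\<alpha> n \<le> ?Phi (\<lambda>x. (1/2) *\<^sub>R (f n x + f k x))" if "n \<le> k" for n k
  proof (rule \<alpha>_le)
    have wk: "Lq (\<lambda>x. w k x - v x) \<le> ennreal (1 / real (Suc n))"
      using that by (intro order_trans[OF wf(2)] ennreal_leI divide_left_mono) auto
    have m: "(\<lambda>x. w n x - v x) \<in> meas" "(\<lambda>x. w k x - v x) \<in> meas"
      using w0pair_measurable(1)[OF wf(1)] v by auto
    have "Lq (\<lambda>x. (1/2) * (w n x + w k x) - v x) \<le> (\<integral>\<^sup>+x. ennreal (1/2) * (ennreal (norm (w n x - v x) powr q) + ennreal (norm (w k x - v x) powr q)) \<partial>\<mu>)"
      unfolding lpm_def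
    proof (intro nn_integral_mono)
      fix x
      have e: "(1/2) * (w n x + w k x) - v x = (1/2) *\<^sub>R ((w n x - v x) + (w k x - v x))" by (simp add: field_simps)
      have "norm ((1/2) * (w n x + w k x) - v x) powr q \<le> 1/2 * (norm (w n x - v x) powr q + norm (w k x - v x) powr q)"
        unfolding e using norm_powr_midpoint[OF q_gt_1, of "w n x - v x" "w k x - v x"] by simp
      then show "ennreal (norm ((1/2) * (w n x + w k x) - v x) powr q) \<le> ennreal (1/2) * (ennreal (norm (w n x - v x) powr q) + ennreal (norm (w k x - v x) powr q))"
        by (simp only: ennreal_plus[symmetric] ennreal_mult[symmetric] powr_ge_zero add_nonneg_nonneg divide_nonneg_nonneg zero_le_one zero_le_numeral ennreal_leI)
    qed
    also have "... = ennreal (1/2) * (Lq (\<lambda>x. w n x - v x) + Lq (\<lambda>x. w k x - v x))"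
      unfolding lpm_def using m by (subst nn_integral_cmult) (auto simp: nn_integral_add)
    also have "... \<le> ennreal (1/2) * (ennreal (1 / real (Suc n)) + ennreal (1 / real (Suc n)))"
      using wf(2)[of n] wk by (intro mult_left_mono add_mono) auto
    also have "... = ennreal (1 / real (Suc n))"
      by (simp only: ennreal_plus[symmetric] ennreal_mult[symmetric] divide_nonneg_nonneg zero_le_one zero_le_numeral of_nat_0_le_iff add_nonneg_nonneg) simp
    finally have "Lq (\<lambda>x. (1/2) * (w n x + w k x) - v x) \<le> ennreal (1 / real (Suc n))" .
    moreover have "w0pair (\<lambda>x. (1/2) * (w n x + w k x)) (\<lambda>x. (1/2) *\<^sub>R (f n x + f k x))"
      by (intro w0pair_cmult w0pair_add wf)
    ultimately show "(\<lambda>x. (1/2) * (w n x + w k x), \<lambda>x. (1/2) *\<^sub>R (f n x + f k x)) \<in> S n" by (simp add: S_def)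
  qed
  have inv0: "(\<lambda>n. 1 / real (Suc n)) \<longlonglongrightarrow> 0" by (rule LIMSEQ_Suc[OF lim_1_over_n])
  have cauchy: "\<exists>N. \<forall>n\<ge>N. \<forall>k\<ge>N. Lq (\<lambda>x. f n x - f k x) \<le> ennreal e" if e: "0 < e" for e
  proof -
    \<comment> \<open>A bound for the sum of two energies along the sequence; \<open>c\<close> is
      then chosen so that this sum takes half of \<open>e\<close>, and the midpoint defect takes the
      rest.\<close>
    define B where "B = 2 * (\<bar>A\<bar> + 1)"
    define c where "c = e / (2 * B)"
    have "0 < B" by (simp add: B_def add_nonneg_pos)
    then have c: "0 < c" "c * B = e / 2" using e by (auto simp: c_def)
    obtain C where C: "0 \<le> C" "\<And>v w :: 'a => real \<times> 'a. v \<in> meas ==> Lq v < \<infinity> ==> w \<in> meas ==> Lq w < \<infinity> ==>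
      (LINT x|\<mu>. norm (v x - w x) powr q) \<le> c * (?Phi v + ?Phi w) + C * ((?Phi v + ?Phi w) / 2 - ?Phi (\<lambda>x. (1/2) *\<^sub>R (v x + w x)))"
      using Phi_uniformly_convex[OF c(1), where 'b="real \<times> 'a"] by blast
    have "(\<lambda>n. C * ((A - \<alpha> n) + 1 / real (Suc n))) \<longlonglongrightarrow> C * ((A - A) + 0)"
      by (intro tendsto_intros A(1) inv0)
    then have "\<forall>\<^sub>F n in sequentially. C * ((A - \<alpha> n) + 1 / real (Suc n)) < e / 2"
      using e by (intro order_tendstoD(2)) auto
    then obtain N where N: "\<And>n. N \<le> n ==> C * ((A - \<alpha> n) + 1 / real (Suc n)) < e / 2" by (auto simp: eventually_sequentially)
    have le: "Lq (\<lambda>x. f n x - f k x) \<le> ennreal e" if nk: "N \<le> n" "n \<le> k" for n k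
    proof -
      have one: "1 / real (Suc k) \<le> 1 / real (Suc n)" "1 / real (Suc n) \<le> 1" using nk by (auto simp: field_simps)
      have P: "?Phi (f n) \<le> A + 1 / real (Suc n)" "?Phi (f k) \<le> A + 1 / real (Suc n)"
        using Pf[of n] Pf[of k] A(2)[of n] A(2)[of k] one by linarith+
      have "?Phi (f n) + ?Phi (f k) \<le> (A + 1 / real (Suc n)) + (A + 1 / real (Suc n))" using P by (rule add_mono)
      also have "... \<le> (\<bar>A\<bar> + 1) + (\<bar>A\<bar> + 1)" by (intro add_mono one(2) abs_ge_self)
      finally have "?Phi (f n) + ?Phi (f k) \<le> B" by (simp add: B_def)
      then have 1: "c * (?Phi (f n) + ?Phi (f k)) \<le> e / 2" using c by (metis mult_left_mono less_imp_le)
      have "(?Phi (f n) + ?Phi (f k)) / 2 - ?Phi (\<lambda>x. (1/2) *\<^sub>R (f n x + f k x)) \<le> (A - \<alpha> n) + 1 / real (Suc n)"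
        by (rule half_sum_diff_le[OF P mid[OF nk(2)]])
      then have 2: "C * ((?Phi (f n) + ?Phi (f k)) / 2 - ?Phi (\<lambda>x. (1/2) *\<^sub>R (f n x + f k x))) \<le> e / 2"
        using mult_left_mono[OF _ C(1)] N[OF nk(1)] by (meson less_imp_le order_trans)
      have i: "integrable \<mu> (\<lambda>x. norm (f n x - f k x) powr q)"
        using lpm_add_finite(2)[OF fm[of n] ff[of n] fm[of k] ff[of k] q0(1)] fm q0 by (intro powr_integrable[where \<sigma>'=q]) auto
      have "(LINT x|\<mu>. norm (f n x - f k x) powr q) \<le> e" using C(2)[OF fm[of n] ff[of n] fm[of k] ff[of k]] 1 2 by linarith
      then show ?thesis unfolding lpm_eq_integral[OF i] by (rule ennreal_leI)
    qed
    have "Lq (\<lambda>x. f n x - f k x) \<le> ennreal e" if "N \<le> n" "N \<le> k" for n k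
      using le[of n k] le[of k n] that lpm_minus_commute[of \<mu> q "f n" "f k"] by (cases "n \<le> k") auto
    then show ?thesis by blast
  qed
  obtain h r where h: "h \<in> meas" "strict_mono (r :: nat => nat)" "AE x in \<mu>. (\<lambda>n. f (r n) x) \<longlonglongrightarrow> h x"
    "(\<lambda>n. Lq (\<lambda>x. f n x - h x)) \<longlonglongrightarrow> 0"
    using lpm_complete[of f \<mu> q, OF fm q0(2) cauchy] by blast
  have "(\<lambda>n. Lq (\<lambda>x. w n x - v x)) \<longlonglongrightarrow> 0"
  proof (rule tendsto_sandwich[OF _ _ tendsto_const])
    have "(\<lambda>n. ennreal (1 / real (Suc n))) \<longlonglongrightarrow> ennreal 0" by (intro tendsto_ennrealI inv0)
    then show "(\<lambda>n. ennreal (1 / real (Suc n))) \<longlonglongrightarrow> 0" by simp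
  qed (use wf(2) in auto)
  then have pair: "w0pair v h" by (rule w0pair_closed[OF wf(1) v h(1) _ h(4)])
  have hf: "Lq h < \<infinity>" by (rule w0pair_finite(2)[OF pair])
  have "(\<lambda>n. Lq (\<lambda>x. f (r n) x - h x)) \<longlonglongrightarrow> 0" using LIMSEQ_subseq_LIMSEQ[OF h(4) h(2)] by (simp add: o_def)
  then have lim1: "(\<lambda>n. ?Phi (f (r n))) \<longlonglongrightarrow> ?Phi h"
    by (rule Phi_tendsto[OF fm ff h(1) hf _ h(3)])
  have "(\<lambda>n. A + 1 / real (Suc n)) \<longlonglongrightarrow> A + 0" by (intro tendsto_add tendsto_const inv0)
  then have "(\<lambda>n. A + 1 / real (Suc n)) \<longlonglongrightarrow> A" by simp
  from LIMSEQ_subseq_LIMSEQ[OF this h(2)] have lim2: "(\<lambda>n. A + 1 / real (Suc (r n))) \<longlonglongrightarrow> A" by (simp add: o_def)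
  have "?Phi h \<le> A"
  proof (rule LIMSEQ_le[OF lim1 lim2])
    show "\<exists>N. \<forall>n\<ge>N. ?Phi (f (r n)) \<le> A + 1 / real (Suc (r n))"
      using Pf A(2) by (intro exI[of _ 0] allI impI) (meson add_right_mono less_imp_le order_trans)
  qed
  then show ?thesis using that pair AL by auto
qed

end

section \<open>Frechet differentiability of the energy\<close>

context double_phase
begin

lemma inner_pflux_bound: "\<bar>pflux k z \<bullet> b\<bar> \<le> norm z powr (k - 1) * norm b"
  using Cauchy_Schwarz_ineq2[of "pflux k z" b] by (simp add: norm_pflux)

lemma pflux_measurable:
  fixes U :: "'a => 'b::euclidean_space"
  assumes "U \<in> meas" "1 < k"
  shows "(\<lambda>x. pflux k (U x)) \<in> meas"
  by (rule borel_measurable_continuous_on[OF pflux_continuous[OF assms(2)] assms(1)])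

lemma pflux_inner_integrable:
  fixes U b :: "'a => 'b::euclidean_space"
  assumes k: "1 < k" "k \<le> q" and U: "U \<in> meas" "Lq U < \<infinity>" and b: "b \<in> meas" "Lq b < \<infinity>"
  shows "integrable \<mu> (\<lambda>x. pflux k (U x) \<bullet> b x)"
proof (rule Bochner_Integration.integrable_bound)
  show "integrable \<mu> (\<lambda>x. norm (U x) powr k + norm (b x) powr k)"
    using k by (intro Bochner_Integration.integrable_add powr_integrable[OF U] powr_integrable[OF b]) auto
  show "(\<lambda>x. pflux k (U x) \<bullet> b x) \<in> meas"
    using pflux_measurable[OF U(1) k(1)] b(1) by measurable
  show "AE x in \<mu>. norm (pflux k (U x) \<bullet> b x) \<le> norm (norm (U x) powr k + norm (b x) powr k)"
  proof (intro AE_I2)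
    fix x
    have "\<bar>pflux k (U x) \<bullet> b x\<bar> \<le> norm (U x) powr (k - 1) * norm (b x)" by (rule inner_pflux_bound)
    also have "... \<le> norm (U x) powr k + norm (b x) powr k" using k by (intro powr_mult_le_add) auto
    finally show "norm (pflux k (U x) \<bullet> b x) \<le> norm (norm (U x) powr k + norm (b x) powr k)" by simp
  qed
qed

text \<open>Here \<open>t\<close> plays the role of the \<open>L^q\<close> norm of \<open>b\<close>.
  Using it as the threshold in the comparison of exponents gives each lower power integral its
  natural scaling t^k.\<close>

lemma powr_integral_scaled:
  fixes dummy :: "'b::euclidean_space"
  obtains V where "0 \<le> V" "\<And>(b :: 'a => 'b) t k. b \<in> meas ==> 0 < t ==> Lq b \<le> ennreal (t powr q) ==> 1 < k ==> k \<le> q ==>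
    (LINT x|\<mu>. norm (b x) powr k) \<le> V * t powr k"
proof -
  let ?V = "measure \<mu> (space \<mu>) + 1"
  have "(LINT x|\<mu>. norm (b x) powr k) \<le> ?V * t powr k"
    if b: "b \<in> meas" and t: "0 < t" and le: "Lq b \<le> ennreal (t powr q)" and k: "1 < k" "k \<le> q"
    for b :: "'a => 'b" and t k
  proof -
    have f: "Lq b < \<infinity>" using le by (rule order.strict_trans1) simp
    have i: "integrable \<mu> (\<lambda>x. norm (b x) powr q)" using b f k by (intro powr_integrable) auto
    have I: "(LINT x|\<mu>. norm (b x) powr q) \<le> t powr q" using le b k by (intro integral_le_of_lpm) auto
    have "(LINT x|\<mu>. norm (b x) powr k) \<le> (LINT x|\<mu>. t powr k + t powr (k - q) * norm (b x) powr q)"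
      using b f k t i emeasure_const_integrable
      by (intro integral_mono powr_integrable[OF b f] Bochner_Integration.integrable_add integrable_mult_right powr_lower_exponent_le) auto
    also have "... = measure \<mu> (space \<mu>) * t powr k + t powr (k - q) * (LINT x|\<mu>. norm (b x) powr q)"
      using i emeasure_const_integrable by simp
    also have "... \<le> measure \<mu> (space \<mu>) * t powr k + t powr (k - q) * t powr q"
      using I by (intro add_left_mono mult_left_mono) auto
    also have "t powr (k - q) * t powr q = t powr k" unfolding powr_add[symmetric] by simp
    finally show ?thesis by (simp add: distrib_right)
  qed
  then show ?thesis using that[of ?V] by simp
qed

text \<open>Hoelder's inequality is replaced by a pointwise Young inequality at scale
  \<open>t\<close>, which gives a bound linear in \<open>t\<close> as continuity of the derivative
  requires.\<close>

lemma pflux_inner_integral_bound: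
  fixes U :: "'a => 'b::euclidean_space"
  assumes k: "1 < k" "k \<le> q" and U: "U \<in> meas" "Lq U < \<infinity>"
  obtains K where "0 \<le> K" "\<And>(b :: 'a => 'b) t. b \<in> meas ==> 0 < t ==> Lq b \<le> ennreal (t powr q) ==>
    integrable \<mu> (\<lambda>x. norm (U x) powr (k - 1) * norm (b x)) \<and> (LINT x|\<mu>. norm (U x) powr (k - 1) * norm (b x)) \<le> K * t"
proof -
  obtain V where V: "0 \<le> V" "\<And>(b :: 'a => 'b) t k. b \<in> meas ==> 0 < t ==> Lq b \<le> ennreal (t powr q) ==> 1 < k ==> k \<le> q ==>
    (LINT x|\<mu>. norm (b x) powr k) \<le> V * t powr k" using powr_integral_scaled[where 'b='b] by blast
  let ?I = "LINT x|\<mu>. norm (U x) powr k"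
  have iU: "integrable \<mu> (\<lambda>x. norm (U x) powr k)" using k by (intro powr_integrable[OF U]) auto
  have "integrable \<mu> (\<lambda>x. norm (U x) powr (k - 1) * norm (b x)) \<and> (LINT x|\<mu>. norm (U x) powr (k - 1) * norm (b x)) \<le> (?I + V) * t"
    if b: "b \<in> meas" and t: "0 < t" and le: "Lq b \<le> ennreal (t powr q)" for b :: "'a => 'b" and t
  proof
    have f: "Lq b < \<infinity>" using le by (rule order.strict_trans1) simp
    have ib: "integrable \<mu> (\<lambda>x. norm (b x) powr k)" using k by (intro powr_integrable[OF b f]) auto
    have pw: "norm (U x) powr (k - 1) * norm (b x) \<le> t * norm (U x) powr k + t powr (1 - k) * norm (b x) powr k" for x
    proof -
      have "norm (U x) powr (k - 1) * (norm (b x) / t) \<le> norm (U x) powr k + (norm (b x) / t) powr k"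
        using k t by (intro powr_mult_le_add) auto
      then have "t * (norm (U x) powr (k - 1) * (norm (b x) / t)) \<le> t * (norm (U x) powr k + (norm (b x) / t) powr k)"
        using t by (intro mult_left_mono) auto
      then show ?thesis using t by (simp add: powr_divide powr_diff distrib_left)
    qed
    have iR: "integrable \<mu> (\<lambda>x. t * norm (U x) powr k + t powr (1 - k) * norm (b x) powr k)"
      using iU ib by (intro Bochner_Integration.integrable_add integrable_mult_right) auto
    show iL: "integrable \<mu> (\<lambda>x. norm (U x) powr (k - 1) * norm (b x))"
    proof (rule Bochner_Integration.integrable_bound[OF iR])
      show "(\<lambda>x. norm (U x) powr (k - 1) * norm (b x)) \<in> meas" using U(1) b by measurable
      show "AE x in \<mu>. norm (norm (U x) powr (k - 1) * norm (b x)) \<le> norm (t * norm (U x) powr k + t powr (1 - k) * norm (b x) powr k)"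
        using pw t by (intro AE_I2) (simp add: abs_mult)
    qed
    have "(LINT x|\<mu>. norm (U x) powr (k - 1) * norm (b x)) \<le> (LINT x|\<mu>. t * norm (U x) powr k + t powr (1 - k) * norm (b x) powr k)"
      using iL iR pw by (intro integral_mono) auto
    also have "... = t * ?I + t powr (1 - k) * (LINT x|\<mu>. norm (b x) powr k)" using iU ib by simp
    also have "... \<le> t * ?I + t powr (1 - k) * (V * t powr k)"
      using V(2)[OF b t le k] by (intro add_left_mono mult_left_mono) auto
    also have "t powr (1 - k) * (V * t powr k) = V * (t powr (1 - k) * t powr k)" by simp
    also have "t powr (1 - k) * t powr k = t" unfolding powr_add[symmetric] using t by simp
    finally show "(LINT x|\<mu>. norm (U x) powr (k - 1) * norm (b x)) \<le> (?I + V) * t" by (simp add: algebra_simps)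
  qed
  moreover have "0 \<le> ?I + V" using V by (intro add_nonneg_nonneg integral_nonneg_AE) auto
  ultimately show ?thesis using that by blast
qed

text \<open>The increment of the flux splits into a small multiple of |U|^(k-1), whose pairing with
  \<open>b\<close> is linear in \<open>t\<close> with a small constant, and a multiple of |b|^(k-1),
  whose pairing is of order t^k with k > 1.\<close>

lemma norm_powr_frechet:
  fixes U :: "'a => 'b::euclidean_space"
  assumes k: "1 < k" "k \<le> q" and U: "U \<in> meas" "Lq U < \<infinity>" and e: "0 < e"
  obtains \<delta> where "0 < \<delta>" "\<And>b t. b \<in> meas ==> 0 < t ==> t < \<delta> ==> Lq b \<le> ennreal (t powr q) ==>
    (LINT x|\<mu>. norm (pflux k (U x + b x) - pflux k (U x)) * norm (b x)) \<le> e * t \<and>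
    integrable \<mu> (\<lambda>x. norm (pflux k (U x + b x) - pflux k (U x)) * norm (b x))"
proof -
  obtain V where V: "0 \<le> V" "\<And>(b :: 'a => 'b) t k. b \<in> meas ==> 0 < t ==> Lq b \<le> ennreal (t powr q) ==> 1 < k ==> k \<le> q ==>
    (LINT x|\<mu>. norm (b x) powr k) \<le> V * t powr k" using powr_integral_scaled[where 'b='b] by blast
  obtain K where K: "0 \<le> K" "\<And>(b :: 'a => 'b) t. b \<in> meas ==> 0 < t ==> Lq b \<le> ennreal (t powr q) ==>
    integrable \<mu> (\<lambda>x. norm (U x) powr (k - 1) * norm (b x)) \<and> (LINT x|\<mu>. norm (U x) powr (k - 1) * norm (b x)) \<le> K * t"
    using pflux_inner_integral_bound[OF k U] by blast
  define \<eta> where "\<eta> = e / (2 * (K + 1))"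
  have \<eta>: "0 < \<eta>" "\<eta> * K \<le> e / 2" using e K(1) by (auto simp: \<eta>_def field_simps)
  obtain C where C: "0 \<le> C" "\<And>z b :: 'b. norm (pflux k (z + b) - pflux k z) \<le> \<eta> * norm z powr (k - 1) + C * norm b powr (k - 1)"
    using pflux_increment[OF k(1) \<eta>(1), where 'b='b] by blast
  \<comment> \<open>Determined by C V t^(k-1) at most e / 2.\<close>
  define \<delta> where "\<delta> = (e / (2 * (C * V + 1))) powr (1 / (k - 1))"
  have CV: "0 \<le> C * V" using C V by simp
  have \<delta>: "0 < \<delta>" using e CV by (simp add: \<delta>_def add_nonneg_eq_0_iff)
  have cancel: "c * (e / (2 * c)) = e / 2" if "c \<noteq> 0" for c :: real using that by simp
  have small: "C * V * t powr k \<le> e / 2 * t" if t: "0 < t" "t < \<delta>" for t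
  proof -
    have "t powr (k - 1) \<le> \<delta> powr (k - 1)" using t k by (intro powr_mono2) auto
    also have "... = e / (2 * (C * V + 1))" using k e CV by (simp add: \<delta>_def powr_powr)
    finally have "t powr (k - 1) \<le> e / (2 * (C * V + 1))" .
    then have "(C * V + 1) * t powr (k - 1) \<le> (C * V + 1) * (e / (2 * (C * V + 1)))" using CV by (intro mult_left_mono) auto
    also have "... = e / 2" using CV by (intro cancel) auto
    finally have "(C * V + 1) * t powr (k - 1) \<le> e / 2" .
    moreover have "C * V * t powr (k - 1) \<le> (C * V + 1) * t powr (k - 1)" by (intro mult_right_mono) auto
    ultimately have "C * V * t powr (k - 1) \<le> e / 2" by (rule order_trans[rotated])
    then have "C * V * t powr (k - 1) * t \<le> e / 2 * t" using t by (intro mult_right_mono) auto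
    then show ?thesis using t by (simp add: powr_diff)
  qed
  show ?thesis
  proof (rule that[OF \<delta>], goal_cases)
    case (1 b t)
    note b = 1(1) and t = 1(2,3) and le = 1(4)
    have f: "Lq b < \<infinity>" using le by (rule order.strict_trans1) simp
    have ib: "integrable \<mu> (\<lambda>x. norm (b x) powr k)" using k by (intro powr_integrable[OF b f]) auto
    note K' = K(2)[OF b t(1) le]
    let ?F = "\<lambda>x. norm (pflux k (U x + b x) - pflux k (U x)) * norm (b x)"
    let ?G = "\<lambda>x. \<eta> * (norm (U x) powr (k - 1) * norm (b x)) + C * norm (b x) powr k"
    have pw: "?F x \<le> ?G x" for x
    proof -
      have "?F x \<le> (\<eta> * norm (U x) powr (k - 1) + C * norm (b x) powr (k - 1)) * norm (b x)"
        by (intro mult_right_mono C) auto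
      also have "... = ?G x" by (cases "b x = 0") (auto simp: distrib_right powr_diff)
      finally show ?thesis .
    qed
    have iG: "integrable \<mu> ?G" using K' ib by (intro Bochner_Integration.integrable_add integrable_mult_right) auto
    have iF: "integrable \<mu> ?F"
    proof (rule Bochner_Integration.integrable_bound[OF iG])
      have "(\<lambda>x. U x + b x) \<in> meas" using U b by measurable
      note [measurable] = pflux_measurable[OF this k(1)] pflux_measurable[OF U(1) k(1)] b
      show "?F \<in> meas" by measurable
      show "AE x in \<mu>. norm (?F x) \<le> norm (?G x)"
      proof (intro AE_I2)
        fix x
        have "norm (?F x) = ?F x" by simp
        also have "... \<le> ?G x" by (rule pw)
        also have "... \<le> norm (?G x)" by simp
        finally show "norm (?F x) \<le> norm (?G x)" .
      qed
    qed
    have "(LINT x|\<mu>. ?F x) \<le> (LINT x|\<mu>. ?G x)" using iF iG pw by (intro integral_mono) auto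
    also have "... = \<eta> * (LINT x|\<mu>. norm (U x) powr (k - 1) * norm (b x)) + C * (LINT x|\<mu>. norm (b x) powr k)"
      using K' ib by simp
    also have "... \<le> \<eta> * (K * t) + C * (V * t powr k)"
      using K' V(2)[OF b t(1) le k] \<eta> C by (intro add_mono mult_left_mono) auto
    also have "\<eta> * (K * t) \<le> e / 2 * t" using mult_right_mono[OF \<eta>(2), of t] t by simp
    also have "C * (V * t powr k) \<le> e / 2 * t" using small[OF t] by (simp add: mult.assoc)
    finally show ?case using iF by simp
  qed
qed

text \<open>Differentiability is phrased with any \<open>t\<close> dominating the size of
  \<open>b\<close> in place of the Luxemburg norm; the translation to the norm is made only at the
  very end.\<close>

lemma Phi_frechet:
  fixes U :: "'a => 'b::euclidean_space"
  assumes U: "U \<in> meas" "Lq U < \<infinity>" and d: "0 < d"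
  obtains \<delta> where "0 < \<delta>" "\<And>b t. b \<in> meas ==> 0 < t ==> t < \<delta> ==> Lq b \<le> ennreal (t powr q) ==>
    \<bar>Phi (\<lambda>x. U x + b x) - Phi U - (LINT x|\<mu>. dphase_flux p q a x (U x) \<bullet> b x)\<bar> \<le> d * t"
proof -
  have pq: "1 < p" "p \<le> q" "1 < q" "q \<le> q" using p_gt_1 p_less_q by auto
  \<comment> \<open>The p-part and the q-part, the latter weighted by at most a1, share
    \<open>d\<close>.\<close>
  define e where "e = d / (1 + a1)"
  have e: "0 < e" "e + a1 * e = d" using d a1_pos by (auto simp: e_def field_simps add_nonneg_eq_0_iff)
  let ?D = "\<lambda>k b x. norm (pflux k (U x + b x) - pflux k (U x)) * norm (b x)"
  obtain d1 where d1: "0 < d1" "\<And>b t. b \<in> meas ==> 0 < t ==> t < d1 ==> Lq b \<le> ennreal (t powr q) ==>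
    (LINT x|\<mu>. ?D p b x) \<le> e * t \<and> integrable \<mu> (?D p b)"
    using norm_powr_frechet[OF pq(1,2) U e(1)] by blast
  obtain d2 where d2: "0 < d2" "\<And>b t. b \<in> meas ==> 0 < t ==> t < d2 ==> Lq b \<le> ennreal (t powr q) ==>
    (LINT x|\<mu>. ?D q b x) \<le> e * t \<and> integrable \<mu> (?D q b)"
    using norm_powr_frechet[OF pq(3,4) U e(1)] by blast
  have "0 < min d1 d2" using d1 d2 by simp
  then show ?thesis
  proof (rule that, goal_cases)
    case (1 b t)
    note b = 1(1) and t = 1(2) and le = 1(4)
    have f: "Lq b < \<infinity>" using le by (rule order.strict_trans1) simp
    have D: "(LINT x|\<mu>. ?D p b x) \<le> e * t" "integrable \<mu> (?D p b)" "(LINT x|\<mu>. ?D q b x) \<le> e * t" "integrable \<mu> (?D q b)"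
      using d1(2)[OF b t _ le] d2(2)[OF b t _ le] 1(3) by auto
    have Ub: "(\<lambda>x. U x + b x) \<in> meas" "Lq (\<lambda>x. U x + b x) < \<infinity>"
      using lpm_add_finite(1)[OF U b f] U(1) b pq by auto
    have ifl: "integrable \<mu> (\<lambda>x. dphase_flux p q a x (U x) \<bullet> b x)"
      unfolding dphase_flux_pflux inner_add_left inner_scaleR_left
      using pflux_inner_integrable[OF pq(1,2) U b f] pflux_inner_integrable[OF pq(3,4) U b f]
      by (intro Bochner_Integration.integrable_add a_mult_integrable)
    have iE: "integrable \<mu> (\<lambda>x. energy x (U x + b x))" "integrable \<mu> (\<lambda>x. energy x (U x))"
      using energy_integrable[OF Ub] energy_integrable[OF U] .
    let ?R = "\<lambda>x. energy x (U x + b x) - energy x (U x) - dphase_flux p q a x (U x) \<bullet> b x"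
    have pw: "\<bar>?R x\<bar> \<le> ?D p b x + a1 * ?D q b x" if x: "x \<in> \<Omega>" for x
    proof -
      have r: "\<bar>norm (U x + b x) powr k - norm (U x) powr k - k * (pflux k (U x) \<bullet> b x)\<bar> / k \<le> ?D k b x" if "1 < k" for k
        using norm_powr_remainder[OF that, of "U x" "b x"] that by (simp add: abs_of_nonneg field_simps)
      have a: "0 \<le> a x" "a x \<le> a1" using a_lower[OF x] a_upper[OF x] a0_pos by auto
      let ?rp = "norm (U x + b x) powr p - norm (U x) powr p - p * (pflux p (U x) \<bullet> b x)"
      let ?rq = "norm (U x + b x) powr q - norm (U x) powr q - q * (pflux q (U x) \<bullet> b x)"
      have "?R x = ?rp / p + a x * (?rq / q)"
        unfolding dphase_flux_pflux energy_def inner_add_left inner_scaleR_left using pq by (simp add: field_simps)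
      then have "\<bar>?R x\<bar> \<le> \<bar>?rp / p\<bar> + \<bar>a x * (?rq / q)\<bar>" by (simp only: abs_triangle_ineq)
      also have "... = \<bar>?rp\<bar> / p + a x * (\<bar>?rq\<bar> / q)" using pq a by (simp add: abs_mult)
      also have "... \<le> ?D p b x + a1 * ?D q b x" using r[OF pq(1)] r[OF pq(3)] a a1_pos pq by (intro add_mono mult_mono) auto
      finally show ?thesis .
    qed
    have "\<bar>LINT x|\<mu>. ?R x\<bar> \<le> (LINT x|\<mu>. ?D p b x + a1 * ?D q b x)"
      using iE ifl D pw
      by (intro integral_abs_bound[THEN order_trans] integral_mono Bochner_Integration.integrable_abs Bochner_Integration.integrable_diff Bochner_Integration.integrable_add integrable_mult_right) auto
    also have "... = (LINT x|\<mu>. ?D p b x) + a1 * (LINT x|\<mu>. ?D q b x)" using D by simp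
    also have "... \<le> e * t + a1 * (e * t)" using D a1_pos by (intro add_mono mult_left_mono) auto
    also have "... = (e + a1 * e) * t" by (simp add: distrib_right)
    finally have "\<bar>LINT x|\<mu>. ?R x\<bar> \<le> d * t" by (simp only: e)
    then show ?case unfolding Phi_energy using iE ifl by simp
  qed
qed

lemma flux_integrable:
  fixes U b :: "'a => 'b::euclidean_space"
  assumes U: "U \<in> meas" "Lq U < \<infinity>" and b: "b \<in> meas" "Lq b < \<infinity>"
  shows "integrable \<mu> (\<lambda>x. dphase_flux p q a x (U x) \<bullet> b x)"
  unfolding dphase_flux_pflux inner_add_left inner_scaleR_left using p_gt_1 p_less_q
  by (intro Bochner_Integration.integrable_add a_mult_integrable pflux_inner_integrable U b) auto

lemma flux_integral_bound:
  fixes U :: "'a => 'b::euclidean_space"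
  assumes U: "U \<in> meas" "Lq U < \<infinity>"
  obtains K where "0 \<le> K" "\<And>(b :: 'a => 'b) t. b \<in> meas ==> 0 < t ==> Lq b \<le> ennreal (t powr q) ==>
    \<bar>LINT x|\<mu>. dphase_flux p q a x (U x) \<bullet> b x\<bar> \<le> K * t"
proof -
  have pq: "1 < p" "p \<le> q" "1 < q" "q \<le> q" using p_gt_1 p_less_q by auto
  let ?D = "\<lambda>k b x. norm (U x) powr (k - 1) * norm (b x)"
  obtain K1 where K1: "0 \<le> K1" "\<And>(b :: 'a => 'b) t. b \<in> meas ==> 0 < t ==> Lq b \<le> ennreal (t powr q) ==>
    integrable \<mu> (?D p b) \<and> (LINT x|\<mu>. ?D p b x) \<le> K1 * t"
    using pflux_inner_integral_bound[OF pq(1,2) U] by blast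
  obtain K2 where K2: "0 \<le> K2" "\<And>(b :: 'a => 'b) t. b \<in> meas ==> 0 < t ==> Lq b \<le> ennreal (t powr q) ==>
    integrable \<mu> (?D q b) \<and> (LINT x|\<mu>. ?D q b x) \<le> K2 * t"
    using pflux_inner_integral_bound[OF pq(3,4) U] by blast
  have "0 \<le> K1 + a1 * K2" using K1 K2 a1_pos by simp
  then show ?thesis
  proof (rule that, goal_cases)
    case (1 b t)
    have f: "Lq b < \<infinity>" using 1(3) by (rule order.strict_trans1) simp
    have D: "integrable \<mu> (?D p b)" "(LINT x|\<mu>. ?D p b x) \<le> K1 * t" "integrable \<mu> (?D q b)" "(LINT x|\<mu>. ?D q b x) \<le> K2 * t"
      using K1(2)[OF 1] K2(2)[OF 1] by auto
    have pw: "\<bar>dphase_flux p q a x (U x) \<bullet> b x\<bar> \<le> ?D p b x + a1 * ?D q b x" if x: "x \<in> \<Omega>" for x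
    proof -
      have a: "0 \<le> a x" "a x \<le> a1" using a_lower[OF x] a_upper[OF x] a0_pos by auto
      have "\<bar>dphase_flux p q a x (U x) \<bullet> b x\<bar> \<le> \<bar>pflux p (U x) \<bullet> b x\<bar> + \<bar>a x * (pflux q (U x) \<bullet> b x)\<bar>"
        unfolding dphase_flux_pflux inner_add_left inner_scaleR_left by (rule abs_triangle_ineq)
      also have "... = \<bar>pflux p (U x) \<bullet> b x\<bar> + a x * \<bar>pflux q (U x) \<bullet> b x\<bar>" using a by (simp add: abs_mult)
      also have "... \<le> ?D p b x + a1 * ?D q b x" using a a1_pos by (intro add_mono mult_mono inner_pflux_bound) auto
      finally show ?thesis .
    qed
    have "\<bar>LINT x|\<mu>. dphase_flux p q a x (U x) \<bullet> b x\<bar> \<le> (LINT x|\<mu>. ?D p b x + a1 * ?D q b x)"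
      using flux_integrable[OF U 1(1) f] D pw
      by (intro integral_abs_bound[THEN order_trans] integral_mono Bochner_Integration.integrable_abs Bochner_Integration.integrable_add integrable_mult_right) auto
    also have "... = (LINT x|\<mu>. ?D p b x) + a1 * (LINT x|\<mu>. ?D q b x)" using D by simp
    also have "... \<le> K1 * t + a1 * (K2 * t)" using D a1_pos by (intro add_mono mult_left_mono) auto
    finally show ?case by (simp add: distrib_right)
  qed
qed

end

section \<open>Primitives of continuous functions\<close>

lemma prim_0: "prim f 0 = 0"
  by (simp add: prim_def zero_ereal_def[symmetric])

text \<open>M is continuous on the half line only, so at the left end the derivative is one-sided;
  the interval up to s + 1 is a compact neighbourhood of s within it.\<close>

lemma prim_has_derivative_within:
  assumes "continuous_on {0..} M" "0 \<le> s"
  shows "(prim M has_real_derivative M s) (at s within {0..s+1})"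
proof -
  have "((\<lambda>u. LBINT y=ereal 0..ereal u. M y) has_vector_derivative M s) (at s within {0..s+1})"
    by (rule interval_integral_FTC2) (use assms in \<open>auto intro: continuous_on_subset\<close>)
  then show ?thesis
    unfolding prim_def[abs_def] by (simp add: has_real_derivative_iff_has_vector_derivative zero_ereal_def)
qed

lemma prim_has_derivative:
  assumes "continuous_on UNIV f"
  shows "(prim f has_real_derivative f t) (at t)"
proof -
  let ?n = "\<bar>t\<bar> + 1"
  have "((\<lambda>u. LBINT y=ereal 0..ereal u. f y) has_vector_derivative f t) (at t within {-?n..?n})"
    by (rule interval_integral_FTC2) (use assms in \<open>auto intro: continuous_on_subset\<close>)
  then have "(prim f has_real_derivative f t) (at t within {-?n..?n})"
    unfolding prim_def[abs_def] by (simp add: has_real_derivative_iff_has_vector_derivative zero_ereal_def)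
  moreover have "at t within {-?n..?n} = at t" by (rule at_within_Icc_at) auto
  ultimately show ?thesis by simp
qed

lemma prim_tangent:
  assumes M: "continuous_on {0..} M" and s: "0 \<le> s" and e: "0 < e"
  obtains d where "0 < d" "\<And>y. 0 \<le> y ==> \<bar>y - s\<bar> < d ==> \<bar>prim M y - prim M s - M s * (y - s)\<bar> \<le> e * \<bar>y - s\<bar>"
proof -
  have "(prim M has_derivative (\<lambda>h. M s * h)) (at s within {0..s+1})"
    using prim_has_derivative_within[OF M s] by (simp add: has_field_derivative_def)
  then obtain d where d: "0 < d" "\<And>y. y \<in> {0..s+1} ==> norm (y - s) < d ==> norm (prim M y - prim M s - M s * (y - s)) \<le> e * norm (y - s)"
    using e unfolding has_derivative_within_alt by blast
  show ?thesis
  proof (rule that[of "min d 1"])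
    fix y assume y: "0 \<le> y" "\<bar>y - s\<bar> < min d 1"
    then have "y \<in> {0..s+1}" by auto
    then show "\<bar>prim M y - prim M s - M s * (y - s)\<bar> \<le> e * \<bar>y - s\<bar>" using d(2)[of y] y by simp
  qed (use d in auto)
qed

lemma prim_continuous_on: "continuous_on {0..} M ==> continuous_on {0..} (prim M)"
proof (unfold continuous_on_iff, intro ballI allI impI)
  fix s e :: real assume M: "\<forall>x\<in>{0..}. \<forall>e>0. \<exists>d>0. \<forall>x'\<in>{0..}. dist x' x < d \<longrightarrow> dist (M x') (M x) < e" and s: "s \<in> {0..}" and e: "0 < e"
  have "continuous_on {0..} M" using M unfolding continuous_on_iff .
  then obtain d where d: "0 < d" "\<And>y. 0 \<le> y ==> \<bar>y - s\<bar> < d ==> \<bar>prim M y - prim M s - M s * (y - s)\<bar> \<le> 1 * \<bar>y - s\<bar>"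
    using prim_tangent[of M s 1] s by auto
  define K where "K = \<bar>M s\<bar> + 1"
  have K: "0 < K" by (simp add: K_def add_nonneg_pos)
  show "\<exists>d>0. \<forall>x'\<in>{0..}. dist x' s < d \<longrightarrow> dist (prim M x') (prim M s) < e"
  proof (intro exI[of _ "min d (e / K)"] conjI ballI impI)
    fix y :: real assume y: "y \<in> {0..}" "dist y s < min d (e / K)"
    have "\<bar>prim M y - prim M s\<bar> \<le> \<bar>M s * (y - s)\<bar> + \<bar>y - s\<bar>" using d(2)[of y] y by (auto simp: dist_real_def abs_if split: if_splits)
    also have "... = K * \<bar>y - s\<bar>" by (simp add: K_def abs_mult distrib_right)
    also have "... < e" using y K by (simp add: dist_real_def pos_less_divide_eq mult.commute)
    finally show "dist (prim M y) (prim M s) < e" by (simp add: dist_real_def)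
  qed (use d e K in auto)
qed

lemma prim_mono:
  assumes M: "continuous_on {0..} M" "\<And>t. 0 \<le> t ==> 0 \<le> M t" and xy: "0 \<le> x" "x \<le> y"
  shows "prim M x \<le> prim M y"
proof (rule DERIV_nonneg_imp_increasing_open[OF xy(2)])
  show "continuous_on {x..y} (prim M)" using continuous_on_subset[OF prim_continuous_on[OF M(1)], of "{x..y}"] xy by auto
  fix z assume z: "x < z" "z < y"
  have "at z within {0..z+1} = at z" by (rule at_within_Icc_at) (use z xy in auto)
  then have "(prim M has_real_derivative M z) (at z)" using prim_has_derivative_within[OF M(1), of z] z xy by simp
  then show "\<exists>y. (prim M has_real_derivative y) (at z) \<and> 0 \<le> y" using M(2)[of z] z xy by auto
qed

section \<open>The lower order term\<close>

lemma prim_increment: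
  assumes f: "continuous_on UNIV f"
  obtains \<xi> where "\<bar>\<xi>\<bar> \<le> \<bar>t\<bar> + \<bar>b\<bar>" "prim f (t + b) - prim f t = b * f \<xi>"
proof -
  note D = prim_has_derivative[OF f]
  consider "b = 0" | "0 < b" | "b < 0" by linarith
  then show ?thesis
  proof cases
    case 1
    then show ?thesis using that[of t] by simp
  next
    case 2
    then obtain z where "t < z" "z < t + b" "prim f (t + b) - prim f t = (t + b - t) * f z"
      using MVT2[of t "t + b" "prim f" f] D by auto
    then show ?thesis by (intro that[of z]) auto
  next
    case 3
    then obtain z where "t + b < z" "z < t" "prim f t - prim f (t + b) = (t - (t + b)) * f z"
      using MVT2[of "t + b" t "prim f" f] D by auto
    then show ?thesis by (intro that[of z]) auto
  qed
qed

text \<open>The first-order remainder divided by the increment; it is 0 for zero increment by the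
  convention for division. As a quotient it tends to zero and can be dominated before the increment
  is integrated.\<close>

definition prim_rem :: "(real => real) => real => real => real" where
  "prim_rem f t b = \<bar>prim f (t + b) - prim f t - f t * b\<bar> / \<bar>b\<bar>"

lemma prim_rem_nonneg: "0 \<le> prim_rem f t b"
  by (simp add: prim_rem_def)

lemma prim_rem_mult: "prim_rem f t b * \<bar>b\<bar> = \<bar>prim f (t + b) - prim f t - f t * b\<bar>"
  by (cases "b = 0") (auto simp: prim_rem_def)

lemma prim_rem_tendsto:
  assumes f: "continuous_on UNIV f" and b: "b \<longlonglongrightarrow> 0"
  shows "(\<lambda>n. prim_rem f t (b n)) \<longlonglongrightarrow> 0"
proof -
  have "(\<lambda>y. if y = 0 then f t else (prim f (t + y) - prim f t) / y) \<midarrow>0\<rightarrow> f t"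
    using prim_has_derivative[OF f, of t] unfolding DERIV_def
    by (rule tendsto_cong[THEN iffD1, rotated]) (auto simp: eventually_at_filter)
  then have "isCont (\<lambda>y. if y = 0 then f t else (prim f (t + y) - prim f t) / y) 0" by (simp add: isCont_def)
  from isCont_tendsto_compose[OF this b]
  have "(\<lambda>n. \<bar>(if b n = 0 then f t else (prim f (t + b n) - prim f t) / b n) - f t\<bar>) \<longlonglongrightarrow> \<bar>f t - f t\<bar>"
    by (intro tendsto_rabs tendsto_diff tendsto_const) simp
  moreover have "\<bar>(if y = 0 then f t else (prim f (t + y) - prim f t) / y) - f t\<bar> = prim_rem f t y" for y
  proof (cases "y = 0")
    case False
    then have "(prim f (t + y) - prim f t) / y - f t = (prim f (t + y) - prim f t - f t * y) / y" by (simp add: field_simps)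
    then show ?thesis using False by (simp add: prim_rem_def abs_divide)
  qed (simp add: prim_rem_def)
  ultimately show ?thesis by simp
qed

lemma prim_growth:
  assumes f: "continuous_on UNIV f" and g: "\<And>t. \<bar>f t\<bar> \<le> C * (1 + \<bar>t\<bar> powr (r - 1))" and r: "1 < r"
  shows "\<bar>prim f t\<bar> \<le> C * (\<bar>t\<bar> + \<bar>t\<bar> powr r)" "prim_rem f t b \<le> 2 * C * (1 + (\<bar>t\<bar> + \<bar>b\<bar>) powr (r - 1))"
proof -
  have C: "0 \<le> C" using order_trans[OF abs_ge_zero g[of 0]] r by simp
  have m: "\<bar>f \<xi>\<bar> \<le> C * (1 + X powr (r - 1))" if "\<bar>\<xi>\<bar> \<le> X" for \<xi> X
    using r C that by (intro order_trans[OF g] mult_left_mono add_left_mono powr_mono2) auto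
  obtain z where z: "\<bar>z\<bar> \<le> \<bar>0\<bar> + \<bar>t\<bar>" "prim f (0 + t) - prim f 0 = t * f z" by (rule prim_increment[OF f])
  then have "\<bar>prim f t\<bar> = \<bar>t\<bar> * \<bar>f z\<bar>" by (simp add: prim_0 abs_mult)
  also have "... \<le> \<bar>t\<bar> * (C * (1 + \<bar>t\<bar> powr (r - 1)))" using z by (intro mult_left_mono m) auto
  also have "... = C * (\<bar>t\<bar> + \<bar>t\<bar> powr r)" by (cases "t = 0") (auto simp: powr_diff algebra_simps)
  finally show "\<bar>prim f t\<bar> \<le> C * (\<bar>t\<bar> + \<bar>t\<bar> powr r)" .
  obtain z where z: "\<bar>z\<bar> \<le> \<bar>t\<bar> + \<bar>b\<bar>" "prim f (t + b) - prim f t = b * f z" by (rule prim_increment[OF f])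
  have "\<bar>prim f (t + b) - prim f t - f t * b\<bar> = \<bar>b\<bar> * \<bar>f z - f t\<bar>"
    using z(2) by (simp add: abs_mult[symmetric] algebra_simps)
  then have "prim_rem f t b \<le> \<bar>f z - f t\<bar>" by (simp add: prim_rem_def)
  also have "... \<le> \<bar>f z\<bar> + \<bar>f t\<bar>" by linarith
  also have "... \<le> C * (1 + (\<bar>t\<bar> + \<bar>b\<bar>) powr (r - 1)) + C * (1 + (\<bar>t\<bar> + \<bar>b\<bar>) powr (r - 1))"
    using z by (intro add_mono m) auto
  finally show "prim_rem f t b \<le> 2 * C * (1 + (\<bar>t\<bar> + \<bar>b\<bar>) powr (r - 1))" by simp
qed

text \<open>Either e is at most c w^(s-1), and the first term suffices, or w is bounded by a power
  of e / c, and the second does.\<close>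

lemma young_epsilon:
  fixes e w c s :: real
  assumes "0 \<le> e" "0 \<le> w" "0 < c" "1 < s"
  shows "e * w \<le> c * w powr s + (1 / c) powr (1 / (s - 1)) * e powr (s / (s - 1))"
proof (cases "e \<le> c * w powr (s - 1)")
  case True
  then have "e * w \<le> c * w powr (s - 1) * w" using assms by (intro mult_right_mono) auto
  also have "... = c * w powr s" using assms by (cases "w = 0") (auto simp: powr_diff)
  finally show ?thesis by (simp add: add_increasing2)
next
  case False
  then have "w powr (s - 1) \<le> e / c" using assms by (simp add: field_simps)
  then have "(w powr (s - 1)) powr (1 / (s - 1)) \<le> (e / c) powr (1 / (s - 1))" using assms by (intro powr_mono2) auto
  then have "w \<le> (e / c) powr (1 / (s - 1))" using assms by (simp add: powr_powr)
  then have "e * w \<le> e * (e / c) powr (1 / (s - 1))" using assms by (intro mult_left_mono) auto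
  also have "... = (1 / c) powr (1 / (s - 1)) * (e powr 1 * e powr (1 / (s - 1)))"
    using assms by (simp add: powr_divide)
  also have "e powr 1 * e powr (1 / (s - 1)) = e powr (s / (s - 1))"
    unfolding powr_add[symmetric] using assms by (simp add: field_simps)
  finally show ?thesis using assms by (simp add: add_increasing)
qed

text \<open>Since r is below s, the growth exponent r - 1 times the conjugate exponent s / (s - 1)
  is at most s.\<close>

lemma growth_conjugate_power:
  fixes C r s X :: real
  assumes "0 \<le> C" "0 \<le> X" "1 < r" "r < s"
  shows "(2 * C * (1 + X powr (r - 1))) powr (s / (s - 1)) \<le> (4 * C) powr (s / (s - 1)) * (1 + X powr s)"
proof -
  let ?m = "max 1 X" let ?s' = "s / (s - 1)"
  have s': "0 < ?s'" using assms by simp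
  have e: "(r - 1) * ?s' \<le> s"
  proof -
    have "(r - 1) * s \<le> (s - 1) * s" using assms by (intro mult_right_mono) auto
    then show ?thesis using assms by (simp add: field_simps)
  qed
  have "1 powr (r - 1) \<le> ?m powr (r - 1)" using assms by (intro powr_mono2) auto
  moreover have "X powr (r - 1) \<le> ?m powr (r - 1)" using assms by (intro powr_mono2) auto
  ultimately have "1 + X powr (r - 1) \<le> 2 * ?m powr (r - 1)" by simp
  then have "2 * C * (1 + X powr (r - 1)) \<le> 2 * C * (2 * ?m powr (r - 1))" using assms by (intro mult_left_mono) auto
  then have "(2 * C * (1 + X powr (r - 1))) powr ?s' \<le> (2 * C * (2 * ?m powr (r - 1))) powr ?s'"
    using assms s' by (intro powr_mono2) auto
  also have "... = (4 * C) powr ?s' * ?m powr ((r - 1) * ?s')"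
  proof -
    have "2 * C * (2 * ?m powr (r - 1)) = (4 * C) * ?m powr (r - 1)" by simp
    then show ?thesis using assms by (simp only:) (simp add: powr_mult powr_powr)
  qed
  also have "... \<le> (4 * C) powr ?s' * ?m powr s" using e by (intro mult_left_mono powr_mono) auto
  also have "?m powr s \<le> 1 + X powr s" by (simp add: max_def)
  finally show ?thesis by (simp add: mult_left_mono)
qed

section \<open>Measurability, continuity and differentiability of the integral of H\<close>

locale nonlinearity = double_phase \<Omega> m p q a0 a1 s a
  for \<Omega> :: "'a::euclidean_space set" and m p q a0 a1 s a +
  fixes h :: "'a => real => real" and r C_r :: real
  assumes h_continuous: "continuous_on (\<Omega> \<times> UNIV) (\<lambda>(x, t). h x t)"
    and r_gt_1: "1 < r" and r_less_s: "r < s" and C_r_pos: "0 < C_r"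
    and growth: "AE x in lebesgue_on \<Omega>. \<forall>t. \<bar>h x t\<bar> \<le> C_r * (1 + \<bar>t\<bar> powr (r - 1))"
begin

lemma h_slice: "x \<in> \<Omega> ==> continuous_on UNIV (h x)"
proof -
  assume "x \<in> \<Omega>"
  moreover have "continuous_on UNIV (\<lambda>t::real. (x, t))" by (intro continuous_intros)
  ultimately show ?thesis using continuous_on_compose2[OF h_continuous, of UNIV "\<lambda>t. (x, t)"] by auto
qed

text \<open>Extension of \<open>h\<close> by zero. Continuity on an open set makes it Borel on the
  whole product, so compositions with Lebesgue measurable functions become measurable.\<close>

definition hext :: "'a \<times> real => real" where
  "hext z = indicator (\<Omega> \<times> UNIV) z *\<^sub>R (case z of (x, t) => h x t)"

lemma hext_measurable: "hext \<in> borel_measurable borel"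
  unfolding hext_def[abs_def]
  by (rule borel_measurable_continuous_on_indicator[OF _ h_continuous]) (simp add: open_Times open_dom)

lemma ident_measurable: "(\<lambda>x. x) \<in> measurable \<mu> borel"
  by (intro measurable_restrict_space1 measurable_completion) simp

lemma hext_pair_measurable:
  assumes "f \<in> measurable M borel" "g \<in> borel_measurable M"
  shows "(\<lambda>x. hext (f x, g x)) \<in> borel_measurable M"
  by (rule measurable_compose[OF borel_measurable_Pair[OF assms] hext_measurable])

lemma h_measurable:
  assumes "u \<in> meas" shows "(\<lambda>x. h x (u x)) \<in> meas"
proof -
  have "(\<lambda>x. hext (x, u x)) \<in> meas" by (rule hext_pair_measurable[OF ident_measurable assms])
  then show ?thesis by (rule measurable_cong[THEN iffD1, rotated]) (simp add: hext_def)
qed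

text \<open>The variable limit of integration is moved into the integrand, so that measurability of
  parameter integrals over the whole line applies.\<close>

lemma prim_h_measurable:
  assumes u[measurable]: "u \<in> meas" shows "(\<lambda>x. prim (h x) (u x)) \<in> meas"
proof -
  \<comment> \<open>The second case, with its sign, encodes the orientation of the integral for
    negative \<open>u x\<close>.\<close>
  define g where "g x t = (if 0 < t \<and> t < u x then hext (x, t) else if u x < t \<and> t < 0 then - hext (x, t) else 0)" for x t
  have [measurable]: "(\<lambda>z. hext (fst z, snd z)) \<in> borel_measurable (\<mu> \<Otimes>\<^sub>M lborel)"
  proof (rule hext_pair_measurable)
    show "fst \<in> measurable (\<mu> \<Otimes>\<^sub>M lborel) borel" by (rule measurable_compose[OF measurable_fst ident_measurable])
    show "snd \<in> borel_measurable (\<mu> \<Otimes>\<^sub>M lborel)" using measurable_snd[of \<mu> lborel] by simp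
  qed
  have "(\<lambda>z. g (fst z) (snd z)) \<in> borel_measurable (\<mu> \<Otimes>\<^sub>M lborel)" unfolding g_def by measurable
  then have "case_prod g \<in> borel_measurable (\<mu> \<Otimes>\<^sub>M lborel)" by (simp add: case_prod_beta')
  then have "(\<lambda>x. LINT t|lborel. g x t) \<in> meas" by (rule lborel.borel_measurable_lebesgue_integral)
  then show ?thesis
  proof (rule measurable_cong[THEN iffD1, rotated])
    fix x assume x: "x \<in> space \<mu>"
    show "(LINT t|lborel. g x t) = prim (h x) (u x)"
    proof (cases "0 \<le> u x")
      case True
      then show ?thesis using x
        unfolding prim_def interval_lebesgue_integral_def set_lebesgue_integral_def g_def
        by (auto intro!: Bochner_Integration.integral_cong simp: hext_def einterval_def indicator_def)
    next
      case False
      have "g x = (\<lambda>t. - (indicator (einterval (ereal (u x)) 0) t *\<^sub>R h x t))"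
        using x False by (intro ext) (auto simp: g_def hext_def einterval_def indicator_def)
      then show ?thesis using False
        unfolding prim_def interval_lebesgue_integral_def set_lebesgue_integral_def by simp
    qed
  qed
qed

lemma AE_growth: "AE x in \<mu>. x \<in> \<Omega> \<and> (\<forall>t. \<bar>h x t\<bar> \<le> C_r * (1 + \<bar>t\<bar> powr (r - 1)))"
  using growth AE_space by eventually_elim auto

lemma s_gt_1: "1 < s" using q_gt_1 q_less_s by simp

lemma powr_integrable_s:
  fixes u :: "'a => real"
  assumes "u \<in> meas" "lpm \<mu> s u < \<infinity>" "0 \<le> k" "k \<le> s"
  shows "integrable \<mu> (\<lambda>x. \<bar>u x\<bar> powr k)"
  using powr_integrable[OF assms] by simp

lemma prim_h_integrable:
  assumes u: "u \<in> meas" "lpm \<mu> s u < \<infinity>"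
  shows "integrable \<mu> (\<lambda>x. prim (h x) (u x))"
proof (rule Bochner_Integration.integrable_bound)
  show "integrable \<mu> (\<lambda>x. C_r * (\<bar>u x\<bar> powr 1 + \<bar>u x\<bar> powr r))"
    using r_gt_1 r_less_s by (intro integrable_mult_right Bochner_Integration.integrable_add powr_integrable_s u) auto
  show "AE x in \<mu>. norm (prim (h x) (u x)) \<le> norm (C_r * (\<bar>u x\<bar> powr 1 + \<bar>u x\<bar> powr r))"
    using AE_growth
  proof eventually_elim
    case (elim x)
    then show ?case using prim_growth(1)[OF h_slice, of x C_r r "u x"] r_gt_1 C_r_pos by simp
  qed
qed (rule prim_h_measurable[OF u(1)])

lemma h_mult_integrable:
  assumes u: "u \<in> meas" "lpm \<mu> s u < \<infinity>" and v: "v \<in> meas" "lpm \<mu> s v < \<infinity>"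
  shows "integrable \<mu> (\<lambda>x. h x (u x) * v x)"
proof (rule Bochner_Integration.integrable_bound)
  show "integrable \<mu> (\<lambda>x. C_r * (\<bar>v x\<bar> powr 1 + (\<bar>u x\<bar> powr r + \<bar>v x\<bar> powr r)))"
    using r_gt_1 r_less_s by (intro integrable_mult_right Bochner_Integration.integrable_add powr_integrable_s u v) auto
  show "(\<lambda>x. h x (u x) * v x) \<in> meas" using h_measurable[OF u(1)] v(1) by measurable
  show "AE x in \<mu>. norm (h x (u x) * v x) \<le> norm (C_r * (\<bar>v x\<bar> powr 1 + (\<bar>u x\<bar> powr r + \<bar>v x\<bar> powr r)))"
    using AE_growth
  proof eventually_elim
    case (elim x)
    have "norm (h x (u x) * v x) = \<bar>h x (u x)\<bar> * \<bar>v x\<bar>" by (simp add: abs_mult)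
    also have "... \<le> C_r * (1 + \<bar>u x\<bar> powr (r - 1)) * \<bar>v x\<bar>" using elim by (intro mult_right_mono) auto
    also have "... = C_r * (\<bar>v x\<bar> powr 1 + \<bar>u x\<bar> powr (r - 1) * \<bar>v x\<bar>)" by (simp add: algebra_simps)
    also have "... \<le> C_r * (\<bar>v x\<bar> powr 1 + (\<bar>u x\<bar> powr r + \<bar>v x\<bar> powr r))"
      using C_r_pos r_gt_1 by (intro mult_left_mono add_left_mono powr_mult_le_add) auto
    also have "... \<le> norm (C_r * (\<bar>v x\<bar> powr 1 + (\<bar>u x\<bar> powr r + \<bar>v x\<bar> powr r)))" by simp
    finally show ?case .
  qed
qed

lemma prim_h_tendsto:
  assumes u: "\<And>n. u n \<in> meas" "\<And>n. lpm \<mu> s (u n) < \<infinity>" and v: "v \<in> meas" "lpm \<mu> s v < \<infinity>"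
    and ae: "AE x in \<mu>. (\<lambda>n. u n x) \<longlonglongrightarrow> v x" and lim: "(\<lambda>n. lpm \<mu> r (\<lambda>x. u n x - v x)) \<longlonglongrightarrow> 0"
  shows "(\<lambda>n. LINT x|\<mu>. prim (h x) (u n x)) \<longlonglongrightarrow> (LINT x|\<mu>. prim (h x) (v x))"
proof (rule integral_tendsto_dominated_perturbation)
  let ?c = "C_r * 2 * 2 powr r"
  have rs: "0 \<le> r" "r \<le> s" "0 \<le> s" using r_gt_1 r_less_s by auto
  have d: "lpm \<mu> s (\<lambda>x. u n x - v x) < \<infinity>" for n by (rule lpm_add_finite(2)[OF u(1)[of n] u(2)[of n] v rs(3)])
  have id: "integrable \<mu> (\<lambda>x. norm (u n x - v x) powr r)" for n
    using d[of n] u(1)[of n] v(1) rs by (intro powr_integrable[where \<sigma>'=s]) auto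
  show "integrable \<mu> (\<lambda>x. C_r + ?c * \<bar>v x\<bar> powr r)"
    using emeasure_const_integrable rs by (intro Bochner_Integration.integrable_add integrable_mult_right powr_integrable_s v) auto
  show "integrable \<mu> (\<lambda>x. ?c * norm (u n x - v x) powr r)" for n using id by (intro integrable_mult_right) auto
  show "0 \<le> ?c * norm (u n x - v x) powr r" for n x using C_r_pos by simp
  have "(\<lambda>n. ?c * (LINT x|\<mu>. norm (u n x - v x) powr r)) \<longlonglongrightarrow> ?c * 0"
    by (intro tendsto_mult tendsto_const lpm_tendsto_imp_integral_tendsto[OF id lim])
  then show "(\<lambda>n. LINT x|\<mu>. ?c * norm (u n x - v x) powr r) \<longlonglongrightarrow> 0" by simp
  show "AE x in \<mu>. (\<lambda>n. prim (h x) (u n x)) \<longlonglongrightarrow> prim (h x) (v x)"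
    using ae AE_growth
  proof eventually_elim
    case (elim x)
    then show ?case using isCont_tendsto_compose[OF DERIV_isCont[OF prim_has_derivative[OF h_slice]]] by blast
  qed
  have key: "\<bar>prim (h x) t\<bar> \<le> C_r + ?c * \<bar>y\<bar> powr r + ?c * norm (t - y) powr r"
    if x: "x \<in> \<Omega> \<and> (\<forall>t. \<bar>h x t\<bar> \<le> C_r * (1 + \<bar>t\<bar> powr (r - 1)))" for x t y
  proof -
    have "\<bar>t\<bar> powr 1 \<le> 1 powr 1 + 1 powr (1 - r) * \<bar>t\<bar> powr r" using r_gt_1 by (intro powr_lower_exponent_le) auto
    moreover have "norm t powr r \<le> 2 powr r * (norm y powr r + norm (t - y) powr r)" by (rule two_powr_convexity_helper[OF rs(1)])
    ultimately have "\<bar>t\<bar> + \<bar>t\<bar> powr r \<le> 1 + 2 * (2 powr r * (norm y powr r + norm (t - y) powr r))" by simp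
    then have "C_r * (\<bar>t\<bar> + \<bar>t\<bar> powr r) \<le> C_r * (1 + 2 * (2 powr r * (norm y powr r + norm (t - y) powr r)))"
      using C_r_pos by (intro mult_left_mono) auto
    then show ?thesis using prim_growth(1)[OF h_slice, of x C_r r t] x r_gt_1 by (simp add: algebra_simps)
  qed
  show "AE x in \<mu>. \<bar>prim (h x) (u n x)\<bar> \<le> C_r + ?c * \<bar>v x\<bar> powr r + ?c * norm (u n x - v x) powr r" for n
    using AE_growth by eventually_elim (rule key)
  show "AE x in \<mu>. \<bar>prim (h x) (v x)\<bar> \<le> C_r + ?c * \<bar>v x\<bar> powr r"
    using AE_growth
  proof eventually_elim
    case (elim x)
    from key[OF this, of "v x" "v x"] show ?case using r_gt_1 by simp
  qed
qed (rule prim_h_measurable[OF u(1)], rule prim_h_measurable[OF v(1)])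

text \<open>The remainder is the quotient \<open>prim_rem\<close> times |v n|. The quotient tends to
  zero almost everywhere with a majorant in the conjugate power, so its conjugate power integral
  vanishes, while |v n| is of size \<open>t n\<close> in \<open>L^s\<close>; Young's inequality
  combines the two.\<close>

lemma prim_h_remainder_sequence:
  assumes u: "u \<in> meas" "lpm \<mu> s u < \<infinity>" and v: "\<And>n. v n \<in> meas"
    and t: "\<And>n. 0 < t n" "t \<longlonglongrightarrow> 0" and C: "0 \<le> C" and le: "\<And>n. lpm \<mu> s (v n) \<le> ennreal (C * t n powr s)"
    and ae: "AE x in \<mu>. (\<lambda>n. v n x) \<longlonglongrightarrow> 0" and d: "0 < d"
  shows "\<forall>\<^sub>F n in sequentially. \<bar>(LINT x|\<mu>. prim (h x) (u x + v n x)) - (LINT x|\<mu>. prim (h x) (u x)) - (LINT x|\<mu>. h x (u x) * v n x)\<bar> \<le> d * t n"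
proof -
  define s' where "s' = s / (s - 1)"
  have s0: "0 \<le> s" "1 < s" "0 < s'" using s_gt_1 by (auto simp: s'_def)
  define e where "e n x = prim_rem (h x) (u x) (v n x)" for n x
  have vf: "lpm \<mu> s (v n) < \<infinity>" for n using le[of n] by (rule order.strict_trans1) simp
  have uv: "(\<lambda>x. u x + v n x) \<in> meas" "lpm \<mu> s (\<lambda>x. u x + v n x) < \<infinity>" for n
    using u(1) v lpm_add_finite(1)[OF u v[of n] vf[of n] s0(1)] by auto
  have iv: "integrable \<mu> (\<lambda>x. \<bar>v n x\<bar> powr s)" for n using s0 by (intro powr_integrable_s[OF v vf]) auto
  have Iv: "(LINT x|\<mu>. \<bar>v n x\<bar> powr s) \<le> C * t n powr s" for n
    using integral_le_of_lpm[OF v le] C s0 by simp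
  have em: "(\<lambda>x. e n x) \<in> meas" for n
    unfolding e_def prim_rem_def using prim_h_measurable[OF uv(1)[of n]] prim_h_measurable[OF u(1)] h_measurable[OF u(1)] v[of n]
    by measurable
  define K where "K = (4 * C_r) powr s'"
  have K: "0 \<le> K" by (simp add: K_def)
  let ?G = "\<lambda>x. K + K * 2 powr s * \<bar>u x\<bar> powr s" and ?p = "\<lambda>n x. K * 2 powr s * \<bar>v n x\<bar> powr s"
  have bnd: "e n x powr s' \<le> ?G x + ?p n x" if x: "x \<in> \<Omega> \<and> (\<forall>t. \<bar>h x t\<bar> \<le> C_r * (1 + \<bar>t\<bar> powr (r - 1)))" for n x
  proof -
    have "e n x \<le> 2 * C_r * (1 + (\<bar>u x\<bar> + \<bar>v n x\<bar>) powr (r - 1))"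
      unfolding e_def using x r_gt_1 by (intro prim_growth(2) h_slice) auto
    then have "e n x powr s' \<le> (2 * C_r * (1 + (\<bar>u x\<bar> + \<bar>v n x\<bar>) powr (r - 1))) powr s'"
      using s0 by (intro powr_mono2) (auto simp: e_def prim_rem_nonneg)
    also have "... \<le> K * (1 + (\<bar>u x\<bar> + \<bar>v n x\<bar>) powr s)"
      unfolding K_def s'_def using C_r_pos r_gt_1 r_less_s by (intro growth_conjugate_power) auto
    also have "... \<le> K * (1 + 2 powr s * (\<bar>u x\<bar> powr s + \<bar>v n x\<bar> powr s))"
      using K norm_add_powr_le[OF s0(1), of "\<bar>u x\<bar>" "\<bar>v n x\<bar>"] by (intro mult_left_mono add_left_mono) auto
    finally show ?thesis by (simp add: algebra_simps)
  qed
  have iG: "integrable \<mu> ?G"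
    using emeasure_const_integrable s0 by (intro Bochner_Integration.integrable_add integrable_mult_right powr_integrable_s u) auto
  have ip: "integrable \<mu> (?p n)" for n by (intro integrable_mult_right iv)
  have es: "(\<lambda>x. e n x powr s') \<in> meas" for n using em[of n] by measurable
  have ie: "integrable \<mu> (\<lambda>x. e n x powr s')" for n
  proof (rule Bochner_Integration.integrable_bound[OF _ es])
    show "integrable \<mu> (\<lambda>x. ?G x + ?p n x)" by (rule Bochner_Integration.integrable_add[OF iG ip])
    show "AE x in \<mu>. norm (e n x powr s') \<le> norm (?G x + ?p n x)"
      using AE_growth
    proof eventually_elim
      case (elim x)
      from bnd[OF this, of n] show ?case by (simp only: real_norm_def abs_of_nonneg[OF powr_ge_zero] order_trans[OF _ abs_ge_self])
    qed
  qed
  have "(\<lambda>n. t n powr s) \<longlonglongrightarrow> 0 powr s" using t s0 by (intro tendsto_powr') (auto intro!: always_eventually less_imp_le)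
  then have ts: "(\<lambda>n. C * t n powr s) \<longlonglongrightarrow> 0" using tendsto_mult_left[of "\<lambda>n. t n powr s" 0 sequentially C] by simp
  have "(\<lambda>n. LINT x|\<mu>. \<bar>v n x\<bar> powr s) \<longlonglongrightarrow> 0"
    by (rule tendsto_sandwich[OF _ _ tendsto_const ts]) (use Iv in \<open>auto intro!: always_eventually\<close>)
  then have "(\<lambda>n. K * 2 powr s * (LINT x|\<mu>. \<bar>v n x\<bar> powr s)) \<longlonglongrightarrow> K * 2 powr s * 0" by (intro tendsto_mult tendsto_const)
  then have lp: "(\<lambda>n. LINT x|\<mu>. ?p n x) \<longlonglongrightarrow> 0" by simp
  have E: "(\<lambda>n. LINT x|\<mu>. e n x powr s') \<longlonglongrightarrow> (LINT x|\<mu>. 0)"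
  proof (rule integral_tendsto_dominated_perturbation[OF es _ iG ip _ lp])
    show "0 \<le> ?p n x" for n x using K by simp
    show "AE x in \<mu>. (\<lambda>n. e n x powr s') \<longlonglongrightarrow> 0"
      using ae AE_growth
    proof eventually_elim
      case (elim x)
      have "(\<lambda>n. e n x) \<longlonglongrightarrow> 0" unfolding e_def using elim by (intro prim_rem_tendsto h_slice) auto
      then have "(\<lambda>n. e n x powr s') \<longlonglongrightarrow> 0 powr s'"
        using s0 by (intro tendsto_powr') (auto simp: e_def prim_rem_nonneg)
      then show ?case by simp
    qed
    show "AE x in \<mu>. \<bar>e n x powr s'\<bar> \<le> ?G x + ?p n x" for n
      using AE_growth by eventually_elim (use bnd in auto)
    show "AE x in \<mu>. \<bar>0\<bar> \<le> ?G x" using K by auto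
  qed auto
  \<comment> \<open>The weight in Young's inequality: the \<open>L^s\<close> bound on v n / t n then
    costs at most d / 2.\<close>
  define c where "c = d / (2 * (C + 1))"
  have c: "0 < c" "c * C \<le> d / 2" using d C by (auto simp: c_def field_simps)
  define D where "D = (1 / c) powr (1 / (s - 1))"
  have "(\<lambda>n. D * (LINT x|\<mu>. e n x powr s')) \<longlonglongrightarrow> D * (LINT x|\<mu>. 0)" by (intro tendsto_mult tendsto_const E)
  then have "(\<lambda>n. D * (LINT x|\<mu>. e n x powr s')) \<longlonglongrightarrow> 0" by simp
  then have "\<forall>\<^sub>F n in sequentially. D * (LINT x|\<mu>. e n x powr s') < d / 2" using d by (intro order_tendstoD(2)) auto
  then show ?thesis
  proof eventually_elim
    case (elim n)
    let ?R = "\<lambda>x. prim (h x) (u x + v n x) - prim (h x) (u x) - h x (u x) * v n x"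
    let ?B = "\<lambda>x. t n * (c / t n powr s * \<bar>v n x\<bar> powr s + D * e n x powr s')"
    have pw: "\<bar>?R x\<bar> \<le> ?B x" for x
    proof -
      have "e n x * (\<bar>v n x\<bar> / t n) \<le> c * (\<bar>v n x\<bar> / t n) powr s + D * e n x powr s'"
        unfolding D_def s'_def using t(1)[of n] c s0 by (intro young_epsilon) (auto simp: e_def prim_rem_nonneg)
      then have "t n * (e n x * (\<bar>v n x\<bar> / t n)) \<le> t n * (c * (\<bar>v n x\<bar> / t n) powr s + D * e n x powr s')"
        using t(1)[of n] by (intro mult_left_mono) auto
      moreover have "t n * (e n x * (\<bar>v n x\<bar> / t n)) = \<bar>?R x\<bar>"
        using t(1)[of n] prim_rem_mult[of "h x" "u x" "v n x"] by (simp add: e_def)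
      ultimately show ?thesis using t(1)[of n] by (simp add: powr_divide)
    qed
    have iR: "integrable \<mu> (\<lambda>x. prim (h x) (u x + v n x))" "integrable \<mu> (\<lambda>x. prim (h x) (u x))" "integrable \<mu> (\<lambda>x. h x (u x) * v n x)"
      using prim_h_integrable[OF uv] prim_h_integrable[OF u] h_mult_integrable[OF u v vf] by auto
    have "\<bar>LINT x|\<mu>. ?R x\<bar> \<le> (LINT x|\<mu>. ?B x)"
      using iR iv[of n] ie[of n] pw
      by (intro integral_abs_bound[THEN order_trans] integral_mono Bochner_Integration.integrable_abs Bochner_Integration.integrable_diff Bochner_Integration.integrable_add integrable_mult_right) auto
    also have "... = t n * (c / t n powr s * (LINT x|\<mu>. \<bar>v n x\<bar> powr s) + D * (LINT x|\<mu>. e n x powr s'))"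
      using iv[of n] ie[of n] by simp
    also have "... \<le> t n * (c / t n powr s * (C * t n powr s) + d / 2)"
      using t(1)[of n] c Iv[of n] elim by (intro mult_left_mono add_mono) auto
    also have "c / t n powr s * (C * t n powr s) = c * C" using t(1)[of n] by simp
    also have "t n * (c * C + d / 2) \<le> t n * (d / 2 + d / 2)" using c t(1)[of n] by (intro mult_left_mono add_mono) auto
    finally have "\<bar>LINT x|\<mu>. ?R x\<bar> \<le> d * t n" by (simp add: mult.commute)
    then show ?case using iR by simp
  qed
qed

text \<open>Argued by contradiction, because almost everywhere convergence of increments is
  available only along a subsequence of a sequence.\<close>

lemma prim_h_frechet:
  assumes u: "u \<in> meas" "lpm \<mu> s u < \<infinity>" and C: "0 \<le> C" and e: "0 < e"
  shows "\<exists>\<delta>>0. \<forall>v t. v \<in> meas \<longrightarrow> 0 < t \<longrightarrow> t < \<delta> \<longrightarrow> lpm \<mu> s v \<le> ennreal (C * t powr s) \<longrightarrow>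
    \<bar>(LINT x|\<mu>. prim (h x) (u x + v x)) - (LINT x|\<mu>. prim (h x) (u x)) - (LINT x|\<mu>. h x (u x) * v x)\<bar> \<le> e * t"
proof (rule ccontr)
  let ?Q = "\<lambda>v t. \<bar>(LINT x|\<mu>. prim (h x) (u x + v x)) - (LINT x|\<mu>. prim (h x) (u x)) - (LINT x|\<mu>. h x (u x) * v x)\<bar> \<le> e * t"
  define B where "B v t \<longleftrightarrow> v \<in> meas \<and> 0 < t \<and> lpm \<mu> s v \<le> ennreal (C * t powr s) \<and> \<not> ?Q v t" for v t
  assume "\<not> ?thesis"
  then have *: "\<exists>v t. B v t \<and> t < \<delta>" if "0 < \<delta>" for \<delta> unfolding B_def using that by blast
  have "\<forall>n. \<exists>z. B (fst z) (snd z) \<and> snd z < 1 / real (Suc n)"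
  proof
    fix n
    obtain v t where "B v t" "t < 1 / real (Suc n)" using *[of "1 / real (Suc n)"] by auto
    then show "\<exists>z. B (fst z) (snd z) \<and> snd z < 1 / real (Suc n)" by (intro exI[of _ "(v, t)"]) simp
  qed
  from choice[OF this] obtain z where zB: "\<And>n. B (fst (z n)) (snd (z n)) \<and> snd (z n) < 1 / real (Suc n)" by blast
  have z: "\<And>n. fst (z n) \<in> meas" "\<And>n. 0 < snd (z n)" "\<And>n. snd (z n) < 1 / real (Suc n)"
    "\<And>n. lpm \<mu> s (fst (z n)) \<le> ennreal (C * snd (z n) powr s)" "\<And>n. \<not> ?Q (fst (z n)) (snd (z n))"
    using zB by (simp_all add: B_def)
  have s0: "0 < s" using s_gt_1 by simp
  have inv0: "(\<lambda>n. 1 / real (Suc n)) \<longlonglongrightarrow> 0" by (rule LIMSEQ_Suc[OF lim_1_over_n])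
  have t0: "(\<lambda>n. snd (z n)) \<longlonglongrightarrow> 0"
    by (rule tendsto_sandwich[OF _ _ tendsto_const inv0]) (use z(2,3) in \<open>auto intro!: always_eventually less_imp_le\<close>)
  have "(\<lambda>n. snd (z n) powr s) \<longlonglongrightarrow> 0 powr s" using t0 z(2) s0 by (intro tendsto_powr') (auto intro!: always_eventually less_imp_le)
  then have "(\<lambda>n. ennreal (C * snd (z n) powr s)) \<longlonglongrightarrow> ennreal (C * 0 powr s)" by (intro tendsto_ennrealI tendsto_mult tendsto_const)
  then have up: "(\<lambda>n. ennreal (C * snd (z n) powr s)) \<longlonglongrightarrow> 0" by simp
  have "(\<lambda>n. lpm \<mu> s (\<lambda>x. fst (z n) x - 0)) \<longlonglongrightarrow> 0"
    by (rule tendsto_sandwich[OF _ _ tendsto_const up]) (use z(4) in \<open>auto intro!: always_eventually\<close>)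
  \<comment> \<open>The increments tend to zero in \<open>L^s\<close>, hence pointwise along a
    subsequence, on which the estimate for sequences contradicts the choice of the
    increments.\<close>
  then obtain k where k: "strict_mono (k :: nat => nat)" "AE x in \<mu>. (\<lambda>n. fst (z (k n)) x) \<longlonglongrightarrow> 0"
    using lpm_tendsto_AE_subseq[of "\<lambda>n. fst (z n)" \<mu> "\<lambda>_. 0" s] z(1) s0 by auto
  have tk: "(\<lambda>n. snd (z (k n))) \<longlonglongrightarrow> 0" using LIMSEQ_subseq_LIMSEQ[OF t0 k(1)] by (simp add: o_def)
  from prim_h_remainder_sequence[where v="\<lambda>n. fst (z (k n))" and t="\<lambda>n. snd (z (k n))", OF u z(1) z(2) tk C z(4) k(2) e]
  have "\<forall>\<^sub>F n in sequentially. ?Q (fst (z (k n))) (snd (z (k n)))" .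
  then obtain n where "?Q (fst (z (k n))) (snd (z (k n)))" using eventually_happens'[OF sequentially_bot] by blast
  then show False using z(5) by blast
qed

end

section \<open>The variational problem\<close>

locale kirchhoff = nonlinearity \<Omega> m p q a0 a1 s a h r C_r
  for \<Omega> :: "'a::euclidean_space set" and m p q a0 a1 s a h r C_r +
  fixes M :: "real => real" and \<gamma> C0 :: real
  assumes M_continuous: "continuous_on {0..} M" and M_nonneg: "\<And>t. 0 \<le> t ==> 0 \<le> M t"
    and gamma_ge_1: "1 \<le> \<gamma>" and gamma_p_less_s: "\<gamma> * p < s"
    and C0_pos: "0 < C0" and M_coercive: "\<And>t. 0 \<le> t ==> C0 * t powr \<gamma> \<le> prim M t"
    and M_scaling: "\<And>\<theta> t. 0 < \<theta> ==> \<theta> \<le> 1 ==> 0 \<le> t ==> prim M (\<theta> * t) \<le> \<theta> powr \<gamma> * prim M t"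
begin

abbreviation "J \<equiv> J_functional m p q a \<Omega> M h"
abbreviation "W \<equiv> W0mH m p q a \<Omega>"
abbreviation "\<Phi> \<equiv> Phi :: ('a => real \<times> 'a) => real"

lemma prim_M_nonneg: "0 \<le> t ==> 0 \<le> prim M t"
proof -
  assume "0 \<le> t"
  moreover have "0 \<le> C0 * t powr \<gamma>" using C0_pos by simp
  ultimately show ?thesis using M_coercive by (blast intro: order_trans)
qed

lemma Phi_wnabla: "w0pair u g ==> \<Phi> (wnabla \<Omega> m u) = \<Phi> g"
  using Phi_cong_AE[of g "wnabla \<Omega> m u"] w0pair_imp_W0mH(2)[of u g] w0pair_measurable(2)[of u g] by (auto simp: eq_commute)

lemma J_pair: "w0pair u g ==> J u = prim M (\<Phi> g) - (LINT x|\<mu>. prim (h x) (u x))"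
  by (simp add: J_functional_def Phi_wnabla)

text \<open>The candidate derivative at \<open>u\<close> in direction \<open>v\<close>. The
  gradients are separate arguments, so that any representative may be used and linear combinations
  need no choice.\<close>

definition dJ :: "('a => real) => ('a => real \<times> 'a) => ('a => real) => ('a => real \<times> 'a) => real" where
  "dJ u g v f = M (\<Phi> g) * (LINT x|\<mu>. dphase_flux p q a x (g x) \<bullet> f x) - (LINT x|\<mu>. h x (u x) * v x)"

lemma dJ_cmult: "dJ u g (\<lambda>x. c * v x) (\<lambda>x. c *\<^sub>R f x) = c * dJ u g v f"
proof -
  have "(LINT x|\<mu>. h x (u x) * (c * v x)) = (LINT x|\<mu>. c * (h x (u x) * v x))"
    by (rule arg_cong[where f="integral\<^sup>L \<mu>"]) (auto simp: mult_ac)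
  then show ?thesis by (simp add: dJ_def right_diff_distrib mult_ac)
qed

lemma w0pair_s_finite: "w0pair u g ==> lpm \<mu> s u < \<infinity>"
  using w0pair_lpm_finite[of u g s] s_gt_1 by simp

text \<open>The chain rule in quantified form: the energy is differentiable in the function, and the
  primitive of M has a one-sided linearization that is valid on the half line where energies
  lie.\<close>

lemma prim_Phi_frechet:
  assumes g: "g \<in> meas" "Lq g < \<infinity>" and e: "0 < e"
  obtains \<delta> where "0 < \<delta>" "\<And>f t. f \<in> meas ==> 0 < t ==> t < \<delta> ==> Lq f \<le> ennreal (t powr q) ==>
    \<bar>prim M (\<Phi> (\<lambda>x. g x + f x)) - prim M (\<Phi> g) - M (\<Phi> g) * (LINT x|\<mu>. dphase_flux p q a x (g x) \<bullet> f x)\<bar> \<le> e * t"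
proof -
  define P where "P = \<Phi> g"
  have P0: "0 \<le> P" by (simp add: P_def Phi_nonneg)
  have MP: "0 \<le> M P" by (rule M_nonneg[OF P0])
  obtain K where K: "0 \<le> K" "\<And>(b :: 'a => real \<times> 'a) t. b \<in> meas ==> 0 < t ==> Lq b \<le> ennreal (t powr q) ==>
    \<bar>LINT x|\<mu>. dphase_flux p q a x (g x) \<bullet> b x\<bar> \<le> K * t"
    using flux_integral_bound[OF g] by blast
  \<comment> \<open>Error of the inner linearization, to be multiplied by M(P).\<close>
  define e1 where "e1 = e / (2 * (M P + 1))"
  have e1: "0 < e1" "M P * e1 \<le> e / 2" using e MP by (auto simp: e1_def field_simps)
  \<comment> \<open>Error of the outer linearization, to be multiplied by the change of the energy,
    which is at most (K + e1) t.\<close>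
  define e2 where "e2 = e / (2 * (K + e1))"
  have Ke: "0 < K + e1" using K e1 by simp
  have "e / (2 * c) * c = e / 2" if "0 < c" for c :: real using that by simp
  from this[OF Ke] have e2: "0 < e2" "e2 * (K + e1) = e / 2" using e Ke by (auto simp only: e2_def zero_less_divide_iff mult_pos_pos zero_less_numeral)
  obtain d1 where d1: "0 < d1" "\<And>(b :: 'a => real \<times> 'a) t. b \<in> meas ==> 0 < t ==> t < d1 ==> Lq b \<le> ennreal (t powr q) ==>
    \<bar>\<Phi> (\<lambda>x. g x + b x) - \<Phi> g - (LINT x|\<mu>. dphase_flux p q a x (g x) \<bullet> b x)\<bar> \<le> e1 * t"
    using Phi_frechet[OF g e1(1)] by blast
  obtain d2 where d2: "0 < d2" "\<And>y. 0 \<le> y ==> \<bar>y - P\<bar> < d2 ==> \<bar>prim M y - prim M P - M P * (y - P)\<bar> \<le> e2 * \<bar>y - P\<bar>"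
    using prim_tangent[OF M_continuous P0 e2(1)] by blast
  have "0 < min d1 (d2 / (K + e1))" using d1 d2 Ke by simp
  then show ?thesis
  proof (rule that, goal_cases)
    case (1 f t)
    define A where "A = (LINT x|\<mu>. dphase_flux p q a x (g x) \<bullet> f x)"
    define Y where "Y = \<Phi> (\<lambda>x. g x + f x)"
    have Y0: "0 \<le> Y" by (simp add: Y_def Phi_nonneg)
    have A: "\<bar>A\<bar> \<le> K * t" unfolding A_def by (rule K(2)[OF 1(1,2,4)])
    have R: "\<bar>Y - P - A\<bar> \<le> e1 * t" unfolding A_def Y_def P_def using 1 by (intro d1(2)) auto
    have "\<bar>Y - P\<bar> \<le> \<bar>Y - P - A\<bar> + \<bar>A\<bar>" using abs_triangle_ineq[of "Y - P - A" A] by simp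
    also have "... \<le> e1 * t + K * t" by (intro add_mono A R)
    also have "... = (K + e1) * t" by (simp add: distrib_right)
    finally have YP: "\<bar>Y - P\<bar> \<le> (K + e1) * t" .
    also have "... < d2" using 1(3) Ke by (simp add: pos_less_divide_eq mult.commute)
    finally have "\<bar>prim M Y - prim M P - M P * (Y - P)\<bar> \<le> e2 * \<bar>Y - P\<bar>" by (rule d2(2)[OF Y0])
    also have "... \<le> e2 * ((K + e1) * t)" using e2 YP by (intro mult_left_mono) auto
    also have "... = e / 2 * t" unfolding mult.assoc[symmetric] e2 ..
    finally have 2: "\<bar>prim M Y - prim M P - M P * (Y - P)\<bar> \<le> e / 2 * t" .
    have "\<bar>M P * (Y - P - A)\<bar> \<le> M P * (e1 * t)" using R MP by (simp add: abs_mult mult_left_mono)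
    also have "... \<le> e / 2 * t" using mult_right_mono[OF e1(2), of t] 1(2) by simp
    finally have 3: "\<bar>M P * (Y - P - A)\<bar> \<le> e / 2 * t" .
    have "prim M Y - prim M P - M P * A = (prim M Y - prim M P - M P * (Y - P)) + M P * (Y - P - A)"
      by (simp add: right_diff_distrib)
    then have "\<bar>prim M Y - prim M P - M P * A\<bar> \<le> e / 2 * t + e / 2 * t"
      using order_trans[OF abs_triangle_ineq add_mono[OF 2 3]] by simp
    then show ?case by (simp add: Y_def P_def A_def)
  qed
qed

lemma J_frechet:
  assumes ug: "w0pair u g" and d: "0 < d"
  obtains \<delta> where "0 < \<delta>" "\<And>v f t. w0pair v f ==> 0 < t ==> t < \<delta> ==> Lq f \<le> ennreal (t powr q) ==>
    \<bar>J (\<lambda>x. u x + v x) - J u - dJ u g v f\<bar> \<le> d * t"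
proof -
  obtain C where C: "0 \<le> C" "\<And>u g A. w0pair u g ==> 0 < A ==> Lq g \<le> ennreal (A powr q) ==> lpm \<mu> s u \<le> ennreal (C * A powr s)"
    by (rule w0pair_sobolev) blast
  have e: "0 < d / 2" using d by simp
  obtain d1 where d1: "0 < d1" "\<And>f t. f \<in> meas ==> 0 < t ==> t < d1 ==> Lq f \<le> ennreal (t powr q) ==>
    \<bar>prim M (\<Phi> (\<lambda>x. g x + f x)) - prim M (\<Phi> g) - M (\<Phi> g) * (LINT x|\<mu>. dphase_flux p q a x (g x) \<bullet> f x)\<bar> \<le> d / 2 * t"
    using prim_Phi_frechet[OF w0pair_measurable(2)[OF ug] w0pair_finite(2)[OF ug] e] by blast
  obtain d2 where d2: "0 < d2" "\<forall>v t. v \<in> meas \<longrightarrow> 0 < t \<longrightarrow> t < d2 \<longrightarrow> lpm \<mu> s v \<le> ennreal (C * t powr s) \<longrightarrow>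
    \<bar>(LINT x|\<mu>. prim (h x) (u x + v x)) - (LINT x|\<mu>. prim (h x) (u x)) - (LINT x|\<mu>. h x (u x) * v x)\<bar> \<le> d / 2 * t"
    using prim_h_frechet[OF w0pair_measurable(1)[OF ug] w0pair_s_finite[OF ug] C(1) e] by blast
  have "0 < min d1 d2" using d1 d2 by simp
  then show ?thesis
  proof (rule that, goal_cases)
    case (1 v f t)
    note vf = 1(1)
    let ?X = "prim M (\<Phi> (\<lambda>x. g x + f x)) - prim M (\<Phi> g) - M (\<Phi> g) * (LINT x|\<mu>. dphase_flux p q a x (g x) \<bullet> f x)"
    let ?Y = "(LINT x|\<mu>. prim (h x) (u x + v x)) - (LINT x|\<mu>. prim (h x) (u x)) - (LINT x|\<mu>. h x (u x) * v x)"
    have X: "\<bar>?X\<bar> \<le> d / 2 * t" using 1 by (intro d1(2) w0pair_measurable(2)[OF vf]) auto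
    have Y: "\<bar>?Y\<bar> \<le> d / 2 * t" 
    proof (rule d2(2)[rule_format, OF w0pair_measurable(1)[OF vf]])
      show "lpm \<mu> s v \<le> ennreal (C * t powr s)" by (rule C(2)[OF vf 1(2,4)])
    qed (use 1 in auto)
    have "J (\<lambda>x. u x + v x) - J u - dJ u g v f = ?X - ?Y"
      unfolding J_pair[OF ug] J_pair[OF w0pair_add[OF ug vf]] dJ_def by simp
    then have "\<bar>J (\<lambda>x. u x + v x) - J u - dJ u g v f\<bar> \<le> d / 2 * t + d / 2 * t"
      using order_trans[OF abs_triangle_ineq4 add_mono[OF X Y]] by (simp only:)
    then show ?case by simp
  qed
qed

text \<open>The derivative along any direction is nonnegative up to every \<open>e\<close>; applying
  this to the opposite direction gives zero.\<close>

lemma dJ_minimizer: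
  assumes ug: "w0pair u g" and min: "\<And>w. w \<in> W ==> J u \<le> J w" and vf: "w0pair v f"
  shows "dJ u g v f = 0"
proof -
  have ge: "0 \<le> dJ u g v f" if vf: "w0pair v f" for v f
  proof (rule field_le_epsilon)
    fix e :: real assume e: "0 < e"
    obtain T where T: "0 < T" "Lq f \<le> ennreal (T powr q)" using finite_lpm_bound[OF w0pair_finite(2)[OF vf]] .
    obtain d where d: "0 < d" "\<And>v f t. w0pair v f ==> 0 < t ==> t < d ==> Lq f \<le> ennreal (t powr q) ==>
      \<bar>J (\<lambda>x. u x + v x) - J u - dJ u g v f\<bar> \<le> e / T * t"
      using J_frechet[OF ug divide_pos_pos[OF e T(1)]] by blast
    \<comment> \<open>Scales the direction into the range where the linearization is valid.\<close>
    define c where "c = d / 2 / T"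
    have c: "0 < c" "c * T = d / 2" using d T by (auto simp: c_def)
    have "Lq (\<lambda>x. c *\<^sub>R f x) = ennreal (c powr q) * Lq f" using lpm_cmult[OF w0pair_measurable(2)[OF vf], of q c] c by simp
    also have "... \<le> ennreal (c powr q) * ennreal (T powr q)" by (intro mult_left_mono T) auto
    also have "... = ennreal ((d / 2) powr q)" using c(1) T(1) by (simp add: ennreal_mult[symmetric] powr_mult[symmetric] c(2))
    finally have "\<bar>J (\<lambda>x. u x + c * v x) - J u - dJ u g (\<lambda>x. c * v x) (\<lambda>x. c *\<^sub>R f x)\<bar> \<le> e / T * (d / 2)"
      using d(1) by (intro d(2) w0pair_cmult vf) auto
    moreover have "J u \<le> J (\<lambda>x. u x + c * v x)"
      by (rule min[OF w0pair_imp_W0mH(1)[OF w0pair_add[OF ug w0pair_cmult[OF vf]]]])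
    ultimately have "- (c * dJ u g v f) \<le> e / T * (d / 2)" by (simp add: dJ_cmult)
    also have "... = c * e" using T by (simp add: c_def mult_ac)
    finally have "c * (- dJ u g v f) \<le> c * e" by simp
    then show "0 \<le> dJ u g v f + e" using c(1) by (simp only: mult_le_cancel_left_pos)
  qed
  have "dJ u g (\<lambda>x. (-1) * v x) (\<lambda>x. (-1) *\<^sub>R f x) = (-1) * dJ u g v f" by (rule dJ_cmult)
  then show ?thesis using ge[OF vf] ge[OF w0pair_cmult[OF vf, of "-1"]] by simp
qed

lemma minimizer_critical_point:
  assumes u: "u \<in> W" and min: "\<And>w. w \<in> W ==> J u \<le> J w"
  shows "critical_point W (norm_W0mH m p q a \<Omega>) J u"
proof -
  let ?g = "wnabla \<Omega> m u" and ?nrm = "norm_W0mH m p q a \<Omega>"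
  have ug: "w0pair u ?g" by (rule W0mH_imp_w0pair[OF u])
  \<comment> \<open>Converts a bound \<open>A\<close> on the Luxemburg norm into the bound k A for
    the size measured by q-th powers.\<close>
  define k where "k = (1 / a0) powr (1 / q)"
  have k: "0 < k" "k powr q = 1 / a0" using a0_pos q_gt_1 by (auto simp: k_def powr_powr)
  have "\<exists>\<delta>>0. \<forall>v\<in>W. ?nrm v < \<delta> \<longrightarrow> \<bar>J (\<lambda>x. u x + v x) - J u - 0\<bar> \<le> \<epsilon> * ?nrm v" if \<epsilon>: "0 < \<epsilon>" for \<epsilon>
  proof -
    have e: "0 < \<epsilon> / k" using \<epsilon> k by simp
    obtain d where d: "0 < d" "\<And>v f t. w0pair v f ==> 0 < t ==> t < d ==> Lq f \<le> ennreal (t powr q) ==>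
      \<bar>J (\<lambda>x. u x + v x) - J u - dJ u ?g v f\<bar> \<le> \<epsilon> / k * t"
      using J_frechet[OF ug e] by blast
    show ?thesis
    proof (intro exI[of _ "d / k"] conjI ballI impI)
      fix v assume v: "v \<in> W" "?nrm v < d / k"
      let ?f = "wnabla \<Omega> m v"
      have vf: "w0pair v ?f" by (rule W0mH_imp_w0pair[OF v(1)])
      note fm = w0pair_measurable(2)[OF vf] w0pair_finite(2)[OF vf]
      have nn: "0 \<le> ?nrm v" unfolding norm_W0mH_def by (rule norm_H_nonneg[OF fm])
      have le: "\<bar>J (\<lambda>x. u x + v x) - J u\<bar> \<le> \<epsilon> * A" if A: "?nrm v < A" "A < d / k" for A
      proof -
        have A0: "0 < A" using nn A by simp
        have "Lq ?f \<le> ennreal (A powr q / a0)" using norm_H_lower[OF fm] A(1) by (simp add: norm_W0mH_def)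
        also have "A powr q / a0 = (k * A) powr q" using k A0 by (simp add: powr_mult)
        finally have "\<bar>J (\<lambda>x. u x + v x) - J u - dJ u ?g v ?f\<bar> \<le> \<epsilon> / k * (k * A)"
          using A A0 k by (intro d(2) vf) (auto simp: field_simps)
        then show ?thesis using k dJ_minimizer[OF ug min vf] by simp
      qed
      \<comment> \<open>The comparison holds for every \<open>A\<close> above the norm; letting
        \<open>A\<close> decrease to the norm gives the estimate, also when the norm is
        zero.\<close>
      have "\<bar>J (\<lambda>x. u x + v x) - J u\<bar> / \<epsilon> \<le> ?nrm v"
      proof (rule dense_ge_bounded[OF v(2)])
        fix A assume "?nrm v < A" "A < d / k"
        from le[OF this] show "\<bar>J (\<lambda>x. u x + v x) - J u\<bar> / \<epsilon> \<le> A" using \<epsilon> by (simp add: field_simps)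
      qed
      then show "\<bar>J (\<lambda>x. u x + v x) - J u - 0\<bar> \<le> \<epsilon> * ?nrm v" using \<epsilon> by (simp add: field_simps)
    qed (use d k in auto)
  qed
  then show ?thesis using u by (auto simp: critical_point_def has_frechet_derivative_on_def intro!: exI[of _ 0])
qed

lemma minimizer_weak_solution:
  assumes u: "u \<in> W" and min: "\<And>w. w \<in> W ==> J u \<le> J w"
  shows "weak_solution m p q a \<Omega> M h u"
  unfolding weak_solution_def
proof (intro conjI ballI u)
  fix v assume "v \<in> W"
  then have "dJ u (wnabla \<Omega> m u) v (wnabla \<Omega> m v) = 0"
    by (intro dJ_minimizer W0mH_imp_w0pair u min)
  then show "M (Phi (wnabla \<Omega> m u)) * (LINT x|\<mu>. dphase_flux p q a x (wnabla \<Omega> m u x) \<bullet> wnabla \<Omega> m v x) =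
        (LINT x|\<mu>. h x (u x) * v x)" by (simp add: dJ_def)
qed

lemma zero_ae_J:
  assumes u: "u \<in> W" and z: "zero_ae \<Omega> u" shows "J u = 0"
proof -
  have ug: "w0pair u (wnabla \<Omega> m u)" by (rule W0mH_imp_w0pair[OF u])
  have z': "AE x in \<mu>. u x = 0" using z by (simp add: zero_ae_def)
  have "Lq (\<lambda>x. 0 * u x - u x) = Lq (\<lambda>x. 0 :: real)"
    by (rule lpm_cong_AE) (use z' in auto)
  then have l: "Lq (\<lambda>x. 0 * u x - u x) = 0" by (simp add: lpm_def)
  \<comment> \<open>A function vanishing almost everywhere is approximated by the pair 0, so
    closedness assigns it the zero gradient.\<close>
  have "w0pair u (\<lambda>x. 0)"
  proof (rule w0pair_closed[of "\<lambda>n x. 0 * u x" "\<lambda>n x. 0 *\<^sub>R wnabla \<Omega> m u x"])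
    show "w0pair (\<lambda>x. 0 * u x) (\<lambda>x. 0 *\<^sub>R wnabla \<Omega> m u x)" by (rule w0pair_cmult[OF ug])
    show "(\<lambda>n. Lq (\<lambda>x. 0 * u x - u x)) \<longlonglongrightarrow> 0" unfolding l by simp
    show "(\<lambda>n. Lq (\<lambda>x. 0 *\<^sub>R wnabla \<Omega> m u x - 0)) \<longlonglongrightarrow> 0" by (simp add: lpm_def)
  qed (use w0pair_measurable(1)[OF ug] in auto)
  from J_pair[OF this] have "J u = prim M (\<Phi> (\<lambda>x. 0)) - (LINT x|\<mu>. prim (h x) (u x))" .
  also have "\<Phi> (\<lambda>x. 0) = 0" by (simp add: Phi_H_def)
  also have "(LINT x|\<mu>. prim (h x) (u x)) = 0"
    by (rule integral_eq_zero_AE) (use z' in \<open>eventually_elim, simp add: prim_0\<close>)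
  finally show ?thesis by (simp add: prim_0)
qed

end

lemma powr_le_threshold:
  fixes x \<delta> k s :: real
  assumes "0 < \<delta>" "\<delta> \<le> x" "k \<le> s"
  shows "x powr k \<le> \<delta> powr (k - s) * x powr s"
proof -
  have "x powr k = x powr (k - s) * x powr s" unfolding powr_add[symmetric] by simp
  also have "... \<le> \<delta> powr (k - s) * x powr s"
    using assms by (intro mult_right_mono powr_mono2') auto
  finally show ?thesis .
qed

section \<open>The eigenvalue, bounds for J and existence of a minimizer\<close>

context kirchhoff
begin

definition pint :: "('a => real) => real" where
  "pint u = (LINT x|\<mu>. \<bar>u x\<bar> powr (\<gamma> * p))"

abbreviation "lam \<equiv> lambda_H m p q a \<Omega> M \<gamma>"

lemma gamma_p_pos: "0 < \<gamma> * p" "1 < \<gamma> * p"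
proof -
  have "1 * 1 < \<gamma> * p" using gamma_ge_1 p_gt_1 by (intro mult_le_less_imp_less) auto
  then show "0 < \<gamma> * p" "1 < \<gamma> * p" by auto
qed

lemma pint_integrable: "w0pair u g ==> integrable \<mu> (\<lambda>x. \<bar>u x\<bar> powr (\<gamma> * p))"
  using gamma_p_pos gamma_p_less_s by (intro powr_integrable_s w0pair_measurable(1) w0pair_s_finite) auto

lemma pint_nonneg: "0 \<le> pint u"
  unfolding pint_def by (intro integral_nonneg_AE) simp

lemma pint_pos:
  assumes "w0pair u g" "\<not> zero_ae \<Omega> u" shows "0 < pint u"
proof (rule ccontr)
  assume "\<not> 0 < pint u"
  then have "pint u = 0" using pint_nonneg[of u] by simp
  then have "AE x in \<mu>. \<bar>u x\<bar> powr (\<gamma> * p) = 0"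
    unfolding pint_def using integral_nonneg_eq_0_iff_AE[OF pint_integrable[OF assms(1)]] by simp
  then have "AE x in \<mu>. u x = 0" by (rule eventually_mono) simp
  then show False using assms(2) by (simp add: zero_ae_def)
qed

text \<open>The infimum defining the eigenvalue is meaningful only over a nonempty set. If all bump
  functions vanished almost everywhere, so would their limit, the indicator of a box of positive
  measure.\<close>

lemma nonzero_test_function: "\<exists>u\<in>W. \<not> zero_ae \<Omega> u"
proof (rule ccontr)
  assume "\<not> ?thesis"
  then have z: "zero_ae \<Omega> f" if "f \<in> \<D>" for f
    using w0pair_imp_W0mH(1)[OF w0pair_test[OF that]] by blast
  obtain x0 where "x0 \<in> \<Omega>" using nonempty_dom by blast
  then obtain b c where bc: "x0 \<in> box b c" "cbox b c \<subseteq> \<Omega>" using open_contains_cbox[OF open_dom] by metis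
  have "AE x in \<mu>. bump n b c x = 0" for n
    using z[OF bump_test_function[OF bc(2), of n]] by (simp add: zero_ae_def)
  then have "AE x in \<mu>. \<forall>n. bump n b c x = 0" unfolding AE_all_countable by blast
  then have "AE x in \<mu>. x \<notin> box b c"
  proof eventually_elim
    case (elim x)
    then have "(\<lambda>n. 0 :: real) \<longlonglongrightarrow> indicator (box b c) x" using bump_tendsto[of b c x] by simp
    then have "indicator (box b c) x = (0 :: real)" by (simp add: LIMSEQ_const_iff)
    then show ?case by (simp add: indicator_eq_0_iff)
  qed
  moreover have sub: "box b c \<subseteq> \<Omega>" using bc(2) box_subset_cbox by blast
  have dom: "\<Omega> \<in> sets lebesgue" using open_dom by simp
  then have "box b c \<in> sets \<mu>" using sub by (simp add: sets_restrict_space_iff)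
  ultimately have "box b c \<in> null_sets \<mu>" by (simp add: AE_iff_null_sets)
  then have "emeasure lebesgue (box b c) = 0"
    using emeasure_restrict_space[of \<Omega> lebesgue "box b c"] dom sub by (auto simp: null_sets_def)
  then have "negligible (box b c)" by (simp add: negligible_iff_null_sets null_sets_def)
  then show False using bc(1) by (auto simp: negligible_interval)
qed

lemma lam_le_quotient:
  assumes u: "u \<in> W" "\<not> zero_ae \<Omega> u"
  shows "lam \<le> prim M (\<Phi> (wnabla \<Omega> m u)) / pint u"
  unfolding lambda_H_def pint_def
proof (rule cINF_lower)
  show "bdd_below ((\<lambda>u. prim M (\<Phi> (wnabla \<Omega> m u)) / (LINT x|\<mu>. \<bar>u x\<bar> powr (\<gamma> * p))) ` {u \<in> W. \<not> zero_ae \<Omega> u})"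
    by (intro bdd_belowI[of _ 0]) (auto intro!: divide_nonneg_nonneg prim_M_nonneg Phi_nonneg integral_nonneg_AE)
qed (use u in auto)

lemma lam_nonneg: "0 \<le> lam"
  unfolding lambda_H_def
  by (rule cINF_greatest) (use nonzero_test_function in \<open>auto intro!: divide_nonneg_nonneg prim_M_nonneg Phi_nonneg integral_nonneg_AE\<close>)

lemma poincare: "w0pair u g ==> lam * pint u \<le> prim M (\<Phi> g)"
proof (cases "zero_ae \<Omega> u")
  case True
  then have "pint u = 0" unfolding pint_def zero_ae_def
    by (intro integral_eq_zero_AE) (auto elim!: eventually_mono)
  then show ?thesis using prim_M_nonneg[OF Phi_nonneg, of g] by simp
next
  case False
  assume ug: "w0pair u g"
  have "lam \<le> prim M (\<Phi> g) / pint u"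
    using lam_le_quotient[OF w0pair_imp_W0mH(1)[OF ug] False] by (simp add: Phi_wnabla[OF ug])
  then show ?thesis using pint_pos[OF ug False] by (simp add: field_simps)
qed

text \<open>Attainment of the infimum is not asserted; the gap left by (h8) makes an approximate
  minimizer sufficient.\<close>

lemma near_minimizer:
  assumes "0 < e"
  obtains u where "u \<in> W" "\<not> zero_ae \<Omega> u" "prim M (\<Phi> (wnabla \<Omega> m u)) < (lam + e) * pint u"
proof -
  let ?Q = "\<lambda>u. prim M (\<Phi> (wnabla \<Omega> m u)) / (LINT x|\<mu>. \<bar>u x\<bar> powr (\<gamma> * p))"
  have "?Q ` {u \<in> W. \<not> zero_ae \<Omega> u} \<noteq> {}" using nonzero_test_function by blast
  moreover have "Inf (?Q ` {u \<in> W. \<not> zero_ae \<Omega> u}) < lam + e" using assms unfolding lambda_H_def by simp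
  ultimately obtain y where "y \<in> ?Q ` {u \<in> W. \<not> zero_ae \<Omega> u}" "y < lam + e" by (rule cInf_lessD[THEN bexE])
  then obtain u where u: "u \<in> W" "\<not> zero_ae \<Omega> u" "?Q u < lam + e" by blast
  have "0 < pint u" by (rule pint_pos[OF W0mH_imp_w0pair[OF u(1)] u(2)])
  then have "prim M (\<Phi> (wnabla \<Omega> m u)) < (lam + e) * pint u" using u(3) by (simp add: pint_def pos_divide_less_eq)
  then show ?thesis using that u by blast
qed

text \<open>By (h6) and the definition of the eigenvalue, the integral of H eats up at most the
  fraction (lam - e) / lam of the Kirchhoff term, up to a constant from bounded arguments.\<close>

lemma J_lower_bound:
  assumes h6: "0 < e" "0 < T" "AE x in \<mu>. \<forall>t. \<bar>t\<bar> \<ge> T \<longrightarrow> prim (h x) t \<le> (lam - e) * \<bar>t\<bar> powr (\<gamma> * p)"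
  obtains c B where "0 < c" "\<And>u g. w0pair u g ==> c * prim M (\<Phi> g) - B \<le> J u"
proof -
  define C where "C = C_r * (T + T powr r) + \<bar>lam - e\<bar> * T powr (\<gamma> * p)"
  \<comment> \<open>The surviving fraction. If lam is at most e, the coefficient in (h6) is
    nonpositive and the whole Kirchhoff term survives.\<close>
  define c where "c = (if lam \<le> e then 1 else e / lam)"
  have c: "0 < c" using h6(1) by (auto simp: c_def)
  have pw: "AE x in \<mu>. prim (h x) (u x) \<le> (lam - e) * \<bar>u x\<bar> powr (\<gamma> * p) + C" for u
    using h6(3) AE_growth
  proof eventually_elim
    case (elim x)
    show ?case
    proof (cases "T \<le> \<bar>u x\<bar>")
      case True
      moreover have "0 \<le> C" using h6 C_r_pos by (simp add: C_def)
      ultimately show ?thesis using elim(1) by (simp add: add_increasing2)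
    next
      case False
      have "prim (h x) (u x) \<le> C_r * (\<bar>u x\<bar> + \<bar>u x\<bar> powr r)"
        using prim_growth(1)[OF h_slice, of x C_r r "u x"] elim(2) r_gt_1 by simp
      also have "... \<le> C_r * (T + T powr r)" using False C_r_pos r_gt_1 by (intro mult_left_mono add_mono powr_mono2) auto
      finally have 1: "prim (h x) (u x) \<le> C_r * (T + T powr r)" .
      have "- (lam - e) * \<bar>u x\<bar> powr (\<gamma> * p) \<le> \<bar>lam - e\<bar> * T powr (\<gamma> * p)"
        using False gamma_p_pos by (intro mult_mono powr_mono2) auto
      then show ?thesis using 1 unfolding C_def minus_mult_left[symmetric] by linarith
    qed
  qed
  have "c * prim M (\<Phi> g) - C * measure \<mu> (space \<mu>) \<le> J u" if ug: "w0pair u g" for u g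
  proof -
    have P: "0 \<le> prim M (\<Phi> g)" by (intro prim_M_nonneg Phi_nonneg)
    have "(LINT x|\<mu>. prim (h x) (u x)) \<le> (LINT x|\<mu>. (lam - e) * \<bar>u x\<bar> powr (\<gamma> * p) + C)"
      using pint_integrable[OF ug] emeasure_const_integrable
      by (intro integral_mono_AE pw prim_h_integrable w0pair_measurable(1)[OF ug] w0pair_s_finite[OF ug] Bochner_Integration.integrable_add integrable_mult_right) auto
    also have "... = (lam - e) * pint u + C * measure \<mu> (space \<mu>)"
      using pint_integrable[OF ug] emeasure_const_integrable by (simp add: pint_def mult.commute)
    finally have H: "(LINT x|\<mu>. prim (h x) (u x)) \<le> (lam - e) * pint u + C * measure \<mu> (space \<mu>)" .
    have "(lam - e) * pint u \<le> (1 - c) * prim M (\<Phi> g)"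
    proof (cases "lam \<le> e")
      case True
      then show ?thesis using pint_nonneg[of u] by (simp add: c_def mult_nonpos_nonneg)
    next
      case False
      have l: "0 < lam" using False h6(1) by simp
      have "(lam - e) * pint u = (1 - c) * (lam * pint u)" using l False by (simp add: c_def field_simps)
      also have "... \<le> (1 - c) * prim M (\<Phi> g)" using False l by (intro mult_left_mono poincare[OF ug]) (simp add: c_def)
      finally show ?thesis .
    qed
    then show ?thesis unfolding J_pair[OF ug] using H by (simp add: algebra_simps)
  qed
  then show ?thesis using that[OF c] by blast
qed

text \<open>Condition (h8) holds only for small arguments, while the chosen function may be
  unbounded. Large values are paid for by a multiple of |v|^s, which is of higher order under
  scaling because s exceeds \<gamma> p.\<close>

lemma J_negative:
  assumes h8: "0 < \<epsilon>" "0 < \<delta>" "AE x in \<mu>. \<forall>t. \<bar>t\<bar> \<le> \<delta> \<longrightarrow> (lam + \<epsilon>) * \<bar>t\<bar> powr (\<gamma> * p) \<le> prim (h x) t"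
  obtains u where "u \<in> W" "J u < 0"
proof -
  have "0 < \<epsilon> / 2" using h8(1) by simp
  then obtain u where u: "u \<in> W" "\<not> zero_ae \<Omega> u" "prim M (\<Phi> (wnabla \<Omega> m u)) < (lam + \<epsilon> / 2) * pint u"
    by (rule near_minimizer)
  define g where "g = wnabla \<Omega> m u"
  have ug: "w0pair u g" unfolding g_def by (rule W0mH_imp_w0pair[OF u(1)])
  note um = w0pair_measurable(1)[OF ug] and gm = w0pair_measurable(2)[OF ug] w0pair_finite(2)[OF ug]
  define P where "P = prim M (\<Phi> g)"
  define I where "I = pint u"
  define S where "S = (LINT x|\<mu>. \<bar>u x\<bar> powr s)"
  have I: "0 < I" unfolding I_def by (rule pint_pos[OF ug u(2)])
  have PI: "P < (lam + \<epsilon> / 2) * I" using u(3) by (simp add: P_def I_def g_def)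
  have S0: "0 \<le> S" unfolding S_def by (intro integral_nonneg_AE) simp
  \<comment> \<open>Above \<delta> every lower power is bounded by a multiple of the s-th
    power.\<close>
  define C where "C = C_r * (\<delta> powr (1 - s) + \<delta> powr (r - s)) + (lam + \<epsilon>) * \<delta> powr (\<gamma> * p - s)"
  have le0: "0 \<le> lam + \<epsilon>" using lam_nonneg h8(1) by simp
  have C0: "0 \<le> C" using C_r_pos le0 by (simp add: C_def)
  have pw: "AE x in \<mu>. (lam + \<epsilon>) * \<bar>v x\<bar> powr (\<gamma> * p) - C * \<bar>v x\<bar> powr s \<le> prim (h x) (v x)" for v :: "'a => real"
    using h8(3) AE_growth
  proof eventually_elim
    case (elim x)
    show ?case
    proof (cases "\<bar>v x\<bar> \<le> \<delta>")
      case True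
      have "0 \<le> C * \<bar>v x\<bar> powr s" using C0 by simp
      moreover have "(lam + \<epsilon>) * \<bar>v x\<bar> powr (\<gamma> * p) \<le> prim (h x) (v x)" using elim(1) True by blast
      ultimately show ?thesis by (simp add: algebra_simps)
    next
      case False
      then have d: "\<delta> \<le> \<bar>v x\<bar>" by simp
      have "- prim (h x) (v x) \<le> C_r * (\<bar>v x\<bar> powr 1 + \<bar>v x\<bar> powr r)"
        using prim_growth(1)[OF h_slice, of x C_r r "v x"] elim(2) r_gt_1 by simp
      also have "... \<le> C_r * (\<delta> powr (1 - s) * \<bar>v x\<bar> powr s + \<delta> powr (r - s) * \<bar>v x\<bar> powr s)"
        using C_r_pos s_gt_1 r_less_s by (intro mult_left_mono add_mono powr_le_threshold[OF h8(2) d]) auto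
      finally have 1: "- prim (h x) (v x) \<le> C_r * (\<delta> powr (1 - s) * \<bar>v x\<bar> powr s + \<delta> powr (r - s) * \<bar>v x\<bar> powr s)" .
      have "(lam + \<epsilon>) * \<bar>v x\<bar> powr (\<gamma> * p) \<le> (lam + \<epsilon>) * (\<delta> powr (\<gamma> * p - s) * \<bar>v x\<bar> powr s)"
        using le0 gamma_p_less_s by (intro mult_left_mono powr_le_threshold[OF h8(2) d]) auto
      then show ?thesis using 1 unfolding C_def by (simp add: algebra_simps)
    qed
  qed
  define k where "k = s - \<gamma> * p"
  have k: "0 < k" using gamma_p_less_s by (simp add: k_def)
  \<comment> \<open>Small enough that the higher order term is at most a quarter of \<epsilon> I
    after factoring out \<theta>^(\<gamma> p).\<close>
  define \<theta> where "\<theta> = min 1 ((\<epsilon> * I / (4 * (C * S + 1))) powr (1 / k))"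
  have CS: "0 \<le> C * S" using C0 S0 by simp
  have X: "0 < \<epsilon> * I / (4 * (C * S + 1))" using h8(1) I CS by (intro divide_pos_pos) auto
  have \<theta>: "0 < \<theta>" "\<theta> \<le> 1" using X unfolding \<theta>_def by auto
  have "\<theta> powr k \<le> ((\<epsilon> * I / (4 * (C * S + 1))) powr (1 / k)) powr k"
    using \<theta> k by (intro powr_mono2) (auto simp: \<theta>_def)
  also have "... = \<epsilon> * I / (4 * (C * S + 1))"
  proof -
    have "(Z powr (1 / k)) powr k = Z" if "0 < Z" for Z :: real using that k by (simp add: powr_powr)
    from this[OF X] show ?thesis .
  qed
  finally have "C * S * \<theta> powr k \<le> C * S * (\<epsilon> * I / (4 * (C * S + 1)))" using CS by (intro mult_left_mono)
  also have "... \<le> (C * S + 1) * (\<epsilon> * I / (4 * (C * S + 1)))" using X by (intro mult_right_mono) auto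
  also have "... = \<epsilon> * I / 4"
  proof -
    have "c * (\<epsilon> * I / (4 * c)) = \<epsilon> * I / 4" if "0 < c" for c :: real using that by simp
    from this[of "C * S + 1"] CS show ?thesis by linarith
  qed
  finally have small: "C * S * \<theta> powr k \<le> \<epsilon> * I / 4" .
  have vg: "w0pair (\<lambda>x. \<theta> * u x) (\<lambda>x. \<theta> *\<^sub>R g x)" by (rule w0pair_cmult[OF ug])
  have "prim M (\<Phi> (\<lambda>x. \<theta> *\<^sub>R g x)) \<le> prim M (\<theta> powr p * \<Phi> g)"
    by (intro prim_mono M_continuous M_nonneg Phi_nonneg Phi_scale gm \<theta>) auto
  also have "... \<le> (\<theta> powr p) powr \<gamma> * P" unfolding P_def
  proof (intro M_scaling Phi_nonneg)
    show "0 < \<theta> powr p" using \<theta> by simp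
    show "\<theta> powr p \<le> 1" using \<theta> p_gt_1 by (intro powr_le1) auto
  qed
  also have "(\<theta> powr p) powr \<gamma> = \<theta> powr (\<gamma> * p)" by (simp add: powr_powr mult.commute)
  finally have 1: "prim M (\<Phi> (\<lambda>x. \<theta> *\<^sub>R g x)) \<le> \<theta> powr (\<gamma> * p) * P" .
  have iu: "integrable \<mu> (\<lambda>x. \<bar>u x\<bar> powr (\<gamma> * p))" "integrable \<mu> (\<lambda>x. \<bar>u x\<bar> powr s)"
    using pint_integrable[OF ug] powr_integrable_s[OF um w0pair_s_finite[OF ug], of s] s_gt_1 by auto
  have e: "\<bar>\<theta> * u x\<bar> powr \<sigma> = \<theta> powr \<sigma> * \<bar>u x\<bar> powr \<sigma>" for x \<sigma> using \<theta> by (simp add: abs_mult powr_mult)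
  have "(lam + \<epsilon>) * (\<theta> powr (\<gamma> * p) * I) - C * (\<theta> powr s * S) = (LINT x|\<mu>. (lam + \<epsilon>) * (\<theta> powr (\<gamma> * p) * \<bar>u x\<bar> powr (\<gamma> * p)) - C * (\<theta> powr s * \<bar>u x\<bar> powr s))"
    unfolding I_def pint_def S_def using iu by simp
  also have "... \<le> (LINT x|\<mu>. prim (h x) (\<theta> * u x))"
    using pw[of "\<lambda>x. \<theta> * u x"] iu unfolding e
    by (intro integral_mono_AE prim_h_integrable w0pair_measurable(1)[OF vg] w0pair_s_finite[OF vg] Bochner_Integration.integrable_diff integrable_mult_right) auto
  finally have 2: "(lam + \<epsilon>) * (\<theta> powr (\<gamma> * p) * I) - C * (\<theta> powr s * S) \<le> (LINT x|\<mu>. prim (h x) (\<theta> * u x))" .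
  have "\<theta> powr s = \<theta> powr (\<gamma> * p) * \<theta> powr k" unfolding powr_add[symmetric] k_def by simp
  then have 3: "C * (\<theta> powr s * S) = \<theta> powr (\<gamma> * p) * (C * S * \<theta> powr k)" by (simp add: mult_ac)
  have "J (\<lambda>x. \<theta> * u x) \<le> \<theta> powr (\<gamma> * p) * P - ((lam + \<epsilon>) * (\<theta> powr (\<gamma> * p) * I) - C * (\<theta> powr s * S))"
    unfolding J_pair[OF vg] using 1 2 by (rule diff_mono)
  also have "... = \<theta> powr (\<gamma> * p) * (P - (lam + \<epsilon>) * I + C * S * \<theta> powr k)" unfolding 3 by (simp add: algebra_simps)
  also have "... < 0"
  proof (rule mult_pos_neg)
    \<comment> \<open>The near minimizer loses half of \<epsilon> I and the error a quarter, which
      leaves a strictly negative value.\<close>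
    have "P - (lam + \<epsilon>) * I + C * S * \<theta> powr k < (lam + \<epsilon> / 2) * I - (lam + \<epsilon>) * I + \<epsilon> * I / 4"
      using PI small by (intro add_less_le_mono diff_strict_right_mono)
    also have "... = - (\<epsilon> * I / 4)" by (simp add: field_simps)
    also have "... < 0" using h8(1) I by simp
    finally show "P - (lam + \<epsilon>) * I + C * S * \<theta> powr k < 0" .
  qed (use \<theta> in simp)
  finally show ?thesis using that[OF w0pair_imp_W0mH(1)[OF vg]] by blast
qed

text \<open>The direct method with the roles separated: compactness provides the limit function, and
  lower semicontinuity then provides a gradient for it whose energy does not exceed the limit
  energy.\<close>

lemma minimizer_exists:
  assumes c: "0 < c" "\<And>u g. w0pair u g ==> c * prim M (\<Phi> g) - B \<le> J u"
  obtains u where "u \<in> W" "\<And>w. w \<in> W ==> J u \<le> J w"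
proof -
  have ne: "W \<noteq> {}" using nonzero_test_function by blast
  have bdd: "bdd_below (J ` W)"
  proof (rule bdd_belowI[of _ "- B"])
    fix y assume "y \<in> J ` W"
    then obtain u where u: "u \<in> W" "y = J u" by blast
    have "0 \<le> c * prim M (\<Phi> (wnabla \<Omega> m u))" using c(1) by (intro mult_nonneg_nonneg prim_M_nonneg Phi_nonneg) simp
    then show "- B \<le> y" using c(2)[OF W0mH_imp_w0pair[OF u(1)]] u(2) by simp
  qed
  define I where "I = (INF u\<in>W. J u)"
  have "\<forall>n. \<exists>u. u \<in> W \<and> J u < I + 1 / real (Suc n)"
  proof
    fix n
    have "(INF u\<in>W. J u) < I + 1 / real (Suc n)" by (simp add: I_def)
    then show "\<exists>u. u \<in> W \<and> J u < I + 1 / real (Suc n)" unfolding cINF_less_iff[OF ne bdd] by blast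
  qed
  from choice[OF this] obtain u where u: "\<And>n. u n \<in> W" "\<And>n. J (u n) < I + 1 / real (Suc n)" by blast
  have IJ: "I \<le> J w" if "w \<in> W" for w unfolding I_def by (rule cINF_lower[OF bdd that])
  define g where "g n = wnabla \<Omega> m (u n)" for n
  have ug: "w0pair (u n) (g n)" for n unfolding g_def by (rule W0mH_imp_w0pair[OF u(1)])
  have inv0: "(\<lambda>n. 1 / real (Suc n)) \<longlonglongrightarrow> 0" by (rule LIMSEQ_Suc[OF lim_1_over_n])
  have "(\<lambda>n. I + 1 / real (Suc n)) \<longlonglongrightarrow> I + 0" by (intro tendsto_add tendsto_const inv0)
  then have "(\<lambda>n. I + 1 / real (Suc n)) \<longlonglongrightarrow> I" by simp
  then have Jlim: "(\<lambda>n. J (u n)) \<longlonglongrightarrow> I"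
    by (rule tendsto_sandwich[OF _ _ tendsto_const, rotated 2]) (use IJ u in \<open>auto intro!: always_eventually less_imp_le simp del: of_nat_Suc\<close>)
  \<comment> \<open>From (M3) and t <= 1 + t^\<gamma>, applied to functions with J at most I +
    1.\<close>
  define K where "K = 1 + (I + 1 + B) / c / C0"
  have PhiK: "\<Phi> (g n) \<le> K" for n
  proof -
    have P0: "0 \<le> \<Phi> (g n)" by (rule Phi_nonneg)
    have "1 / real (Suc n) \<le> 1" by simp
    then have "c * prim M (\<Phi> (g n)) \<le> I + 1 + B" using c(2)[OF ug[of n]] u(2)[of n] by linarith
    then have "prim M (\<Phi> (g n)) \<le> (I + 1 + B) / c" using c(1) by (simp add: field_simps)
    then have C0P: "C0 * \<Phi> (g n) powr \<gamma> \<le> (I + 1 + B) / c" using M_coercive[OF P0] by (rule order_trans[rotated])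
    have "\<Phi> (g n) powr \<gamma> \<le> (I + 1 + B) / c / C0"
      by (subst pos_le_divide_eq[OF C0_pos], subst mult.commute, rule C0P)
    moreover have "\<Phi> (g n) powr 1 \<le> 1 powr 1 + 1 powr (1 - \<gamma>) * \<Phi> (g n) powr \<gamma>"
      using P0 gamma_ge_1 by (intro powr_lower_exponent_le) auto
    ultimately show ?thesis using P0 by (simp add: K_def)
  qed
  have K0: "0 \<le> K" using Phi_nonneg[of "g 0"] PhiK[of 0] by (rule order_trans)
  have lB: "Lq (g n) \<le> ennreal (q / a0 * K)" for n
  proof -
    have "Lq (g n) \<le> ennreal (q / a0 * \<Phi> (g n))" by (rule lpm_le_Phi[OF w0pair_measurable(2)[OF ug] w0pair_finite(2)[OF ug]])
    also have "... \<le> ennreal (q / a0 * K)" using PhiK[of n] a0_pos q_gt_1 by (intro ennreal_leI mult_left_mono) auto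
    finally show ?thesis .
  qed
  have B0: "0 \<le> q / a0 * K" using K0 a0_pos q_gt_1 by simp
  obtain v k where vk: "v \<in> meas" "strict_mono (k :: nat => nat)" "AE x in \<mu>. (\<lambda>n. u (k n) x) \<longlonglongrightarrow> v x"
    "lpm \<mu> s v < \<infinity>" "\<And>\<sigma>. 1 \<le> \<sigma> ==> \<sigma> < s ==> (\<lambda>n. lpm \<mu> \<sigma> (\<lambda>x. u (k n) x - v x)) \<longlonglongrightarrow> 0"
    by (rule w0pair_compact[of u g, OF ug lB B0]) blast
  \<comment> \<open>A further subsequence makes the energies converge, so that the Kirchhoff terms
    converge as well.\<close>
  have "seq_compact {0..K}" by (simp add: compact_imp_seq_compact)
  moreover have "\<forall>n. \<Phi> (g (k n)) \<in> {0..K}" using Phi_nonneg PhiK by auto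
  ultimately obtain l j where lj: "l \<in> {0..K}" "strict_mono (j :: nat => nat)" "((\<lambda>n. \<Phi> (g (k n))) \<circ> j) \<longlonglongrightarrow> l"
    by (rule seq_compactE)
  have Plim: "(\<lambda>n. \<Phi> (g (k (j n)))) \<longlonglongrightarrow> l" using lj(3) by (simp add: o_def)
  have lim: "(\<lambda>n. lpm \<mu> \<sigma> (\<lambda>x. u (k (j n)) x - v x)) \<longlonglongrightarrow> 0" if "1 \<le> \<sigma>" "\<sigma> < s" for \<sigma>
    using LIMSEQ_subseq_LIMSEQ[OF vk(5)[OF that] lj(2)] by (simp add: o_def)
  have ae: "AE x in \<mu>. (\<lambda>n. u (k (j n)) x) \<longlonglongrightarrow> v x"
    using vk(3) by eventually_elim (use LIMSEQ_subseq_LIMSEQ[OF _ lj(2)] in \<open>auto simp: o_def\<close>)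
  have limq: "(\<lambda>n. Lq (\<lambda>x. u (k (j n)) x - v x)) \<longlonglongrightarrow> 0" using q_gt_1 q_less_s by (intro lim) auto
  obtain f where f: "w0pair v f" "\<Phi> f \<le> l"
    using Phi_lower_semicontinuous[of "\<lambda>n. u (k (j n))" "\<lambda>n. g (k (j n))", OF ug vk(1) limq Plim] by blast
  have "(\<lambda>n. prim M (\<Phi> (g (k (j n))))) \<longlonglongrightarrow> prim M l"
    by (rule continuous_on_tendsto_compose[OF prim_continuous_on[OF M_continuous] Plim]) (use lj(1) in \<open>auto simp: Phi_nonneg\<close>)
  moreover have "(\<lambda>n. LINT x|\<mu>. prim (h x) (u (k (j n)) x)) \<longlonglongrightarrow> (LINT x|\<mu>. prim (h x) (v x))"
    using r_gt_1 r_less_s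
    by (intro prim_h_tendsto vk(1,4) ae lim w0pair_measurable(1)[OF ug] w0pair_s_finite[OF ug]) auto
  ultimately have "(\<lambda>n. J (u (k (j n)))) \<longlonglongrightarrow> prim M l - (LINT x|\<mu>. prim (h x) (v x))"
    unfolding J_pair[OF ug] by (rule tendsto_diff)
  moreover have "(\<lambda>n. J (u (k (j n)))) \<longlonglongrightarrow> I"
    using LIMSEQ_subseq_LIMSEQ[OF Jlim strict_mono_o[OF vk(2) lj(2)]] by (simp add: o_def)
  ultimately have I: "I = prim M l - (LINT x|\<mu>. prim (h x) (v x))" by (rule LIMSEQ_unique[rotated])
  \<comment> \<open>Monotonicity of the primitive of M transports the inequality between energies to
    J.\<close>
  have "prim M (\<Phi> f) \<le> prim M l" by (intro prim_mono M_continuous M_nonneg Phi_nonneg f) auto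
  then have JI: "J v \<le> I" unfolding J_pair[OF f(1)] I by simp
  show ?thesis by (rule that[OF w0pair_imp_W0mH(1)[OF f(1)] order_trans[OF JI IJ]])
qed

theorem minimizer:
  assumes h6: "0 < \<epsilon>" "0 < T" "AE x in \<mu>. \<forall>t. \<bar>t\<bar> \<ge> T \<longrightarrow> prim (h x) t \<le> (lam - \<epsilon>) * \<bar>t\<bar> powr (\<gamma> * p)"
    and h8: "0 < \<epsilon>'" "0 < \<delta>" "AE x in \<mu>. \<forall>t. \<bar>t\<bar> \<le> \<delta> \<longrightarrow> (lam + \<epsilon>') * \<bar>t\<bar> powr (\<gamma> * p) \<le> prim (h x) t"
  shows "bdd_below (J ` W) \<and> (INF u\<in>W. J u) < 0 \<and> critical_value W (norm_W0mH m p q a \<Omega>) J (INF u\<in>W. J u)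
    \<and> (\<exists>u. weak_solution m p q a \<Omega> M h u \<and> \<not> zero_ae \<Omega> u)"
proof -
  obtain c B where cB: "0 < c" "\<And>u g. w0pair u g ==> c * prim M (\<Phi> g) - B \<le> J u"
    using J_lower_bound[OF h6] by blast
  obtain u where u: "u \<in> W" "\<And>w. w \<in> W ==> J u \<le> J w" using minimizer_exists[OF cB] by blast
  obtain w where w: "w \<in> W" "J w < 0" using J_negative[OF h8] by blast
  have bdd: "bdd_below (J ` W)" using u(2) by (intro bdd_belowI[of _ "J u"]) auto
  have I: "(INF u\<in>W. J u) = J u"
    using u by (intro antisym cINF_lower[OF bdd] cINF_greatest) auto
  have neg: "J u < 0" using u(2)[OF w(1)] w(2) by simp
  \<comment> \<open>J vanishes at functions that are zero almost everywhere, while the minimum is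
    negative.\<close>
  then have nz: "\<not> zero_ae \<Omega> u" using zero_ae_J[OF u(1)] by auto
  show ?thesis
    unfolding I critical_value_def
    by (intro conjI exI[of _ u] bdd neg nz minimizer_critical_point[OF u] minimizer_weak_solution[OF u] refl)
qed

end

section \<open>The given hypotheses as an instance of the abstract setting\<close>

lemma hoelder_on_continuous:
  assumes "hoelder_on \<kappa> S f" "0 < \<kappa>"
  shows "continuous_on S f"
proof -
  obtain C where C: "0 \<le> C" "\<And>x y. x \<in> S ==> y \<in> S ==> \<bar>f x - f y\<bar> \<le> C * dist x y powr \<kappa>"
    using assms(1) unfolding hoelder_on_def by blast
  show ?thesis unfolding continuous_on
  proof
    fix x assume x: "x \<in> S"
    have "((\<lambda>y. C * dist y x powr \<kappa>) \<longlongrightarrow> C * dist x x powr \<kappa>) (at x within S)"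
      using assms(2) by (intro tendsto_mult tendsto_const tendsto_powr' tendsto_dist tendsto_ident_at) auto
    then have lim: "((\<lambda>y. C * dist y x powr \<kappa>) \<longlongrightarrow> 0) (at x within S)" by simp
    have "\<forall>\<^sub>F y in at x within S. norm (f y - f x) \<le> C * dist y x powr \<kappa>"
      using C(2) x by (auto simp: eventually_at_filter)
    then have "((\<lambda>y. f y - f x) \<longlongrightarrow> 0) (at x within S)" by (rule Lim_null_comparison[OF _ lim])
    then show "(f \<longlongrightarrow> f x) (at x within S)" by (simp add: LIM_zero_iff)
  qed
qed

theorem theorem4p7:
  fixes \<Omega> :: "'a::euclidean_space set"
    and m :: nat and p q \<kappa> a0 \<gamma> r C_r :: real
    and a :: "'a \<Rightarrow> real" and M :: "real \<Rightarrow> real" and h :: "'a \<Rightarrow> real \<Rightarrow> real"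
  assumes dom: "bounded_lipschitz_domain \<Omega>"
    and m: "m \<ge> 1"
    and pq: "1 < p" "p < q" "real m * q < real DIM('a)"
      "q / p \<le> real DIM('a) / (real DIM('a) - 1)"
    and a: "0 < \<kappa>" "\<kappa> \<le> 1" "hoelder_on \<kappa> (closure \<Omega>) a"
      "0 < a0" "\<forall>x\<in>closure \<Omega>. a0 \<le> a x"
    and M: "continuous_on {0..} M" "\<forall>t\<ge>0. 0 \<le> M t"
    and gamma: "1 \<le> \<gamma>" "\<gamma> < sobolev_exponent DIM('a) m p / q"
    and M2: "\<forall>\<sigma>>0. \<exists>k>0. \<forall>t\<ge>\<sigma>. k \<le> M t"
    and M3: "\<exists>C0>0. \<forall>t\<ge>0. C0 * t powr \<gamma> \<le> prim M t"
    and M5: "\<forall>\<theta> s. 0 < \<theta> \<and> \<theta> \<le> 1 \<and> 0 \<le> s \<longrightarrow> prim M (\<theta> * s) \<le> \<theta> powr \<gamma> * prim M s"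
    and h: "continuous_on (\<Omega> \<times> UNIV) (\<lambda>(x, t). h x t)"
    and growth: "1 < r" "r < sobolev_exponent DIM('a) m p" "0 < C_r"
      "AE x in lebesgue_on \<Omega>. \<forall>t. \<bar>h x t\<bar> \<le> C_r * (1 + \<bar>t\<bar> powr (r - 1))"
    and h6: "\<exists>\<epsilon>>0. \<exists>T>0. AE x in lebesgue_on \<Omega>. \<forall>t. \<bar>t\<bar> \<ge> T \<longrightarrow>
      prim (h x) t \<le> (lambda_H m p q a \<Omega> M \<gamma> - \<epsilon>) * \<bar>t\<bar> powr (\<gamma> * p)"
    and h8: "\<exists>\<epsilon>>0. \<exists>\<delta>>0. AE x in lebesgue_on \<Omega>. \<forall>t. \<bar>t\<bar> \<le> \<delta> \<longrightarrow>
      prim (h x) t \<ge> (lambda_H m p q a \<Omega> M \<gamma> + \<epsilon>) * \<bar>t\<bar> powr (\<gamma> * p)"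
  shows "bdd_below (J_functional m p q a \<Omega> M h ` W0mH m p q a \<Omega>)
    \<and> (INF u\<in>W0mH m p q a \<Omega>. J_functional m p q a \<Omega> M h u) < 0
    \<and> critical_value (W0mH m p q a \<Omega>) (norm_W0mH m p q a \<Omega>) (J_functional m p q a \<Omega> M h)
        (INF u\<in>W0mH m p q a \<Omega>. J_functional m p q a \<Omega> M h u)
    \<and> (\<exists>u. weak_solution m p q a \<Omega> M h u \<and> \<not> zero_ae \<Omega> u)"
proof -
  let ?N = "real DIM('a)"
  define s where "s = sobolev_exponent DIM('a) m p"
  have \<Omega>: "open \<Omega>" "bounded \<Omega>" "\<Omega> \<noteq> {}" using dom by (auto simp: bounded_lipschitz_domain_def)
  have p0: "0 < p" "0 < q" using pq by auto
  have "real m * p < ?N" using mult_left_mono[of p q "real m"] pq by simp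
  then have "1 / s = 1 / p - real m / ?N" using p0 by (simp add: s_def sobolev_exponent_def field_simps)
  \<comment> \<open>Strict because p < q: the target exponent is critical for p but subcritical for
    q.\<close>
  then have sub: "1 / q - real m / ?N < 1 / s" using pq by (simp add: frac_less2)
  \<comment> \<open>This places both q and \<gamma> p strictly below s.\<close>
  have qs: "\<gamma> * q < s" using gamma p0 by (simp add: s_def pos_less_divide_eq)
  have "1 * q \<le> \<gamma> * q" using gamma(1) p0 by (intro mult_right_mono) auto
  then have "q < s" using qs by linarith
  have "\<gamma> * p \<le> \<gamma> * q" using gamma pq by (intro mult_left_mono) auto
  then have "\<gamma> * p < s" using qs by linarith
  have a_cont: "continuous_on (closure \<Omega>) a" by (rule hoelder_on_continuous[OF a(3,1)])
  \<comment> \<open>The upper bound \<open>a1\<close> comes from continuity on the compact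
    closure.\<close>
  have "compact (a ` closure \<Omega>)" using \<Omega> a_cont by (intro compact_continuous_image) (auto simp: compact_closure)
  then have "bounded (a ` closure \<Omega>)" by (rule compact_imp_bounded)
  then obtain a1 where "\<forall>y\<in>a ` closure \<Omega>. norm y \<le> a1" unfolding bounded_iff by blast
  then have a1: "\<bar>a x\<bar> \<le> a1" if "x \<in> closure \<Omega>" for x using that by simp
  have cl: "x \<in> closure \<Omega>" if "x \<in> \<Omega>" for x using that closure_subset by blast
  obtain C0 where C0: "0 < C0" "\<forall>t\<ge>0. C0 * t powr \<gamma> \<le> prim M t" using M3 by blast
  obtain \<epsilon> T where h6': "0 < \<epsilon>" "0 < T" "AE x in lebesgue_on \<Omega>. \<forall>t. \<bar>t\<bar> \<ge> T \<longrightarrow>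
      prim (h x) t \<le> (lambda_H m p q a \<Omega> M \<gamma> - \<epsilon>) * \<bar>t\<bar> powr (\<gamma> * p)" using h6 by blast
  obtain \<epsilon>' \<delta> where h8': "0 < \<epsilon>'" "0 < \<delta>" "AE x in lebesgue_on \<Omega>. \<forall>t. \<bar>t\<bar> \<le> \<delta> \<longrightarrow>
      prim (h x) t \<ge> (lambda_H m p q a \<Omega> M \<gamma> + \<epsilon>') * \<bar>t\<bar> powr (\<gamma> * p)" using h8 by blast
  interpret kirchhoff \<Omega> m p q a0 a1 s a h r C_r M \<gamma> C0
  proof
    show "a \<in> borel_measurable (lebesgue_on \<Omega>)"
      using \<Omega>(1) continuous_on_subset[OF a_cont closure_subset] by (intro continuous_imp_measurable_on_sets_lebesgue) auto
    show "a x \<le> a1" if "x \<in> \<Omega>" for x using abs_le_D1[OF a1[OF cl[OF that]]] .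
    show "r < s" using growth(2) by (simp add: s_def)
    show "prim M (\<theta> * t) \<le> \<theta> powr \<gamma> * prim M t" if "0 < \<theta>" "\<theta> \<le> 1" "0 \<le> t" for \<theta> t using M5 that by blast
  qed (use \<Omega> m pq a cl M gamma C0 h growth sub \<open>q < s\<close> \<open>\<gamma> * p < s\<close> in auto)
  show ?thesis by (rule minimizer[OF h6' h8'])
qed

end
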